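(* Let $R$ be a commutative Noetherian local ring admitting a dualizing complex. Then for every nonzero finitely generated $R$-module $M$ one has $$\dim_R M \leq \mathrm{Gid}_R\, M,$$ where $\dim_R M$ is the Krull dimension of $M$ and $\mathrm{Gid}_R\, M$ is its Gorenstein injective dimension (possibly $\infty$).
   Context: All rings are commutative and Noetherian. $R$-complexes are indexed homologically: $X=(\cdots\to X_{i+1}\to X_i\to X_{i-1}\to\cdots)$; an isomorphism of $R$-complexes means an isomorphism in the derived category of $R$-modules, and a module is viewed as a complex concentrated in degree $0$. An $R$-module $G$ is G-injective (Gorenstein injective) if there is an exact complex $C=(\cdots\to C_1\xrightarrow{d_1} C_0\xrightarrow{d_0} C_{-1}\to\cdots)$ of injective $R$-modules with $G\cong\mathrm{Ker}(d_0)$ such that $\mathrm{Hom}_R(T,C)$ is exact for every injective $R$-module $T$. For an $R$-complex $X$ and an integer $n$, write $\mathrm{Gid}_R\,X\leq n$ if $X$ is isomorphic (in the derived category) to a complex of the form $0\to A_m\to A_{m-1}\to\cdots\to A_{-n+1}\to A_{-n}\to 0$ with every $A_i$ G-injective. Put $\mathrm{Gid}_R\,X=-\infty$ if $X$ is exact; $\mathrm{Gid}_R\,X<\infty$ if $\mathrm{Gid}_R\,X\le n$ for some integer $n$, and $\mathrm{Gid}_R\,X=\infty$ otherwise; $\mathrm{Gid}_R\,X=n$ if $\mathrm{Gid}_R\,X\le n$ but $\mathrm{Gid}_R\,X\not\le n-1$. *)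

theory Defs
  imports "HOL-Algebra.Module" "HOL-Algebra.QuotRing" "HOL-Algebra.Ring_Divisibility"
    "HOL-Library.Extended_Real"
begin

section \<open>Modules\<close>

text \<open>The multiplicative fields that module records inherit from rings carry no information;
  they are left unspecified in the constructions below.\<close>

definition module_morphism ::
    "('a, 'k) ring_scheme \<Rightarrow> ('a, 'b) module \<Rightarrow> ('a, 'c) module \<Rightarrow> ('b \<Rightarrow> 'c) \<Rightarrow> bool" where
  "module_morphism R M N f \<longleftrightarrow>
     f \<in> carrier M \<rightarrow> carrier N \<and>
     (\<forall>x\<in>carrier M. \<forall>y\<in>carrier M. f (x \<oplus>\<^bsub>M\<^esub> y) = f x \<oplus>\<^bsub>N\<^esub> f y) \<and>
     (\<forall>r\<in>carrier R. \<forall>x\<in>carrier M. f (r \<odot>\<^bsub>M\<^esub> x) = r \<odot>\<^bsub>N\<^esub> f x)"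

definition module_iso ::
    "('a, 'k) ring_scheme \<Rightarrow> ('a, 'b) module \<Rightarrow> ('a, 'c) module \<Rightarrow> bool" where
  "module_iso R M N \<longleftrightarrow> (\<exists>f. module_morphism R M N f \<and> bij_betw f (carrier M) (carrier N))"

definition regular_module :: "('a, 'k) ring_scheme \<Rightarrow> ('a, 'a) module" where
  "regular_module R =
     \<lparr>carrier = carrier R, monoid.mult = undefined, one = undefined,
      zero = \<zero>\<^bsub>R\<^esub>, add = (\<oplus>\<^bsub>R\<^esub>), smult = (\<otimes>\<^bsub>R\<^esub>)\<rparr>"

definition finitely_generated :: "('a, 'k) ring_scheme \<Rightarrow> ('a, 'b) module \<Rightarrow> bool" where
  "finitely_generated R M \<longleftrightarrow>
     (\<exists>S \<subseteq> carrier M. finite S \<and> (\<forall>N. submodule N R M \<longrightarrow> S \<subseteq> N \<longrightarrow> N = carrier M))"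

definition annihilator :: "('a, 'k) ring_scheme \<Rightarrow> ('a, 'b) module \<Rightarrow> 'a set" where
  "annihilator R M = {r \<in> carrier R. \<forall>x\<in>carrier M. r \<odot>\<^bsub>M\<^esub> x = \<zero>\<^bsub>M\<^esub>}"

text \<open>A quantifier cannot range over the modules of all types.  The test modules \<open>A\<close>, \<open>B\<close> range
  over those whose elements are taken from the sum type \<open>'a + 'b\<close>: this type contains a copy of
  \<open>R\<close> and of its ideals, so that by Baer's criterion the property does not depend on the choice
  of this type.\<close>

definition injective_module :: "('a, 'k) ring_scheme \<Rightarrow> ('a, 'b) module \<Rightarrow> bool" where
  "injective_module R I \<longleftrightarrow>
     module R I \<and>
     (\<forall>(A :: ('a, 'a + 'b) module) (B :: ('a, 'a + 'b) module) f g.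
        module R A \<longrightarrow> module R B \<longrightarrow>
        module_morphism R A B f \<longrightarrow> inj_on f (carrier A) \<longrightarrow> module_morphism R A I g \<longrightarrow>
        (\<exists>h. module_morphism R B I h \<and> (\<forall>x\<in>carrier A. h (f x) = g x)))"


section \<open>Krull dimension\<close>

text \<open>The dimension of the zero ring, hence of the zero module, is \<open>- \<infinity>\<close>.\<close>

definition krull_dim :: "('a, 'k) ring_scheme \<Rightarrow> ereal" where
  "krull_dim R =
     Sup {ereal (real n) | n. \<exists>p :: nat \<Rightarrow> 'a set.
            (\<forall>i\<le>n. primeideal (p i) R) \<and> (\<forall>i<n. p i \<subset> p (Suc i))}"

definition module_dim :: "('a, 'k) ring_scheme \<Rightarrow> ('a, 'b) module \<Rightarrow> ereal" where
  "module_dim R M = krull_dim (R Quot (annihilator R M))"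


section \<open>Complexes\<close>

text \<open>\<open>bdry X i\<close> is the differential \<open>X\<^sub>i \<rightarrow> X\<^sub>i\<^sub>-\<^sub>1\<close>.\<close>

record ('a, 'b) rcomplex =
  obj :: "int \<Rightarrow> ('a, 'b) module"
  bdry :: "int \<Rightarrow> 'b \<Rightarrow> 'b"

definition is_complex :: "('a, 'k) ring_scheme \<Rightarrow> ('a, 'b) rcomplex \<Rightarrow> bool" where
  "is_complex R X \<longleftrightarrow>
     (\<forall>i. module R (obj X i)) \<and>
     (\<forall>i. module_morphism R (obj X i) (obj X (i - 1)) (bdry X i)) \<and>
     (\<forall>i. \<forall>x\<in>carrier (obj X i). bdry X (i - 1) (bdry X i x) = \<zero>\<^bsub>obj X (i - 2)\<^esub>)"

definition cycles :: "('a, 'b) rcomplex \<Rightarrow> int \<Rightarrow> 'b set" where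
  "cycles X i = {x \<in> carrier (obj X i). bdry X i x = \<zero>\<^bsub>obj X (i - 1)\<^esub>}"

definition boundaries :: "('a, 'b) rcomplex \<Rightarrow> int \<Rightarrow> 'b set" where
  "boundaries X i = bdry X (i + 1) ` carrier (obj X (i + 1))"

definition kernel_module :: "('a, 'b) rcomplex \<Rightarrow> int \<Rightarrow> ('a, 'b) module" where
  "kernel_module X i = (obj X i)\<lparr>carrier := cycles X i\<rparr>"

definition exact_complex :: "('a, 'k) ring_scheme \<Rightarrow> ('a, 'b) rcomplex \<Rightarrow> bool" where
  "exact_complex R X \<longleftrightarrow> is_complex R X \<and> (\<forall>i. cycles X i = boundaries X i)"

definition bounded_complex :: "('a, 'b) rcomplex \<Rightarrow> bool" where
  "bounded_complex X \<longleftrightarrow>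
     (\<exists>a b. \<forall>i. i < a \<or> b < i \<longrightarrow> carrier (obj X i) = {\<zero>\<^bsub>obj X i\<^esub>})"

definition homology :: "('a, 'b) rcomplex \<Rightarrow> int \<Rightarrow> ('a, 'b set) module" where
  "homology X i =
     \<lparr>carrier = {boundaries X i +>\<^bsub>obj X i\<^esub> z | z. z \<in> cycles X i},
      monoid.mult = undefined, one = undefined,
      zero = boundaries X i,
      add = (\<lambda>K L. K <+>\<^bsub>obj X i\<^esub> L),
      smult = (\<lambda>r K. \<Union>z\<in>K. boundaries X i +>\<^bsub>obj X i\<^esub> (r \<odot>\<^bsub>obj X i\<^esub> z))\<rparr>"

definition chain_map ::
    "('a, 'k) ring_scheme \<Rightarrow> ('a, 'b) rcomplex \<Rightarrow> ('a, 'c) rcomplex \<Rightarrow> (int \<Rightarrow> 'b \<Rightarrow> 'c) \<Rightarrow> bool" where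
  "chain_map R X Y f \<longleftrightarrow>
     (\<forall>i. module_morphism R (obj X i) (obj Y i) (f i)) \<and>
     (\<forall>i. \<forall>x\<in>carrier (obj X i). bdry Y i (f i x) = f (i - 1) (bdry X i x))"

definition homology_map ::
    "('a, 'c) rcomplex \<Rightarrow> (int \<Rightarrow> 'b \<Rightarrow> 'c) \<Rightarrow> int \<Rightarrow> 'b set \<Rightarrow> 'c set" where
  "homology_map Y f i K = (\<Union>z\<in>K. boundaries Y i +>\<^bsub>obj Y i\<^esub> f i z)"

definition quasi_iso ::
    "('a, 'k) ring_scheme \<Rightarrow> ('a, 'b) rcomplex \<Rightarrow> ('a, 'c) rcomplex \<Rightarrow> (int \<Rightarrow> 'b \<Rightarrow> 'c) \<Rightarrow> bool" where
  "quasi_iso R X Y f \<longleftrightarrow>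
     is_complex R X \<and> is_complex R Y \<and> chain_map R X Y f \<and>
     (\<forall>i. bij_betw (homology_map Y f i) (carrier (homology X i)) (carrier (homology Y i)))"

text \<open>Isomorphism in the derived category, i.e. in the localization at the quasi-isomorphisms:
  an isomorphism is represented by a roof \<open>X \<leftarrow> Z \<rightarrow> Y\<close> of two quasi-isomorphisms.  The middle
  complex has its elements in the same type as \<open>Y\<close>.\<close>

definition derived_iso ::
    "('a, 'k) ring_scheme \<Rightarrow> ('a, 'b) rcomplex \<Rightarrow> ('a, 'c) rcomplex \<Rightarrow> bool" where
  "derived_iso R X Y \<longleftrightarrow>
     (\<exists>(Z :: ('a, 'c) rcomplex) f g. quasi_iso R Z X f \<and> quasi_iso R Z Y g)"

text \<open>The module \<open>M\<close> as a complex concentrated in degree \<open>0\<close>.\<close>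

definition stalk :: "('a, 'b) module \<Rightarrow> ('a, 'b) rcomplex" where
  "stalk M =
     \<lparr>obj = (\<lambda>i. if i = 0 then M else M\<lparr>carrier := {\<zero>\<^bsub>M\<^esub>}\<rparr>),
      bdry = (\<lambda>i x. \<zero>\<^bsub>M\<^esub>)\<rparr>"

text \<open>The complex \<open>Hom\<^sub>R(X,Y)\<close>: its degree \<open>n\<close> part is the product over all \<open>i\<close> of the modules
  \<open>Hom\<^sub>R(X\<^sub>i, Y\<^sub>i\<^sub>+\<^sub>n)\<close>, and its differential is \<open>\<phi> \<mapsto> d\<^sub>Y \<phi> - (- 1)\<^sup>n \<phi> d\<^sub>X\<close>.  Homomorphisms are made
  extensional so that equal maps are equal elements.\<close>

definition hom_complex ::
    "('a, 'k) ring_scheme \<Rightarrow> ('a, 'b) rcomplex \<Rightarrow> ('a, 'c) rcomplex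
       \<Rightarrow> ('a, int \<Rightarrow> 'b \<Rightarrow> 'c) rcomplex" where
  "hom_complex R X Y =
     \<lparr>obj = (\<lambda>n.
        \<lparr>carrier = {\<phi>. \<forall>i. module_morphism R (obj X i) (obj Y (i + n)) (\<phi> i) \<and>
                           \<phi> i \<in> extensional (carrier (obj X i))},
         monoid.mult = undefined, one = undefined,
         zero = (\<lambda>i. \<lambda>x\<in>carrier (obj X i). \<zero>\<^bsub>obj Y (i + n)\<^esub>),
         add = (\<lambda>\<phi> \<psi> i. \<lambda>x\<in>carrier (obj X i). \<phi> i x \<oplus>\<^bsub>obj Y (i + n)\<^esub> \<psi> i x),
         smult = (\<lambda>r \<phi> i. \<lambda>x\<in>carrier (obj X i). r \<odot>\<^bsub>obj Y (i + n)\<^esub> \<phi> i x)\<rparr>),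
      bdry = (\<lambda>n \<phi> i. \<lambda>x\<in>carrier (obj X i).
        if even n
        then bdry Y (i + n) (\<phi> i x) \<ominus>\<^bsub>obj Y (i + n - 1)\<^esub> \<phi> (i - 1) (bdry X i x)
        else bdry Y (i + n) (\<phi> i x) \<oplus>\<^bsub>obj Y (i + n - 1)\<^esub> \<phi> (i - 1) (bdry X i x))\<rparr>"


section \<open>Dualizing complexes\<close>

text \<open>The homothety morphism from \<open>R\<close> to \<open>Hom\<^sub>R(X,X)\<close>; its degree \<open>0\<close> part sends \<open>r\<close> to
  multiplication by \<open>r\<close>.\<close>

definition homothety ::
    "('a, 'b) rcomplex \<Rightarrow> int \<Rightarrow> 'a \<Rightarrow> (int \<Rightarrow> 'b \<Rightarrow> 'b)" where
  "homothety X n r i =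
     (\<lambda>x\<in>carrier (obj X i). if n = 0 then r \<odot>\<^bsub>obj X i\<^esub> x else \<zero>\<^bsub>obj X (i + n)\<^esub>)"

text \<open>A dualizing complex has finitely generated homology modules and finite injective dimension,
  i.e. a bounded injective resolution \<open>D \<rightarrow> I\<close> (in particular its homology is bounded), and the
  homothety morphism from \<open>R\<close> to \<open>RHom\<^sub>R(D,D) = Hom\<^sub>R(I,I)\<close> is an isomorphism in the derived
  category.\<close>

definition dualizing_complex :: "('a, 'k) ring_scheme \<Rightarrow> ('a, 'b) rcomplex \<Rightarrow> bool" where
  "dualizing_complex R D \<longleftrightarrow>
     is_complex R D \<and>
     (\<forall>i. finitely_generated R (homology D i)) \<and>
     (\<exists>(I :: ('a, 'b) rcomplex) f.
        bounded_complex I \<and> (\<forall>i. injective_module R (obj I i)) \<and> quasi_iso R D I f \<and>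
        quasi_iso R (stalk (regular_module R)) (hom_complex R I I) (homothety I))"


section \<open>Gorenstein injective dimension\<close>

text \<open>The test modules \<open>T\<close> again range over the modules with elements in \<open>'a + 'b\<close>.  Over a
  Noetherian ring every injective module is a direct sum of injective hulls \<open>E(R/p)\<close>, and each of
  these fits into the type \<open>'a\<close>; so these test modules suffice.\<close>

definition G_injective :: "('a, 'k) ring_scheme \<Rightarrow> ('a, 'b) module \<Rightarrow> bool" where
  "G_injective R G \<longleftrightarrow>
     module R G \<and>
     (\<exists>C :: ('a, 'b) rcomplex.
        exact_complex R C \<and> (\<forall>i. injective_module R (obj C i)) \<and>
        module_iso R G (kernel_module C 0) \<and>
        (\<forall>T :: ('a, 'a + 'b) module.
           injective_module R T \<longrightarrow> exact_complex R (hom_complex R (stalk T) C)))"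

text \<open>The type argument is the universe from which the elements of the complexes of G-injective
  modules are taken; a statement that is polymorphic in it covers complexes of every size.\<close>

definition Gid_le ::
    "'u itself \<Rightarrow> ('a, 'k) ring_scheme \<Rightarrow> ('a, 'b) rcomplex \<Rightarrow> int \<Rightarrow> bool" where
  "Gid_le U R X n \<longleftrightarrow>
     (\<exists>(A :: ('a, 'u) rcomplex) m.
        is_complex R A \<and> (\<forall>i. G_injective R (obj A i)) \<and>
        (\<forall>i. i < - n \<or> m < i \<longrightarrow> carrier (obj A i) = {\<zero>\<^bsub>obj A i\<^esub>}) \<and>
        derived_iso R X A)"

definition Gid ::
    "'u itself \<Rightarrow> ('a, 'k) ring_scheme \<Rightarrow> ('a, 'b) rcomplex \<Rightarrow> ereal" where
  "Gid U R X =
     (if exact_complex R X then - \<infinity>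
      else if \<exists>n. Gid_le U R X n
      then ereal (of_int (THE n. Gid_le U R X n \<and> \<not> Gid_le U R X (n - 1)))
      else \<infinity>)"


section \<open>Local rings\<close>

definition noetherian_local_ring :: "('a, 'k) ring_scheme \<Rightarrow> bool" where
  "noetherian_local_ring R \<longleftrightarrow>
     cring R \<and> noetherian_ring R \<and> (\<exists>!m. maximalideal m R)"

end

theory Submission
  imports Defs
begin

text \<open>Let \<open>x\<^sub>1, \<dots>, x\<^sub>d\<close> generate the maximal ideal \<open>\<mm>\<close>, and let \<open>H\<^sup>i\<close> be local cohomology, computed as
  the direct limit of the Koszul cohomology of the powers \<open>x\<^sub>1\<^sup>t, \<dots>, x\<^sub>d\<^sup>t\<close>.  Injective modules have
  \<open>H\<^sup>i = 0\<close> for \<open>i > 0\<close>.  A G-injective module has a left resolution by injective modules and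
  \<open>H\<^sup>i\<close> vanishes for \<open>i > d\<close>, so by dimension shifting G-injective modules are acyclic as well, and
  \<open>Gid M \<le> n\<close> implies \<open>H\<^sup>i(M) = 0\<close> for \<open>i > n\<close>.

  For an ideal \<open>I\<close> let \<open>c(I)\<close> be the largest \<open>i\<close> such that \<open>H\<^sup>i(R/Q) \<noteq> 0\<close> for some prime \<open>Q \<supseteq> I\<close>.  For
  \<open>I = ann M\<close> and \<open>c = c(I)\<close> one has \<open>H\<^sup>c(M) \<noteq> 0\<close>, since \<open>H\<^sup>c\<close> is right exact on the modules killed by
  \<open>I\<close> and \<open>M\<close> maps nontrivially to \<open>R/Q\<close>.  It remains to see that \<open>c\<close> drops strictly along inclusions
  of primes, because then \<open>c(ann M) \<ge> dim M\<close>.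

  Suppose \<open>P\<close> is a maximal prime with \<open>c(q) = c(P) = c\<close> for some prime \<open>q \<supset> P\<close>.  As \<open>H\<^sup>c(R/P)\<close> is
  artinian, some \<open>b \<notin> P\<close> satisfies \<open>b H = y b H\<close> for \<open>H = H\<^sup>c(R/P)\<close> and all \<open>y \<notin> P\<close>.  There is a prime
  \<open>Q \<supset> q\<close> with \<open>H\<^sup>c\<^sup>-\<^sup>1(R/Q) \<noteq> 0\<close>, and by Krull's principal ideal theorem a prime \<open>q'\<close> with
  \<open>P \<subset> q' \<subset> Q\<close> and \<open>b \<notin> q'\<close>; then \<open>c(q') = c\<close> and \<open>H\<^sup>c(R/q') \<noteq> 0\<close>.  Now \<open>b\<close> acts surjectively on
  \<open>H\<^sup>c(R/q')\<close>, which is a quotient of \<open>H\<close>; but choosing \<open>y \<in> q' - P\<close> shows that \<open>b\<close> also acts as zero.\<close>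

section \<open>Modules of functions\<close>

text \<open>Only a few properties of local cohomology enter: the long exact sequence, torsion by
  each generator, vanishing above the number of generators and on injective modules, and the values
  on the residue field. Each can be checked on explicit cochains, so H^i never has to be recognised
  as a derived functor. The bound d may exceed dim R; dimension shifting only needs some bound.

  Cohomology modules and localizations are never formed. A class is a cocycle up to coboundaries,
  and a chain condition on Z/B is one on the submodules between B and Z. A statement over R_Q is
  phrased with a multiplier s outside Q, and an ideal of R_Q is a saturated ideal of R.

  The detour from q to q' in the strict drop of c is forced: b depends on P alone and may lie in q,
  whereas b acts surjectively on H^c(R/q') because H^c vanishes over q' + (b), and the primes over
  that ideal are strictly above q' only if b is outside q'.\<close>

lemma module_morphismD:
  assumes "module_morphism R M N f"
  shows "x \<in> carrier M \<Longrightarrow> f x \<in> carrier N"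
    and "x \<in> carrier M \<Longrightarrow> y \<in> carrier M \<Longrightarrow> f (x \<oplus>\<^bsub>M\<^esub> y) = f x \<oplus>\<^bsub>N\<^esub> f y"
    and "r \<in> carrier R \<Longrightarrow> x \<in> carrier M \<Longrightarrow> f (r \<odot>\<^bsub>M\<^esub> x) = r \<odot>\<^bsub>N\<^esub> f x"
  using assms by (auto simp: module_morphism_def)

lemma module_morphism_zero:
  assumes "module R M" "module R N" "module_morphism R M N f"
  shows "f \<zero>\<^bsub>M\<^esub> = \<zero>\<^bsub>N\<^esub>"
proof -
  interpret M: module R M by fact
  interpret N: module R N by fact
  have "f \<zero>\<^bsub>M\<^esub> \<oplus>\<^bsub>N\<^esub> f \<zero>\<^bsub>M\<^esub> = f \<zero>\<^bsub>M\<^esub>"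
    using module_morphismD(2)[OF assms(3), of "\<zero>\<^bsub>M\<^esub>" "\<zero>\<^bsub>M\<^esub>"] by simp
  then show ?thesis
    using N.add.l_cancel_one' module_morphismD(1)[OF assms(3)] by (metis M.M.zero_closed)
qed

lemma module_morphism_uminus:
  assumes "module R M" "module R N" "module_morphism R M N f" "x \<in> carrier M"
  shows "f (\<ominus>\<^bsub>M\<^esub> x) = \<ominus>\<^bsub>N\<^esub> f x"
proof -
  interpret M: module R M by fact
  interpret N: module R N by fact
  have "f (\<ominus>\<^bsub>M\<^esub> x) \<oplus>\<^bsub>N\<^esub> f x = \<zero>\<^bsub>N\<^esub>"
    using module_morphismD(2)[OF assms(3), of "\<ominus>\<^bsub>M\<^esub> x" x] assms(4)
      module_morphism_zero[OF assms(1-3)] by (simp add: M.M.l_neg)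
  then show ?thesis
    using module_morphismD(1)[OF assms(3)] assms(4) by (metis M.M.a_inv_closed N.minus_equality)
qed

lemma module_morphism_minus:
  assumes "module R M" "module R N" "module_morphism R M N f" "x \<in> carrier M" "y \<in> carrier M"
  shows "f (x \<ominus>\<^bsub>M\<^esub> y) = f x \<ominus>\<^bsub>N\<^esub> f y"
proof -
  interpret M: module R M by fact
  show ?thesis
    unfolding a_minus_def using assms module_morphismD(2)[OF assms(3)]
      module_morphism_uminus[OF assms(1-3)] by simp
qed

text \<open>Two layers of this construction give the ambient module of all sequences of Koszul
  cochains. Cochains are total functions; homogeneity and compatibility then become conditions that
  cut out submodules.\<close>

definition fun_module :: "('a, 'b) module \<Rightarrow> ('a, 'i \<Rightarrow> 'b) module" where
  "fun_module N =
     \<lparr>carrier = {f. \<forall>i. f i \<in> carrier N}, monoid.mult = undefined, one = undefined,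
      zero = (\<lambda>i. \<zero>\<^bsub>N\<^esub>), add = (\<lambda>f g i. f i \<oplus>\<^bsub>N\<^esub> g i), smult = (\<lambda>r f i. r \<odot>\<^bsub>N\<^esub> f i)\<rparr>"

lemma fun_module_simps [simp]:
  "f \<in> carrier (fun_module N) \<longleftrightarrow> (\<forall>i. f i \<in> carrier N)"
  "\<zero>\<^bsub>fun_module N\<^esub> = (\<lambda>i. \<zero>\<^bsub>N\<^esub>)"
  "f \<oplus>\<^bsub>fun_module N\<^esub> g = (\<lambda>i. f i \<oplus>\<^bsub>N\<^esub> g i)"
  "r \<odot>\<^bsub>fun_module N\<^esub> f = (\<lambda>i. r \<odot>\<^bsub>N\<^esub> f i)"
  by (auto simp: fun_module_def)

lemma fun_module_module:
  assumes "module R N"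
  shows "module R (fun_module N)"
proof -
  interpret N: module R N by fact
  have neg: "\<exists>y\<in>carrier (fun_module N). y \<oplus>\<^bsub>fun_module N\<^esub> x = \<zero>\<^bsub>fun_module N\<^esub>"
    if "x \<in> carrier (fun_module N)" for x
    using that by (intro bexI[where x = "\<lambda>i. \<ominus>\<^bsub>N\<^esub> x i"]) (auto simp: N.M.l_neg)
  have ag: "abelian_group (fun_module N)"
    by (rule abelian_groupI) (auto simp: N.M.a_assoc neg[simplified] intro!: N.M.a_comm)
  show ?thesis
    by (rule moduleI[OF N.R.is_cring ag])
      (auto simp: N.smult_l_distr N.smult_r_distr N.smult_assoc1)
qed

lemma fun_module_uminus:
  assumes "module R N" "\<And>i. f i \<in> carrier N"
  shows "\<ominus>\<^bsub>fun_module N\<^esub> f = (\<lambda>i. \<ominus>\<^bsub>N\<^esub> f i)"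
proof -
  interpret N: module R N by fact
  interpret F: module R "fun_module N" by (rule fun_module_module) fact
  show ?thesis
    by (rule F.minus_equality) (use assms in \<open>auto simp: N.M.l_neg\<close>)
qed

lemma fun_module_minus:
  assumes "module R N" "\<And>i. f i \<in> carrier N" "\<And>i. g i \<in> carrier N"
  shows "f \<ominus>\<^bsub>fun_module N\<^esub> g = (\<lambda>i. f i \<ominus>\<^bsub>N\<^esub> g i)"
  using fun_module_uminus[of R N g] assms by (simp add: a_minus_def)


section \<open>The Koszul differentials\<close>

text \<open>A basis element of the Koszul complex is a list of booleans that marks the chosen generators.\<close>

fun monomial_of :: "('a, 'k) ring_scheme \<Rightarrow> 'a list \<Rightarrow> bool list \<Rightarrow> 'a" where
  "monomial_of R (x # xs) (b # \<sigma>) =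
     (if b then x \<otimes>\<^bsub>R\<^esub> monomial_of R xs \<sigma> else monomial_of R xs \<sigma>)"
| "monomial_of R _ _ = \<one>\<^bsub>R\<^esub>"

text \<open>The Koszul complex of \<open>x # xs\<close> is the mapping cone of x^t acting on the
  Koszul complex of \<open>xs\<close>: the leading entries \<open>False\<close> and
  \<open>True\<close> mark its two summands, and the minus sign makes the square vanish.\<close>

fun koszul_d :: "('a, 'k) ring_scheme \<Rightarrow> ('a, 'b) module \<Rightarrow> nat \<Rightarrow> 'a list
    \<Rightarrow> (bool list \<Rightarrow> 'b) \<Rightarrow> bool list \<Rightarrow> 'b" where
  "koszul_d R N t (x # xs) \<phi> (False # \<sigma>) = koszul_d R N t xs (\<lambda>\<tau>. \<phi> (False # \<tau>)) \<sigma>"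
| "koszul_d R N t (x # xs) \<phi> (True # \<sigma>) =
     (x [^]\<^bsub>R\<^esub> t) \<odot>\<^bsub>N\<^esub> \<phi> (False # \<sigma>) \<ominus>\<^bsub>N\<^esub> koszul_d R N t xs (\<lambda>\<tau>. \<phi> (True # \<tau>)) \<sigma>"
| "koszul_d R N t _ \<phi> _ = \<zero>\<^bsub>N\<^esub>"

lemma (in cring) monomial_of_closed [simp]:
  "set xs \<subseteq> carrier R \<Longrightarrow> monomial_of R xs \<sigma> \<in> carrier R"
proof (induction xs arbitrary: \<sigma>)
  case (Cons x xs)
  then show ?case by (cases \<sigma>) auto
qed auto

locale rmodule = module R M for R :: "('a, 'k) ring_scheme" (structure) and M :: "('a, 'b) module" (structure)

context rmodule
begin

lemma koszul_d_closed:
  assumes "set xs \<subseteq> carrier R" "\<And>\<sigma>. \<phi> \<sigma> \<in> carrier M"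
  shows "koszul_d R M t xs \<phi> \<sigma> \<in> carrier M"
  using assms
proof (induction xs arbitrary: \<sigma> \<phi>)
  case (Cons x xs)
  then show ?case by (cases \<sigma>; cases "hd \<sigma>") auto
qed auto

lemma koszul_d_zero:
  assumes "set xs \<subseteq> carrier R"
  shows "koszul_d R M t xs (\<lambda>_. \<zero>\<^bsub>M\<^esub>) \<sigma> = \<zero>\<^bsub>M\<^esub>"
  using assms
proof (induction xs arbitrary: \<sigma>)
  case (Cons x xs)
  then show ?case by (cases \<sigma>; cases "hd \<sigma>") (auto simp: a_minus_def)
qed simp

lemma koszul_d_add:
  assumes "set xs \<subseteq> carrier R" "\<And>\<sigma>. \<phi> \<sigma> \<in> carrier M" "\<And>\<sigma>. \<psi> \<sigma> \<in> carrier M"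
  shows "koszul_d R M t xs (\<lambda>\<sigma>. \<phi> \<sigma> \<oplus>\<^bsub>M\<^esub> \<psi> \<sigma>) \<sigma> =
    koszul_d R M t xs \<phi> \<sigma> \<oplus>\<^bsub>M\<^esub> koszul_d R M t xs \<psi> \<sigma>"
  using assms
proof (induction xs arbitrary: \<sigma> \<phi> \<psi>)
  case (Cons x xs)
  have c: "koszul_d R M t xs (\<lambda>\<tau>. \<phi> (b # \<tau>)) \<tau> \<in> carrier M"
     "koszul_d R M t xs (\<lambda>\<tau>. \<psi> (b # \<tau>)) \<tau> \<in> carrier M" for b \<tau>
    using Cons.prems by (auto intro!: koszul_d_closed)
  have IH: "koszul_d R M t xs (\<lambda>\<tau>. \<phi> (b # \<tau>) \<oplus>\<^bsub>M\<^esub> \<psi> (b # \<tau>)) \<tau> =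
     koszul_d R M t xs (\<lambda>\<tau>. \<phi> (b # \<tau>)) \<tau> \<oplus>\<^bsub>M\<^esub> koszul_d R M t xs (\<lambda>\<tau>. \<psi> (b # \<tau>)) \<tau>" for b \<tau>
    by (rule Cons.IH) (use Cons.prems in auto)
  show ?case
  proof (cases \<sigma>)
    case (Cons b \<tau>)
    then show ?thesis using Cons.prems c[of b \<tau>] IH[of b \<tau>] 
      by (cases b) (auto simp: a_minus_def M.minus_add smult_r_distr M.a_ac)
  qed auto
qed auto

lemma koszul_d_smult:
  assumes "set xs \<subseteq> carrier R" "\<And>\<sigma>. \<phi> \<sigma> \<in> carrier M" "r \<in> carrier R"
  shows "koszul_d R M t xs (\<lambda>\<sigma>. r \<odot>\<^bsub>M\<^esub> \<phi> \<sigma>) \<sigma> = r \<odot>\<^bsub>M\<^esub> koszul_d R M t xs \<phi> \<sigma>"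
  using assms
proof (induction xs arbitrary: \<sigma> \<phi>)
  case (Cons x xs)
  have c: "koszul_d R M t xs (\<lambda>\<tau>. \<phi> (b # \<tau>)) \<tau> \<in> carrier M" for b \<tau>
    using Cons.prems by (auto intro!: koszul_d_closed)
  have IH: "koszul_d R M t xs (\<lambda>\<tau>. r \<odot>\<^bsub>M\<^esub> \<phi> (b # \<tau>)) \<tau> = r \<odot>\<^bsub>M\<^esub> koszul_d R M t xs (\<lambda>\<tau>. \<phi> (b # \<tau>)) \<tau>"
    for b \<tau>
    by (rule Cons.IH) (use Cons.prems in auto)
  show ?case
  proof (cases \<sigma>)
    case (Cons b \<tau>)
    then show ?thesis using Cons.prems c[of b \<tau>] IH[of b \<tau>]
      by (cases b) (auto simp: a_minus_def smult_r_distr smult_r_minus R.m_comm simp flip: smult_assoc1)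
  qed (use Cons in auto)
qed auto

lemma koszul_d_square:
  assumes "set xs \<subseteq> carrier R" "\<And>\<sigma>. \<phi> \<sigma> \<in> carrier M"
  shows "koszul_d R M t xs (koszul_d R M t xs \<phi>) \<sigma> = \<zero>\<^bsub>M\<^esub>"
  using assms
proof (induction xs arbitrary: \<sigma> \<phi>)
  case (Cons x xs)
  have c: "koszul_d R M t xs (\<lambda>\<tau>. \<phi> (b # \<tau>)) \<tau> \<in> carrier M" for b \<tau>
    using Cons.prems by (auto intro!: koszul_d_closed)
  have IH: "koszul_d R M t xs (koszul_d R M t xs (\<lambda>\<tau>. \<phi> (b # \<tau>))) \<tau> = \<zero>\<^bsub>M\<^esub>" for b \<tau>
    by (rule Cons.IH) (use Cons.prems in auto)
  have x: "x [^] t \<in> carrier R" using Cons.prems by auto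
  show ?case
  proof (cases \<sigma>)
    case (Cons b \<tau>)
    show ?thesis
    proof (cases b)
      case True
      \<comment> \<open>Subtraction becomes addition of a (-1)-fold, so that additivity and
        linearity apply. The inner square vanishes by induction, and the two terms with x^t
        cancel.\<close>
      have "koszul_d R M t xs (\<lambda>\<tau>. x [^] t \<odot>\<^bsub>M\<^esub> \<phi> (False # \<tau>) \<ominus>\<^bsub>M\<^esub> koszul_d R M t xs (\<lambda>\<tau>. \<phi> (True # \<tau>)) \<tau>) \<tau>
         = koszul_d R M t xs (\<lambda>\<tau>. x [^] t \<odot>\<^bsub>M\<^esub> \<phi> (False # \<tau>) \<oplus>\<^bsub>M\<^esub> (\<ominus>\<^bsub>R\<^esub> \<one>) \<odot>\<^bsub>M\<^esub> koszul_d R M t xs (\<lambda>\<tau>. \<phi> (True # \<tau>)) \<tau>) \<tau>"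
        using c[of True] by (simp add: a_minus_def smult_l_minus)
      also have "\<dots> = x [^] t \<odot>\<^bsub>M\<^esub> koszul_d R M t xs (\<lambda>\<tau>. \<phi> (False # \<tau>)) \<tau>"
        using Cons.prems x c[of True] c[of False] IH[of True \<tau>]
        by (simp add: koszul_d_add koszul_d_smult)
      finally show ?thesis using c[of False \<tau>] Cons True x
        by (simp add: a_minus_def M.r_neg)
    qed (use Cons IH in simp)
  qed auto
qed auto

text \<open>The map from the t-th to the (t+1)-st powers multiplies each coefficient by the product
  of its marked generators. When the differential adds a mark for x, that mark supplies the extra
  factor that turns x^t into x^(t+1).\<close>

lemma koszul_d_transition:
  assumes "set xs \<subseteq> carrier R" "\<And>\<sigma>. \<phi> \<sigma> \<in> carrier M"
  shows "koszul_d R M (Suc t) xs (\<lambda>\<sigma>. monomial_of R xs \<sigma> \<odot>\<^bsub>M\<^esub> \<phi> \<sigma>) \<sigma> =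
    monomial_of R xs \<sigma> \<odot>\<^bsub>M\<^esub> koszul_d R M t xs \<phi> \<sigma>"
  using assms
proof (induction xs arbitrary: \<sigma> \<phi>)
  case (Cons x xs)
  have c: "koszul_d R M t xs (\<lambda>\<tau>. \<phi> (b # \<tau>)) \<tau> \<in> carrier M" for b \<tau> t
    using Cons.prems by (auto intro!: koszul_d_closed)
  have IH: "koszul_d R M (Suc t) xs (\<lambda>\<tau>. monomial_of R xs \<tau> \<odot>\<^bsub>M\<^esub> \<phi> (b # \<tau>)) \<tau>
      = monomial_of R xs \<tau> \<odot>\<^bsub>M\<^esub> koszul_d R M t xs (\<lambda>\<tau>. \<phi> (b # \<tau>)) \<tau>" for b \<tau>
    by (rule Cons.IH) (use Cons.prems in auto)
  have x: "x \<in> carrier R" "x [^] t \<in> carrier R" "set xs \<subseteq> carrier R" using Cons.prems by auto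
  show ?case
  proof (cases \<sigma>)
    case (Cons b \<tau>)
    show ?thesis
    proof (cases b)
      case True
      have "koszul_d R M (Suc t) xs (\<lambda>\<tau>. (x \<otimes> monomial_of R xs \<tau>) \<odot>\<^bsub>M\<^esub> \<phi> (True # \<tau>)) \<tau>
         = x \<odot>\<^bsub>M\<^esub> (monomial_of R xs \<tau> \<odot>\<^bsub>M\<^esub> koszul_d R M t xs (\<lambda>\<tau>. \<phi> (True # \<tau>)) \<tau>)"
        using Cons.prems x IH[of True \<tau>] by (simp add: smult_assoc1 koszul_d_smult)
      moreover have "x [^] t \<otimes> x \<otimes> monomial_of R xs \<tau> = x \<otimes> monomial_of R xs \<tau> \<otimes> x [^] t"
        using x by (simp add: R.m_ac)
      ultimately show ?thesis using c[of t True \<tau>] Cons True x Cons.prems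
        by (simp add: a_minus_def smult_r_distr smult_r_minus R.m_ac smult_assoc1[symmetric])
    qed (use Cons IH in simp)
  qed auto
qed (simp)

text \<open>The degree of a basis element is its number of marks, so homogeneity is a support
  condition. Degrees are integers, which lets degree -1 occur without a special case.\<close>

lemma koszul_d_support:
  assumes "\<And>\<sigma>. length \<sigma> \<noteq> length xs \<or> int (count_list \<sigma> True) \<noteq> i \<Longrightarrow> \<phi> \<sigma> = \<zero>\<^bsub>M\<^esub>"
    and "length \<sigma> \<noteq> length xs \<or> int (count_list \<sigma> True) \<noteq> i + 1"
    and "set xs \<subseteq> carrier R"
  shows "koszul_d R M t xs \<phi> \<sigma> = \<zero>\<^bsub>M\<^esub>"
  using assms
proof (induction xs arbitrary: \<sigma> \<phi> i)
  case (Cons x xs)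
  show ?case
  proof (cases \<sigma>)
    case (Cons b \<tau>)
    have F: "koszul_d R M t xs (\<lambda>\<tau>. \<phi> (False # \<tau>)) \<tau> = \<zero>\<^bsub>M\<^esub>"
      if "length \<tau> \<noteq> length xs \<or> int (count_list \<tau> True) \<noteq> i + 1"
      by (rule Cons.IH[where i = i]) (use Cons.prems that in auto)
    have T: "koszul_d R M t xs (\<lambda>\<tau>. \<phi> (True # \<tau>)) \<tau> = \<zero>\<^bsub>M\<^esub>"
      if "length \<tau> \<noteq> length xs \<or> int (count_list \<tau> True) \<noteq> i"
      by (rule Cons.IH[where i = "i - 1"]) (use Cons.prems that in auto)
    have P: "\<phi> (False # \<tau>) = \<zero>\<^bsub>M\<^esub>" if "length \<tau> \<noteq> length xs \<or> int (count_list \<tau> True) \<noteq> i"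
      using Cons.prems(1) that by auto
    show ?thesis
      using Cons Cons.prems F T P by (cases b) (auto simp: a_minus_def)
  qed simp
qed (auto split: list.splits)

lemma koszul_d_morphism:
  assumes "module R N" "module_morphism R M N f" "set xs \<subseteq> carrier R" "\<And>\<sigma>. \<phi> \<sigma> \<in> carrier M"
  shows "koszul_d R N t xs (\<lambda>\<sigma>. f (\<phi> \<sigma>)) \<sigma> = f (koszul_d R M t xs \<phi> \<sigma>)"
  using assms(3,4)
proof (induction xs arbitrary: \<sigma> \<phi>)
  case Nil
  then show ?case using module_morphism_zero[OF module_axioms assms(1,2)] by simp
next
  case (Cons x xs)
  have c: "koszul_d R M t xs (\<lambda>\<tau>. \<phi> (b # \<tau>)) \<tau> \<in> carrier M" for b \<tau> t
    using Cons.prems by (auto intro!: koszul_d_closed)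
  have IH: "koszul_d R N t xs (\<lambda>\<tau>. f (\<phi> (b # \<tau>))) \<tau> = f (koszul_d R M t xs (\<lambda>\<tau>. \<phi> (b # \<tau>)) \<tau>)" for b \<tau>
    by (rule Cons.IH) (use Cons.prems in auto)
  show ?case
  proof (cases \<sigma>)
    case Nil
    then show ?thesis using module_morphism_zero[OF module_axioms assms(1,2)] by simp
  next
    case (Cons b \<tau>)
    then show ?thesis 
      using module_morphism_minus[OF module_axioms assms(1,2)] c Cons.prems module_morphismD[OF assms(2)]
        IH by (cases b) auto
  qed
qed

end

section \<open>Cohomology of a sequence of ring elements\<close>

text \<open>An element of the direct limit over \<open>t\<close> of the Koszul cochains on the \<open>t\<close>-th powers is represented
  by a sequence of Koszul cochains that is compatible with the transition maps for all large \<open>t\<close>;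
  representatives that agree for all large \<open>t\<close> are identified.  This works because the transition map
  multiplies each coefficient by a monomial.\<close>

definition cochains ::
    "('a, 'k) ring_scheme \<Rightarrow> ('a, 'b) module \<Rightarrow> 'a list \<Rightarrow> int \<Rightarrow> (nat \<Rightarrow> bool list \<Rightarrow> 'b) set" where
  "cochains R N xs i =
     {\<Phi>. (\<forall>t \<sigma>. \<Phi> t \<sigma> \<in> carrier N) \<and>
        (\<forall>t \<sigma>. length \<sigma> \<noteq> length xs \<or> int (count_list \<sigma> True) \<noteq> i \<longrightarrow> \<Phi> t \<sigma> = \<zero>\<^bsub>N\<^esub>) \<and>
        (\<forall>\<^sub>F t in sequentially. \<Phi> (Suc t) = (\<lambda>\<sigma>. monomial_of R xs \<sigma> \<odot>\<^bsub>N\<^esub> \<Phi> t \<sigma>))}"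

definition cobdry ::
    "('a, 'k) ring_scheme \<Rightarrow> ('a, 'b) module \<Rightarrow> 'a list \<Rightarrow> (nat \<Rightarrow> bool list \<Rightarrow> 'b)
       \<Rightarrow> nat \<Rightarrow> bool list \<Rightarrow> 'b" where
  "cobdry R N xs \<Phi> = (\<lambda>t. koszul_d R N t xs (\<Phi> t))"

definition cocycles ::
    "('a, 'k) ring_scheme \<Rightarrow> ('a, 'b) module \<Rightarrow> 'a list \<Rightarrow> int \<Rightarrow> (nat \<Rightarrow> bool list \<Rightarrow> 'b) set" where
  "cocycles R N xs i =
     {\<Phi> \<in> cochains R N xs i. \<forall>\<^sub>F t in sequentially. cobdry R N xs \<Phi> t = (\<lambda>_. \<zero>\<^bsub>N\<^esub>)}"

definition coboundaries ::
    "('a, 'k) ring_scheme \<Rightarrow> ('a, 'b) module \<Rightarrow> 'a list \<Rightarrow> int \<Rightarrow> (nat \<Rightarrow> bool list \<Rightarrow> 'b) set" where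
  "coboundaries R N xs i =
     {\<Phi> \<in> cochains R N xs i. \<exists>\<Psi> \<in> cochains R N xs (i - 1).
        \<forall>\<^sub>F t in sequentially. \<Phi> t = cobdry R N xs \<Psi> t}"

definition cohomology_zero ::
    "('a, 'k) ring_scheme \<Rightarrow> ('a, 'b) module \<Rightarrow> 'a list \<Rightarrow> int \<Rightarrow> bool" where
  "cohomology_zero R N xs i \<longleftrightarrow> cocycles R N xs i \<subseteq> coboundaries R N xs i"

abbreviation cochain_module :: "('a, 'b) module \<Rightarrow> ('a, nat \<Rightarrow> bool list \<Rightarrow> 'b) module" where
  "cochain_module N \<equiv> fun_module (fun_module N)"

locale sequence_cohomology = rmodule R M
  for R :: "('a, 'k) ring_scheme" (structure) and M :: "('a, 'b) module" (structure) +
  fixes xs :: "'a list"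
  assumes xs_closed: "set xs \<subseteq> carrier R"
begin

abbreviation "C \<equiv> cochains R M xs"
abbreviation "Z \<equiv> cocycles R M xs"
abbreviation "B \<equiv> coboundaries R M xs"
abbreviation "\<delta> \<equiv> cobdry R M xs"
abbreviation "T \<equiv> cochain_module M"

lemma T_module: "module R T"
  by (intro fun_module_module module_axioms)

sublocale T: module R T by (rule T_module)

lemma T_minus: "\<Phi> \<ominus>\<^bsub>T\<^esub> \<Psi> = (\<lambda>t \<sigma>. \<Phi> t \<sigma> \<ominus>\<^bsub>M\<^esub> \<Psi> t \<sigma>)"
  if "\<And>t \<sigma>. \<Phi> t \<sigma> \<in> carrier M" "\<And>t \<sigma>. \<Psi> t \<sigma> \<in> carrier M"
proof -
  have "\<Phi> t \<ominus>\<^bsub>fun_module M\<^esub> \<Psi> t = (\<lambda>\<sigma>. \<Phi> t \<sigma> \<ominus>\<^bsub>M\<^esub> \<Psi> t \<sigma>)" for t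
    by (rule fun_module_minus[OF module_axioms]) (use that in auto)
  then show ?thesis
    using that fun_module_minus[OF fun_module_module[OF module_axioms], of \<Phi> \<Psi>] by simp
qed

lemma cochains_closed: "\<Phi> \<in> C i \<Longrightarrow> \<Phi> t \<sigma> \<in> carrier M"
  by (auto simp: cochains_def)

lemma cochains_support:
  "\<Phi> \<in> C i \<Longrightarrow> length \<sigma> \<noteq> length xs \<or> int (count_list \<sigma> True) \<noteq> i \<Longrightarrow> \<Phi> t \<sigma> = \<zero>\<^bsub>M\<^esub>"
  by (auto simp: cochains_def)

lemma cochains_eventually:
  "\<Phi> \<in> C i \<Longrightarrow> \<forall>\<^sub>F t in sequentially. \<Phi> (Suc t) = (\<lambda>\<sigma>. monomial_of R xs \<sigma> \<odot>\<^bsub>M\<^esub> \<Phi> t \<sigma>)"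
  by (auto simp: cochains_def)

lemma mon_closed [simp]: "monomial_of R xs \<sigma> \<in> carrier R"
  using xs_closed by simp

lemma submodule_cochains: "submodule (C i) R T"
proof (rule T.submoduleI)
  show "C i \<subseteq> carrier T" by (auto simp: cochains_def)
  show "\<zero>\<^bsub>T\<^esub> \<in> C i" by (auto simp: cochains_def)
next
  fix \<Phi> \<Psi> assume a: "\<Phi> \<in> C i" "\<Psi> \<in> C i"
  have "\<forall>\<^sub>F t in sequentially. (\<lambda>\<sigma>. \<Phi> (Suc t) \<sigma> \<oplus>\<^bsub>M\<^esub> \<Psi> (Suc t) \<sigma>)
      = (\<lambda>\<sigma>. monomial_of R xs \<sigma> \<odot>\<^bsub>M\<^esub> (\<Phi> t \<sigma> \<oplus>\<^bsub>M\<^esub> \<Psi> t \<sigma>))"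
    using cochains_eventually[OF a(1)] cochains_eventually[OF a(2)]
    by eventually_elim (auto simp: cochains_closed[OF a(1)] cochains_closed[OF a(2)] smult_r_distr)
  then show "\<Phi> \<oplus>\<^bsub>T\<^esub> \<Psi> \<in> C i" using a by (auto simp: cochains_def)
next
  fix r \<Phi> assume a: "r \<in> carrier R" "\<Phi> \<in> C i"
  have "\<forall>\<^sub>F t in sequentially. (\<lambda>\<sigma>. r \<odot>\<^bsub>M\<^esub> \<Phi> (Suc t) \<sigma>)
      = (\<lambda>\<sigma>. monomial_of R xs \<sigma> \<odot>\<^bsub>M\<^esub> (r \<odot>\<^bsub>M\<^esub> \<Phi> t \<sigma>))"
    using cochains_eventually[OF a(2)]
    by eventually_elim (auto simp: cochains_closed[OF a(2)] a(1) R.m_comm simp flip: smult_assoc1)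
  then show s: "r \<odot>\<^bsub>T\<^esub> \<Phi> \<in> C i" using a by (auto simp: cochains_def)
next
  fix \<Phi> assume a: "\<Phi> \<in> C i"
  have "\<forall>\<^sub>F t in sequentially. (\<lambda>\<sigma>. \<ominus>\<^bsub>M\<^esub> \<Phi> (Suc t) \<sigma>)
      = (\<lambda>\<sigma>. monomial_of R xs \<sigma> \<odot>\<^bsub>M\<^esub> (\<ominus>\<^bsub>M\<^esub> \<Phi> t \<sigma>))"
    using cochains_eventually[OF a]
    by eventually_elim (auto simp: cochains_closed[OF a] smult_r_minus)
  moreover have "\<ominus>\<^bsub>T\<^esub> \<Phi> = (\<lambda>t \<sigma>. \<ominus>\<^bsub>M\<^esub> \<Phi> t \<sigma>)"
  proof -
    have "\<ominus>\<^bsub>fun_module M\<^esub> \<Phi> t = (\<lambda>\<sigma>. \<ominus>\<^bsub>M\<^esub> \<Phi> t \<sigma>)" for t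
      by (rule fun_module_uminus[OF module_axioms]) (rule cochains_closed[OF a])
    then show ?thesis
      using fun_module_uminus[OF fun_module_module[OF module_axioms], of \<Phi>] cochains_closed[OF a]
      by simp
  qed
  ultimately show "\<ominus>\<^bsub>T\<^esub> \<Phi> \<in> C i" using a by (auto simp: cochains_def)
qed

lemma cobdry_cochains: "\<Phi> \<in> C i \<Longrightarrow> \<delta> \<Phi> \<in> C (i + 1)"
proof -
  assume a: "\<Phi> \<in> C i"
  have "\<forall>\<^sub>F t in sequentially. \<delta> \<Phi> (Suc t) = (\<lambda>\<sigma>. monomial_of R xs \<sigma> \<odot>\<^bsub>M\<^esub> \<delta> \<Phi> t \<sigma>)"
    using cochains_eventually[OF a]
    by eventually_elim (auto simp: cobdry_def cochains_closed[OF a] koszul_d_transition xs_closed)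
  moreover have "\<delta> \<Phi> t \<sigma> = \<zero>\<^bsub>M\<^esub>" if "length \<sigma> \<noteq> length xs \<or> int (count_list \<sigma> True) \<noteq> i + 1" for t \<sigma>
    unfolding cobdry_def by (rule koszul_d_support[OF cochains_support[OF a] that xs_closed])
  moreover have "\<delta> \<Phi> t \<sigma> \<in> carrier M" for t \<sigma>
    unfolding cobdry_def by (rule koszul_d_closed[OF xs_closed cochains_closed[OF a]])
  ultimately show ?thesis by (auto simp: cochains_def)
qed

lemma cobdry_cobdry: "\<Phi> \<in> C i \<Longrightarrow> \<delta> (\<delta> \<Phi>) t = (\<lambda>_. \<zero>\<^bsub>M\<^esub>)"
  unfolding cobdry_def by (rule ext) (rule koszul_d_square[OF xs_closed cochains_closed])

lemma cobdry_zero: "\<Phi> t = (\<lambda>_. \<zero>\<^bsub>M\<^esub>) \<Longrightarrow> \<delta> \<Phi> t = (\<lambda>_. \<zero>\<^bsub>M\<^esub>)"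
  using koszul_d_zero[OF xs_closed] by (auto simp: cobdry_def)

lemma cobdry_cong: "\<Phi> t = \<Psi> t \<Longrightarrow> \<delta> \<Phi> t = \<delta> \<Psi> t"
  by (auto simp: cobdry_def)

lemma cobdry_add:
  "\<Phi> \<in> C i \<Longrightarrow> \<Psi> \<in> C j \<Longrightarrow> \<delta> (\<Phi> \<oplus>\<^bsub>T\<^esub> \<Psi>) t = (\<lambda>\<sigma>. \<delta> \<Phi> t \<sigma> \<oplus>\<^bsub>M\<^esub> \<delta> \<Psi> t \<sigma>)"
  by (auto simp: cobdry_def koszul_d_add xs_closed cochains_closed)

lemma cobdry_smult:
  "r \<in> carrier R \<Longrightarrow> \<Phi> \<in> C i \<Longrightarrow> \<delta> (r \<odot>\<^bsub>T\<^esub> \<Phi>) t = (\<lambda>\<sigma>. r \<odot>\<^bsub>M\<^esub> \<delta> \<Phi> t \<sigma>)"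
  by (auto simp: cobdry_def koszul_d_smult xs_closed cochains_closed)

lemma cobdry_closed: "\<Phi> \<in> C i \<Longrightarrow> \<delta> \<Phi> t \<sigma> \<in> carrier M"
  using cobdry_cochains cochains_closed by blast

lemma T_uminus: "\<Phi> \<in> C i \<Longrightarrow> \<ominus>\<^bsub>T\<^esub> \<Phi> = (\<ominus> \<one>) \<odot>\<^bsub>T\<^esub> \<Phi>"
  using T.smult_l_minus[of \<one> \<Phi>] T.smult_one[of \<Phi>] cochains_closed[of \<Phi> i]
  by (metis R.one_closed T_module fun_module_simps(1))

lemma submoduleI':
  assumes "S \<subseteq> C i" "\<zero>\<^bsub>T\<^esub> \<in> S" "\<And>a b. a \<in> S \<Longrightarrow> b \<in> S \<Longrightarrow> a \<oplus>\<^bsub>T\<^esub> b \<in> S"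
    "\<And>r a. r \<in> carrier R \<Longrightarrow> a \<in> S \<Longrightarrow> r \<odot>\<^bsub>T\<^esub> a \<in> S"
  shows "submodule S R T"
proof (rule T.submoduleI)
  show "S \<subseteq> carrier T" using assms(1) cochains_closed by fastforce
  show "\<ominus>\<^bsub>T\<^esub> a \<in> S" if "a \<in> S" for a
    using T_uminus[of a i] assms that by auto
qed (use assms in auto)

lemma submodule_cocycles: "submodule (Z i) R T"
proof (rule submoduleI'[of _ i])
  note s = T.submoduleE[OF submodule_cochains]
  show "Z i \<subseteq> C i" by (auto simp: cocycles_def)
  show "\<zero>\<^bsub>T\<^esub> \<in> Z i" 
    using koszul_d_zero[OF xs_closed] by (auto simp: cocycles_def cochains_def cobdry_def fun_eq_iff)
  show "a \<oplus>\<^bsub>T\<^esub> b \<in> Z i" if "a \<in> Z i" "b \<in> Z i" for a b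
  proof -
    have ab: "a \<in> C i" "b \<in> C i" using that by (auto simp: cocycles_def)
    have "\<forall>\<^sub>F t in sequentially. \<delta> a t = (\<lambda>_. \<zero>\<^bsub>M\<^esub>)" "\<forall>\<^sub>F t in sequentially. \<delta> b t = (\<lambda>_. \<zero>\<^bsub>M\<^esub>)"
      using that by (auto simp: cocycles_def)
    then have "\<forall>\<^sub>F t in sequentially. \<delta> (a \<oplus>\<^bsub>T\<^esub> b) t = (\<lambda>_. \<zero>\<^bsub>M\<^esub>)"
      by eventually_elim (auto simp only: cobdry_add[OF ab] M.l_zero M.zero_closed)
    then show ?thesis using s(5)[OF ab] by (auto simp: cocycles_def)
  qed
  show "r \<odot>\<^bsub>T\<^esub> a \<in> Z i" if "r \<in> carrier R" "a \<in> Z i" for r a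
  proof -
    have a: "a \<in> C i" using that by (auto simp: cocycles_def)
    have "\<forall>\<^sub>F t in sequentially. \<delta> a t = (\<lambda>_. \<zero>\<^bsub>M\<^esub>)"
      using that by (auto simp: cocycles_def)
    then have "\<forall>\<^sub>F t in sequentially. \<delta> (r \<odot>\<^bsub>T\<^esub> a) t = (\<lambda>_. \<zero>\<^bsub>M\<^esub>)"
      by eventually_elim (auto simp only: cobdry_smult[OF that(1) a] smult_r_null[OF that(1)])
    then show ?thesis using s(4)[OF that(1) a] by (auto simp: cocycles_def)
  qed
qed

lemma submodule_coboundaries: "submodule (B i) R T"
proof (rule submoduleI'[of _ i])
  note s = T.submoduleE[OF submodule_cochains]
  show "B i \<subseteq> C i" by (auto simp: coboundaries_def)
  have "\<zero>\<^bsub>T\<^esub> \<in> C j" for j by (auto simp: cochains_def)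
  then show "\<zero>\<^bsub>T\<^esub> \<in> B i" 
    using koszul_d_zero[OF xs_closed]
    by (auto simp: coboundaries_def cobdry_def fun_eq_iff intro!: bexI[of _ "\<zero>\<^bsub>T\<^esub>"])
  show "a \<oplus>\<^bsub>T\<^esub> b \<in> B i" if "a \<in> B i" "b \<in> B i" for a b
  proof -
    have ab: "a \<in> C i" "b \<in> C i" using that by (auto simp: coboundaries_def)
    obtain \<Phi> \<Psi> where *: "\<Phi> \<in> C (i - 1)" "\<Psi> \<in> C (i - 1)"
      and "\<forall>\<^sub>F t in sequentially. a t = \<delta> \<Phi> t" "\<forall>\<^sub>F t in sequentially. b t = \<delta> \<Psi> t"
      using \<open>a \<in> B i\<close> \<open>b \<in> B i\<close> unfolding coboundaries_def by blast
    from this(3,4) have "\<forall>\<^sub>F t in sequentially. (a \<oplus>\<^bsub>T\<^esub> b) t = \<delta> (\<Phi> \<oplus>\<^bsub>T\<^esub> \<Psi>) t"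
      by eventually_elim (subst cobdry_add[OF *], simp)
    then show ?thesis using s(5)[OF ab] s(5)[OF *] by (auto simp: coboundaries_def)
  qed
  show "r \<odot>\<^bsub>T\<^esub> a \<in> B i" if "r \<in> carrier R" "a \<in> B i" for r a
  proof -
    have a: "a \<in> C i" using that by (auto simp: coboundaries_def)
    obtain \<Phi> where *: "\<Phi> \<in> C (i - 1)" and "\<forall>\<^sub>F t in sequentially. a t = \<delta> \<Phi> t"
      using \<open>a \<in> B i\<close> by (auto simp: coboundaries_def)
    from this(2) have "\<forall>\<^sub>F t in sequentially. (r \<odot>\<^bsub>T\<^esub> a) t = \<delta> (r \<odot>\<^bsub>T\<^esub> \<Phi>) t"
      by eventually_elim (subst cobdry_smult[OF that(1) *], simp)
    then show ?thesis using s(4)[OF that(1) a] s(4)[OF that(1) *] by (auto simp: coboundaries_def)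
  qed
qed

lemma coboundaries_subset_cocycles: "B i \<subseteq> Z i"
proof
  fix \<Phi> assume "\<Phi> \<in> B i"
  then obtain \<Psi> where \<Phi>: "\<Phi> \<in> C i" and \<Psi>: "\<Psi> \<in> C (i - 1)"
    and "\<forall>\<^sub>F t in sequentially. \<Phi> t = \<delta> \<Psi> t"
    by (auto simp: coboundaries_def)
  from this(3) have "\<forall>\<^sub>F t in sequentially. \<delta> \<Phi> t = (\<lambda>_. \<zero>\<^bsub>M\<^esub>)"
    by eventually_elim (use cobdry_cobdry[OF \<Psi>] cobdry_cong in metis)
  then show "\<Phi> \<in> Z i" using \<Phi> by (auto simp: cocycles_def)
qed

lemma coboundaries_eventually_zero:
  assumes "\<Phi> \<in> C i" "\<forall>\<^sub>F t in sequentially. \<Phi> t = (\<lambda>_. \<zero>\<^bsub>M\<^esub>)"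
  shows "\<Phi> \<in> B i"
proof -
  have "\<zero>\<^bsub>T\<^esub> \<in> C j" for j by (auto simp: cochains_def)
  then show ?thesis using assms koszul_d_zero[OF xs_closed] unfolding coboundaries_def
    by (auto simp: cobdry_def fun_eq_iff intro!: bexI[of _ "\<zero>\<^bsub>T\<^esub>"])
qed

lemma coboundaries_cong:
  assumes "\<Phi> \<in> C i" "\<Psi> \<in> B i" "\<forall>\<^sub>F t in sequentially. \<Phi> t = \<Psi> t"
  shows "\<Phi> \<in> B i"
proof -
  obtain \<Theta> where "\<Theta> \<in> C (i - 1)" and e: "\<forall>\<^sub>F t in sequentially. \<Psi> t = \<delta> \<Theta> t"
    using assms by (auto simp: coboundaries_def)
  moreover have "\<forall>\<^sub>F t in sequentially. \<Phi> t = \<delta> \<Theta> t"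
    using e assms(3) by eventually_elim simp
  ultimately show ?thesis using assms(1) by (auto simp: coboundaries_def)
qed

text \<open>The representative of the class that a single Koszul cochain \<open>u\<close> at stage
  \<open>t\<^sub>0\<close> has in the direct limit. Constructions are carried out at one stage and
  then transported, because independent choices at all stages would not respect the transition
  maps.\<close>

definition propagate :: "nat \<Rightarrow> (bool list \<Rightarrow> 'b) \<Rightarrow> nat \<Rightarrow> bool list \<Rightarrow> 'b" where
  "propagate t\<^sub>0 u = (\<lambda>t \<sigma>. if t < t\<^sub>0 then \<zero>\<^bsub>M\<^esub> else (monomial_of R xs \<sigma> [^] (t - t\<^sub>0)) \<odot>\<^bsub>M\<^esub> u \<sigma>)"

lemma propagate_cochains:
  assumes "\<And>\<sigma>. u \<sigma> \<in> carrier M"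
    and "\<And>\<sigma>. length \<sigma> \<noteq> length xs \<or> int (count_list \<sigma> True) \<noteq> i \<Longrightarrow> u \<sigma> = \<zero>\<^bsub>M\<^esub>"
  shows "propagate t\<^sub>0 u \<in> C i"
proof -
  have "\<forall>\<^sub>F t in sequentially. propagate t\<^sub>0 u (Suc t) = (\<lambda>\<sigma>. monomial_of R xs \<sigma> \<odot>\<^bsub>M\<^esub> propagate t\<^sub>0 u t \<sigma>)"
    using eventually_ge_at_top[of t\<^sub>0]
    by eventually_elim
      (use assms in \<open>auto simp: propagate_def Suc_diff_le smult_assoc1[symmetric] R.m_comm\<close>)
  then show ?thesis using assms by (auto simp: cochains_def propagate_def)
qed

lemma cochain_eq_propagate:
  assumes "\<Phi> \<in> C i" "\<And>t. t \<ge> t\<^sub>0 \<Longrightarrow> \<Phi> (Suc t) = (\<lambda>\<sigma>. monomial_of R xs \<sigma> \<odot>\<^bsub>M\<^esub> \<Phi> t \<sigma>)"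
    and "t \<ge> t\<^sub>0"
  shows "\<Phi> t = propagate t\<^sub>0 (\<Phi> t\<^sub>0) t"
  using \<open>t \<ge> t\<^sub>0\<close>
proof (induction rule: dec_induct)
  case base
  then show ?case using cochains_closed[OF assms(1)] by (auto simp: propagate_def)
next
  case (step n)
  then show ?case using assms(2)[of n] cochains_closed[OF assms(1)]
    by (auto simp: propagate_def Suc_diff_le smult_assoc1[symmetric] R.m_comm)
qed

text \<open>A list with d entries has at most d marks, so a cochain in such a degree is
  zero.\<close>

lemma cohomology_zero_above: "i > int (length xs) \<Longrightarrow> cohomology_zero R M xs i"
proof -
  assume i: "i > int (length xs)"
  show ?thesis unfolding cohomology_zero_def
  proof
    fix \<Phi> assume "\<Phi> \<in> Z i"
    then have \<Phi>: "\<Phi> \<in> C i" by (auto simp: cocycles_def)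
    have "length \<sigma> \<noteq> length xs \<or> int (count_list \<sigma> True) \<noteq> i" for \<sigma>
      using count_le_length[of \<sigma> True] i by auto
    then have "\<Phi> t = (\<lambda>_. \<zero>\<^bsub>M\<^esub>)" for t
      using cochains_support[OF \<Phi>] by blast
    then show "\<Phi> \<in> B i" by (intro coboundaries_eventually_zero[OF \<Phi>]) auto
  qed
qed

lemma cohomology_zero_negative: "i < 0 \<Longrightarrow> cohomology_zero R M xs i"
proof -
  assume i: "i < 0"
  show ?thesis unfolding cohomology_zero_def
  proof
    fix \<Phi> assume "\<Phi> \<in> Z i"
    then have \<Phi>: "\<Phi> \<in> C i" by (auto simp: cocycles_def)
    have "\<Phi> t = (\<lambda>_. \<zero>\<^bsub>M\<^esub>)" for t
      using cochains_support[OF \<Phi>] i by auto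
    then show "\<Phi> \<in> B i" by (intro coboundaries_eventually_zero[OF \<Phi>]) auto
  qed
qed

lemma cohomology_zero_trivial: "carrier M = {\<zero>\<^bsub>M\<^esub>} \<Longrightarrow> cohomology_zero R M xs i"
  unfolding cohomology_zero_def
  by (auto simp: cocycles_def cochains_def fun_eq_iff intro!: coboundaries_eventually_zero)

end

lemma sequence_cohomologyI:
  "module R M \<Longrightarrow> set xs \<subseteq> carrier R \<Longrightarrow> sequence_cohomology R M xs"
  by (simp add: sequence_cohomology_def rmodule_def sequence_cohomology_axioms_def)


section \<open>The long exact sequence\<close>

definition short_exact ::
    "('a, 'k) ring_scheme \<Rightarrow> ('a, 'b) module \<Rightarrow> ('a, 'c) module \<Rightarrow> ('a, 'd) module
       \<Rightarrow> ('b \<Rightarrow> 'c) \<Rightarrow> ('c \<Rightarrow> 'd) \<Rightarrow> bool" where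
  "short_exact R L M N f g \<longleftrightarrow>
     module R L \<and> module R M \<and> module R N \<and> module_morphism R L M f \<and> module_morphism R M N g \<and>
     inj_on f (carrier L) \<and> g ` carrier M = carrier N \<and>
     f ` carrier L = {x \<in> carrier M. g x = \<zero>\<^bsub>N\<^esub>}"

definition push :: "('b \<Rightarrow> 'c) \<Rightarrow> (nat \<Rightarrow> bool list \<Rightarrow> 'b) \<Rightarrow> nat \<Rightarrow> bool list \<Rightarrow> 'c" where
  "push f \<Phi> = (\<lambda>t \<sigma>. f (\<Phi> t \<sigma>))"

lemma push_cochains:
  assumes "module R M" "module R N" "module_morphism R M N f" "set xs \<subseteq> carrier R"
    and \<Phi>: "\<Phi> \<in> cochains R M xs i"
  shows "push f \<Phi> \<in> cochains R N xs i" "cobdry R N xs (push f \<Phi>) = push f (cobdry R M xs \<Phi>)"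
proof -
  interpret M: sequence_cohomology R M xs by (rule sequence_cohomologyI) fact+
  interpret N: sequence_cohomology R N xs by (rule sequence_cohomologyI) fact+
  have "\<forall>\<^sub>F t in sequentially. push f \<Phi> (Suc t) = (\<lambda>\<sigma>. monomial_of R xs \<sigma> \<odot>\<^bsub>N\<^esub> push f \<Phi> t \<sigma>)"
    using M.cochains_eventually[OF \<Phi>]
    by eventually_elim (auto simp: push_def module_morphismD(3)[OF assms(3)] M.cochains_closed[OF \<Phi>])
  then show "push f \<Phi> \<in> cochains R N xs i"
    using \<Phi> module_morphismD(1)[OF assms(3)] module_morphism_zero[OF assms(1-3)]
    by (auto simp: cochains_def push_def)
  show "cobdry R N xs (push f \<Phi>) = push f (cobdry R M xs \<Phi>)"
    unfolding cobdry_def push_def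
    by (intro ext M.koszul_d_morphism[OF assms(2-4)] M.cochains_closed[OF \<Phi>])
qed

lemma push_zero: 
  assumes "module R M" "module R N" "module_morphism R M N f" "\<Phi> t = (\<lambda>_. \<zero>\<^bsub>M\<^esub>)"
  shows "push f \<Phi> t = (\<lambda>_. \<zero>\<^bsub>N\<^esub>)"
  using module_morphism_zero[OF assms(1-3)] assms(4) by (auto simp: push_def)

lemma push_cocycles:
  assumes "module R M" "module R N" "module_morphism R M N f" "set xs \<subseteq> carrier R"
    and \<Phi>: "\<Phi> \<in> cocycles R M xs i"
  shows "push f \<Phi> \<in> cocycles R N xs i"
proof -
  have \<Phi>': "\<Phi> \<in> cochains R M xs i" 
    and e: "\<forall>\<^sub>F t in sequentially. cobdry R M xs \<Phi> t = (\<lambda>_. \<zero>\<^bsub>M\<^esub>)" 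
    using \<Phi> by (auto simp: cocycles_def)
  have "\<forall>\<^sub>F t in sequentially. cobdry R N xs (push f \<Phi>) t = (\<lambda>_. \<zero>\<^bsub>N\<^esub>)" 
    using e unfolding push_cochains(2)[OF assms(1-4) \<Phi>']
    by eventually_elim (rule push_zero[OF assms(1-3)])
  then show ?thesis using push_cochains(1)[OF assms(1-4) \<Phi>'] by (auto simp: cocycles_def)
qed

lemma push_coboundaries:
  assumes "module R M" "module R N" "module_morphism R M N f" "set xs \<subseteq> carrier R"
    and \<Phi>: "\<Phi> \<in> coboundaries R M xs i"
  shows "push f \<Phi> \<in> coboundaries R N xs i"
proof -
  obtain \<Psi> where \<Phi>': "\<Phi> \<in> cochains R M xs i" and \<Psi>: "\<Psi> \<in> cochains R M xs (i - 1)"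
    and e: "\<forall>\<^sub>F t in sequentially. \<Phi> t = cobdry R M xs \<Psi> t" 
    using \<Phi> by (auto simp: coboundaries_def)
  have "\<forall>\<^sub>F t in sequentially. push f \<Phi> t = cobdry R N xs (push f \<Psi>) t" 
    using e unfolding push_cochains(2)[OF assms(1-4) \<Psi>]
    by eventually_elim (simp add: push_def)
  then show ?thesis using push_cochains(1)[OF assms(1-4) \<Phi>'] push_cochains(1)[OF assms(1-4) \<Psi>]
    by (auto simp: coboundaries_def)
qed

locale long_exact =
  fixes R :: "('a, 'k) ring_scheme" (structure) and L :: "('a, 'b) module" and M :: "('a, 'c) module"
    and N :: "('a, 'd) module" and f g xs
  assumes ses: "short_exact R L M N f g" and xs_closed: "set xs \<subseteq> carrier R"
begin

lemma L_module: "module R L" and M_module: "module R M" and N_module: "module R N"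
  and f_morphism: "module_morphism R L M f" and g_morphism: "module_morphism R M N g"
  and f_inj: "inj_on f (carrier L)" and g_surj: "g ` carrier M = carrier N"
  and exact: "f ` carrier L = {x \<in> carrier M. g x = \<zero>\<^bsub>N\<^esub>}"
  using ses by (auto simp: short_exact_def)

sublocale L: sequence_cohomology R L xs
  by (rule sequence_cohomologyI[OF L_module xs_closed])
sublocale M: sequence_cohomology R M xs
  by (rule sequence_cohomologyI[OF M_module xs_closed])
sublocale N: sequence_cohomology R N xs
  by (rule sequence_cohomologyI[OF N_module xs_closed])

lemmas push_f = push_cochains[OF L_module M_module f_morphism xs_closed]
lemmas push_g = push_cochains[OF M_module N_module g_morphism xs_closed]

lemma g_f: "x \<in> carrier L \<Longrightarrow> g (f x) = \<zero>\<^bsub>N\<^esub>"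
  using exact by auto

lemma f_eq_zero: "x \<in> carrier L \<Longrightarrow> f x = \<zero>\<^bsub>M\<^esub> \<Longrightarrow> x = \<zero>\<^bsub>L\<^esub>"
  using f_inj module_morphism_zero[OF L_module M_module f_morphism]
  by (metis L.M.zero_closed inj_onD)

lemma push_g_f: "\<Phi> \<in> L.C i \<Longrightarrow> push g (push f \<Phi>) t = (\<lambda>_. \<zero>\<^bsub>N\<^esub>)"
  by (auto simp: push_def g_f L.cochains_closed)

text \<open>Preimages under g are chosen at one stage only and then propagated; g commutes with the
  transition maps, so the lift remains correct at every later stage.\<close>

lemma lift_cochain:
  assumes "\<Phi> \<in> N.C i"
  obtains \<Psi> where "\<Psi> \<in> M.C i" "\<forall>\<^sub>F t in sequentially. push g \<Psi> t = \<Phi> t"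
proof -
  obtain t\<^sub>0 where t\<^sub>0: "\<And>t. t \<ge> t\<^sub>0 \<Longrightarrow> \<Phi> (Suc t) = (\<lambda>\<sigma>. monomial_of R xs \<sigma> \<odot>\<^bsub>N\<^esub> \<Phi> t \<sigma>)"
    using N.cochains_eventually[OF assms] by (auto simp: eventually_sequentially)
  \<comment> \<open>Zero must be lifted to zero, since otherwise the lift would leave degree
    i.\<close>
  have ex: "\<exists>v. v \<in> carrier M \<and> g v = \<Phi> t\<^sub>0 \<sigma> \<and> (\<Phi> t\<^sub>0 \<sigma> = \<zero>\<^bsub>N\<^esub> \<longrightarrow> v = \<zero>\<^bsub>M\<^esub>)" for \<sigma>
    using g_surj N.cochains_closed[OF assms, of t\<^sub>0 \<sigma>] M.M.zero_closed
      module_morphism_zero[OF M_module N_module g_morphism] by (metis imageE)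
  define u where "u \<sigma> = (SOME v. v \<in> carrier M \<and> g v = \<Phi> t\<^sub>0 \<sigma> \<and> (\<Phi> t\<^sub>0 \<sigma> = \<zero>\<^bsub>N\<^esub> \<longrightarrow> v = \<zero>\<^bsub>M\<^esub>))" for \<sigma>
  have u: "u \<sigma> \<in> carrier M" "g (u \<sigma>) = \<Phi> t\<^sub>0 \<sigma>" "\<Phi> t\<^sub>0 \<sigma> = \<zero>\<^bsub>N\<^esub> \<Longrightarrow> u \<sigma> = \<zero>\<^bsub>M\<^esub>" for \<sigma>
    using someI_ex[OF ex[of \<sigma>]] unfolding u_def by auto
  have "M.propagate t\<^sub>0 u \<in> M.C i"
    by (rule M.propagate_cochains) (use u N.cochains_support[OF assms] in auto)
  moreover have "\<forall>\<^sub>F t in sequentially. push g (M.propagate t\<^sub>0 u) t = \<Phi> t"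
    using eventually_ge_at_top[of t\<^sub>0]
  proof eventually_elim
    case (elim t)
    show ?case
      using N.cochain_eq_propagate[OF assms t\<^sub>0 elim] u(1,2) module_morphismD(3)[OF g_morphism] elim
      by (auto simp: push_def M.propagate_def N.propagate_def)
  qed
  ultimately show ?thesis using that by blast
qed

text \<open>Here preimages may be taken at every stage separately: since f is injective they are
  unique, and uniqueness makes them compatible with the transition maps.\<close>

lemma kernel_cochain:
  assumes "\<Phi> \<in> M.C i" "\<forall>\<^sub>F t in sequentially. push g \<Phi> t = (\<lambda>_. \<zero>\<^bsub>N\<^esub>)"
  obtains \<Psi> where "\<Psi> \<in> L.C i" "\<forall>\<^sub>F t in sequentially. push f \<Psi> t = \<Phi> t"
proof -
  \<comment> \<open>The finitely many stages at which the image under g is not yet zero receive the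
    value zero; only the tail of the sequence matters.\<close>
  define \<Psi> where "\<Psi> t \<sigma> = (if push g \<Phi> t = (\<lambda>_. \<zero>\<^bsub>N\<^esub>) then inv_into (carrier L) f (\<Phi> t \<sigma>) else \<zero>\<^bsub>L\<^esub>)"
    for t \<sigma>
  have *: "\<Phi> t \<sigma> \<in> f ` carrier L" if "push g \<Phi> t = (\<lambda>_. \<zero>\<^bsub>N\<^esub>)" for t \<sigma>
    using M.cochains_closed[OF assms(1)] fun_cong[OF that, of \<sigma>] unfolding exact push_def by auto
  have cl: "\<Psi> t \<sigma> \<in> carrier L" for t \<sigma>
    using * by (auto simp: \<Psi>_def inv_into_into)
  have f: "f (\<Psi> t \<sigma>) = \<Phi> t \<sigma>" if "push g \<Phi> t = (\<lambda>_. \<zero>\<^bsub>N\<^esub>)" for t \<sigma>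
    using *[OF that] that by (auto simp: \<Psi>_def f_inv_into_f)
  have supp: "\<Psi> t \<sigma> = \<zero>\<^bsub>L\<^esub>" if "length \<sigma> \<noteq> length xs \<or> int (count_list \<sigma> True) \<noteq> i" for t \<sigma>
  proof (cases "push g \<Phi> t = (\<lambda>_. \<zero>\<^bsub>N\<^esub>)")
    case True
    then show ?thesis using f[OF True] cl f_eq_zero M.cochains_support[OF assms(1) that] by metis
  qed (auto simp: \<Psi>_def)
  have 2: "\<forall>\<^sub>F t in sequentially. push g \<Phi> (Suc t) = (\<lambda>_. \<zero>\<^bsub>N\<^esub>)"
    using assms(2) eventually_sequentially_Suc[of "\<lambda>t. push g \<Phi> t = (\<lambda>_. \<zero>\<^bsub>N\<^esub>)"] by simp
  have "\<forall>\<^sub>F t in sequentially. \<Psi> (Suc t) = (\<lambda>\<sigma>. monomial_of R xs \<sigma> \<odot>\<^bsub>L\<^esub> \<Psi> t \<sigma>)"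
    using assms(2) 2 M.cochains_eventually[OF assms(1)]
  proof eventually_elim
    case (elim t)
    show ?case
    proof
      fix \<sigma>
      have "f (\<Psi> (Suc t) \<sigma>) = f (monomial_of R xs \<sigma> \<odot>\<^bsub>L\<^esub> \<Psi> t \<sigma>)"
        using elim f cl module_morphismD(3)[OF f_morphism, of "monomial_of R xs \<sigma>" "\<Psi> t \<sigma>"] by simp
      then show "\<Psi> (Suc t) \<sigma> = monomial_of R xs \<sigma> \<odot>\<^bsub>L\<^esub> \<Psi> t \<sigma>"
        using f_inj cl by (simp add: inj_on_eq_iff)
    qed
  qed
  then have "\<Psi> \<in> L.C i" using cl supp by (auto simp: cochains_def)
  moreover have "\<forall>\<^sub>F t in sequentially. push f \<Psi> t = \<Phi> t"
    using assms(2) by eventually_elim (use f in \<open>auto simp: push_def\<close>)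
  ultimately show ?thesis using that by blast
qed

lemma minus_zero: "x \<in> carrier M \<Longrightarrow> x \<ominus>\<^bsub>M\<^esub> \<zero>\<^bsub>M\<^esub> = x"
  by (simp add: a_minus_def)

lemma T_minus_cochains: "\<Phi> \<in> M.C i \<Longrightarrow> \<Psi> \<in> M.C i \<Longrightarrow> \<Phi> \<ominus>\<^bsub>M.T\<^esub> \<Psi> \<in> M.C i"
  using M.T.submoduleE(3,5)[OF M.submodule_cochains[of i]] by (simp add: a_minus_def)

lemma eventually_cobdry_f_cancel:
  assumes "\<Phi> \<in> L.C i" "\<Psi> \<in> L.C i" "\<forall>\<^sub>F t in sequentially. push f \<Phi> t = push f \<Psi> t"
  shows "\<forall>\<^sub>F t in sequentially. \<Phi> t = \<Psi> t"
  using assms(3)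
proof eventually_elim
  case (elim t)
  show ?case
  proof
    fix \<sigma>
    have "f (\<Phi> t \<sigma>) = f (\<Psi> t \<sigma>)" using fun_cong[OF elim, of \<sigma>] by (simp add: push_def)
    then show "\<Phi> t \<sigma> = \<Psi> t \<sigma>"
      using f_inj L.cochains_closed[OF assms(1)] L.cochains_closed[OF assms(2)] by (simp add: inj_on_eq_iff)
  qed
qed

lemma cobdry_minus:
  assumes "\<Phi> \<in> M.C i" "\<Psi> \<in> M.C i"
  shows "M.\<delta> (\<Phi> \<ominus>\<^bsub>M.T\<^esub> \<Psi>) t = (\<lambda>\<sigma>. M.\<delta> \<Phi> t \<sigma> \<ominus>\<^bsub>M\<^esub> M.\<delta> \<Psi> t \<sigma>)"
proof -
  have "\<Phi> \<ominus>\<^bsub>M.T\<^esub> \<Psi> = \<Phi> \<oplus>\<^bsub>M.T\<^esub> ((\<ominus> \<one>) \<odot>\<^bsub>M.T\<^esub> \<Psi>)"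
    using M.T_uminus[OF assms(2)] by (simp add: a_minus_def)
  moreover have "(\<ominus> \<one>) \<odot>\<^bsub>M.T\<^esub> \<Psi> \<in> M.C i"
    using M.T.submoduleE(4)[OF M.submodule_cochains[of i] _ assms(2)] by simp
  moreover have "M.\<delta> \<Psi> t \<sigma> \<in> carrier M" for \<sigma> using M.cobdry_closed[OF assms(2)] .
  ultimately show ?thesis
    using M.cobdry_add[OF assms(1)] M.cobdry_smult[OF _ assms(2)]
    by (simp add: a_minus_def M.smult_l_minus)
qed

text \<open>Exactness at H^i(M). A primitive of the image in N is lifted to M, and subtracting its
  coboundary moves the cocycle into the image of L.\<close>

lemma exact_middle:
  assumes \<Phi>: "\<Phi> \<in> M.Z i" and g\<Phi>: "push g \<Phi> \<in> N.B i"
  obtains \<Psi> where "\<Psi> \<in> L.Z i" "\<Phi> \<ominus>\<^bsub>M.T\<^esub> push f \<Psi> \<in> M.B i"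
proof -
  have \<Phi>C: "\<Phi> \<in> M.C i" and d\<Phi>: "\<forall>\<^sub>F t in sequentially. M.\<delta> \<Phi> t = (\<lambda>_. \<zero>\<^bsub>M\<^esub>)" 
    using \<Phi> by (auto simp: cocycles_def)
  obtain \<Theta> where \<Theta>: "\<Theta> \<in> N.C (i - 1)" "\<forall>\<^sub>F t in sequentially. push g \<Phi> t = N.\<delta> \<Theta> t"
    using g\<Phi> by (auto simp: coboundaries_def)
  obtain \<Theta>' where \<Theta>': "\<Theta>' \<in> M.C (i - 1)" "\<forall>\<^sub>F t in sequentially. push g \<Theta>' t = \<Theta> t"
    using lift_cochain[OF \<Theta>(1)] by blast
  have d\<Theta>': "M.\<delta> \<Theta>' \<in> M.C i" using M.cobdry_cochains[OF \<Theta>'(1)] by simp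
  have X: "\<Phi> \<ominus>\<^bsub>M.T\<^esub> M.\<delta> \<Theta>' \<in> M.C i" using T_minus_cochains[OF \<Phi>C d\<Theta>'] .
  have "\<forall>\<^sub>F t in sequentially. push g (\<Phi> \<ominus>\<^bsub>M.T\<^esub> M.\<delta> \<Theta>') t = (\<lambda>_. \<zero>\<^bsub>N\<^esub>)"
    using \<Theta>(2) \<Theta>'(2)
  proof eventually_elim
    case (elim t)
    have "push g (M.\<delta> \<Theta>') t = push g \<Phi> t"
      using elim push_g(2)[OF \<Theta>'(1)] N.cobdry_cong[of "push g \<Theta>'" t \<Theta>] by simp
    then have "g (M.\<delta> \<Theta>' t \<sigma>) = g (\<Phi> t \<sigma>)" for \<sigma> by (auto simp: push_def dest: fun_cong)
    moreover have "g x \<ominus>\<^bsub>N\<^esub> g x = \<zero>\<^bsub>N\<^esub>" if "x \<in> carrier M" for x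
      using module_morphismD(1)[OF g_morphism that] by (simp add: a_minus_def N.M.r_neg)
    ultimately show ?case
      by (auto simp: push_def M.T_minus[OF M.cochains_closed[OF \<Phi>C] M.cochains_closed[OF d\<Theta>']]
        module_morphism_minus[OF M_module N_module g_morphism] M.cochains_closed[OF \<Phi>C]
        M.cochains_closed[OF d\<Theta>'])
  qed
  then obtain \<Psi> where \<Psi>: "\<Psi> \<in> L.C i"
    "\<forall>\<^sub>F t in sequentially. push f \<Psi> t = (\<Phi> \<ominus>\<^bsub>M.T\<^esub> M.\<delta> \<Theta>') t"
    using kernel_cochain[OF X] by blast
  have dX: "\<forall>\<^sub>F t in sequentially. M.\<delta> (\<Phi> \<ominus>\<^bsub>M.T\<^esub> M.\<delta> \<Theta>') t = (\<lambda>_. \<zero>\<^bsub>M\<^esub>)"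
    using d\<Phi> by eventually_elim
      (simp only: cobdry_minus[OF \<Phi>C d\<Theta>'] M.cobdry_cobdry[OF \<Theta>'(1)] minus_zero M.M.zero_closed)
  \<comment> \<open>Comparing with the zero cochain turns cancellation along f into a proof that the
    preimage is a cocycle.\<close>
  have zC: "\<zero>\<^bsub>L.T\<^esub> \<in> L.C (i + 1)" by (auto simp: cochains_def)
  have "\<forall>\<^sub>F t in sequentially. push f (L.\<delta> \<Psi>) t = push f \<zero>\<^bsub>L.T\<^esub> t"
    using \<Psi>(2) dX
  proof eventually_elim
    case (elim t)
    then show ?case using push_f(2)[OF \<Psi>(1)] M.cobdry_cong[of "push f \<Psi>" t]
      module_morphism_zero[OF L_module M_module f_morphism] by (simp add: push_def)
  qed
  from eventually_cobdry_f_cancel[OF L.cobdry_cochains[OF \<Psi>(1)] zC this]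
  have "\<Psi> \<in> L.Z i" using \<Psi>(1) by (simp add: cocycles_def)
  moreover have "\<forall>\<^sub>F t in sequentially. (\<Phi> \<ominus>\<^bsub>M.T\<^esub> push f \<Psi>) t = M.\<delta> \<Theta>' t"
    using \<Psi>(2)
  proof eventually_elim
    case (elim t)
    have c: "\<Phi> t \<sigma> \<in> carrier M" "M.\<delta> \<Theta>' t \<sigma> \<in> carrier M" "push f \<Psi> t \<sigma> \<in> carrier M" for t \<sigma>
      using M.cochains_closed \<Phi>C d\<Theta>' push_f(1)[OF \<Psi>(1)] by blast+
    have "a \<ominus>\<^bsub>M\<^esub> (a \<ominus>\<^bsub>M\<^esub> b) = b" if "a \<in> carrier M" "b \<in> carrier M" for a b
      using that by (simp add: a_minus_def M.M.minus_add M.M.a_assoc[symmetric] M.M.r_neg)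
    with elim c show ?case by (simp add: M.T_minus)
  qed
  moreover have "\<Phi> \<ominus>\<^bsub>M.T\<^esub> push f \<Psi> \<in> M.C i"
    using T_minus_cochains[OF \<Phi>C push_f(1)[OF \<Psi>(1)]] .
  ultimately show ?thesis using that \<Theta>'(1) by (auto simp: coboundaries_def)
qed

text \<open>The connecting homomorphism of the snake lemma, kept as a relation between cocycles: the
  lift to M and the representatives are arbitrary, so there is no preferred value.\<close>

definition connecting :: "int \<Rightarrow> (nat \<Rightarrow> bool list \<Rightarrow> 'd) \<Rightarrow> (nat \<Rightarrow> bool list \<Rightarrow> 'b) \<Rightarrow> bool" where
  "connecting i \<Phi> \<Psi> \<longleftrightarrow> \<Phi> \<in> N.Z i \<and> \<Psi> \<in> L.Z (i + 1) \<and>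
     (\<exists>\<Theta> \<in> M.C i. (\<forall>\<^sub>F t in sequentially. push g \<Theta> t = \<Phi> t) \<and>
        (\<forall>\<^sub>F t in sequentially. M.\<delta> \<Theta> t = push f \<Psi> t))"

lemma connecting_exists:
  assumes "\<Phi> \<in> N.Z i"
  obtains \<Psi> where "connecting i \<Phi> \<Psi>"
proof -
  have \<Phi>C: "\<Phi> \<in> N.C i" and d\<Phi>: "\<forall>\<^sub>F t in sequentially. N.\<delta> \<Phi> t = (\<lambda>_. \<zero>\<^bsub>N\<^esub>)" 
    using assms by (auto simp: cocycles_def)
  obtain \<Theta> where \<Theta>: "\<Theta> \<in> M.C i" "\<forall>\<^sub>F t in sequentially. push g \<Theta> t = \<Phi> t"
    using lift_cochain[OF \<Phi>C] by blast
  have "\<forall>\<^sub>F t in sequentially. push g (M.\<delta> \<Theta>) t = (\<lambda>_. \<zero>\<^bsub>N\<^esub>)"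
    using \<Theta>(2) d\<Phi>
    by eventually_elim (metis N.cobdry_cong push_g(2)[OF \<Theta>(1)])
  then obtain \<Psi> where \<Psi>: "\<Psi> \<in> L.C (i + 1)" "\<forall>\<^sub>F t in sequentially. push f \<Psi> t = M.\<delta> \<Theta> t"
    using kernel_cochain[OF M.cobdry_cochains[OF \<Theta>(1)]] by blast
  have zC: "\<zero>\<^bsub>L.T\<^esub> \<in> L.C (i + 1 + 1)" by (auto simp: cochains_def)
  have "\<forall>\<^sub>F t in sequentially. push f (L.\<delta> \<Psi>) t = push f \<zero>\<^bsub>L.T\<^esub> t"
    using \<Psi>(2)
  proof eventually_elim
    case (elim t)
    then show ?case using push_f(2)[OF \<Psi>(1)] M.cobdry_cong[of "push f \<Psi>" t] M.cobdry_cobdry[OF \<Theta>(1)]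
      module_morphism_zero[OF L_module M_module f_morphism] by (simp add: push_def)
  qed
  from eventually_cobdry_f_cancel[OF L.cobdry_cochains[OF \<Psi>(1)] zC this]
  have "\<Psi> \<in> L.Z (i + 1)" using \<Psi>(1) by (simp add: cocycles_def)
  moreover have "\<forall>\<^sub>F t in sequentially. M.\<delta> \<Theta> t = push f \<Psi> t"
    using \<Psi>(2) by eventually_elim simp
  ultimately show ?thesis using that[of \<Psi>] assms \<Theta> by (auto simp: connecting_def)
qed

text \<open>Exactness at H^i(N): a lift of the cocycle has coboundary f of a coboundary, and
  subtracting f of a primitive makes the lift itself a cocycle.\<close>

lemma exact_right:
  assumes "connecting i \<Phi> \<Psi>" "\<Psi> \<in> L.B (i + 1)"
  obtains \<Theta> where "\<Theta> \<in> M.Z i" "\<forall>\<^sub>F t in sequentially. push g \<Theta> t = \<Phi> t"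
proof -
  obtain \<Theta> where \<Theta>: "\<Theta> \<in> M.C i" "\<forall>\<^sub>F t in sequentially. push g \<Theta> t = \<Phi> t"
      "\<forall>\<^sub>F t in sequentially. M.\<delta> \<Theta> t = push f \<Psi> t"
    using assms(1) by (auto simp: connecting_def)
  obtain \<Xi> where \<Xi>: "\<Xi> \<in> L.C i" "\<forall>\<^sub>F t in sequentially. \<Psi> t = L.\<delta> \<Xi> t"
    using assms(2) by (auto simp: coboundaries_def)
  note f\<Xi> = push_f(1)[OF \<Xi>(1)]
  have X: "\<Theta> \<ominus>\<^bsub>M.T\<^esub> push f \<Xi> \<in> M.C i" using T_minus_cochains[OF \<Theta>(1) f\<Xi>] .
  have c: "\<Theta> t \<sigma> \<in> carrier M" "push f \<Xi> t \<sigma> \<in> carrier M" for t \<sigma>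
    using M.cochains_closed \<Theta>(1) f\<Xi> by blast+
  have "\<forall>\<^sub>F t in sequentially. M.\<delta> (\<Theta> \<ominus>\<^bsub>M.T\<^esub> push f \<Xi>) t = (\<lambda>_. \<zero>\<^bsub>M\<^esub>)"
    using \<Theta>(3) \<Xi>(2)
  proof eventually_elim
    case (elim t)
    have "M.\<delta> \<Theta> t = M.\<delta> (push f \<Xi>) t"
      using elim push_f(2)[OF \<Xi>(1)] by (simp add: push_def)
    then show ?case using cobdry_minus[OF \<Theta>(1) f\<Xi>] M.cobdry_closed[OF f\<Xi>]
      by (simp add: a_minus_def M.M.r_neg)
  qed
  moreover have "\<forall>\<^sub>F t in sequentially. push g (\<Theta> \<ominus>\<^bsub>M.T\<^esub> push f \<Xi>) t = \<Phi> t"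
    using \<Theta>(2)
  proof eventually_elim
    case (elim t)
    have "g (push f \<Xi> t \<sigma>) = \<zero>\<^bsub>N\<^esub>" for \<sigma>
      using fun_cong[OF push_g_f[OF \<Xi>(1), of t]] by (simp add: push_def)
    then have "g ((\<Theta> \<ominus>\<^bsub>M.T\<^esub> push f \<Xi>) t \<sigma>) = g (\<Theta> t \<sigma>)" for \<sigma>
      using module_morphismD(1)[OF g_morphism c(1)]
      unfolding M.T_minus[OF c] module_morphism_minus[OF M_module N_module g_morphism c]
      by (simp add: a_minus_def)
    then have "push g (\<Theta> \<ominus>\<^bsub>M.T\<^esub> push f \<Xi>) t = push g \<Theta> t" by (simp add: push_def)
    then show ?case using elim by simp
  qed
  ultimately show ?thesis using X that by (auto simp: cocycles_def)
qed

text \<open>Exactness at H^(i+1)(L): if the image in M has a primitive, then g of that primitive is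
  a cocycle that connects to the given class.\<close>

lemma exact_left:
  assumes "\<Psi> \<in> L.Z (i + 1)" "push f \<Psi> \<in> M.B (i + 1)"
  obtains \<Phi> where "connecting i \<Phi> \<Psi>"
proof -
  obtain \<Theta> where \<Theta>: "\<Theta> \<in> M.C i" "\<forall>\<^sub>F t in sequentially. push f \<Psi> t = M.\<delta> \<Theta> t"
    using assms(2) by (auto simp: coboundaries_def)
  have \<Psi>C: "\<Psi> \<in> L.C (i + 1)" using assms(1) by (auto simp: cocycles_def)
  have "\<forall>\<^sub>F t in sequentially. N.\<delta> (push g \<Theta>) t = (\<lambda>_. \<zero>\<^bsub>N\<^esub>)"
    using \<Theta>(2)
  proof eventually_elim
    case (elim t)
    then have "push g (M.\<delta> \<Theta>) t = push g (push f \<Psi>) t" unfolding push_def by metis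
    then show ?case using push_g(2)[OF \<Theta>(1)] push_g_f[OF \<Psi>C] by simp
  qed
  then have "push g \<Theta> \<in> N.Z i" using push_g(1)[OF \<Theta>(1)] by (auto simp: cocycles_def)
  moreover have "\<forall>\<^sub>F t in sequentially. M.\<delta> \<Theta> t = push f \<Psi> t"
    using \<Theta>(2) by eventually_elim simp
  ultimately have "connecting i (push g \<Theta>) \<Psi>" unfolding connecting_def using \<Theta>(1) assms(1)
    by (intro conjI bexI[of _ \<Theta>]) auto
  then show ?thesis using that by blast
qed

text \<open>Together with additivity of the relation this says that the connecting map is single
  valued on classes.\<close>

lemma connecting_coboundary:
  assumes "connecting i \<Phi> \<Psi>" "\<Phi> \<in> N.B i"
  shows "\<Psi> \<in> L.B (i + 1)"
proof -
  obtain \<Theta> where \<Theta>: "\<Theta> \<in> M.C i" "\<forall>\<^sub>F t in sequentially. push g \<Theta> t = \<Phi> t"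
      "\<forall>\<^sub>F t in sequentially. M.\<delta> \<Theta> t = push f \<Psi> t" and \<Psi>C: "\<Psi> \<in> L.C (i + 1)"
    using assms(1) by (auto simp: connecting_def cocycles_def)
  obtain \<Xi> where \<Xi>: "\<Xi> \<in> N.C (i - 1)" "\<forall>\<^sub>F t in sequentially. \<Phi> t = N.\<delta> \<Xi> t"
    using assms(2) by (auto simp: coboundaries_def)
  obtain \<Xi>' where \<Xi>': "\<Xi>' \<in> M.C (i - 1)" "\<forall>\<^sub>F t in sequentially. push g \<Xi>' t = \<Xi> t"
    using lift_cochain[OF \<Xi>(1)] by blast
  have d\<Xi>': "M.\<delta> \<Xi>' \<in> M.C i" using M.cobdry_cochains[OF \<Xi>'(1)] by simp
  have X: "\<Theta> \<ominus>\<^bsub>M.T\<^esub> M.\<delta> \<Xi>' \<in> M.C i" using T_minus_cochains[OF \<Theta>(1) d\<Xi>'] .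
  have c: "\<Theta> t \<sigma> \<in> carrier M" "M.\<delta> \<Xi>' t \<sigma> \<in> carrier M" for t \<sigma>
    using M.cochains_closed \<Theta>(1) d\<Xi>' by blast+
  have "\<forall>\<^sub>F t in sequentially. push g (\<Theta> \<ominus>\<^bsub>M.T\<^esub> M.\<delta> \<Xi>') t = (\<lambda>_. \<zero>\<^bsub>N\<^esub>)"
    using \<Theta>(2) \<Xi>(2) \<Xi>'(2)
  proof eventually_elim
    case (elim t)
    have "push g (M.\<delta> \<Xi>') t = push g \<Theta> t"
      using elim push_g(2)[OF \<Xi>'(1)] N.cobdry_cong[of "push g \<Xi>'" t \<Xi>] by simp
    then have "g (M.\<delta> \<Xi>' t \<sigma>) = g (\<Theta> t \<sigma>)" for \<sigma> by (auto simp: push_def dest: fun_cong)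
    moreover have "g x \<ominus>\<^bsub>N\<^esub> g x = \<zero>\<^bsub>N\<^esub>" if "x \<in> carrier M" for x
      using module_morphismD(1)[OF g_morphism that] by (simp add: a_minus_def N.M.r_neg)
    ultimately show ?case
      by (auto simp: push_def M.T_minus[OF c] c
        module_morphism_minus[OF M_module N_module g_morphism])
  qed
  then obtain \<Omega> where \<Omega>: "\<Omega> \<in> L.C i"
    "\<forall>\<^sub>F t in sequentially. push f \<Omega> t = (\<Theta> \<ominus>\<^bsub>M.T\<^esub> M.\<delta> \<Xi>') t"
    using kernel_cochain[OF X] by blast
  have "\<forall>\<^sub>F t in sequentially. push f (L.\<delta> \<Omega>) t = push f \<Psi> t"
    using \<Omega>(2) \<Theta>(3)
  proof eventually_elim
    case (elim t)
    have "push f (L.\<delta> \<Omega>) t = M.\<delta> (\<Theta> \<ominus>\<^bsub>M.T\<^esub> M.\<delta> \<Xi>') t"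
      using elim push_f(2)[OF \<Omega>(1)] M.cobdry_cong[of "push f \<Omega>" t] by simp
    also have "\<dots> = M.\<delta> \<Theta> t"
      unfolding cobdry_minus[OF \<Theta>(1) d\<Xi>'] M.cobdry_cobdry[OF \<Xi>'(1)]
      using M.cobdry_closed[OF \<Theta>(1)] by (simp add: minus_zero)
    finally show ?case using elim by simp
  qed
  from eventually_cobdry_f_cancel[OF L.cobdry_cochains[OF \<Omega>(1)] \<Psi>C this]
  have "\<forall>\<^sub>F t in sequentially. \<Psi> t = L.\<delta> \<Omega> t" by eventually_elim simp
  then show ?thesis using \<Psi>C \<Omega>(1) by (auto simp: coboundaries_def)
qed

lemma cohomology_zero_middle:
  assumes "cohomology_zero R L xs i" "cohomology_zero R N xs i"
  shows "cohomology_zero R M xs i"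
  unfolding cohomology_zero_def
proof
  fix \<Phi> assume \<Phi>: "\<Phi> \<in> M.Z i"
  have "push g \<Phi> \<in> N.B i"
    using push_cocycles[OF M_module N_module g_morphism xs_closed \<Phi>] assms(2)
    by (auto simp: cohomology_zero_def)
  then obtain \<Psi> where \<Psi>: "\<Psi> \<in> L.Z i" "\<Phi> \<ominus>\<^bsub>M.T\<^esub> push f \<Psi> \<in> M.B i"
    using exact_middle[OF \<Phi>] by blast
  have f\<Psi>: "push f \<Psi> \<in> M.B i"
    using push_coboundaries[OF L_module M_module f_morphism xs_closed] \<Psi>(1) assms(1)
    by (auto simp: cohomology_zero_def)
  have c: "\<Phi> t \<sigma> \<in> carrier M" "push f \<Psi> t \<sigma> \<in> carrier M" for t \<sigma>
    using M.cochains_closed \<Phi> f\<Psi> by (auto simp: cocycles_def coboundaries_def)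
  have "(\<Phi> \<ominus>\<^bsub>M.T\<^esub> push f \<Psi>) \<oplus>\<^bsub>M.T\<^esub> push f \<Psi> = \<Phi>"
    using c unfolding M.T_minus[OF c] by (auto simp: a_minus_def M.M.a_assoc M.M.l_neg)
  then show "\<Phi> \<in> M.B i"
    using M.T.submoduleE(5)[OF M.submodule_coboundaries \<Psi>(2) f\<Psi>] by simp
qed

lemma cohomology_zero_right:
  assumes "cohomology_zero R M xs i" "cohomology_zero R L xs (i + 1)"
  shows "cohomology_zero R N xs i"
  unfolding cohomology_zero_def
proof
  fix \<Phi> assume \<Phi>: "\<Phi> \<in> N.Z i"
  obtain \<Psi> where \<Psi>: "connecting i \<Phi> \<Psi>" using connecting_exists[OF \<Phi>] .
  then have "\<Psi> \<in> L.B (i + 1)"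
    using assms(2) by (auto simp: connecting_def cohomology_zero_def)
  then obtain \<Theta> where \<Theta>: "\<Theta> \<in> M.Z i" "\<forall>\<^sub>F t in sequentially. push g \<Theta> t = \<Phi> t"
    using exact_right[OF \<Psi>] by blast
  have "push g \<Theta> \<in> N.B i"
    using push_coboundaries[OF M_module N_module g_morphism xs_closed] \<Theta>(1) assms(1)
    by (auto simp: cohomology_zero_def)
  moreover have "\<forall>\<^sub>F t in sequentially. \<Phi> t = push g \<Theta> t"
    using \<Theta>(2) by eventually_elim simp
  ultimately show "\<Phi> \<in> N.B i"
    using \<Phi> N.coboundaries_cong by (auto simp: cocycles_def)
qed

lemma cohomology_zero_left:
  assumes "cohomology_zero R M xs (i + 1)" "cohomology_zero R N xs i"
  shows "cohomology_zero R L xs (i + 1)"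
  unfolding cohomology_zero_def
proof
  fix \<Psi> assume \<Psi>: "\<Psi> \<in> L.Z (i + 1)"
  have "push f \<Psi> \<in> M.B (i + 1)"
    using push_cocycles[OF L_module M_module f_morphism xs_closed \<Psi>] assms(1)
    by (auto simp: cohomology_zero_def)
  then obtain \<Phi> where "connecting i \<Phi> \<Psi>" using exact_left[OF \<Psi>] by blast
  then show "\<Psi> \<in> L.B (i + 1)"
    using connecting_coboundary assms(2) by (auto simp: connecting_def cohomology_zero_def)
qed

end

section \<open>Torsion\<close>

text \<open>Contraction with the j-th coordinate: it removes the mark at position j, with one sign
  for each mark that precedes it.\<close>

fun koszul_h :: "('a, 'b) module \<Rightarrow> nat \<Rightarrow> (bool list \<Rightarrow> 'b) \<Rightarrow> bool list \<Rightarrow> 'b" where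
  "koszul_h N 0 \<phi> (False # \<sigma>) = \<phi> (True # \<sigma>)"
| "koszul_h N (Suc j) \<phi> (False # \<sigma>) = koszul_h N j (\<lambda>\<tau>. \<phi> (False # \<tau>)) \<sigma>"
| "koszul_h N (Suc j) \<phi> (True # \<sigma>) = \<ominus>\<^bsub>N\<^esub> koszul_h N j (\<lambda>\<tau>. \<phi> (True # \<tau>)) \<sigma>"
| "koszul_h N _ \<phi> _ = \<zero>\<^bsub>N\<^esub>"

context rmodule
begin

lemma uminus_zero [simp]: "\<ominus>\<^bsub>M\<^esub> \<zero>\<^bsub>M\<^esub> = \<zero>\<^bsub>M\<^esub>"
  using M.r_neg[OF M.zero_closed] by simp

lemma koszul_h_closed:
  assumes "\<And>\<sigma>. \<phi> \<sigma> \<in> carrier M"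
  shows "koszul_h M j \<phi> \<sigma> \<in> carrier M"
  using assms
proof (induction j arbitrary: \<phi> \<sigma>)
  case 0
  then show ?case by (cases \<sigma>; cases "hd \<sigma>") auto
next
  case (Suc j)
  then show ?case by (cases \<sigma>; cases "hd \<sigma>") auto
qed

lemma koszul_h_zero: "koszul_h M j (\<lambda>_. \<zero>\<^bsub>M\<^esub>) \<sigma> = \<zero>\<^bsub>M\<^esub>"
proof (induction j arbitrary: \<sigma>)
  case 0
  then show ?case by (cases \<sigma>; cases "hd \<sigma>") auto
next
  case (Suc j)
  then show ?case by (cases \<sigma>; cases "hd \<sigma>") auto
qed

lemma minus_uminus_swap:
  "x \<in> carrier M \<Longrightarrow> y \<in> carrier M \<Longrightarrow> \<ominus>\<^bsub>M\<^esub> (x \<ominus>\<^bsub>M\<^esub> y) = (\<ominus>\<^bsub>M\<^esub> x) \<ominus>\<^bsub>M\<^esub> (\<ominus>\<^bsub>M\<^esub> y)"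
  by (simp add: a_minus_def M.minus_add)

text \<open>The combination has the shape of the \<open>True\<close> clause of
  \<open>koszul_d\<close>, which is where the homotopy formula needs it.\<close>

lemma koszul_h_linear:
  assumes "\<And>\<sigma>. \<phi> \<sigma> \<in> carrier M" "\<And>\<sigma>. \<psi> \<sigma> \<in> carrier M" "r \<in> carrier R"
  shows "koszul_h M j (\<lambda>\<sigma>. r \<odot>\<^bsub>M\<^esub> \<phi> \<sigma> \<ominus>\<^bsub>M\<^esub> \<psi> \<sigma>) \<sigma> = r \<odot>\<^bsub>M\<^esub> koszul_h M j \<phi> \<sigma> \<ominus>\<^bsub>M\<^esub> koszul_h M j \<psi> \<sigma>"
  using assms
proof (induction j arbitrary: \<phi> \<psi> \<sigma>)
  case 0
  then show ?case by (cases \<sigma>; cases "hd \<sigma>") (auto simp: a_minus_def)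
next
  case (Suc j)
  have IH: "koszul_h M j (\<lambda>\<tau>. r \<odot>\<^bsub>M\<^esub> \<phi> (b # \<tau>) \<ominus>\<^bsub>M\<^esub> \<psi> (b # \<tau>)) \<tau> =
      r \<odot>\<^bsub>M\<^esub> koszul_h M j (\<lambda>\<tau>. \<phi> (b # \<tau>)) \<tau> \<ominus>\<^bsub>M\<^esub> koszul_h M j (\<lambda>\<tau>. \<psi> (b # \<tau>)) \<tau>" for b \<tau>
    by (rule Suc.IH) (use Suc.prems in auto)
  have c: "koszul_h M j (\<lambda>\<tau>. \<phi> (b # \<tau>)) \<tau> \<in> carrier M" "koszul_h M j (\<lambda>\<tau>. \<psi> (b # \<tau>)) \<tau> \<in> carrier M" for b \<tau>
    by (rule koszul_h_closed, use Suc.prems in blast)+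
  show ?case
  proof (cases \<sigma>)
    case Nil
    then show ?thesis using assms(3) by (simp add: a_minus_def)
  next
    case (Cons b \<tau>)
    then show ?thesis
      using IH[of b \<tau>] c[of b \<tau>] assms(3) by (cases b) (auto simp: minus_uminus_swap smult_r_minus)
  qed
qed

text \<open>The identity d h + h d = x_j^t. Contraction is a null homotopy of multiplication by
  x_j^t, so this power kills the cohomology of the Koszul complex at stage t.\<close>

lemma koszul_homotopy:
  assumes "set xs \<subseteq> carrier R" "\<And>\<sigma>. \<phi> \<sigma> \<in> carrier M" "j < length xs" "length \<sigma> = length xs"
  shows "koszul_d R M t xs (koszul_h M j \<phi>) \<sigma> \<oplus>\<^bsub>M\<^esub> koszul_h M j (koszul_d R M t xs \<phi>) \<sigma>
    = (xs ! j) [^] t \<odot>\<^bsub>M\<^esub> \<phi> \<sigma>"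
  using assms
proof (induction xs arbitrary: \<phi> j \<sigma>)
  case (Cons y xs)
  obtain b \<tau> where \<sigma>: "\<sigma> = b # \<tau>" "length \<tau> = length xs" using Cons.prems(4) by (cases \<sigma>) auto
  have y: "y [^] t \<in> carrier R" "set xs \<subseteq> carrier R" using Cons.prems by auto
  have cd: "koszul_d R M t xs (\<lambda>\<tau>. \<phi> (b # \<tau>)) \<tau> \<in> carrier M" for b \<tau>
    by (rule koszul_d_closed) (use Cons.prems in auto)
  have z: "koszul_d R M t xs (\<lambda>_. \<zero>\<^bsub>M\<^esub>) \<tau> = \<zero>\<^bsub>M\<^esub>" for \<tau> using koszul_d_zero[OF y(2)] .
  show ?case
  proof (cases j)
    case 0
    have cancel: "d \<oplus>\<^bsub>M\<^esub> (a \<ominus>\<^bsub>M\<^esub> d) = a" if "a \<in> carrier M" "d \<in> carrier M" for a d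
      using that by (simp add: a_minus_def M.a_lcomm[of d a] M.r_neg)
    show ?thesis
      using 0 \<sigma> Cons.prems y cd z cancel
      by (cases b) (auto simp: a_minus_def)
  next
    case (Suc k)
    have k: "k < length xs" using Suc Cons.prems by simp
    have IH: "koszul_d R M t xs (koszul_h M k (\<lambda>\<tau>. \<phi> (b # \<tau>))) \<tau> \<oplus>\<^bsub>M\<^esub> koszul_h M k (koszul_d R M t xs (\<lambda>\<tau>. \<phi> (b # \<tau>))) \<tau>
       = (xs ! k) [^] t \<odot>\<^bsub>M\<^esub> \<phi> (b # \<tau>)" for b
      by (rule Cons.IH) (use Cons.prems k \<sigma> in auto)
    have ch: "koszul_h M k (\<lambda>\<tau>. \<phi> (b # \<tau>)) \<tau> \<in> carrier M" for b \<tau>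
      by (rule koszul_h_closed) (use Cons.prems in auto)
    have cdh: "koszul_d R M t xs (koszul_h M k (\<lambda>\<tau>. \<phi> (b # \<tau>))) \<tau> \<in> carrier M" for b \<tau>
      by (rule koszul_d_closed) (use ch y in auto)
    have chd: "koszul_h M k (koszul_d R M t xs (\<lambda>\<tau>. \<phi> (b # \<tau>))) \<tau> \<in> carrier M" for b \<tau>
      by (rule koszul_h_closed) (rule cd)
    show ?thesis
    proof (cases b)
      case True
      have 1: "koszul_d R M t xs (\<lambda>\<tau>. \<ominus>\<^bsub>M\<^esub> koszul_h M k (\<lambda>\<tau>. \<phi> (True # \<tau>)) \<tau>) \<tau> =
         \<ominus>\<^bsub>M\<^esub> koszul_d R M t xs (koszul_h M k (\<lambda>\<tau>. \<phi> (True # \<tau>))) \<tau>"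
        using koszul_d_smult[where \<phi> = "koszul_h M k (\<lambda>\<tau>. \<phi> (True # \<tau>))", OF y(2) ch[of True], of "\<ominus> \<one>"]
          ch[of True] cdh[of True]
        by (simp add: smult_l_minus)
      have 2: "koszul_h M k (\<lambda>\<tau>. y [^] t \<odot>\<^bsub>M\<^esub> \<phi> (False # \<tau>) \<ominus>\<^bsub>M\<^esub> koszul_d R M t xs (\<lambda>\<tau>. \<phi> (True # \<tau>)) \<tau>) \<tau>
        = y [^] t \<odot>\<^bsub>M\<^esub> koszul_h M k (\<lambda>\<tau>. \<phi> (False # \<tau>)) \<tau> \<ominus>\<^bsub>M\<^esub> koszul_h M k (koszul_d R M t xs (\<lambda>\<tau>. \<phi> (True # \<tau>))) \<tau>"
        by (rule koszul_h_linear) (use Cons.prems y cd in auto)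
      \<comment> \<open>Here a is y^t times the contracted unmarked part. It enters once through d h
        and once, with the opposite sign, through h d.\<close>
      have alg: "(a \<ominus>\<^bsub>M\<^esub> (\<ominus>\<^bsub>M\<^esub> p)) \<oplus>\<^bsub>M\<^esub> (\<ominus>\<^bsub>M\<^esub> (a \<ominus>\<^bsub>M\<^esub> q)) = p \<oplus>\<^bsub>M\<^esub> q"
        if c: "a \<in> carrier M" "p \<in> carrier M" "q \<in> carrier M" for a p q
      proof -
        have "(a \<oplus>\<^bsub>M\<^esub> p) \<oplus>\<^bsub>M\<^esub> (\<ominus>\<^bsub>M\<^esub> a \<oplus>\<^bsub>M\<^esub> q) = (a \<oplus>\<^bsub>M\<^esub> \<ominus>\<^bsub>M\<^esub> a) \<oplus>\<^bsub>M\<^esub> (p \<oplus>\<^bsub>M\<^esub> q)"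
          using c by (simp add: M.a_ac)
        then show ?thesis using c by (simp add: a_minus_def M.minus_add M.r_neg)
      qed
      show ?thesis
        using \<sigma> True Suc 1 2 IH[of True] alg[OF _ cdh chd] y ch by simp
    qed (use \<sigma> Suc IH[of False] in simp)
  qed
qed simp

lemma koszul_h_support:
  assumes "\<And>\<sigma>. length \<sigma> \<noteq> n \<or> int (count_list \<sigma> True) \<noteq> i \<Longrightarrow> \<phi> \<sigma> = \<zero>\<^bsub>M\<^esub>"
    and "length \<sigma> \<noteq> n \<or> int (count_list \<sigma> True) \<noteq> i - 1"
  shows "koszul_h M j \<phi> \<sigma> = \<zero>\<^bsub>M\<^esub>"
  using assms
proof (induction j arbitrary: \<phi> n i \<sigma>)
  case 0
  then show ?case by (cases \<sigma>; cases "hd \<sigma>") auto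
next
  case (Suc j)
  show ?case
  proof (cases \<sigma>)
    case (Cons b \<tau>)
    show ?thesis
    proof (cases n)
      case 0
      have "\<phi> (b # \<tau>) = \<zero>\<^bsub>M\<^esub>" for b \<tau> using Suc.prems(1) 0 by simp
      then show ?thesis using Cons koszul_h_zero by (cases b) auto
    next
      case n: (Suc m)
      have "koszul_h M j (\<lambda>\<tau>. \<phi> (b # \<tau>)) \<tau> = \<zero>\<^bsub>M\<^esub>"
        by (rule Suc.IH[where n = m and i = "if b then i - 1 else i"])
          (use Suc.prems Cons n in \<open>auto split: if_splits\<close>)
      then show ?thesis using Cons by (cases b) auto
    qed
  qed auto
qed

end

context sequence_cohomology
begin

lemma cobdry_propagate:
  assumes "\<And>\<sigma>. u \<sigma> \<in> carrier M" "t \<ge> t\<^sub>0"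
  shows "\<delta> (propagate t\<^sub>0 u) t = propagate t\<^sub>0 (koszul_d R M t\<^sub>0 xs u) t"
  using assms(2)
proof (induction rule: dec_induct)
  case base
  have "propagate t\<^sub>0 u t\<^sub>0 = u" using assms(1) by (auto simp: propagate_def)
  then show ?case using koszul_d_closed[OF xs_closed assms(1)] by (simp add: cobdry_def propagate_def)
next
  case (step n)
  have c: "propagate t\<^sub>0 u n \<sigma> \<in> carrier M" for \<sigma> using assms(1) by (simp add: propagate_def)
  have s: "propagate t\<^sub>0 v (Suc n) = (\<lambda>\<sigma>. monomial_of R xs \<sigma> \<odot>\<^bsub>M\<^esub> propagate t\<^sub>0 v n \<sigma>)"
    if "\<And>\<sigma>. v \<sigma> \<in> carrier M" for v
    using that step by (auto simp: propagate_def Suc_diff_le smult_assoc1[symmetric] R.m_comm)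
  have "\<delta> (propagate t\<^sub>0 u) (Suc n) = (\<lambda>\<sigma>. monomial_of R xs \<sigma> \<odot>\<^bsub>M\<^esub> \<delta> (propagate t\<^sub>0 u) n \<sigma>)"
    unfolding cobdry_def s[OF assms(1)] by (intro ext koszul_d_transition xs_closed c)
  then show ?case
    using step.IH s[OF koszul_d_closed[OF xs_closed assms(1)]] by simp
qed

text \<open>At a stage \<open>t\<^sub>0\<close> where the sequence is already compatible and closed,
  the homotopy formula exhibits x^\<open>t\<^sub>0\<close> times the cocycle as a coboundary; the
  transported primitive then serves all later stages. The exponent depends on the class.\<close>

lemma torsion:
  assumes "x \<in> set xs" "\<Phi> \<in> Z i"
  obtains k :: nat where "x [^] k \<odot>\<^bsub>T\<^esub> \<Phi> \<in> B i"
proof -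
  obtain j where j: "j < length xs" "xs ! j = x" using assms(1) by (auto simp: in_set_conv_nth)
  have x: "x \<in> carrier R" using assms(1) xs_closed by auto
  have \<Phi>: "\<Phi> \<in> C i" using assms(2) by (simp add: cocycles_def)
  have "\<forall>\<^sub>F t in sequentially. \<delta> \<Phi> t = (\<lambda>_. \<zero>\<^bsub>M\<^esub>)" using assms(2) by (simp add: cocycles_def)
  then obtain t\<^sub>0 where t\<^sub>0: "\<And>t. t \<ge> t\<^sub>0 \<Longrightarrow> \<Phi> (Suc t) = (\<lambda>\<sigma>. monomial_of R xs \<sigma> \<odot>\<^bsub>M\<^esub> \<Phi> t \<sigma>)"
     "\<And>t. t \<ge> t\<^sub>0 \<Longrightarrow> \<delta> \<Phi> t = (\<lambda>_. \<zero>\<^bsub>M\<^esub>)"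
    using eventually_conj[OF cochains_eventually[OF \<Phi>]] unfolding eventually_sequentially by blast
  define u where "u = koszul_h M j (\<Phi> t\<^sub>0)"
  have u: "u \<sigma> \<in> carrier M" for \<sigma> unfolding u_def by (rule koszul_h_closed) (rule cochains_closed[OF \<Phi>])
  have supp: "u \<sigma> = \<zero>\<^bsub>M\<^esub>" if "length \<sigma> \<noteq> length xs \<or> int (count_list \<sigma> True) \<noteq> i - 1" for \<sigma>
    unfolding u_def by (rule koszul_h_support[OF _ that]) (rule cochains_support[OF \<Phi>])
  have \<Psi>: "propagate t\<^sub>0 u \<in> C (i - 1)"
    by (rule propagate_cochains) (use u supp in auto)
  have du: "koszul_d R M t\<^sub>0 xs u = (\<lambda>\<sigma>. x [^] t\<^sub>0 \<odot>\<^bsub>M\<^esub> \<Phi> t\<^sub>0 \<sigma>)"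
  proof
    fix \<sigma>
    show "koszul_d R M t\<^sub>0 xs u \<sigma> = x [^] t\<^sub>0 \<odot>\<^bsub>M\<^esub> \<Phi> t\<^sub>0 \<sigma>"
    proof (cases "length \<sigma> = length xs")
      case True
      have "koszul_d R M t\<^sub>0 xs (\<Phi> t\<^sub>0) = (\<lambda>_. \<zero>\<^bsub>M\<^esub>)" using t\<^sub>0(2) by (simp add: cobdry_def)
      then show ?thesis
        using koszul_homotopy[where \<phi> = "\<Phi> t\<^sub>0" and t = t\<^sub>0, OF xs_closed cochains_closed[OF \<Phi>] j(1) True] j(2)
          koszul_h_zero koszul_d_closed[OF xs_closed u] unfolding u_def by simp
    next
      case False
      then show ?thesis
        using koszul_d_support[OF supp _ xs_closed] cochains_support[OF \<Phi>] x by simp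
    qed
  qed
  have X: "x [^] t\<^sub>0 \<odot>\<^bsub>T\<^esub> \<Phi> \<in> C i"
    using T.submoduleE(4)[OF submodule_cochains _ \<Phi>] x by simp
  have "\<forall>\<^sub>F t in sequentially. (x [^] t\<^sub>0 \<odot>\<^bsub>T\<^esub> \<Phi>) t = \<delta> (propagate t\<^sub>0 u) t"
    using eventually_ge_at_top[of t\<^sub>0]
  proof eventually_elim
    case (elim t)
    show ?case
      using cobdry_propagate[OF u elim] du cochain_eq_propagate[OF \<Phi> t\<^sub>0(1) elim] elim x
        cochains_closed[OF \<Phi>]
      by (auto simp: propagate_def smult_assoc1[symmetric] R.m_comm)
  qed
  then have "x [^] t\<^sub>0 \<odot>\<^bsub>T\<^esub> \<Phi> \<in> B i" using X \<Psi> unfolding coboundaries_def by blast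
  then show ?thesis using that by blast
qed


section \<open>Modules killed by the sequence\<close>

lemma monomial_kills:
  assumes "\<And>x m. x \<in> set xs \<Longrightarrow> m \<in> carrier M \<Longrightarrow> x \<odot>\<^bsub>M\<^esub> m = \<zero>\<^bsub>M\<^esub>"
    and "length \<sigma> = length xs" "True \<in> set \<sigma>" "m \<in> carrier M"
  shows "monomial_of R xs \<sigma> \<odot>\<^bsub>M\<^esub> m = \<zero>\<^bsub>M\<^esub>"
  using assms xs_closed
proof (induction xs arbitrary: \<sigma>)
  case (Cons x xs)
  then obtain b \<tau> where \<sigma>: "\<sigma> = b # \<tau>" "length \<tau> = length xs" by (cases \<sigma>) auto
  show ?case
  proof (cases b)
    case True
    have "(x \<otimes> monomial_of R xs \<tau>) \<odot>\<^bsub>M\<^esub> m = x \<odot>\<^bsub>M\<^esub> (monomial_of R xs \<tau> \<odot>\<^bsub>M\<^esub> m)"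
      using Cons.prems by (simp add: smult_assoc1)
    then show ?thesis using True \<sigma> Cons.prems by simp
  next
    case False
    then show ?thesis using Cons \<sigma> by auto
  qed
qed simp

text \<open>In positive degree every basis element carries a mark, so the transition maps vanish and
  with them the direct limit of the cochains.\<close>

lemma cohomology_zero_killed:
  assumes kill: "\<And>x m. x \<in> set xs \<Longrightarrow> m \<in> carrier M \<Longrightarrow> x \<odot>\<^bsub>M\<^esub> m = \<zero>\<^bsub>M\<^esub>" and "i > 0"
  shows "cohomology_zero R M xs i"
  unfolding cohomology_zero_def
proof
  fix \<Phi> assume "\<Phi> \<in> Z i"
  then have \<Phi>: "\<Phi> \<in> C i" by (simp add: cocycles_def)
  have "\<forall>\<^sub>F t in sequentially. \<Phi> (Suc t) = (\<lambda>_. \<zero>\<^bsub>M\<^esub>)"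
    using cochains_eventually[OF \<Phi>]
  proof eventually_elim
    case (elim t)
    have "monomial_of R xs \<sigma> \<odot>\<^bsub>M\<^esub> \<Phi> t \<sigma> = \<zero>\<^bsub>M\<^esub>" for \<sigma>
    proof (cases "length \<sigma> \<noteq> length xs \<or> int (count_list \<sigma> True) \<noteq> i")
      case True
      then show ?thesis using cochains_support[OF \<Phi> True] by simp
    next
      case False
      then have "True \<in> set \<sigma>" using assms(2) by (metis count_list_0_iff int_ops(1) less_irrefl)
      then show ?thesis using monomial_kills[OF kill] False cochains_closed[OF \<Phi>] by simp
    qed
    then show ?case using elim by simp
  qed
  then have "\<forall>\<^sub>F t in sequentially. \<Phi> t = (\<lambda>_. \<zero>\<^bsub>M\<^esub>)"
    using eventually_sequentially_Suc[of "\<lambda>t. \<Phi> t = (\<lambda>_. \<zero>\<^bsub>M\<^esub>)"] by simp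
  then show "\<Phi> \<in> B i" using coboundaries_eventually_zero[OF \<Phi>] by simp
qed

text \<open>In degree 0 the only basis element is the unmarked list, and its monomial is 1. Hence
  the direct limit of the degree 0 cochains is the module itself.\<close>

definition constant_cochain :: "'b \<Rightarrow> nat \<Rightarrow> bool list \<Rightarrow> 'b" where
  "constant_cochain m = (\<lambda>t \<sigma>. if \<sigma> = replicate (length xs) False then m else \<zero>\<^bsub>M\<^esub>)"

lemma monomial_of_replicate: "monomial_of R xs (replicate (length xs) False) = \<one>"
  by (induction xs) auto

lemma replicate_False_iff:
  "length \<sigma> = length xs \<and> count_list \<sigma> True = 0 \<longleftrightarrow> \<sigma> = replicate (length xs) False"
proof
  assume a: "length \<sigma> = length xs \<and> count_list \<sigma> True = 0"
  then have "\<forall>b \<in> set \<sigma>. b = False" by (metis (full_types) count_list_0_iff)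
  then show "\<sigma> = replicate (length xs) False" using a by (metis replicate_length_same)
qed (auto simp: count_list_0_iff)

lemma constant_cochain: "m \<in> carrier M \<Longrightarrow> constant_cochain m \<in> C 0"
  using monomial_of_replicate by (auto simp: cochains_def constant_cochain_def fun_eq_iff)

lemma cochain_zero_eq_constant:
  assumes "\<Phi> \<in> C 0"
  obtains m where "m \<in> carrier M" "\<forall>\<^sub>F t in sequentially. \<Phi> t = constant_cochain m t"
proof -
  let ?r = "replicate (length xs) False"
  obtain t\<^sub>0 where t\<^sub>0: "\<And>t. t \<ge> t\<^sub>0 \<Longrightarrow> \<Phi> (Suc t) = (\<lambda>\<sigma>. monomial_of R xs \<sigma> \<odot>\<^bsub>M\<^esub> \<Phi> t \<sigma>)"
    using cochains_eventually[OF assms] by (auto simp: eventually_sequentially)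
  have "\<forall>\<^sub>F t in sequentially. \<Phi> t = constant_cochain (\<Phi> t\<^sub>0 ?r) t"
    using eventually_ge_at_top[of t\<^sub>0]
  proof eventually_elim
    case (elim t)
    show ?case
    proof
      fix \<sigma>
      show "\<Phi> t \<sigma> = constant_cochain (\<Phi> t\<^sub>0 ?r) t \<sigma>"
      proof (cases "\<sigma> = ?r")
        case True
        then show ?thesis
          using fun_cong[OF cochain_eq_propagate[OF assms t\<^sub>0 elim], of ?r] elim cochains_closed[OF assms]
          by (simp add: propagate_def monomial_of_replicate constant_cochain_def)
      next
        case False
        then have "length \<sigma> \<noteq> length xs \<or> int (count_list \<sigma> True) \<noteq> 0"
          by (metis replicate_False_iff of_nat_eq_0_iff)
        then show ?thesis using cochains_support[OF assms] False by (simp add: constant_cochain_def)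
      qed
    qed
  qed
  then show ?thesis using that cochains_closed[OF assms] by blast
qed

lemma coboundaries_0_iff: "\<Phi> \<in> B 0 \<longleftrightarrow> \<Phi> \<in> C 0 \<and> (\<forall>\<^sub>F t in sequentially. \<Phi> t = (\<lambda>_. \<zero>\<^bsub>M\<^esub>))"
proof
  assume "\<Phi> \<in> B 0"
  then obtain \<Psi> where \<Psi>: "\<Phi> \<in> C 0" "\<Psi> \<in> C (-1)" "\<forall>\<^sub>F t in sequentially. \<Phi> t = \<delta> \<Psi> t"
    by (auto simp: coboundaries_def)
  have "\<Psi> t = (\<lambda>_. \<zero>\<^bsub>M\<^esub>)" for t using cochains_support[OF \<Psi>(2)] by auto
  then have "\<delta> \<Psi> t = (\<lambda>_. \<zero>\<^bsub>M\<^esub>)" for t using cobdry_zero by blast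
  then show "\<Phi> \<in> C 0 \<and> (\<forall>\<^sub>F t in sequentially. \<Phi> t = (\<lambda>_. \<zero>\<^bsub>M\<^esub>))" using \<Psi> by simp
qed (use coboundaries_eventually_zero in blast)

text \<open>The list is varied below the fixed \<open>xs\<close> of the locale so that induction is
  possible. Stage 0 is excluded because x^0 = 1 does not kill the module.\<close>

lemma koszul_d_killed:
  assumes "set ys \<subseteq> set xs"
    and "\<And>x m. x \<in> set xs \<Longrightarrow> m \<in> carrier M \<Longrightarrow> x \<odot>\<^bsub>M\<^esub> m = \<zero>\<^bsub>M\<^esub>"
    and "t > 0" "\<And>\<sigma>. \<phi> \<sigma> \<in> carrier M"
  shows "koszul_d R M t ys \<phi> \<sigma> = \<zero>\<^bsub>M\<^esub>"
  using assms(1,4)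
proof (induction ys arbitrary: \<phi> \<sigma>)
  case (Cons y ys)
  have y: "y \<in> carrier R" using Cons.prems xs_closed by auto
  have IH: "koszul_d R M t ys (\<lambda>\<tau>. \<phi> (b # \<tau>)) \<tau> = \<zero>\<^bsub>M\<^esub>" for b \<tau>
    by (rule Cons.IH) (use Cons.prems in auto)
  have "y [^] t \<odot>\<^bsub>M\<^esub> m = \<zero>\<^bsub>M\<^esub>" if "m \<in> carrier M" for m
  proof -
    have "y [^] t = y \<otimes> y [^] (t - 1)" 
      using y \<open>t > 0\<close> by (metis R.nat_pow_Suc2 Suc_diff_1)
    then show ?thesis using y that assms(2) Cons.prems by (simp add: smult_assoc1)
  qed
  then show ?case using IH Cons.prems by (cases \<sigma>; cases "hd \<sigma>") (auto simp: a_minus_def)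
qed simp

lemma cohomology_not_zero_killed:
  assumes kill: "\<And>x m. x \<in> set xs \<Longrightarrow> m \<in> carrier M \<Longrightarrow> x \<odot>\<^bsub>M\<^esub> m = \<zero>\<^bsub>M\<^esub>"
    and m: "m \<in> carrier M" "m \<noteq> \<zero>\<^bsub>M\<^esub>"
  shows "\<not> cohomology_zero R M xs 0"
proof
  assume z: "cohomology_zero R M xs 0"
  have c: "constant_cochain m \<in> C 0" using constant_cochain m by blast
  have "\<forall>\<^sub>F t in sequentially. \<delta> (constant_cochain m) t = (\<lambda>_. \<zero>\<^bsub>M\<^esub>)"
    \<comment> \<open>At every stage from 1 on the differential is zero, so a constant cochain is a
      cocycle.\<close>
    using eventually_gt_at_top[of 0]
  proof eventually_elim
    case (elim t)
    show ?case unfolding cobdry_def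
      by (rule ext) (rule koszul_d_killed[OF order_refl kill elim cochains_closed[OF c]])
  qed
  then have "constant_cochain m \<in> B 0" using z c by (auto simp: cohomology_zero_def cocycles_def)
  then obtain t where "constant_cochain m t = (\<lambda>_. \<zero>\<^bsub>M\<^esub>)"
    by (auto simp: coboundaries_0_iff eventually_sequentially)
  then have "constant_cochain m t (replicate (length xs) False) = \<zero>\<^bsub>M\<^esub>" by simp
  then show False using m by (simp add: constant_cochain_def)
qed

end

section \<open>Noetherian modules\<close>

lemma (in cring) ideal_criterion:
  assumes "I \<subseteq> carrier R" "\<zero> \<in> I" "\<And>a b. a \<in> I \<Longrightarrow> b \<in> I \<Longrightarrow> a \<oplus> b \<in> I"
    "\<And>r a. r \<in> carrier R \<Longrightarrow> a \<in> I \<Longrightarrow> r \<otimes> a \<in> I"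
  shows "ideal I R"
proof (rule idealI)
  show "subgroup I (add_monoid R)"
  proof
    show "inv\<^bsub>add_monoid R\<^esub> x \<in> I" if "x \<in> I" for x
    proof -
      have "(\<ominus> \<one>) \<otimes> x \<in> I" using assms(4) that by simp
      then show ?thesis using that assms(1) by (simp add: l_minus subsetD flip: a_inv_def)
    qed
  qed (use assms in auto)
  show "a \<otimes> x \<in> I" if "a \<in> I" "x \<in> carrier R" for a x
    using that assms m_comm[of a x] by auto
qed (use assms ring_axioms in auto)

lemma (in cring) ideal_facts:
  assumes "ideal I R"
  shows "I \<subseteq> carrier R" "\<zero> \<in> I" "\<And>a b. a \<in> I \<Longrightarrow> b \<in> I \<Longrightarrow> a \<oplus> b \<in> I"
    "\<And>r a. r \<in> carrier R \<Longrightarrow> a \<in> I \<Longrightarrow> r \<otimes> a \<in> I" "\<And>r a. r \<in> carrier R \<Longrightarrow> a \<in> I \<Longrightarrow> a \<otimes> r \<in> I"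
    "\<And>a b. a \<in> I \<Longrightarrow> b \<in> I \<Longrightarrow> a \<ominus> b \<in> I" "\<And>a. a \<in> I \<Longrightarrow> \<ominus> a \<in> I"
proof -
  interpret ideal I R by fact
  show "I \<subseteq> carrier R" "\<zero> \<in> I" "\<And>a b. a \<in> I \<Longrightarrow> b \<in> I \<Longrightarrow> a \<oplus> b \<in> I"
    "\<And>r a. r \<in> carrier R \<Longrightarrow> a \<in> I \<Longrightarrow> r \<otimes> a \<in> I" "\<And>r a. r \<in> carrier R \<Longrightarrow> a \<in> I \<Longrightarrow> a \<otimes> r \<in> I"
    "\<And>a b. a \<in> I \<Longrightarrow> b \<in> I \<Longrightarrow> a \<ominus> b \<in> I" "\<And>a. a \<in> I \<Longrightarrow> \<ominus> a \<in> I"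
    by (auto simp: I_l_closed I_r_closed a_minus_def)
qed

lemma (in module) submodule_criterion:
  assumes "N \<subseteq> carrier M" "\<zero>\<^bsub>M\<^esub> \<in> N" "\<And>a b. a \<in> N \<Longrightarrow> b \<in> N \<Longrightarrow> a \<oplus>\<^bsub>M\<^esub> b \<in> N"
    "\<And>r a. r \<in> carrier R \<Longrightarrow> a \<in> N \<Longrightarrow> r \<odot>\<^bsub>M\<^esub> a \<in> N"
  shows "submodule N R M"
proof (rule submoduleI)
  show "\<ominus>\<^bsub>M\<^esub> a \<in> N" if "a \<in> N" for a
  proof -
    have "(\<ominus> \<one>) \<odot>\<^bsub>M\<^esub> a \<in> N" using assms(4) that by simp
    then show ?thesis using that assms(1) by (simp add: smult_l_minus subsetD)
  qed
qed (use assms in auto)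

lemma (in module) submodule_facts:
  assumes "submodule N R M"
  shows "N \<subseteq> carrier M" "\<zero>\<^bsub>M\<^esub> \<in> N" "\<And>a b. a \<in> N \<Longrightarrow> b \<in> N \<Longrightarrow> a \<oplus>\<^bsub>M\<^esub> b \<in> N"
    "\<And>r a. r \<in> carrier R \<Longrightarrow> a \<in> N \<Longrightarrow> r \<odot>\<^bsub>M\<^esub> a \<in> N"
    "\<And>a b. a \<in> N \<Longrightarrow> b \<in> N \<Longrightarrow> a \<ominus>\<^bsub>M\<^esub> b \<in> N" "\<And>a. a \<in> N \<Longrightarrow> \<ominus>\<^bsub>M\<^esub> a \<in> N"
proof -
  note s = submoduleE[OF assms]
  show "N \<subseteq> carrier M" "\<And>a b. a \<in> N \<Longrightarrow> b \<in> N \<Longrightarrow> a \<oplus>\<^bsub>M\<^esub> b \<in> N"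
    "\<And>r a. r \<in> carrier R \<Longrightarrow> a \<in> N \<Longrightarrow> r \<odot>\<^bsub>M\<^esub> a \<in> N"
    "\<And>a b. a \<in> N \<Longrightarrow> b \<in> N \<Longrightarrow> a \<ominus>\<^bsub>M\<^esub> b \<in> N" "\<And>a. a \<in> N \<Longrightarrow> \<ominus>\<^bsub>M\<^esub> a \<in> N"
    using s by (auto simp: a_minus_def)
  show "\<zero>\<^bsub>M\<^esub> \<in> N"
    using subgroup.one_closed[OF submodule.axioms(1)[OF assms]] by simp
qed

lemma (in module) submodule_zero: "submodule {\<zero>\<^bsub>M\<^esub>} R M"
  by (rule submodule_criterion) auto

lemma (in module) submodule_restrict_module:
  "submodule N R M \<Longrightarrow> module R (M\<lparr>carrier := N\<rparr>)"
  using submodule.submodule_is_module module_axioms by blast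

lemma submodule_inclusion:
  assumes "submodule N R M" "N \<subseteq> N'"
  shows "module_morphism R (M\<lparr>carrier := N\<rparr>) (M\<lparr>carrier := N'\<rparr>) (\<lambda>x. x)"
  using assms by (auto simp: module_morphism_def)

definition noetherian_module :: "('a, 'k) ring_scheme \<Rightarrow> ('a, 'b) module \<Rightarrow> bool" where
  "noetherian_module R M \<longleftrightarrow> module R M \<and>
     (\<forall>N. submodule N R M \<longrightarrow>
        (\<exists>S. finite S \<and> S \<subseteq> N \<and> (\<forall>N'. submodule N' R M \<longrightarrow> S \<subseteq> N' \<longrightarrow> N \<subseteq> N')))"

lemma (in module) submodule_Union_chain:
  assumes "\<C> \<noteq> {}" "\<And>N. N \<in> \<C> \<Longrightarrow> submodule N R M" "\<And>N N'. N \<in> \<C> \<Longrightarrow> N' \<in> \<C> \<Longrightarrow> N \<subseteq> N' \<or> N' \<subseteq> N"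
  shows "submodule (\<Union>\<C>) R M"
proof (rule submodule_criterion)
  show "\<Union>\<C> \<subseteq> carrier M" using submodule_facts(1)[OF assms(2)] by blast
  show "\<zero>\<^bsub>M\<^esub> \<in> \<Union>\<C>" using assms(1) submodule_facts(2)[OF assms(2)] by blast
  show "r \<odot>\<^bsub>M\<^esub> a \<in> \<Union>\<C>" if "r \<in> carrier R" "a \<in> \<Union>\<C>" for r a
    using that submodule_facts(4)[OF assms(2)] by blast
  show "a \<oplus>\<^bsub>M\<^esub> b \<in> \<Union>\<C>" if ab: "a \<in> \<Union>\<C>" "b \<in> \<Union>\<C>" for a b
  proof -
    obtain N N' where "N \<in> \<C>" "N' \<in> \<C>" "a \<in> N" "b \<in> N'" using ab by blast
    then show ?thesis using assms(3)[of N N'] submodule_facts(3)[OF assms(2)] by blast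
  qed
qed

lemma noetherian_module_maximal:
  assumes "noetherian_module R M" "\<F> \<noteq> {}" "\<And>N. N \<in> \<F> \<Longrightarrow> submodule N R M"
  obtains N where "N \<in> \<F>" "\<And>N'. N' \<in> \<F> \<Longrightarrow> N \<subseteq> N' \<Longrightarrow> N' = N"
proof -
  interpret module R M using assms(1) by (simp add: noetherian_module_def)
  have "\<exists>N\<in>\<F>. \<forall>N'\<in>\<F>. N \<subseteq> N' \<longrightarrow> N' = N"
  proof (rule subset_Zorn_nonempty[OF assms(2)])
    fix \<C> assume \<C>: "\<C> \<noteq> {}" "subset.chain \<F> \<C>"
    have ch: "\<C> \<subseteq> \<F>" "\<And>N N'. N \<in> \<C> \<Longrightarrow> N' \<in> \<C> \<Longrightarrow> N \<subseteq> N' \<or> N' \<subseteq> N"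
      using \<C>(2) by (auto simp: subset.chain_def)
    \<comment> \<open>The union of the chain is finitely generated; finitely many generators already
      lie in one member, which is therefore the union.\<close>
    have "submodule (\<Union>\<C>) R M"
      by (rule submodule_Union_chain) (use \<C>(1) ch assms(3) in auto)
    then obtain S where S: "finite S" "S \<subseteq> \<Union>\<C>" "\<And>N'. submodule N' R M \<Longrightarrow> S \<subseteq> N' \<Longrightarrow> \<Union>\<C> \<subseteq> N'"
      using assms(1) unfolding noetherian_module_def by meson
    have "\<exists>N\<in>\<C>. S \<subseteq> N" using S(1,2)
    proof (induction rule: finite_induct)
      case empty
      then show ?case using \<C>(1) by blast
    next
      case (insert x F)
      then obtain N N' where "N \<in> \<C>" "F \<subseteq> N" "N' \<in> \<C>" "x \<in> N'" by blast
      then show ?case using ch(2)[of N N'] by blast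
    qed
    then obtain N where N: "N \<in> \<C>" "S \<subseteq> N" by blast
    then have "\<Union>\<C> = N" using S(3)[of N] assms(3) ch(1) by blast
    then show "\<Union>\<C> \<in> \<F>" using N ch(1) by blast
  qed
  then show ?thesis using that by blast
qed

lemma noetherian_module_chain:
  fixes N :: "nat \<Rightarrow> 'b set"
  assumes "noetherian_module R M" "\<And>i. submodule (N i) R M" "\<And>i. N i \<subseteq> N (Suc i)"
  obtains k where "\<And>i. i \<ge> k \<Longrightarrow> N i = N k"
proof -
  obtain L where L: "L \<in> range N" "\<And>N'. N' \<in> range N \<Longrightarrow> L \<subseteq> N' \<Longrightarrow> N' = L"
    using noetherian_module_maximal[OF assms(1), of "range N"] assms(2) by blast
  then obtain k where k: "L = N k" by blast
  have "N k \<subseteq> N i" if "i \<ge> k" for i using lift_Suc_mono_le[of N, OF assms(3) that] .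
  then show ?thesis using that[of k] L k by blast
qed

lemma regular_module_simps [simp]:
  "carrier (regular_module R) = carrier R" "\<zero>\<^bsub>regular_module R\<^esub> = \<zero>\<^bsub>R\<^esub>"
  "a \<oplus>\<^bsub>regular_module R\<^esub> b = a \<oplus>\<^bsub>R\<^esub> b" "a \<odot>\<^bsub>regular_module R\<^esub> b = a \<otimes>\<^bsub>R\<^esub> b"
  by (auto simp: regular_module_def)

lemma (in cring) regular_module_module: "module R (regular_module R)"
proof (rule moduleI[OF is_cring])
  have "\<exists>y\<in>carrier R. y \<oplus> x = \<zero>" if "x \<in> carrier R" for x
    using that l_neg by blast
  then show "abelian_group (regular_module R)"
    by (intro abelian_groupI) (auto simp: a_assoc intro: a_comm)
qed (auto simp: l_distr r_distr m_assoc)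

lemma (in cring) submodule_regular_iff: "submodule I R (regular_module R) \<longleftrightarrow> ideal I R"
proof
  interpret reg: module R "regular_module R" by (rule regular_module_module)
  show "ideal I R" if "submodule I R (regular_module R)"
    using reg.submodule_facts[OF that] by (intro ideal_criterion) auto
  show "submodule I R (regular_module R)" if "ideal I R"
    using ideal_facts[OF that] by (intro reg.submodule_criterion) auto
qed

lemma noetherian_regular_module:
  fixes R :: "('a, 'k) ring_scheme" (structure)
  assumes "cring R" "noetherian_ring R"
  shows "noetherian_module R (regular_module R)"
proof -
  interpret cring R by fact
  interpret noetherian_ring R by fact
  have "\<exists>S. finite S \<and> S \<subseteq> N \<and> (\<forall>N'. ideal N' R \<longrightarrow> S \<subseteq> N' \<longrightarrow> N \<subseteq> N')" if N: "ideal N R" for N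
  proof -
    obtain A where "A \<subseteq> carrier R" "finite A" "N = Idl A" using finetely_gen[OF N] by blast
    then show ?thesis using genideal_self genideal_minimal by metis
  qed
  then show ?thesis
    by (auto simp: noetherian_module_def regular_module_module submodule_regular_iff)
qed

definition module_span :: "('a, 'k) ring_scheme \<Rightarrow> ('a, 'b) module \<Rightarrow> 'b set \<Rightarrow> 'b set" where
  "module_span R M S = \<Inter>{N. submodule N R M \<and> S \<subseteq> N}"

context rmodule
begin

lemma submodule_span:
  assumes "S \<subseteq> carrier M"
  shows "submodule (module_span R M S) R M" "S \<subseteq> module_span R M S"
    "\<And>N. submodule N R M \<Longrightarrow> S \<subseteq> N \<Longrightarrow> module_span R M S \<subseteq> N"
proof -
  have c: "carrier M \<in> {N. submodule N R M \<and> S \<subseteq> N}" using assms carrier_is_submodule by auto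
  show "submodule (module_span R M S) R M"
  proof (rule submodule_criterion)
    show "module_span R M S \<subseteq> carrier M" using c unfolding module_span_def by blast
  qed (auto simp: module_span_def dest: submodule_facts)
qed (auto simp: module_span_def)

text \<open>The set is N + R u. Writing it through differences exhibits the coefficient of u
  directly, which the later arguments extract.\<close>

lemma submodule_add_cyclic:
  assumes "submodule N R M" "u \<in> carrier M"
  shows "submodule {n \<in> carrier M. \<exists>r\<in>carrier R. n \<ominus>\<^bsub>M\<^esub> r \<odot>\<^bsub>M\<^esub> u \<in> N} R M"
    and "N \<subseteq> {n \<in> carrier M. \<exists>r\<in>carrier R. n \<ominus>\<^bsub>M\<^esub> r \<odot>\<^bsub>M\<^esub> u \<in> N}"
    and "u \<in> {n \<in> carrier M. \<exists>r\<in>carrier R. n \<ominus>\<^bsub>M\<^esub> r \<odot>\<^bsub>M\<^esub> u \<in> N}"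
proof -
  note N = submodule_facts[OF assms(1)]
  have sub: "(a \<oplus>\<^bsub>M\<^esub> b) \<ominus>\<^bsub>M\<^esub> (r \<oplus> s) \<odot>\<^bsub>M\<^esub> u = (a \<ominus>\<^bsub>M\<^esub> r \<odot>\<^bsub>M\<^esub> u) \<oplus>\<^bsub>M\<^esub> (b \<ominus>\<^bsub>M\<^esub> s \<odot>\<^bsub>M\<^esub> u)"
    if "a \<in> carrier M" "b \<in> carrier M" "r \<in> carrier R" "s \<in> carrier R" for a b r s
    using that assms(2) by (simp add: a_minus_def smult_l_distr M.minus_add M.a_ac)
  have sm: "s \<odot>\<^bsub>M\<^esub> a \<ominus>\<^bsub>M\<^esub> (s \<otimes> r) \<odot>\<^bsub>M\<^esub> u = s \<odot>\<^bsub>M\<^esub> (a \<ominus>\<^bsub>M\<^esub> r \<odot>\<^bsub>M\<^esub> u)"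
    if "a \<in> carrier M" "r \<in> carrier R" "s \<in> carrier R" for a r s
    using that assms(2) by (simp add: a_minus_def smult_r_distr smult_assoc1 smult_r_minus)
  have z: "n \<ominus>\<^bsub>M\<^esub> \<zero> \<odot>\<^bsub>M\<^esub> u = n" if "n \<in> carrier M" for n
    using that assms(2) M.r_neg[OF M.zero_closed] by (simp add: a_minus_def)
  show 2: "N \<subseteq> {n \<in> carrier M. \<exists>r\<in>carrier R. n \<ominus>\<^bsub>M\<^esub> r \<odot>\<^bsub>M\<^esub> u \<in> N}"
    using N(1) z by (auto intro!: bexI[of _ "\<zero>"])
  show "submodule {n \<in> carrier M. \<exists>r\<in>carrier R. n \<ominus>\<^bsub>M\<^esub> r \<odot>\<^bsub>M\<^esub> u \<in> N} R M"
  proof (rule submodule_criterion)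
    show "\<zero>\<^bsub>M\<^esub> \<in> {n \<in> carrier M. \<exists>r\<in>carrier R. n \<ominus>\<^bsub>M\<^esub> r \<odot>\<^bsub>M\<^esub> u \<in> N}" using 2 N(2) by blast
    fix a b assume "a \<in> {n \<in> carrier M. \<exists>r\<in>carrier R. n \<ominus>\<^bsub>M\<^esub> r \<odot>\<^bsub>M\<^esub> u \<in> N}"
      "b \<in> {n \<in> carrier M. \<exists>r\<in>carrier R. n \<ominus>\<^bsub>M\<^esub> r \<odot>\<^bsub>M\<^esub> u \<in> N}"
    then obtain r s where rs: "a \<in> carrier M" "b \<in> carrier M" "r \<in> carrier R" "s \<in> carrier R"
      "a \<ominus>\<^bsub>M\<^esub> r \<odot>\<^bsub>M\<^esub> u \<in> N" "b \<ominus>\<^bsub>M\<^esub> s \<odot>\<^bsub>M\<^esub> u \<in> N" by blast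
    then have "(a \<oplus>\<^bsub>M\<^esub> b) \<ominus>\<^bsub>M\<^esub> (r \<oplus> s) \<odot>\<^bsub>M\<^esub> u \<in> N" using sub[OF rs(1-4)] N(3) by simp
    then show "a \<oplus>\<^bsub>M\<^esub> b \<in> {n \<in> carrier M. \<exists>r\<in>carrier R. n \<ominus>\<^bsub>M\<^esub> r \<odot>\<^bsub>M\<^esub> u \<in> N}"
      using rs by (auto intro!: bexI[of _ "r \<oplus> s"])
  next
    fix s a assume s: "s \<in> carrier R" and "a \<in> {n \<in> carrier M. \<exists>r\<in>carrier R. n \<ominus>\<^bsub>M\<^esub> r \<odot>\<^bsub>M\<^esub> u \<in> N}"
    then obtain r where r: "a \<in> carrier M" "r \<in> carrier R" "a \<ominus>\<^bsub>M\<^esub> r \<odot>\<^bsub>M\<^esub> u \<in> N" by blast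
    then have "s \<odot>\<^bsub>M\<^esub> a \<ominus>\<^bsub>M\<^esub> (s \<otimes> r) \<odot>\<^bsub>M\<^esub> u \<in> N" using sm[OF r(1,2) s] s N(4) by simp
    then show "s \<odot>\<^bsub>M\<^esub> a \<in> {n \<in> carrier M. \<exists>r\<in>carrier R. n \<ominus>\<^bsub>M\<^esub> r \<odot>\<^bsub>M\<^esub> u \<in> N}"
      using r s by (auto intro!: bexI[of _ "s \<otimes> r"])
  qed auto
  show "u \<in> {n \<in> carrier M. \<exists>r\<in>carrier R. n \<ominus>\<^bsub>M\<^esub> r \<odot>\<^bsub>M\<^esub> u \<in> N}"
    using assms(2) N(2) by (auto intro!: bexI[of _ "\<one>"] simp: a_minus_def M.r_neg)
qed

lemma span_insert:
  assumes "insert u S \<subseteq> carrier M" "n \<in> module_span R M (insert u S)"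
  obtains r where "r \<in> carrier R" "n \<ominus>\<^bsub>M\<^esub> r \<odot>\<^bsub>M\<^esub> u \<in> module_span R M S"
proof -
  have S: "S \<subseteq> carrier M" "u \<in> carrier M" using assms by auto
  note c = submodule_add_cyclic[OF submodule_span(1)[OF S(1)] S(2)]
  have "insert u S \<subseteq> {n \<in> carrier M. \<exists>r\<in>carrier R. n \<ominus>\<^bsub>M\<^esub> r \<odot>\<^bsub>M\<^esub> u \<in> module_span R M S}"
    using c(2,3) submodule_span(2)[OF S(1)] by blast
  from submodule_span(3)[OF assms(1) c(1) this] show ?thesis using assms(2) that by blast
qed

text \<open>The ideal of coefficients of u that occur in N', taken modulo N; it plays the part of
  the ideal of leading coefficients in Hilbert's basis theorem.\<close>

lemma colon_ideal:
  assumes "submodule N R M" "submodule N' R M" "u \<in> carrier M"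
  shows "ideal {r \<in> carrier R. \<exists>n\<in>N'. n \<ominus>\<^bsub>M\<^esub> r \<odot>\<^bsub>M\<^esub> u \<in> N} R"
proof (rule R.ideal_criterion)
  note N = submodule_facts[OF assms(1)] and N' = submodule_facts[OF assms(2)]
  show "\<zero> \<in> {r \<in> carrier R. \<exists>n\<in>N'. n \<ominus>\<^bsub>M\<^esub> r \<odot>\<^bsub>M\<^esub> u \<in> N}"
    using N(2) N'(2) assms(3) M.r_neg[OF M.zero_closed]
    by (auto intro!: bexI[of _ "\<zero>\<^bsub>M\<^esub>"] simp: a_minus_def)
  fix a b assume a: "a \<in> {r \<in> carrier R. \<exists>n\<in>N'. n \<ominus>\<^bsub>M\<^esub> r \<odot>\<^bsub>M\<^esub> u \<in> N}"
    and b: "b \<in> {r \<in> carrier R. \<exists>n\<in>N'. n \<ominus>\<^bsub>M\<^esub> r \<odot>\<^bsub>M\<^esub> u \<in> N}"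
  then obtain n m where nm: "n \<in> N'" "n \<ominus>\<^bsub>M\<^esub> a \<odot>\<^bsub>M\<^esub> u \<in> N" "m \<in> N'" "m \<ominus>\<^bsub>M\<^esub> b \<odot>\<^bsub>M\<^esub> u \<in> N" by blast
  have "(n \<oplus>\<^bsub>M\<^esub> m) \<ominus>\<^bsub>M\<^esub> (a \<oplus> b) \<odot>\<^bsub>M\<^esub> u = (n \<ominus>\<^bsub>M\<^esub> a \<odot>\<^bsub>M\<^esub> u) \<oplus>\<^bsub>M\<^esub> (m \<ominus>\<^bsub>M\<^esub> b \<odot>\<^bsub>M\<^esub> u)"
    using a b nm N'(1) assms(3) by (simp add: a_minus_def smult_l_distr M.minus_add M.a_ac subset_iff)
  then show "a \<oplus> b \<in> {r \<in> carrier R. \<exists>n\<in>N'. n \<ominus>\<^bsub>M\<^esub> r \<odot>\<^bsub>M\<^esub> u \<in> N}"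
    using a b nm N(3) N'(3) by (auto intro!: bexI[of _ "n \<oplus>\<^bsub>M\<^esub> m"])
next
  note N = submodule_facts[OF assms(1)] and N' = submodule_facts[OF assms(2)]
  fix s a assume s: "s \<in> carrier R" and a: "a \<in> {r \<in> carrier R. \<exists>n\<in>N'. n \<ominus>\<^bsub>M\<^esub> r \<odot>\<^bsub>M\<^esub> u \<in> N}"
  then obtain n where n: "n \<in> N'" "n \<ominus>\<^bsub>M\<^esub> a \<odot>\<^bsub>M\<^esub> u \<in> N" by blast
  have "s \<odot>\<^bsub>M\<^esub> n \<ominus>\<^bsub>M\<^esub> (s \<otimes> a) \<odot>\<^bsub>M\<^esub> u = s \<odot>\<^bsub>M\<^esub> (n \<ominus>\<^bsub>M\<^esub> a \<odot>\<^bsub>M\<^esub> u)"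
    using a n s N'(1) assms(3) by (simp add: a_minus_def smult_r_distr smult_assoc1 smult_r_minus subset_iff)
  then show "s \<otimes> a \<in> {r \<in> carrier R. \<exists>n\<in>N'. n \<ominus>\<^bsub>M\<^esub> r \<odot>\<^bsub>M\<^esub> u \<in> N}"
    using a n s N(4) N'(4) by (auto intro!: bexI[of _ "s \<odot>\<^bsub>M\<^esub> n"])
qed auto

text \<open>Remove one generator u of the ambient span. The part of N inside the smaller span is
  finitely generated by induction, the ideal of u-coefficients of N by the noetherian hypothesis,
  and lifts of the latter complete the former to generators of N.\<close>

lemma submodule_of_span_finitely_generated:
  assumes noeth: "noetherian_ring R" and "finite S" "S \<subseteq> carrier M" "submodule N R M"
    "N \<subseteq> module_span R M S"
  shows "\<exists>T. finite T \<and> T \<subseteq> N \<and> (\<forall>N'. submodule N' R M \<longrightarrow> T \<subseteq> N' \<longrightarrow> N \<subseteq> N')"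
  using assms(2-5)
proof (induction S arbitrary: N rule: finite_induct)
  case empty
  have "N \<subseteq> {\<zero>\<^bsub>M\<^esub>}" using submodule_span(3)[OF _ submodule_zero, of "{}"] empty by auto
  then show ?case using submodule_facts(2) by (intro exI[of _ "{}"]) auto
next
  case (insert u S)
  have u: "u \<in> carrier M" "S \<subseteq> carrier M" using insert.prems by auto
  let ?L = "module_span R M S"
  have L: "submodule ?L R M" using submodule_span(1) u by blast
  note sL = submodule_facts[OF L] and sN = submodule_facts[OF \<open>submodule N R M\<close>]
  have "submodule (N \<inter> ?L) R M"
    by (rule submodule_criterion) (use sL sN in auto)
  then obtain T where T: "finite T" "T \<subseteq> N \<inter> ?L"
    "\<And>N'. submodule N' R M \<Longrightarrow> T \<subseteq> N' \<Longrightarrow> N \<inter> ?L \<subseteq> N'"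
    using insert.IH[of "N \<inter> ?L"] u by auto
  define I where "I N' = {r \<in> carrier R. \<exists>n\<in>N'. n \<ominus>\<^bsub>M\<^esub> r \<odot>\<^bsub>M\<^esub> u \<in> ?L}" for N'
  have I: "ideal (I N') R" if "submodule N' R M" for N'
    unfolding I_def by (rule colon_ideal[OF L that u(1)])
  obtain A where A: "finite A" "A \<subseteq> I N" "\<And>J. ideal J R \<Longrightarrow> A \<subseteq> J \<Longrightarrow> I N \<subseteq> J"
    using noetherian_regular_module[OF R.is_cring noeth] I[OF \<open>submodule N R M\<close>]
    unfolding noetherian_module_def R.submodule_regular_iff by meson
  have "\<forall>r\<in>A. \<exists>n. n \<in> N \<and> n \<ominus>\<^bsub>M\<^esub> r \<odot>\<^bsub>M\<^esub> u \<in> ?L" using A(2) by (auto simp: I_def)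
  then obtain n where n: "\<And>r. r \<in> A \<Longrightarrow> n r \<in> N" "\<And>r. r \<in> A \<Longrightarrow> n r \<ominus>\<^bsub>M\<^esub> r \<odot>\<^bsub>M\<^esub> u \<in> ?L" by metis
  have "N \<subseteq> N'" if N': "submodule N' R M" "T \<union> n ` A \<subseteq> N'" for N'
  proof
    fix v assume v: "v \<in> N"
    note sN' = submodule_facts[OF N'(1)]
    have sub: "submodule (N' \<inter> N) R M"
      by (rule submodule_criterion) (use sN' sN in auto)
    \<comment> \<open>Intersecting with N keeps the comparison element w inside N, so that v - w
      lies in N and in the smaller span.\<close>
    have "A \<subseteq> I (N' \<inter> N)"
    proof
      fix r assume "r \<in> A"
      then show "r \<in> I (N' \<inter> N)" using A(2) n[of r] N'(2) by (auto simp: I_def intro!: bexI[of _ "n r"])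
    qed
    then have IN: "I N \<subseteq> I (N' \<inter> N)" using A(3) I[OF sub] by blast
    obtain r where r: "r \<in> carrier R" "v \<ominus>\<^bsub>M\<^esub> r \<odot>\<^bsub>M\<^esub> u \<in> ?L"
      using span_insert[of u S v] v insert.prems by blast
    then have "r \<in> I (N' \<inter> N)" using IN v by (auto simp: I_def)
    then obtain w where w: "w \<in> N'" "w \<in> N" "w \<ominus>\<^bsub>M\<^esub> r \<odot>\<^bsub>M\<^esub> u \<in> ?L" by (auto simp: I_def)
    have c: "v \<in> carrier M" "w \<in> carrier M" "r \<odot>\<^bsub>M\<^esub> u \<in> carrier M" using v w sN(1) r u by auto
    have "(v \<ominus>\<^bsub>M\<^esub> r \<odot>\<^bsub>M\<^esub> u) \<ominus>\<^bsub>M\<^esub> (w \<ominus>\<^bsub>M\<^esub> r \<odot>\<^bsub>M\<^esub> u) \<in> ?L" using r(2) w(3) sL(5) by blast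
    moreover have "(v \<ominus>\<^bsub>M\<^esub> r \<odot>\<^bsub>M\<^esub> u) \<ominus>\<^bsub>M\<^esub> (w \<ominus>\<^bsub>M\<^esub> r \<odot>\<^bsub>M\<^esub> u) = v \<ominus>\<^bsub>M\<^esub> w"
    proof -
      have "v \<oplus>\<^bsub>M\<^esub> \<ominus>\<^bsub>M\<^esub> (r \<odot>\<^bsub>M\<^esub> u) \<oplus>\<^bsub>M\<^esub> (\<ominus>\<^bsub>M\<^esub> w \<oplus>\<^bsub>M\<^esub> r \<odot>\<^bsub>M\<^esub> u) =
         (v \<oplus>\<^bsub>M\<^esub> \<ominus>\<^bsub>M\<^esub> w) \<oplus>\<^bsub>M\<^esub> (\<ominus>\<^bsub>M\<^esub> (r \<odot>\<^bsub>M\<^esub> u) \<oplus>\<^bsub>M\<^esub> r \<odot>\<^bsub>M\<^esub> u)"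
        using c by (simp add: M.a_ac)
      then show ?thesis using c by (simp add: a_minus_def M.minus_add M.l_neg)
    qed
    ultimately have "v \<ominus>\<^bsub>M\<^esub> w \<in> N \<inter> ?L" using sN(5)[OF v w(2)] by simp
    then have "v \<ominus>\<^bsub>M\<^esub> w \<in> N'" using T(3)[OF N'(1)] N'(2) by blast
    then have "(v \<ominus>\<^bsub>M\<^esub> w) \<oplus>\<^bsub>M\<^esub> w \<in> N'" using sN'(3) w(1) by blast
    then show "v \<in> N'" using c by (simp add: a_minus_def M.a_assoc M.l_neg)
  qed
  then show ?case using T A n by (intro exI[of _ "T \<union> n ` A"]) auto
qed

end

lemma noetherian_module_finitely_generated:
  assumes "noetherian_ring R" "module R M" "finitely_generated R M"
  shows "noetherian_module R M"
proof -
  interpret rmodule R M by (simp add: rmodule_def assms(2))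
  obtain S where S: "S \<subseteq> carrier M" "finite S" "\<And>N. submodule N R M \<Longrightarrow> S \<subseteq> N \<Longrightarrow> N = carrier M"
    using assms(3) by (auto simp: finitely_generated_def)
  have "module_span R M S = carrier M" using S(3) submodule_span[OF S(1)] by blast
  then show ?thesis
    using submodule_of_span_finitely_generated[OF assms(1) S(2,1)] assms(2) submodule_facts(1)
    unfolding noetherian_module_def by metis
qed


section \<open>Cyclic modules\<close>

text \<open>The quotient of \<open>R\<close> by an ideal is realised on a set of representatives, so that its elements
  still have the type \<open>'a\<close>.\<close>

definition coset_rep :: "('a, 'k) ring_scheme \<Rightarrow> 'a set \<Rightarrow> 'a \<Rightarrow> 'a" where
  "coset_rep R I x = (SOME y. y \<in> carrier R \<and> y \<ominus>\<^bsub>R\<^esub> x \<in> I)"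

definition quot_module :: "('a, 'k) ring_scheme \<Rightarrow> 'a set \<Rightarrow> ('a, 'a) module" where
  "quot_module R I =
     \<lparr>carrier = coset_rep R I ` carrier R, monoid.mult = undefined, one = undefined,
      zero = coset_rep R I \<zero>\<^bsub>R\<^esub>, add = (\<lambda>x y. coset_rep R I (x \<oplus>\<^bsub>R\<^esub> y)),
      smult = (\<lambda>r x. coset_rep R I (r \<otimes>\<^bsub>R\<^esub> x))\<rparr>"

context cring
begin

lemma coset_rep:
  assumes "ideal I R" "x \<in> carrier R"
  shows "coset_rep R I x \<in> carrier R" "coset_rep R I x \<ominus> x \<in> I"
proof -
  have "x \<ominus> x \<in> I" using ideal_facts(2)[OF assms(1)] assms(2) by (simp add: a_minus_def r_neg)
  then have "\<exists>y. y \<in> carrier R \<and> y \<ominus> x \<in> I" using assms(2) by blast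
  from someI_ex[OF this] show "coset_rep R I x \<in> carrier R" "coset_rep R I x \<ominus> x \<in> I"
    unfolding coset_rep_def by auto
qed

lemma minus_minus_cancel:
  assumes "x \<in> carrier R" "y \<in> carrier R" "z \<in> carrier R"
  shows "(x \<ominus> y) \<oplus> (y \<ominus> z) = x \<ominus> z" "\<ominus> (x \<ominus> y) = y \<ominus> x"
  using assms by (algebra, simp add: a_minus_def minus_add a_comm)

lemma coset_rep_eq_iff:
  assumes "ideal I R" "x \<in> carrier R" "y \<in> carrier R"
  shows "coset_rep R I x = coset_rep R I y \<longleftrightarrow> x \<ominus> y \<in> I"
proof
  note I = ideal_facts[OF assms(1)]
  note cx = coset_rep[OF assms(1,2)] and cy = coset_rep[OF assms(1,3)]
  assume e: "coset_rep R I x = coset_rep R I y"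
  have "(x \<ominus> coset_rep R I x) \<oplus> (coset_rep R I y \<ominus> y) \<in> I"
    using I(3)[OF _ cy(2)] I(7)[OF cx(2)] minus_minus_cancel(2)[OF cx(1) assms(2)] assms by auto
  then show "x \<ominus> y \<in> I" using minus_minus_cancel(1)[OF assms(2) cy(1) assms(3)] e by simp
next
  note I = ideal_facts[OF assms(1)]
  assume d: "x \<ominus> y \<in> I"
  have "z \<ominus> x \<in> I \<longleftrightarrow> z \<ominus> y \<in> I" if "z \<in> carrier R" for z
  proof
    show "z \<ominus> y \<in> I" if "z \<ominus> x \<in> I"
      using I(3)[OF that d] minus_minus_cancel(1)[OF \<open>z \<in> carrier R\<close> assms(2,3)] by simp
    have "y \<ominus> x \<in> I" using I(7)[OF d] minus_minus_cancel(2)[OF assms(2,3)] assms by simp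
    then show "z \<ominus> x \<in> I" if "z \<ominus> y \<in> I"
      using I(3)[OF that] minus_minus_cancel(1)[OF \<open>z \<in> carrier R\<close> assms(3,2)] by metis
  qed
  then show "coset_rep R I x = coset_rep R I y" unfolding coset_rep_def by (metis (no_types, lifting))
qed

lemma quot_module_simps:
  "carrier (quot_module R I) = coset_rep R I ` carrier R" "\<zero>\<^bsub>quot_module R I\<^esub> = coset_rep R I \<zero>"
  by (auto simp: quot_module_def)

lemma quot_module_ops:
  assumes "ideal I R" "x \<in> carrier R" "y \<in> carrier R"
  shows "coset_rep R I x \<oplus>\<^bsub>quot_module R I\<^esub> coset_rep R I y = coset_rep R I (x \<oplus> y)"
    "y \<odot>\<^bsub>quot_module R I\<^esub> coset_rep R I x = coset_rep R I (y \<otimes> x)"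
proof -
  note I = ideal_facts[OF assms(1)]
  note cx = coset_rep[OF assms(1,2)] and cy = coset_rep[OF assms(1,3)]
  have "(coset_rep R I x \<oplus> coset_rep R I y) \<ominus> (x \<oplus> y) = (coset_rep R I x \<ominus> x) \<oplus> (coset_rep R I y \<ominus> y)"
    using cx cy assms by (simp add: a_minus_def minus_add a_ac)
  then have "(coset_rep R I x \<oplus> coset_rep R I y) \<ominus> (x \<oplus> y) \<in> I" using I(3) cx cy by simp
  then show "coset_rep R I x \<oplus>\<^bsub>quot_module R I\<^esub> coset_rep R I y = coset_rep R I (x \<oplus> y)"
    using coset_rep_eq_iff[OF assms(1), of "coset_rep R I x \<oplus> coset_rep R I y" "x \<oplus> y"] assms cx cy
    by (simp add: quot_module_def)
  have "y \<otimes> coset_rep R I x \<ominus> y \<otimes> x = y \<otimes> (coset_rep R I x \<ominus> x)"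
    using cx cy assms by (simp add: a_minus_def r_distr r_minus)
  then have "y \<otimes> coset_rep R I x \<ominus> y \<otimes> x \<in> I" using I(4) cx assms by simp
  then show "y \<odot>\<^bsub>quot_module R I\<^esub> coset_rep R I x = coset_rep R I (y \<otimes> x)"
    using coset_rep_eq_iff[OF assms(1), of "y \<otimes> coset_rep R I x" "y \<otimes> x"] assms cx cy
    by (simp add: quot_module_def)
qed

lemma quot_module_module:
  assumes "ideal I R"
  shows "module R (quot_module R I)"
proof (rule moduleI[OF is_cring])
  note ops = quot_module_ops[OF assms]
  show "abelian_group (quot_module R I)"
  proof (rule abelian_groupI)
    show "\<exists>y\<in>carrier (quot_module R I). y \<oplus>\<^bsub>quot_module R I\<^esub> x = \<zero>\<^bsub>quot_module R I\<^esub>"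
      if x: "x \<in> carrier (quot_module R I)" for x
    proof -
      obtain r where "r \<in> carrier R" "x = coset_rep R I r" using x by (auto simp: quot_module_simps)
      then show ?thesis
        using ops(1)[of "\<ominus> r" r] by (intro bexI[of _ "coset_rep R I (\<ominus> r)"]) (auto simp: quot_module_simps l_neg)
    qed
  qed (auto simp: quot_module_simps ops a_ac)
qed (use quot_module_ops[OF assms] in \<open>auto simp: quot_module_simps l_distr r_distr m_assoc\<close>)

lemma coset_rep_zero_iff:
  assumes "ideal I R" "x \<in> carrier R"
  shows "coset_rep R I x = \<zero>\<^bsub>quot_module R I\<^esub> \<longleftrightarrow> x \<in> I"
  using coset_rep_eq_iff[OF assms zero_closed] assms(2) by (simp add: quot_module_simps a_minus_def)

lemma quot_module_killed:
  assumes "ideal I R" "r \<in> I" "x \<in> carrier (quot_module R I)"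
  shows "r \<odot>\<^bsub>quot_module R I\<^esub> x = \<zero>\<^bsub>quot_module R I\<^esub>"
proof -
  obtain s where "s \<in> carrier R" "x = coset_rep R I s" using assms(3) by (auto simp: quot_module_simps)
  then show ?thesis
    using ideal_facts[OF assms(1)] assms quot_module_ops[OF assms(1)] coset_rep_zero_iff[OF assms(1)]
    by (metis subsetD m_closed)
qed

lemma noetherian_quot_module:
  assumes "noetherian_ring R" "ideal I R"
  shows "noetherian_module R (quot_module R I)"
proof (rule noetherian_module_finitely_generated[OF assms(1) quot_module_module[OF assms(2)]])
  interpret Q: module R "quot_module R I" by (rule quot_module_module) fact
  have "N = carrier (quot_module R I)"
    if "submodule N R (quot_module R I)" "coset_rep R I \<one> \<in> N" for N
  proof
    show "N \<subseteq> carrier (quot_module R I)" using Q.submodule_facts(1)[OF that(1)] .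
    show "carrier (quot_module R I) \<subseteq> N"
    proof
      fix x assume "x \<in> carrier (quot_module R I)"
      then obtain r where r: "r \<in> carrier R" "x = coset_rep R I r" by (auto simp: quot_module_simps)
      then show "x \<in> N"
        using Q.submodule_facts(4)[OF that(1) r(1) that(2)] quot_module_ops(2)[OF assms(2) one_closed r(1)]
        by simp
    qed
  qed
  then show "finitely_generated R (quot_module R I)" unfolding finitely_generated_def
    by (intro exI[of _ "{coset_rep R I \<one>}"]) (auto simp: quot_module_simps)
qed

lemma quot_module_surjection:
  assumes "ideal I R" "ideal J R" "I \<subseteq> J"
  shows "module_morphism R (quot_module R I) (quot_module R J) (coset_rep R J)"
    "coset_rep R J ` carrier (quot_module R I) = carrier (quot_module R J)"
    "x \<in> carrier R \<Longrightarrow> coset_rep R J (coset_rep R I x) = coset_rep R J x"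
proof -
  show e: "coset_rep R J (coset_rep R I x) = coset_rep R J x" if "x \<in> carrier R" for x
    using coset_rep_eq_iff[OF assms(2)] coset_rep[OF assms(1) that] that assms(3) by blast
  show "coset_rep R J ` carrier (quot_module R I) = carrier (quot_module R J)"
    unfolding quot_module_simps image_image by (rule image_cong) (simp_all add: e)
  show "module_morphism R (quot_module R I) (quot_module R J) (coset_rep R J)"
    unfolding module_morphism_def
    by (auto simp: quot_module_simps quot_module_ops[OF assms(1)] quot_module_ops[OF assms(2)] e)
qed

end


section \<open>Prime filtrations\<close>

text \<open>Every nonzero noetherian module contains a copy of some \<open>R/Q\<close>, because an annihilator that is
  maximal among those of nonzero elements is prime.\<close>

lemma prime_filtration_induct:
  fixes R :: "('a, 'k) ring_scheme" (structure) and M :: "('a, 'b) module"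
  assumes noeth: "noetherian_ring R" "noetherian_module R M"
    and sub: "submodule N\<^sub>0 R M" "submodule N\<^sub>1 R M" "N\<^sub>0 \<subseteq> N\<^sub>1" and start: "P N\<^sub>0"
    and step: "\<And>N N' Q g. \<lbrakk>submodule N R M; submodule N' R M; N\<^sub>0 \<subseteq> N; N' \<subseteq> N\<^sub>1; P N; primeideal Q R;
        \<And>r. r \<in> carrier R \<Longrightarrow> (\<And>x. x \<in> N\<^sub>1 \<Longrightarrow> r \<odot>\<^bsub>M\<^esub> x \<in> N\<^sub>0) \<Longrightarrow> r \<in> Q;
        short_exact R (M\<lparr>carrier := N\<rparr>) (M\<lparr>carrier := N'\<rparr>) (quot_module R Q) (\<lambda>x. x) g\<rbrakk> \<Longrightarrow> P N'"
  shows "P N\<^sub>1"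
proof -
  interpret rmodule R M using noeth(2) by (simp add: rmodule_def noetherian_module_def)
  \<comment> \<open>No filtration is built. A submodule that is maximal among those with property P
    must be the top one, because otherwise it could be enlarged by one step with cyclic quotient
    R/Q.\<close>
  let ?F = "{N. submodule N R M \<and> N\<^sub>0 \<subseteq> N \<and> N \<subseteq> N\<^sub>1 \<and> P N}"
  obtain N where N: "N \<in> ?F" "\<And>N'. N' \<in> ?F \<Longrightarrow> N \<subseteq> N' \<Longrightarrow> N' = N"
    using noetherian_module_maximal[OF noeth(2), of ?F] sub start by blast
  have sN: "submodule N R M" using N(1) by blast
  note fN = submodule_facts[OF sN] and f1 = submodule_facts[OF sub(2)]
  show ?thesis
  proof (cases "N = N\<^sub>1")
    case False
    define ann where "ann u = {r \<in> carrier R. r \<odot>\<^bsub>M\<^esub> u \<in> N}" for u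
    have ann: "ideal (ann u) R" if "u \<in> N\<^sub>1" for u
      unfolding ann_def using that f1(1) fN
      by (intro R.ideal_criterion) (auto simp: smult_l_distr smult_assoc1 subset_iff)
    \<comment> \<open>These are the annihilators of the nonzero elements of \<open>N\<^sub>1\<close>
      modulo N.\<close>
    let ?G = "ann ` (N\<^sub>1 - N)"
    have "?G \<noteq> {}" using False N(1) by auto
    then obtain Q where Q: "Q \<in> ?G" "\<And>Q'. Q' \<in> ?G \<Longrightarrow> Q \<subseteq> Q' \<Longrightarrow> Q' = Q"
      using noetherian_module_maximal[OF noetherian_regular_module[OF R.is_cring noeth(1)], of ?G] ann
      unfolding R.submodule_regular_iff by blast
    then obtain u where u: "u \<in> N\<^sub>1" "u \<notin> N" "Q = ann u" by blast
    have uM: "u \<in> carrier M" using u f1(1) by blast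
    have idQ: "ideal Q R" using ann u by blast
    have prime: "primeideal Q R"
    proof (rule primeidealI[OF idQ R.is_cring])
      have "\<one> \<notin> Q" using u uM by (auto simp: ann_def)
      then show "carrier R \<noteq> Q" by auto
      fix a b assume ab: "a \<in> carrier R" "b \<in> carrier R" "a \<otimes> b \<in> Q"
      show "a \<in> Q \<or> b \<in> Q"
      proof (cases "b \<in> Q")
        case False
        then have "b \<odot>\<^bsub>M\<^esub> u \<in> N\<^sub>1 - N" using u f1(4) ab by (auto simp: ann_def)
        moreover have "Q \<subseteq> ann (b \<odot>\<^bsub>M\<^esub> u)"
        proof
          fix r assume "r \<in> Q"
          then have r: "r \<in> carrier R" "r \<odot>\<^bsub>M\<^esub> u \<in> N" by (auto simp: ann_def u(3))
          have "r \<odot>\<^bsub>M\<^esub> (b \<odot>\<^bsub>M\<^esub> u) = b \<odot>\<^bsub>M\<^esub> (r \<odot>\<^bsub>M\<^esub> u)"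
            using r ab uM by (simp add: smult_assoc1[symmetric] R.m_comm)
          then show "r \<in> ann (b \<odot>\<^bsub>M\<^esub> u)" using r fN(4) ab by (simp add: ann_def)
        qed
        ultimately have "ann (b \<odot>\<^bsub>M\<^esub> u) = Q" using Q(2) by blast
        moreover have "a \<in> ann (b \<odot>\<^bsub>M\<^esub> u)"
          using ab uM by (simp add: ann_def u(3) smult_assoc1[symmetric])
        ultimately show ?thesis by simp
      qed simp
    qed
    define N' where "N' = {n \<in> carrier M. \<exists>r\<in>carrier R. n \<ominus>\<^bsub>M\<^esub> r \<odot>\<^bsub>M\<^esub> u \<in> N}"
    note cyc = submodule_add_cyclic[OF sN uM, folded N'_def]
    have sN': "submodule N' R M" by (rule cyc)
    note fN' = submodule_facts[OF sN']
    have N'1: "N' \<subseteq> N\<^sub>1"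
    proof
      fix n assume "n \<in> N'"
      then obtain r where r: "n \<in> carrier M" "r \<in> carrier R" "n \<ominus>\<^bsub>M\<^esub> r \<odot>\<^bsub>M\<^esub> u \<in> N" by (auto simp: N'_def)
      have "(n \<ominus>\<^bsub>M\<^esub> r \<odot>\<^bsub>M\<^esub> u) \<oplus>\<^bsub>M\<^esub> r \<odot>\<^bsub>M\<^esub> u \<in> N\<^sub>1"
        using r N(1) f1(3,4) u by blast
      then show "n \<in> N\<^sub>1" using r uM by (simp add: a_minus_def M.a_assoc M.l_neg)
    qed
    \<comment> \<open>The coefficient of u in n is determined only modulo the annihilator Q of the
      class of u, so its residue in R/Q is well defined and gives the quotient map.\<close>
    define c where "c n = (SOME r. r \<in> carrier R \<and> n \<ominus>\<^bsub>M\<^esub> r \<odot>\<^bsub>M\<^esub> u \<in> N)" for n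
    have c: "c n \<in> carrier R \<and> n \<ominus>\<^bsub>M\<^esub> c n \<odot>\<^bsub>M\<^esub> u \<in> N" if "n \<in> N'" for n
    proof -
      have "\<exists>r. r \<in> carrier R \<and> n \<ominus>\<^bsub>M\<^esub> r \<odot>\<^bsub>M\<^esub> u \<in> N" using that by (auto simp: N'_def)
      from someI_ex[OF this] show ?thesis unfolding c_def .
    qed
    define g where "g n = coset_rep R Q (c n)" for n
    have g_eq: "g n = coset_rep R Q r" if "n \<in> N'" "r \<in> carrier R" "n \<ominus>\<^bsub>M\<^esub> r \<odot>\<^bsub>M\<^esub> u \<in> N" for n r
    proof -
      have n: "n \<in> carrier M" using that fN'(1) by blast
      have cn: "c n \<in> carrier R" "n \<ominus>\<^bsub>M\<^esub> c n \<odot>\<^bsub>M\<^esub> u \<in> N" using c[OF that(1)] by auto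
      have "(n \<ominus>\<^bsub>M\<^esub> r \<odot>\<^bsub>M\<^esub> u) \<ominus>\<^bsub>M\<^esub> (n \<ominus>\<^bsub>M\<^esub> c n \<odot>\<^bsub>M\<^esub> u) \<in> N" using fN(5) that(3) cn(2) by blast
      moreover have "(n \<ominus>\<^bsub>M\<^esub> r \<odot>\<^bsub>M\<^esub> u) \<ominus>\<^bsub>M\<^esub> (n \<ominus>\<^bsub>M\<^esub> c n \<odot>\<^bsub>M\<^esub> u) = (c n \<ominus> r) \<odot>\<^bsub>M\<^esub> u"
      proof -
        have "n \<oplus>\<^bsub>M\<^esub> \<ominus>\<^bsub>M\<^esub> (r \<odot>\<^bsub>M\<^esub> u) \<oplus>\<^bsub>M\<^esub> (\<ominus>\<^bsub>M\<^esub> n \<oplus>\<^bsub>M\<^esub> c n \<odot>\<^bsub>M\<^esub> u) =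
           (n \<oplus>\<^bsub>M\<^esub> \<ominus>\<^bsub>M\<^esub> n) \<oplus>\<^bsub>M\<^esub> (c n \<odot>\<^bsub>M\<^esub> u \<oplus>\<^bsub>M\<^esub> \<ominus>\<^bsub>M\<^esub> (r \<odot>\<^bsub>M\<^esub> u))"
          using n that cn uM by (simp add: M.a_ac)
        then show ?thesis
          using n that cn uM by (simp add: a_minus_def M.minus_add M.r_neg smult_l_distr smult_l_minus)
      qed
      ultimately have "c n \<ominus> r \<in> Q" using cn that by (simp add: u(3) ann_def)
      then show ?thesis using R.coset_rep_eq_iff[OF idQ cn(1) that(2)] by (simp add: g_def)
    qed
    have "short_exact R (M\<lparr>carrier := N\<rparr>) (M\<lparr>carrier := N'\<rparr>) (quot_module R Q) (\<lambda>x. x) g"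
      unfolding short_exact_def
    proof (intro conjI)
      show "module R (M\<lparr>carrier := N\<rparr>)" "module R (M\<lparr>carrier := N'\<rparr>)"
        using submodule_restrict_module sN sN' by auto
      show "module R (quot_module R Q)" by (rule R.quot_module_module[OF idQ])
      show "module_morphism R (M\<lparr>carrier := N\<rparr>) (M\<lparr>carrier := N'\<rparr>) (\<lambda>x. x)"
        by (rule submodule_inclusion[OF sN cyc(2)])
      have add: "g (x \<oplus>\<^bsub>M\<^esub> y) = g x \<oplus>\<^bsub>quot_module R Q\<^esub> g y" if "x \<in> N'" "y \<in> N'" for x y
      proof -
        have xy: "x \<in> carrier M" "y \<in> carrier M" using that fN'(1) by auto
        note cx = c[OF that(1)] and cy = c[OF that(2)]
        have "(x \<oplus>\<^bsub>M\<^esub> y) \<ominus>\<^bsub>M\<^esub> (c x \<oplus> c y) \<odot>\<^bsub>M\<^esub> u = (x \<ominus>\<^bsub>M\<^esub> c x \<odot>\<^bsub>M\<^esub> u) \<oplus>\<^bsub>M\<^esub> (y \<ominus>\<^bsub>M\<^esub> c y \<odot>\<^bsub>M\<^esub> u)"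
          using xy cx cy uM by (simp add: a_minus_def smult_l_distr M.minus_add M.a_ac)
        then have "g (x \<oplus>\<^bsub>M\<^esub> y) = coset_rep R Q (c x \<oplus> c y)"
          using g_eq fN'(3)[OF that] cx cy fN(3) by simp
        then show ?thesis using R.quot_module_ops(1)[OF idQ, of "c x" "c y"] cx cy by (simp add: g_def)
      qed
      have sm: "g (r \<odot>\<^bsub>M\<^esub> x) = r \<odot>\<^bsub>quot_module R Q\<^esub> g x" if "r \<in> carrier R" "x \<in> N'" for r x
      proof -
        have x: "x \<in> carrier M" using that fN'(1) by auto
        note cx = c[OF that(2)]
        have "r \<odot>\<^bsub>M\<^esub> x \<ominus>\<^bsub>M\<^esub> (r \<otimes> c x) \<odot>\<^bsub>M\<^esub> u = r \<odot>\<^bsub>M\<^esub> (x \<ominus>\<^bsub>M\<^esub> c x \<odot>\<^bsub>M\<^esub> u)"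
          using x that cx uM by (simp add: a_minus_def smult_r_distr smult_assoc1 smult_r_minus)
        then have "g (r \<odot>\<^bsub>M\<^esub> x) = coset_rep R Q (r \<otimes> c x)"
          using g_eq fN'(4)[OF that] cx fN(4) that by simp
        then show ?thesis using R.quot_module_ops(2)[OF idQ, of "c x" r] cx that by (simp add: g_def)
      qed
      have gc: "g x \<in> carrier (quot_module R Q)" if "x \<in> N'" for x
        using c[OF that] by (auto simp: g_def R.quot_module_simps)
      show "module_morphism R (M\<lparr>carrier := N'\<rparr>) (quot_module R Q) g"
        using add sm gc by (auto simp: module_morphism_def)
      show "inj_on (\<lambda>x. x) (carrier (M\<lparr>carrier := N\<rparr>))" by simp
      have self: "r \<odot>\<^bsub>M\<^esub> u \<in> N'" "g (r \<odot>\<^bsub>M\<^esub> u) = coset_rep R Q r" if "r \<in> carrier R" for r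
      proof -
        show "r \<odot>\<^bsub>M\<^esub> u \<in> N'" using cyc(3) fN'(4) that by blast
        then show "g (r \<odot>\<^bsub>M\<^esub> u) = coset_rep R Q r"
          by (rule g_eq) (use that uM fN(2) in \<open>auto simp: a_minus_def M.r_neg\<close>)
      qed
      show "g ` carrier (M\<lparr>carrier := N'\<rparr>) = carrier (quot_module R Q)"
      proof
        show "g ` carrier (M\<lparr>carrier := N'\<rparr>) \<subseteq> carrier (quot_module R Q)" using gc by auto
        show "carrier (quot_module R Q) \<subseteq> g ` carrier (M\<lparr>carrier := N'\<rparr>)"
        proof
          fix y assume "y \<in> carrier (quot_module R Q)"
          then obtain r where "r \<in> carrier R" "y = coset_rep R Q r" by (auto simp: R.quot_module_simps)
          then have "y = g (r \<odot>\<^bsub>M\<^esub> u)" "r \<odot>\<^bsub>M\<^esub> u \<in> N'" using self by auto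
          then show "y \<in> g ` carrier (M\<lparr>carrier := N'\<rparr>)" by auto
        qed
      qed
      have "g x = \<zero>\<^bsub>quot_module R Q\<^esub> \<longleftrightarrow> x \<in> N" if "x \<in> N'" for x
      proof -
        have x: "x \<in> carrier M" using that fN'(1) by auto
        note cx = c[OF that]
        have "g x = \<zero>\<^bsub>quot_module R Q\<^esub> \<longleftrightarrow> c x \<odot>\<^bsub>M\<^esub> u \<in> N"
          using R.coset_rep_zero_iff[OF idQ] cx by (simp add: g_def u(3) ann_def)
        also have "\<dots> \<longleftrightarrow> x \<in> N"
        proof
          assume "c x \<odot>\<^bsub>M\<^esub> u \<in> N"
          then have "(x \<ominus>\<^bsub>M\<^esub> c x \<odot>\<^bsub>M\<^esub> u) \<oplus>\<^bsub>M\<^esub> c x \<odot>\<^bsub>M\<^esub> u \<in> N" using cx fN(3) by blast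
          then show "x \<in> N" using x cx uM by (simp add: a_minus_def M.a_assoc M.l_neg)
        next
          assume "x \<in> N"
          then have "x \<ominus>\<^bsub>M\<^esub> (x \<ominus>\<^bsub>M\<^esub> c x \<odot>\<^bsub>M\<^esub> u) \<in> N" using cx fN(5) by blast
          then show "c x \<odot>\<^bsub>M\<^esub> u \<in> N" using x cx uM
            by (simp add: a_minus_def M.minus_add M.a_assoc[symmetric] M.r_neg)
        qed
        finally show ?thesis .
      qed
      then show "(\<lambda>x. x) ` carrier (M\<lparr>carrier := N\<rparr>) =
          {x \<in> carrier (M\<lparr>carrier := N'\<rparr>). g x = \<zero>\<^bsub>quot_module R Q\<^esub>}"
        using cyc(2) by auto
    qed
    \<comment> \<open>If r carries the top into the bottom submodule, then it carries u into N and
      hence lies in the annihilator Q.\<close>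
    moreover have "r \<in> Q" if "r \<in> carrier R" "\<And>x. x \<in> N\<^sub>1 \<Longrightarrow> r \<odot>\<^bsub>M\<^esub> x \<in> N\<^sub>0" for r
      using that u(1,3) N(1) by (auto simp: ann_def)
    ultimately have "P N'" using step[OF sN sN' _ N'1 _ prime] N(1) by blast
    then have "N' = N" using N(2)[of N'] N(1) sN' N'1 cyc(2) by blast
    then show ?thesis using cyc(3) u(2) by blast
  qed (use N(1) in blast)
qed

section \<open>Injective modules\<close>

text \<open>The extension property for the inclusions of ideals into R, where an extension is named
  by its value at 1. Unlike the defining test on modules it mentions no auxiliary type and is easy
  to verify for torsion submodules.\<close>

definition baer :: "('a, 'k) ring_scheme \<Rightarrow> ('a, 'b) module \<Rightarrow> bool" where
  "baer R E \<longleftrightarrow> (\<forall>I g. ideal I R \<longrightarrow> module_morphism R (regular_module R\<lparr>carrier := I\<rparr>) E g \<longrightarrow>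
     (\<exists>e\<in>carrier E. \<forall>r\<in>I. g r = r \<odot>\<^bsub>E\<^esub> e))"

text \<open>Test modules for injectivity have elements in a sum type; this copy places ideals of R
  and R itself there.\<close>

definition Inl_module :: "('a, 'b) module \<Rightarrow> ('a, 'b + 'c) module" where
  "Inl_module N =
     \<lparr>carrier = Inl ` carrier N, monoid.mult = undefined, one = undefined,
      zero = Inl \<zero>\<^bsub>N\<^esub>, add = (\<lambda>x y. Inl (projl x \<oplus>\<^bsub>N\<^esub> projl y)),
      smult = (\<lambda>r x. Inl (r \<odot>\<^bsub>N\<^esub> projl x))\<rparr>"

lemma Inl_module_module:
  assumes "module R N"
  shows "module R (Inl_module N :: ('a, 'b + 'c) module)"
proof -
  interpret N: module R N by fact
  have "abelian_group (Inl_module N :: ('a, 'b + 'c) module)"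
  proof (rule abelian_groupI)
    fix x :: "'b + 'c" assume "x \<in> carrier (Inl_module N)"
    then obtain v where "v \<in> carrier N" "x = Inl v" by (auto simp: Inl_module_def)
    then show "\<exists>y\<in>carrier (Inl_module N). y \<oplus>\<^bsub>Inl_module N\<^esub> x = \<zero>\<^bsub>Inl_module N :: ('a, 'b + 'c) module\<^esub>"
      by (intro bexI[of _ "Inl (\<ominus>\<^bsub>N\<^esub> v)"]) (auto simp: Inl_module_def N.M.l_neg)
  qed (auto simp: Inl_module_def N.M.a_ac)
  then show ?thesis
    by (intro moduleI[OF N.R.is_cring])
      (auto simp: Inl_module_def N.smult_l_distr N.smult_r_distr N.smult_assoc1)
qed

lemma injective_module_baer:
  fixes R :: "('a, 'k) ring_scheme" and E :: "('a, 'b) module"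
  assumes "injective_module R E"
  shows "baer R E"
  unfolding baer_def
proof (intro allI impI)
  fix I g assume I: "ideal I R" and g: "module_morphism R (regular_module R\<lparr>carrier := I\<rparr>) E g"
  have E: "module R E" using assms by (simp add: injective_module_def)
  interpret E: module R E by fact
  note fI = E.R.ideal_facts[OF I]
  interpret reg: module R "regular_module R" by (rule E.R.regular_module_module)
  have sub: "submodule I R (regular_module R)" using I E.R.submodule_regular_iff by blast
  let ?A = "Inl_module (regular_module R\<lparr>carrier := I\<rparr>) :: ('a, 'a + 'b) module"
  let ?B = "Inl_module (regular_module R) :: ('a, 'a + 'b) module"
  have A: "module R ?A" by (rule Inl_module_module[OF reg.submodule_restrict_module[OF sub]])
  have B: "module R ?B" by (rule Inl_module_module) (rule E.R.regular_module_module)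
  have f: "module_morphism R ?A ?B (\<lambda>x. x)"
    using fI(1) by (auto simp: module_morphism_def Inl_module_def)
  have g': "module_morphism R ?A E (g \<circ> projl)"
    using module_morphismD[OF g] by (auto simp: module_morphism_def Inl_module_def)
  obtain h where h: "module_morphism R ?B E h" "\<And>x. x \<in> carrier ?A \<Longrightarrow> h x = g (projl x)"
  proof -
    have "inj_on (\<lambda>x. x) (carrier ?A)" by simp
    then have "\<exists>h. module_morphism R ?B E h \<and> (\<forall>x\<in>carrier ?A. h x = (g \<circ> projl) x)"
      using assms A B f g' unfolding injective_module_def by blast
    then show ?thesis using that by auto
  qed
  have "h (Inl \<one>\<^bsub>R\<^esub>) \<in> carrier E" 
    by (rule module_morphismD(1)[OF h(1)]) (auto simp: Inl_module_def)
  moreover have "g r = r \<odot>\<^bsub>E\<^esub> h (Inl \<one>\<^bsub>R\<^esub>)" if "r \<in> I" for r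
  proof -
    have r: "r \<in> carrier R" using fI(1) that by blast
    have "h (r \<odot>\<^bsub>?B\<^esub> Inl \<one>\<^bsub>R\<^esub>) = r \<odot>\<^bsub>E\<^esub> h (Inl \<one>\<^bsub>R\<^esub>)"
      by (rule module_morphismD(3)[OF h(1) r]) (auto simp: Inl_module_def)
    moreover have "r \<odot>\<^bsub>?B\<^esub> Inl \<one>\<^bsub>R\<^esub> = Inl r" using r by (simp add: Inl_module_def)
    ultimately show ?thesis using h(2)[of "Inl r"] that by (auto simp: Inl_module_def)
  qed
  ultimately show "\<exists>e\<in>carrier E. \<forall>r\<in>I. g r = r \<odot>\<^bsub>E\<^esub> e" by blast
qed

lemma ideal_chain:
  fixes I :: "nat \<Rightarrow> 'a set"
  assumes "cring R" "noetherian_ring R" "\<And>i. ideal (I i) R" "\<And>i. I i \<subseteq> I (Suc i)"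
  obtains k where "\<And>i. i \<ge> k \<Longrightarrow> I i = I k"
  using noetherian_module_chain[OF noetherian_regular_module[OF assms(1,2)], of I] assms(3,4)
    cring.submodule_regular_iff[OF assms(1)] by metis

definition torsion_part :: "('a, 'k) ring_scheme \<Rightarrow> ('a, 'b) module \<Rightarrow> 'a \<Rightarrow> 'b set" where
  "torsion_part R E y = {u \<in> carrier E. \<exists>k::nat. (y [^]\<^bsub>R\<^esub> k) \<odot>\<^bsub>E\<^esub> u = \<zero>\<^bsub>E\<^esub>}"

context rmodule
begin

lemma smult_commute:
  "r \<in> carrier R \<Longrightarrow> s \<in> carrier R \<Longrightarrow> u \<in> carrier M \<Longrightarrow> r \<odot>\<^bsub>M\<^esub> (s \<odot>\<^bsub>M\<^esub> u) = s \<odot>\<^bsub>M\<^esub> (r \<odot>\<^bsub>M\<^esub> u)"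
  by (simp add: smult_assoc1[symmetric] R.m_comm)

lemma pow_kills_mono:
  assumes "y \<in> carrier R" "u \<in> carrier M" "y [^] (k::nat) \<odot>\<^bsub>M\<^esub> u = \<zero>\<^bsub>M\<^esub>" "k \<le> l"
  shows "y [^] l \<odot>\<^bsub>M\<^esub> u = \<zero>\<^bsub>M\<^esub>"
proof -
  have "y [^] l = y [^] (l - k) \<otimes> y [^] k" using assms by (simp add: R.nat_pow_mult)
  then show ?thesis using assms by (simp add: smult_assoc1)
qed

lemma submodule_torsion_part:
  assumes "y \<in> carrier R"
  shows "submodule (torsion_part R M y) R M"
proof (rule submodule_criterion)
  show "\<zero>\<^bsub>M\<^esub> \<in> torsion_part R M y" using assms by (auto simp: torsion_part_def intro!: exI[of _ 0])
  show "r \<odot>\<^bsub>M\<^esub> a \<in> torsion_part R M y" if r: "r \<in> carrier R" "a \<in> torsion_part R M y" for r a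
  proof -
    obtain k :: nat where "a \<in> carrier M" "y [^] k \<odot>\<^bsub>M\<^esub> a = \<zero>\<^bsub>M\<^esub>"
      using r by (auto simp: torsion_part_def)
    then show ?thesis
      using r assms smult_commute[of "y [^] k" r a] by (auto simp: torsion_part_def intro!: exI[of _ k])
  qed
  show "a \<oplus>\<^bsub>M\<^esub> b \<in> torsion_part R M y" if ab: "a \<in> torsion_part R M y" "b \<in> torsion_part R M y" for a b
  proof -
    obtain k l :: nat where k: "a \<in> carrier M" "b \<in> carrier M" "y [^] k \<odot>\<^bsub>M\<^esub> a = \<zero>\<^bsub>M\<^esub>" "y [^] l \<odot>\<^bsub>M\<^esub> b = \<zero>\<^bsub>M\<^esub>"
      using ab by (auto simp: torsion_part_def)
    then have "y [^] (k + l) \<odot>\<^bsub>M\<^esub> (a \<oplus>\<^bsub>M\<^esub> b) = \<zero>\<^bsub>M\<^esub>"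
      using pow_kills_mono[OF assms k(1,3), of "k + l"] pow_kills_mono[OF assms k(2,4), of "k + l"] assms
      by (simp add: smult_r_distr)
    then show ?thesis using k by (auto simp: torsion_part_def)
  qed
qed (auto simp: torsion_part_def)

text \<open>In other words E maps onto its localization E_y: up to y-torsion every element is
  divisible by every power of y, with one exponent k that controls the torsion. It is obtained by
  extending a map from the principal ideal generated by y^(s+k), which sends the multiple by r to
  y^k r u.\<close>

lemma baer_divisible:
  assumes "noetherian_ring R" "baer R M" "y \<in> carrier R"
  obtains k :: nat where "\<And>s u. u \<in> carrier M \<Longrightarrow> \<exists>e\<in>carrier M. y [^] (s + k) \<odot>\<^bsub>M\<^esub> e = y [^] k \<odot>\<^bsub>M\<^esub> u"
proof -
  \<comment> \<open>The annihilators of the powers of y stabilise at k. From then on a multiple of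
    y^(s+k) determines its cofactor up to elements killed by y^k, which is what makes the map well
    defined.\<close>
  define A where "A j = {r \<in> carrier R. y [^] j \<otimes> r = \<zero>}" for j :: nat
  have "ideal (A j) R" for j
    unfolding A_def using assms(3) by (intro R.ideal_criterion) (auto simp: R.r_distr R.m_lcomm)
  moreover have "A j \<subseteq> A (Suc j)" for j
    using assms(3) by (auto simp: A_def R.m_assoc R.m_comm[of _ y])
  ultimately obtain k where k: "\<And>i. i \<ge> k \<Longrightarrow> A i = A k"
    using ideal_chain[OF R.is_cring assms(1), of A] by blast
  have "\<exists>e\<in>carrier M. y [^] (s + k) \<odot>\<^bsub>M\<^esub> e = y [^] k \<odot>\<^bsub>M\<^esub> u" if u: "u \<in> carrier M" for s u
  proof -
    define I where "I = (\<lambda>r. y [^] (s + k) \<otimes> r) ` carrier R"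
    define c where "c x = (SOME r. r \<in> carrier R \<and> x = y [^] (s + k) \<otimes> r)" for x
    have c: "c x \<in> carrier R \<and> x = y [^] (s + k) \<otimes> c x" if "x \<in> I" for x
    proof -
      have "\<exists>r. r \<in> carrier R \<and> x = y [^] (s + k) \<otimes> r" using that by (auto simp: I_def)
      from someI_ex[OF this] show ?thesis unfolding c_def .
    qed
    define g where "g x = y [^] k \<odot>\<^bsub>M\<^esub> (c x \<odot>\<^bsub>M\<^esub> u)" for x
    have g: "g (y [^] (s + k) \<otimes> r) = y [^] k \<odot>\<^bsub>M\<^esub> (r \<odot>\<^bsub>M\<^esub> u)" if r: "r \<in> carrier R" for r
    proof -
      let ?x = "y [^] (s + k) \<otimes> r"
      have "?x \<in> I" using r by (auto simp: I_def)
      then have cx: "c ?x \<in> carrier R" "?x = y [^] (s + k) \<otimes> c ?x" using c by blast+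
      have "y [^] (s + k) \<otimes> (c ?x \<ominus> r) = y [^] (s + k) \<otimes> c ?x \<ominus> y [^] (s + k) \<otimes> r"
        using cx(1) r assms(3) by (simp add: a_minus_def R.r_distr R.r_minus)
      also have "\<dots> = \<zero>" using cx(2)[symmetric] r assms(3) by (simp add: a_minus_def R.r_neg)
      finally have "c ?x \<ominus> r \<in> A (s + k)" using cx(1) r by (simp add: A_def)
      then have "c ?x \<ominus> r \<in> A k" using k[of "s + k"] by simp
      then have "y [^] k \<otimes> (c ?x \<ominus> r) = \<zero>" by (simp add: A_def)
      then have "(y [^] k \<otimes> (c ?x \<ominus> r)) \<odot>\<^bsub>M\<^esub> u = \<zero>\<^bsub>M\<^esub>" using u by simp
      moreover have "(y [^] k \<otimes> (c ?x \<ominus> r)) \<odot>\<^bsub>M\<^esub> u = g ?x \<oplus>\<^bsub>M\<^esub> \<ominus>\<^bsub>M\<^esub> (y [^] k \<odot>\<^bsub>M\<^esub> (r \<odot>\<^bsub>M\<^esub> u))"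
        using cx(1) r assms(3) u
        by (simp add: g_def smult_assoc1 a_minus_def smult_l_distr smult_r_distr smult_l_minus smult_r_minus)
      ultimately have "g ?x \<oplus>\<^bsub>M\<^esub> \<ominus>\<^bsub>M\<^esub> (y [^] k \<odot>\<^bsub>M\<^esub> (r \<odot>\<^bsub>M\<^esub> u)) = \<zero>\<^bsub>M\<^esub>" by simp
      then show ?thesis using cx(1) r assms(3) u M.minus_equality[of "g ?x" "\<ominus>\<^bsub>M\<^esub> (y [^] k \<odot>\<^bsub>M\<^esub> (r \<odot>\<^bsub>M\<^esub> u))"]
        by (simp add: g_def)
    qed
    have y: "y [^] n \<in> carrier R" for n :: nat using assms(3) by simp
    have I: "ideal I R"
    proof (rule R.ideal_criterion)
      show "\<zero> \<in> I" using y by (auto simp: I_def intro!: image_eqI[of _ _ \<zero>])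
      show "a \<oplus> b \<in> I" if ab: "a \<in> I" "b \<in> I" for a b
      proof -
        have "a \<oplus> b = y [^] (s + k) \<otimes> (c a \<oplus> c b)" 
          using c[OF ab(1)] c[OF ab(2)] y by (metis R.r_distr)
        then show ?thesis using c[OF ab(1)] c[OF ab(2)] by (auto simp: I_def)
      qed
      show "r \<otimes> a \<in> I" if ra: "r \<in> carrier R" "a \<in> I" for r a
      proof -
        have "r \<otimes> a = y [^] (s + k) \<otimes> (r \<otimes> c a)" 
          using c[OF ra(2)] y ra by (metis R.m_lcomm)
        then show ?thesis using c[OF ra(2)] ra by (auto simp: I_def)
      qed
    qed (use y in \<open>auto simp: I_def\<close>)
    have "module_morphism R (regular_module R\<lparr>carrier := I\<rparr>) M g"
      unfolding module_morphism_def
    proof (intro conjI ballI)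
      show "g \<in> carrier (regular_module R\<lparr>carrier := I\<rparr>) \<rightarrow> carrier M"
        using c y u by (auto simp: g_def)
    next
      fix a b assume "a \<in> carrier (regular_module R\<lparr>carrier := I\<rparr>)" "b \<in> carrier (regular_module R\<lparr>carrier := I\<rparr>)"
      then have ab: "a \<in> I" "b \<in> I" by auto
      have "a \<oplus> b = y [^] (s + k) \<otimes> (c a \<oplus> c b)" 
        using c[OF ab(1)] c[OF ab(2)] y by (metis R.r_distr)
      then have "g (a \<oplus> b) = y [^] k \<odot>\<^bsub>M\<^esub> ((c a \<oplus> c b) \<odot>\<^bsub>M\<^esub> u)" using g c ab by simp
      then show "g (a \<oplus>\<^bsub>regular_module R\<lparr>carrier := I\<rparr>\<^esub> b) = g a \<oplus>\<^bsub>M\<^esub> g b"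
        using c[OF ab(1)] c[OF ab(2)] u y by (simp add: g_def smult_l_distr smult_r_distr)
    next
      fix r a assume "r \<in> carrier R" "a \<in> carrier (regular_module R\<lparr>carrier := I\<rparr>)"
      then have ra: "r \<in> carrier R" "a \<in> I" by auto
      have "r \<otimes> a = y [^] (s + k) \<otimes> (r \<otimes> c a)" 
        using c[OF ra(2)] y ra by (metis R.m_lcomm)
      then have "g (r \<otimes> a) = y [^] k \<odot>\<^bsub>M\<^esub> ((r \<otimes> c a) \<odot>\<^bsub>M\<^esub> u)" using g c[OF ra(2)] ra by simp
      then show "g (r \<odot>\<^bsub>regular_module R\<lparr>carrier := I\<rparr>\<^esub> a) = r \<odot>\<^bsub>M\<^esub> g a"
        using c[OF ra(2)] u y ra by (simp add: g_def smult_assoc1 smult_commute)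
    qed
    then obtain e where e: "e \<in> carrier M" "\<And>r. r \<in> I \<Longrightarrow> g r = r \<odot>\<^bsub>M\<^esub> e"
      using assms(2) I unfolding baer_def by meson
    have "y [^] (s + k) \<otimes> \<one> \<in> I" by (auto simp: I_def)
    then show ?thesis using e g[OF R.one_closed] u y by (intro bexI[of _ e]) auto
  qed
  then show ?thesis using that by blast
qed

text \<open>This is the Artin--Rees argument for a principal ideal.\<close>

lemma baer_torsion_part:
  assumes noeth: "noetherian_ring R" and "baer R M" and y: "y \<in> carrier R"
  shows "baer R (M\<lparr>carrier := torsion_part R M y\<rparr>)"
  unfolding baer_def
proof (intro allI impI)
  let ?E = "M\<lparr>carrier := torsion_part R M y\<rparr>"
  fix I g assume I: "ideal I R" and g: "module_morphism R (regular_module R\<lparr>carrier := I\<rparr>) ?E g"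
  note fI = R.ideal_facts[OF I]
  have gD: "a \<in> I \<Longrightarrow> g a \<in> carrier M \<and> (\<exists>k::nat. y [^] k \<odot>\<^bsub>M\<^esub> g a = \<zero>\<^bsub>M\<^esub>)"
    "a \<in> I \<Longrightarrow> b \<in> I \<Longrightarrow> g (a \<oplus> b) = g a \<oplus>\<^bsub>M\<^esub> g b"
    "r \<in> carrier R \<Longrightarrow> a \<in> I \<Longrightarrow> g (r \<otimes> a) = r \<odot>\<^bsub>M\<^esub> g a" for a b r
    using module_morphismD[OF g] by (auto simp: torsion_part_def)
  have yn: "y [^] n \<in> carrier R" for n :: nat using y by simp
  \<comment> \<open>Since I is noetherian, one power y^k kills the whole image g(I).\<close>
  define A where "A j = {r \<in> I. y [^] j \<odot>\<^bsub>M\<^esub> g r = \<zero>\<^bsub>M\<^esub>}" for j :: nat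
  have g0: "g \<zero> = \<zero>\<^bsub>M\<^esub>" using gD(3)[of \<zero> \<zero>] gD(1)[OF fI(2)] fI(2) by simp
  have "ideal (A j) R" for j
    unfolding A_def using fI gD yn g0
    by (intro R.ideal_criterion) (auto simp: smult_r_distr smult_commute[of "y [^] j"])
  moreover have "A j \<subseteq> A (Suc j)" for j
    using gD(1) pow_kills_mono[OF y, of _ j "Suc j"] unfolding A_def by auto
  ultimately obtain k where k: "\<And>i. i \<ge> k \<Longrightarrow> A i = A k"
    using ideal_chain[OF R.is_cring noeth, of A] by blast
  have gk: "y [^] k \<odot>\<^bsub>M\<^esub> g r = \<zero>\<^bsub>M\<^esub>" if "r \<in> I" for r
  proof -
    obtain j :: nat where "y [^] j \<odot>\<^bsub>M\<^esub> g r = \<zero>\<^bsub>M\<^esub>" using gD(1)[OF \<open>r \<in> I\<close>] by blast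
    then have "r \<in> A (j + k)" using pow_kills_mono[OF y, of _ j "j + k"] gD(1) \<open>r \<in> I\<close> by (simp add: A_def)
    then have "r \<in> A k" using k[of "j + k"] by simp
    then show ?thesis by (simp add: A_def)
  qed
  \<comment> \<open>Once these ideals are stable, a multiple of y^(k+n0) in I is y^k times an
    element of I and hence is sent to zero by g.\<close>
  define C where "C j = {r \<in> carrier R. y [^] j \<otimes> r \<in> I}" for j :: nat
  have "ideal (C j) R" for j
    unfolding C_def using fI yn
    by (intro R.ideal_criterion) (auto simp: R.r_distr R.m_lcomm[of "y [^] j"])
  moreover have "C j \<subseteq> C (Suc j)" for j
    using fI(4)[OF y] y by (auto simp: C_def R.m_assoc R.m_comm[of _ y] R.m_lcomm[of _ y])
  ultimately obtain n\<^sub>0 where n\<^sub>0: "\<And>i. i \<ge> n\<^sub>0 \<Longrightarrow> C i = C n\<^sub>0"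
    using ideal_chain[OF R.is_cring noeth, of C] by blast
  define n where "n = k + n\<^sub>0"
  have gn: "g (y [^] n \<otimes> r) = \<zero>\<^bsub>M\<^esub>" if r: "r \<in> carrier R" "y [^] n \<otimes> r \<in> I" for r
  proof -
    have "r \<in> C n\<^sub>0" using n\<^sub>0[of n] r by (auto simp: C_def n_def)
    then have 1: "y [^] n\<^sub>0 \<otimes> r \<in> I" by (simp add: C_def)
    have "y [^] n \<otimes> r = y [^] k \<otimes> (y [^] n\<^sub>0 \<otimes> r)"
      using y r by (simp add: n_def R.nat_pow_mult[symmetric] R.m_assoc)
    then show ?thesis using gD(3)[OF yn 1] gk[OF 1] by simp
  qed
  \<comment> \<open>On I + y^n R the map is g on the first summand and zero on the second; by the
    preceding step the two agree on the intersection.\<close>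
  define J where "J = {x \<in> carrier R. \<exists>a\<in>I. \<exists>r\<in>carrier R. x = a \<oplus> y [^] n \<otimes> r}"
  define c where "c x = (SOME a. a \<in> I \<and> (\<exists>r\<in>carrier R. x = a \<oplus> y [^] n \<otimes> r))" for x
  have c: "c x \<in> I \<and> (\<exists>r\<in>carrier R. x = c x \<oplus> y [^] n \<otimes> r)" if "x \<in> J" for x
  proof -
    have "\<exists>a. a \<in> I \<and> (\<exists>r\<in>carrier R. x = a \<oplus> y [^] n \<otimes> r)" using that by (auto simp: J_def)
    from someI_ex[OF this] show ?thesis unfolding c_def .
  qed
  have J: "a \<oplus> y [^] n \<otimes> r \<in> J" if "a \<in> I" "r \<in> carrier R" for a r
    using that fI(1) yn by (auto simp: J_def)
  have gc: "g (c (a \<oplus> y [^] n \<otimes> r)) = g a" if ar: "a \<in> I" "r \<in> carrier R" for a r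
  proof -
    let ?x = "a \<oplus> y [^] n \<otimes> r"
    obtain r' where r': "c ?x \<in> I" "r' \<in> carrier R" "?x = c ?x \<oplus> y [^] n \<otimes> r'"
      using c[OF J[OF ar]] by blast
    have cl: "c ?x \<in> carrier R" "a \<in> carrier R" using r' ar fI(1) by auto
    have "c ?x \<ominus> a = y [^] n \<otimes> (r \<ominus> r')"
    proof -
      have "a \<oplus> y [^] n \<otimes> r = c ?x \<oplus> y [^] n \<otimes> r'" by (rule r'(3))
      moreover have "c ?x \<oplus> y [^] n \<otimes> r' \<oplus> (\<ominus> a \<ominus> y [^] n \<otimes> r') = c ?x \<ominus> a"
      proof -
        have "c ?x \<oplus> y [^] n \<otimes> r' \<oplus> (\<ominus> a \<oplus> \<ominus> (y [^] n \<otimes> r')) = 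
           (c ?x \<oplus> \<ominus> a) \<oplus> (y [^] n \<otimes> r' \<oplus> \<ominus> (y [^] n \<otimes> r'))"
          using cl r'(2) yn by (simp add: R.a_ac)
        then show ?thesis using cl r'(2) yn by (simp add: a_minus_def R.r_neg)
      qed
      moreover have "a \<oplus> y [^] n \<otimes> r \<oplus> (\<ominus> a \<ominus> y [^] n \<otimes> r') = y [^] n \<otimes> (r \<ominus> r')"
      proof -
        have "a \<oplus> y [^] n \<otimes> r \<oplus> (\<ominus> a \<oplus> \<ominus> (y [^] n \<otimes> r')) = 
           (a \<oplus> \<ominus> a) \<oplus> (y [^] n \<otimes> r \<oplus> \<ominus> (y [^] n \<otimes> r'))"
          using cl r'(2) yn ar by (simp add: R.a_ac)
        then show ?thesis using cl r'(2) yn ar by (simp add: a_minus_def R.r_neg R.r_distr R.r_minus)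
      qed
      ultimately show ?thesis by simp
    qed
    moreover have "c ?x \<ominus> a \<in> I" using fI(6) r' ar by blast
    ultimately have "g (c ?x \<ominus> a) = \<zero>\<^bsub>M\<^esub>" using gn[of "r \<ominus> r'"] ar r' by simp
    moreover have "g (c ?x) = g (c ?x \<ominus> a) \<oplus>\<^bsub>M\<^esub> g a"
      using gD(2)[OF \<open>c ?x \<ominus> a \<in> I\<close> ar(1)] cl by (simp add: a_minus_def R.a_assoc R.l_neg)
    ultimately show ?thesis using gD(1)[OF ar(1)] by simp
  qed
  have idJ: "ideal J R"
  proof (rule R.ideal_criterion)
    show "\<zero> \<in> J" using J[OF fI(2) R.zero_closed] yn by simp
    show "u \<oplus> v \<in> J" if uv: "u \<in> J" "v \<in> J" for u v
    proof -
      obtain a r b s where ar: "a \<in> I" "r \<in> carrier R" "u = a \<oplus> y [^] n \<otimes> r"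
        "b \<in> I" "s \<in> carrier R" "v = b \<oplus> y [^] n \<otimes> s" using uv by (auto simp: J_def)
      have "u \<oplus> v = (a \<oplus> b) \<oplus> y [^] n \<otimes> (r \<oplus> s)"
        using ar fI(1) yn by (simp add: R.r_distr R.a_ac subset_iff)
      then show ?thesis using J[OF fI(3)[OF ar(1,4)] R.a_closed[OF ar(2,5)]] by simp
    qed
    show "t \<otimes> u \<in> J" if u: "t \<in> carrier R" "u \<in> J" for t u
    proof -
      obtain a r where ar: "a \<in> I" "r \<in> carrier R" "u = a \<oplus> y [^] n \<otimes> r" using u by (auto simp: J_def)
      have "t \<otimes> u = t \<otimes> a \<oplus> y [^] n \<otimes> (t \<otimes> r)"
        using ar fI(1) yn u by (simp add: R.r_distr R.m_lcomm subset_iff)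
      then show ?thesis using J[OF fI(4)[OF u(1) ar(1)] R.m_closed[OF u(1) ar(2)]] by simp
    qed
  qed (auto simp: J_def)
  have "module_morphism R (regular_module R\<lparr>carrier := J\<rparr>) M (g \<circ> c)"
    unfolding module_morphism_def
  proof (intro conjI ballI)
    show "g \<circ> c \<in> carrier (regular_module R\<lparr>carrier := J\<rparr>) \<rightarrow> carrier M" using c gD(1) by auto
  next
    fix u v assume "u \<in> carrier (regular_module R\<lparr>carrier := J\<rparr>)" "v \<in> carrier (regular_module R\<lparr>carrier := J\<rparr>)"
    then have uv: "u \<in> J" "v \<in> J" by auto
    obtain a r b s where ar: "a \<in> I" "r \<in> carrier R" "u = a \<oplus> y [^] n \<otimes> r"
      "b \<in> I" "s \<in> carrier R" "v = b \<oplus> y [^] n \<otimes> s" using uv by (auto simp: J_def)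
    have "u \<oplus> v = (a \<oplus> b) \<oplus> y [^] n \<otimes> (r \<oplus> s)"
      using ar fI(1) yn by (simp add: R.r_distr R.a_ac subset_iff)
    then show "(g \<circ> c) (u \<oplus>\<^bsub>regular_module R\<lparr>carrier := J\<rparr>\<^esub> v) = (g \<circ> c) u \<oplus>\<^bsub>M\<^esub> (g \<circ> c) v"
      using gc ar gD(2) fI(3) by simp
  next
    fix t u assume "t \<in> carrier R" "u \<in> carrier (regular_module R\<lparr>carrier := J\<rparr>)"
    then have u: "t \<in> carrier R" "u \<in> J" by auto
    obtain a r where ar: "a \<in> I" "r \<in> carrier R" "u = a \<oplus> y [^] n \<otimes> r" using u by (auto simp: J_def)
    have "t \<otimes> u = t \<otimes> a \<oplus> y [^] n \<otimes> (t \<otimes> r)"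
      using ar fI(1) yn u by (simp add: R.r_distr R.m_lcomm subset_iff)
    then show "(g \<circ> c) (t \<odot>\<^bsub>regular_module R\<lparr>carrier := J\<rparr>\<^esub> u) = t \<odot>\<^bsub>M\<^esub> (g \<circ> c) u"
      using gc ar gD(3) fI(4) u by simp
  qed
  then obtain e where e: "e \<in> carrier M" "\<And>r. r \<in> J \<Longrightarrow> (g \<circ> c) r = r \<odot>\<^bsub>M\<^esub> e"
    using assms(2) idJ unfolding baer_def by meson
  \<comment> \<open>The extended map vanishes at y^n itself, so the element that represents it is
    torsion.\<close>
  have "y [^] n \<odot>\<^bsub>M\<^esub> e = \<zero>\<^bsub>M\<^esub>"
    using e(2)[OF J[OF fI(2) R.one_closed]] gc[OF fI(2) R.one_closed] yn g0 by simp
  then have "e \<in> torsion_part R M y" using e by (auto simp: torsion_part_def)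
  moreover have "g r = r \<odot>\<^bsub>M\<^esub> e" if "r \<in> I" for r
    using e(2)[OF J[OF that R.zero_closed]] gc[OF that R.zero_closed] yn fI(1) that by (simp add: subset_iff)
  ultimately show "\<exists>e\<in>carrier ?E. \<forall>r\<in>I. g r = r \<odot>\<^bsub>?E\<^esub> e" by auto
qed

end

section \<open>Vanishing of cohomology on injective modules\<close>

lemma (in sequence_cohomology) T_minus_closed:
  "\<Phi> \<in> C i \<Longrightarrow> \<Psi> \<in> C i \<Longrightarrow> \<Phi> \<ominus>\<^bsub>T\<^esub> \<Psi> \<in> C i"
  using T.submodule_facts(5)[OF submodule_cochains] by blast

text \<open>Induction on the generators. The limit complex for \<open>y # xs\<close> is the cone of
  the map from the complex for \<open>xs\<close> over E to the one over E_y. As E maps onto E_y, the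
  marked part of a cocycle can be removed by a coboundary; what remains has values in the y-torsion
  of E, again a module with Baer's property.\<close>

lemma baer_cohomology_zero:
  fixes R :: "('a, 'k) ring_scheme" and E :: "('a, 'b) module"
  assumes "noetherian_ring R" "module R E" "baer R E" "set xs \<subseteq> carrier R" "i > 0"
  shows "cohomology_zero R E xs i"
  using assms(2-5)
proof (induction xs arbitrary: E)
  case Nil
  then interpret sequence_cohomology R E "[]" by (intro sequence_cohomologyI) auto
  show ?case using cohomology_zero_above[of i] Nil by simp
next
  case (Cons y xs)
  interpret Y: sequence_cohomology R E "y # xs" by (intro sequence_cohomologyI) (use Cons in auto)
  interpret X: sequence_cohomology R E xs by (intro sequence_cohomologyI) (use Cons in auto)
  have y: "y \<in> carrier R" and xs: "set xs \<subseteq> carrier R" using Cons.prems by auto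
  have yn: "y [^]\<^bsub>R\<^esub> n \<in> carrier R" for n :: nat using y by simp
  let ?E = "E\<lparr>carrier := torsion_part R E y\<rparr>"
  have sE: "submodule (torsion_part R E y) R E" by (rule Y.submodule_torsion_part[OF y])
  have Ey: "module R ?E" by (rule Y.submodule_restrict_module[OF sE])
  have incl: "module_morphism R ?E E (\<lambda>x. x)"
    using Y.submodule_facts(1)[OF sE] by (auto simp: module_morphism_def)
  interpret T: sequence_cohomology R ?E xs by (intro sequence_cohomologyI Ey xs)
  have d_incl: "koszul_d R E t xs \<phi> \<sigma> = koszul_d R ?E t xs \<phi> \<sigma>"
    if "\<And>\<sigma>. \<phi> \<sigma> \<in> torsion_part R E y" for t \<phi> \<sigma>
    using T.koszul_d_morphism[OF Cons.prems(1) incl xs, of \<phi>] that by simp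
  obtain k :: nat where k:
    "\<And>s u. u \<in> carrier E \<Longrightarrow> \<exists>e\<in>carrier E. y [^]\<^bsub>R\<^esub> (s + k) \<odot>\<^bsub>E\<^esub> e = y [^]\<^bsub>R\<^esub> k \<odot>\<^bsub>E\<^esub> u"
    using Y.baer_divisible[OF assms(1) Cons.prems(2) y] by blast
  show ?case unfolding cohomology_zero_def
  proof
    fix \<Phi> assume \<Phi>Z: "\<Phi> \<in> Y.Z i"
    then have \<Phi>: "\<Phi> \<in> Y.C i" by (simp add: cocycles_def)
    obtain t\<^sub>0 where t\<^sub>0: "\<And>t. t \<ge> t\<^sub>0 \<Longrightarrow> \<Phi> (Suc t) = (\<lambda>\<sigma>. monomial_of R (y # xs) \<sigma> \<odot>\<^bsub>E\<^esub> \<Phi> t \<sigma>)"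
      using Y.cochains_eventually[OF \<Phi>] by (auto simp: eventually_sequentially)
    \<comment> \<open>Advancing k stages multiplies a coefficient marked at y by y^k, so at stage s
      = \<open>t\<^sub>0\<close> + k the marked part is y^k w. This is the kind of element that
      divisibility can rewrite as y^s e.\<close>
    define w where "w \<sigma> = (monomial_of R xs \<sigma> [^]\<^bsub>R\<^esub> k) \<odot>\<^bsub>E\<^esub> \<Phi> t\<^sub>0 (True # \<sigma>)" for \<sigma>
    have w: "w \<sigma> \<in> carrier E" for \<sigma> using Y.cochains_closed[OF \<Phi>] by (simp add: w_def)
    define s where "s = t\<^sub>0 + k"
    have \<Phi>s: "\<Phi> s (True # \<sigma>) = y [^]\<^bsub>R\<^esub> k \<odot>\<^bsub>E\<^esub> w \<sigma>" for \<sigma>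
    proof -
      have "\<Phi> s = Y.propagate t\<^sub>0 (\<Phi> t\<^sub>0) s"
        by (rule Y.cochain_eq_propagate[OF \<Phi> t\<^sub>0]) (auto simp: s_def)
      then have "\<Phi> s (True # \<sigma>) = (y \<otimes>\<^bsub>R\<^esub> monomial_of R xs \<sigma>) [^]\<^bsub>R\<^esub> k \<odot>\<^bsub>E\<^esub> \<Phi> t\<^sub>0 (True # \<sigma>)"
        by (simp add: Y.propagate_def s_def)
      then show ?thesis using y X.mon_closed Y.cochains_closed[OF \<Phi>]
        by (simp add: w_def Y.R.nat_pow_distrib Y.smult_assoc1)
    qed
    \<comment> \<open>The last conjunct keeps the correction in degree i - 1.\<close>
    have ex: "\<exists>e. e \<in> carrier E \<and> y [^]\<^bsub>R\<^esub> s \<odot>\<^bsub>E\<^esub> e = y [^]\<^bsub>R\<^esub> k \<odot>\<^bsub>E\<^esub> w \<sigma> \<and> (w \<sigma> = \<zero>\<^bsub>E\<^esub> \<longrightarrow> e = \<zero>\<^bsub>E\<^esub>)" for \<sigma>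
    proof (cases "w \<sigma> = \<zero>\<^bsub>E\<^esub>")
      case True
      then show ?thesis using yn by (intro exI[of _ "\<zero>\<^bsub>E\<^esub>"]) auto
    next
      case False
      then show ?thesis using k[OF w[of \<sigma>], of t\<^sub>0] by (auto simp: s_def)
    qed
    then obtain e where e: "\<And>\<sigma>. e \<sigma> \<in> carrier E" "\<And>\<sigma>. y [^]\<^bsub>R\<^esub> s \<odot>\<^bsub>E\<^esub> e \<sigma> = y [^]\<^bsub>R\<^esub> k \<odot>\<^bsub>E\<^esub> w \<sigma>"
      "\<And>\<sigma>. w \<sigma> = \<zero>\<^bsub>E\<^esub> \<Longrightarrow> e \<sigma> = \<zero>\<^bsub>E\<^esub>" by metis
    \<comment> \<open>The inclusion of the summand without a mark at y. Its coboundary has marked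
      part y^t f, which is chosen to equal the marked part of the cocycle.\<close>
    define extend :: "(bool list \<Rightarrow> 'b) \<Rightarrow> bool list \<Rightarrow> 'b" where
      "extend f \<tau> = (case \<tau> of [] \<Rightarrow> \<zero>\<^bsub>E\<^esub> | b # \<sigma> \<Rightarrow> if b then \<zero>\<^bsub>E\<^esub> else f \<sigma>)" for f \<tau>
    have extend_simps: "extend f (False # \<sigma>) = f \<sigma>" "extend f (True # \<sigma>) = \<zero>\<^bsub>E\<^esub>" "extend f [] = \<zero>\<^bsub>E\<^esub>" for f \<sigma>
      by (auto simp: extend_def)
    have extend_closed: "extend f \<tau> \<in> carrier E" if "\<And>\<sigma>. f \<sigma> \<in> carrier E" for f \<tau>
      using that by (auto simp: extend_def split: list.splits)
    have d_extend: "koszul_d R E t (y # xs) (extend f) (False # \<sigma>) = koszul_d R E t xs f \<sigma>"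
      "koszul_d R E t (y # xs) (extend f) (True # \<sigma>) = y [^]\<^bsub>R\<^esub> t \<odot>\<^bsub>E\<^esub> f \<sigma>"
      if "\<And>\<sigma>. f \<sigma> \<in> carrier E" for f t \<sigma>
      using that yn Y.koszul_d_zero[OF xs] by (simp_all add: extend_simps a_minus_def)
    define \<Psi> where "\<Psi> = Y.propagate s (extend e)"
    have \<Psi>: "\<Psi> \<in> Y.C (i - 1)"
      unfolding \<Psi>_def
    proof (rule Y.propagate_cochains)
      fix \<tau> assume *: "length \<tau> \<noteq> length (y # xs) \<or> int (count_list \<tau> True) \<noteq> i - 1"
      show "extend e \<tau> = \<zero>\<^bsub>E\<^esub>"
      proof (cases \<tau>)
        case [simp]: (Cons b \<sigma>)
        show ?thesis
        proof (cases b)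
          case False
          then have "\<Phi> t\<^sub>0 (True # \<sigma>) = \<zero>\<^bsub>E\<^esub>"
            using * by (intro Y.cochains_support[OF \<Phi>]) auto
          then have "e \<sigma> = \<zero>\<^bsub>E\<^esub>" using e(3) xs by (simp add: w_def)
          then show ?thesis using False by (simp add: extend_simps)
        qed (simp add: extend_simps)
      qed (simp add: extend_simps)
    qed (use extend_closed e in auto)
    have d\<Psi>: "Y.\<delta> \<Psi> \<in> Y.C i" using Y.cobdry_cochains[OF \<Psi>] by simp
    have d\<Psi>B: "Y.\<delta> \<Psi> \<in> Y.B i" using d\<Psi> \<Psi> by (auto simp: coboundaries_def intro!: bexI[of _ \<Psi>])
    define X where "X = \<Phi> \<ominus>\<^bsub>Y.T\<^esub> Y.\<delta> \<Psi>"
    have XZ: "X \<in> Y.Z i"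
      unfolding X_def using Y.T.submodule_facts(5)[OF Y.submodule_cocycles \<Phi>Z] d\<Psi>B
        Y.coboundaries_subset_cocycles by blast
    then have XC: "X \<in> Y.C i" by (simp add: cocycles_def)
    have X_eq: "X t \<tau> = \<Phi> t \<tau> \<ominus>\<^bsub>E\<^esub> Y.\<delta> \<Psi> t \<tau>" for t \<tau>
      unfolding X_def Y.T_minus[OF Y.cochains_closed[OF \<Phi>] Y.cochains_closed[OF d\<Psi>]] ..
    have X_True: "X t (True # \<sigma>) = \<zero>\<^bsub>E\<^esub>" if "t \<ge> s" for t \<sigma>
    proof -
      have "\<Phi> t = Y.propagate s (\<Phi> s) t"
        by (rule Y.cochain_eq_propagate[OF \<Phi> _ that]) (use t\<^sub>0 s_def in auto)
      moreover have "Y.\<delta> \<Psi> t = Y.propagate s (koszul_d R E s (y # xs) (extend e)) t"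
        unfolding \<Psi>_def by (rule Y.cobdry_propagate[OF extend_closed[OF e(1)] that])
      moreover have "koszul_d R E s (y # xs) (extend e) (True # \<sigma>) = \<Phi> s (True # \<sigma>)"
        using d_extend(2)[OF e(1)] e(2) \<Phi>s by simp
      ultimately have "Y.\<delta> \<Psi> t (True # \<sigma>) = \<Phi> t (True # \<sigma>)" by (simp add: Y.propagate_def)
      then show ?thesis using Y.cochains_closed[OF \<Phi>] by (simp add: X_eq a_minus_def Y.M.r_neg)
    qed
    have "\<forall>\<^sub>F t in sequentially. t \<ge> s \<and> X (Suc t) = (\<lambda>\<sigma>. monomial_of R (y # xs) \<sigma> \<odot>\<^bsub>E\<^esub> X t \<sigma>) \<and>
        Y.\<delta> X t = (\<lambda>_. \<zero>\<^bsub>E\<^esub>)"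
      using Y.cochains_eventually[OF XC] XZ eventually_ge_at_top[of s]
      by (auto simp: cocycles_def eventually_conj_iff)
    then obtain t\<^sub>1 where t\<^sub>1: "\<And>t. t \<ge> t\<^sub>1 \<Longrightarrow> t \<ge> s"
      "\<And>t. t \<ge> t\<^sub>1 \<Longrightarrow> X (Suc t) = (\<lambda>\<sigma>. monomial_of R (y # xs) \<sigma> \<odot>\<^bsub>E\<^esub> X t \<sigma>)"
      "\<And>t. t \<ge> t\<^sub>1 \<Longrightarrow> Y.\<delta> X t = (\<lambda>_. \<zero>\<^bsub>E\<^esub>)" by (auto simp: eventually_sequentially)
    \<comment> \<open>The stages before \<open>t\<^sub>1\<close> are reset to zero because torsion
      values are required at every stage, not just eventually.\<close>
    define \<phi> where "\<phi> t \<sigma> = (if t \<ge> t\<^sub>1 then X t (False # \<sigma>) else \<zero>\<^bsub>E\<^esub>)" for t \<sigma>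
    \<comment> \<open>The marked part of X is zero, so closedness of X in that component says that
      y^t kills the unmarked part.\<close>
    have \<phi>_tors: "\<phi> t \<sigma> \<in> torsion_part R E y" for t \<sigma>
    proof (cases "t \<ge> t\<^sub>1")
      case True
      have "koszul_d R E t (y # xs) (X t) (True # \<sigma>) = \<zero>\<^bsub>E\<^esub>"
        using fun_cong[OF t\<^sub>1(3)[OF True]] by (simp only: cobdry_def)
      then have "y [^]\<^bsub>R\<^esub> t \<odot>\<^bsub>E\<^esub> X t (False # \<sigma>) = \<zero>\<^bsub>E\<^esub>"
        using X_True[OF t\<^sub>1(1)[OF True]] Y.koszul_d_zero[OF xs] yn Y.cochains_closed[OF XC]
        by (simp add: a_minus_def)
      then show ?thesis using True Y.cochains_closed[OF XC] by (auto simp: \<phi>_def torsion_part_def)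
    next
      case False
      then show ?thesis using Y.submodule_facts(2)[OF sE] by (simp add: \<phi>_def)
    qed
    have \<phi>C: "\<phi> \<in> T.C i"
    proof -
      have "\<forall>\<^sub>F t in sequentially. \<phi> (Suc t) = (\<lambda>\<sigma>. monomial_of R xs \<sigma> \<odot>\<^bsub>?E\<^esub> \<phi> t \<sigma>)"
        using eventually_ge_at_top[of t\<^sub>1]
        by eventually_elim (auto simp: \<phi>_def t\<^sub>1(2) fun_eq_iff)
      moreover have "\<phi> t \<sigma> = \<zero>\<^bsub>E\<^esub>" if "length \<sigma> \<noteq> length xs \<or> int (count_list \<sigma> True) \<noteq> i" for t \<sigma>
        unfolding \<phi>_def using Y.cochains_support[OF XC, of "False # \<sigma>"] that by auto
      ultimately show ?thesis using \<phi>_tors by (auto simp: cochains_def)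
    qed
    have "\<forall>\<^sub>F t in sequentially. T.\<delta> \<phi> t = (\<lambda>_. \<zero>\<^bsub>?E\<^esub>)"
      using eventually_ge_at_top[of t\<^sub>1]
    proof eventually_elim
      case (elim t)
      have "koszul_d R ?E t xs (\<phi> t) \<sigma> = \<zero>\<^bsub>E\<^esub>" for \<sigma>
      proof -
        have "koszul_d R E t (y # xs) (X t) (False # \<sigma>) = \<zero>\<^bsub>E\<^esub>"
          using fun_cong[OF t\<^sub>1(3)[OF elim]] by (simp only: cobdry_def)
        moreover have "\<phi> t = (\<lambda>\<sigma>. X t (False # \<sigma>))" using elim by (auto simp: \<phi>_def)
        moreover have "koszul_d R E t xs (\<phi> t) \<sigma> = koszul_d R ?E t xs (\<phi> t) \<sigma>"
          by (rule d_incl) (rule \<phi>_tors)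
        ultimately show ?thesis by simp
      qed
      then show ?case by (auto simp: cobdry_def)
    qed
    then have "\<phi> \<in> T.Z i" using \<phi>C by (simp add: cocycles_def)
    moreover have "cohomology_zero R ?E xs i"
      using Cons.IH[OF Ey Y.baer_torsion_part[OF assms(1) Cons.prems(2) y] xs \<open>i > 0\<close>] .
    ultimately have "\<phi> \<in> T.B i" by (auto simp: cohomology_zero_def)
    then obtain \<psi> where \<psi>: "\<psi> \<in> T.C (i - 1)" "\<forall>\<^sub>F t in sequentially. \<phi> t = T.\<delta> \<psi> t"
      by (auto simp: coboundaries_def)
    have \<psi>_tors: "\<psi> t \<sigma> \<in> torsion_part R E y" for t \<sigma> using T.cochains_closed[OF \<psi>(1)] by simp
    have \<psi>_closed: "\<psi> t \<sigma> \<in> carrier E" for t \<sigma> using \<psi>_tors by (simp add: torsion_part_def)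
    obtain t\<^sub>2 where t\<^sub>2: "\<And>t. t \<ge> t\<^sub>2 \<Longrightarrow> \<psi> (Suc t) = (\<lambda>\<sigma>. monomial_of R xs \<sigma> \<odot>\<^bsub>?E\<^esub> \<psi> t \<sigma>)"
      using T.cochains_eventually[OF \<psi>(1)] by (auto simp: eventually_sequentially)
    have "\<forall>\<sigma>. \<exists>n::nat. y [^]\<^bsub>R\<^esub> n \<odot>\<^bsub>E\<^esub> \<psi> t\<^sub>2 \<sigma> = \<zero>\<^bsub>E\<^esub>" using \<psi>_tors by (simp add: torsion_part_def)
    then obtain n where n: "\<And>\<sigma>. y [^]\<^bsub>R\<^esub> (n \<sigma> :: nat) \<odot>\<^bsub>E\<^esub> \<psi> t\<^sub>2 \<sigma> = \<zero>\<^bsub>E\<^esub>" by metis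
    define L where "L = {\<sigma> :: bool list. length \<sigma> = length xs}"
    have finL: "finite L" unfolding L_def using finite_lists_length_eq[of "UNIV :: bool set"] by simp
    \<comment> \<open>Only finitely many lists have the right length, so one power of y kills all
      values of the primitive at stage \<open>t\<^sub>2\<close>, and then at all later
      stages.\<close>
    define K where "K = Max (insert 0 (n ` L))"
    have K: "y [^]\<^bsub>R\<^esub> t \<odot>\<^bsub>E\<^esub> \<psi> t\<^sub>2 \<sigma> = \<zero>\<^bsub>E\<^esub>" if "t \<ge> K" for t \<sigma>
    proof (cases "\<sigma> \<in> L")
      case True
      then have "n \<sigma> \<le> K" unfolding K_def using finL by (intro Max_ge) auto
      then show ?thesis using Y.pow_kills_mono[OF y \<psi>_closed n] that by auto
    next
      case False
      then show ?thesis using T.cochains_support[OF \<psi>(1)] yn by (simp add: L_def)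
    qed
    have y\<psi>: "y [^]\<^bsub>R\<^esub> t \<odot>\<^bsub>E\<^esub> \<psi> t \<sigma> = \<zero>\<^bsub>E\<^esub>" if "t \<ge> K" "t \<ge> t\<^sub>2" for t \<sigma>
    proof -
      have "\<psi> t \<sigma> = monomial_of R xs \<sigma> [^]\<^bsub>R\<^esub> (t - t\<^sub>2) \<odot>\<^bsub>E\<^esub> \<psi> t\<^sub>2 \<sigma>"
        using fun_cong[OF T.cochain_eq_propagate[OF \<psi>(1) t\<^sub>2 that(2)], of \<sigma>] that by (simp add: T.propagate_def)
      then show ?thesis
        using K[OF that(1)] yn \<psi>_closed Y.smult_commute[of "y [^]\<^bsub>R\<^esub> t" "monomial_of R xs \<sigma> [^]\<^bsub>R\<^esub> (t - t\<^sub>2)" "\<psi> t\<^sub>2 \<sigma>"]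
        by simp
    qed
    \<comment> \<open>For stages t beyond K the factor y^t kills the primitive, so its extension
      contributes nothing to the marked part of the coboundary.\<close>
    define \<Psi>' where "\<Psi>' t = extend (\<psi> t)" for t
    have \<Psi>': "\<Psi>' \<in> Y.C (i - 1)"
    proof -
      have "\<forall>\<^sub>F t in sequentially. \<Psi>' (Suc t) = (\<lambda>\<sigma>. monomial_of R (y # xs) \<sigma> \<odot>\<^bsub>E\<^esub> \<Psi>' t \<sigma>)"
        using eventually_ge_at_top[of t\<^sub>2]
      proof eventually_elim
        case (elim t)
        show ?case
        proof
          fix \<tau>
          show "\<Psi>' (Suc t) \<tau> = monomial_of R (y # xs) \<tau> \<odot>\<^bsub>E\<^esub> \<Psi>' t \<tau>"
            using fun_cong[OF t\<^sub>2[OF elim]] y xs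
            by (cases \<tau>; cases "hd \<tau>") (auto simp: \<Psi>'_def extend_simps)
        qed
      qed
      moreover have "\<Psi>' t \<tau> = \<zero>\<^bsub>E\<^esub>" if "length \<tau> \<noteq> length (y # xs) \<or> int (count_list \<tau> True) \<noteq> i - 1" for t \<tau>
        using that T.cochains_support[OF \<psi>(1)]
        by (cases \<tau>; cases "hd \<tau>") (auto simp: \<Psi>'_def extend_simps)
      moreover have "\<Psi>' t \<tau> \<in> carrier E" for t \<tau>
        unfolding \<Psi>'_def by (rule extend_closed) (rule \<psi>_closed)
      ultimately show ?thesis by (auto simp: cochains_def)
    qed
    have "\<forall>\<^sub>F t in sequentially. X t = Y.\<delta> \<Psi>' t"
      using \<psi>(2) eventually_ge_at_top[of "max (max K t\<^sub>2) t\<^sub>1"]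
    proof eventually_elim
      case (elim t)
      show ?case
      proof
        fix \<tau>
        show "X t \<tau> = Y.\<delta> \<Psi>' t \<tau>"
        proof (cases \<tau>)
          case Nil
          then show ?thesis using Y.cochains_support[OF XC] by (simp add: cobdry_def)
        next
          case (Cons b \<sigma>)
          show ?thesis
          proof (cases b)
            case True
            have "Y.\<delta> \<Psi>' t \<tau> = \<zero>\<^bsub>E\<^esub>"
              unfolding cobdry_def \<Psi>'_def Cons using d_extend(2)[OF \<psi>_closed] y\<psi> elim(2) True by simp
            then show ?thesis using X_True t\<^sub>1(1) elim Cons True by simp
          next
            case False
            have "X t \<tau> = \<phi> t \<sigma>" using elim(2) Cons False by (simp add: \<phi>_def)
            also have "\<dots> = koszul_d R ?E t xs (\<psi> t) \<sigma>" using elim(1) by (simp add: cobdry_def)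
            also have "\<dots> = koszul_d R E t xs (\<psi> t) \<sigma>"
              by (rule d_incl[symmetric]) (rule \<psi>_tors)
            also have "\<dots> = Y.\<delta> \<Psi>' t \<tau>"
              unfolding cobdry_def \<Psi>'_def Cons using d_extend(1)[OF \<psi>_closed] False by simp
            finally show ?thesis .
          qed
        qed
      qed
    qed
    then have "X \<in> Y.B i" using XC \<Psi>' by (auto simp: coboundaries_def)
    then have "X \<oplus>\<^bsub>Y.T\<^esub> Y.\<delta> \<Psi> \<in> Y.B i" using Y.T.submodule_facts(3)[OF Y.submodule_coboundaries] d\<Psi>B by blast
    moreover have "X \<oplus>\<^bsub>Y.T\<^esub> Y.\<delta> \<Psi> = \<Phi>"
      using Y.cochains_closed[OF \<Phi>] Y.cochains_closed[OF d\<Psi>]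
      by (simp add: X_eq a_minus_def Y.M.a_assoc Y.M.l_neg)
    ultimately show "\<Phi> \<in> Y.B i" by simp
  qed
qed

section \<open>Complexes of modules\<close>

lemma is_complexD:
  assumes "is_complex R X"
  shows "module R (obj X i)" "module_morphism R (obj X i) (obj X (i - 1)) (bdry X i)"
    "module_morphism R (obj X (i + 1)) (obj X i) (bdry X (i + 1))"
    "x \<in> carrier (obj X (i + 1)) \<Longrightarrow> bdry X i (bdry X (i + 1) x) = \<zero>\<^bsub>obj X (i - 1)\<^esub>"
proof -
  show "module R (obj X i)" "module_morphism R (obj X i) (obj X (i - 1)) (bdry X i)"
    using assms by (auto simp: is_complex_def)
  have "module_morphism R (obj X (i + 1)) (obj X (i + 1 - 1)) (bdry X (i + 1))"
    using assms unfolding is_complex_def by blast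
  then show "module_morphism R (obj X (i + 1)) (obj X i) (bdry X (i + 1))" by simp
  assume "x \<in> carrier (obj X (i + 1))"
  then have "bdry X (i + 1 - 1) (bdry X (i + 1) x) = \<zero>\<^bsub>obj X (i + 1 - 2)\<^esub>"
    using assms unfolding is_complex_def by blast
  then show "bdry X i (bdry X (i + 1) x) = \<zero>\<^bsub>obj X (i - 1)\<^esub>" by simp
qed

lemma submodule_cycles:
  assumes "is_complex R X"
  shows "submodule (cycles X i) R (obj X i)"
proof -
  note X = is_complexD[OF assms]
  interpret N: module R "obj X i" by (rule X)
  interpret N': module R "obj X (i - 1)" by (rule X)
  show ?thesis
    using module_morphismD[OF X(2)] module_morphism_zero[OF X(1) X(1) X(2)]
    by (intro N.submodule_criterion) (auto simp: cycles_def)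
qed

lemma submodule_boundaries:
  assumes "is_complex R X"
  shows "submodule (boundaries X i) R (obj X i)"
proof -
  note X = is_complexD[OF assms]
  interpret N: module R "obj X i" by (rule X)
  interpret N': module R "obj X (i + 1)" by (rule X)
  note d = module_morphismD[OF X(3)[of i]]
  show ?thesis
  proof (rule N.submodule_criterion)
    show "\<zero>\<^bsub>obj X i\<^esub> \<in> boundaries X i"
      unfolding boundaries_def using module_morphism_zero[OF X(1) X(1) X(3)[of i]] 
      by (intro image_eqI[of _ _ "\<zero>\<^bsub>obj X (i + 1)\<^esub>"]) auto
    show "a \<oplus>\<^bsub>obj X i\<^esub> b \<in> boundaries X i" if "a \<in> boundaries X i" "b \<in> boundaries X i" for a b
    proof -
      obtain u v where "u \<in> carrier (obj X (i + 1))" "v \<in> carrier (obj X (i + 1))"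
        "a = bdry X (i + 1) u" "b = bdry X (i + 1) v" using \<open>a \<in> _\<close> \<open>b \<in> _\<close> by (auto simp: boundaries_def)
      then show ?thesis unfolding boundaries_def
        using d(2)[of u v] by (intro image_eqI[of _ _ "u \<oplus>\<^bsub>obj X (i + 1)\<^esub> v"]) auto
    qed
    show "r \<odot>\<^bsub>obj X i\<^esub> a \<in> boundaries X i" if "r \<in> carrier R" "a \<in> boundaries X i" for r a
    proof -
      obtain u where "u \<in> carrier (obj X (i + 1))" "a = bdry X (i + 1) u"
        using \<open>a \<in> _\<close> by (auto simp: boundaries_def)
      then show ?thesis unfolding boundaries_def
        using d(3)[of r u] \<open>r \<in> _\<close> by (intro image_eqI[of _ _ "r \<odot>\<^bsub>obj X (i + 1)\<^esub> u"]) auto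
    qed
  qed (use d(1) in \<open>auto simp: boundaries_def\<close>)
qed

lemma boundaries_subset_cycles: "is_complex R X \<Longrightarrow> boundaries X i \<subseteq> cycles X i"
  using is_complexD(4) module_morphismD(1)[OF is_complexD(3)] by (force simp: boundaries_def cycles_def)

lemma short_exact_cycles_boundaries:
  assumes "is_complex R X"
  shows "short_exact R (obj X (i + 1)\<lparr>carrier := cycles X (i + 1)\<rparr>) (obj X (i + 1))
    (obj X i\<lparr>carrier := boundaries X i\<rparr>) (\<lambda>x. x) (bdry X (i + 1))"
proof -
  note X = is_complexD[OF assms]
  have "module R (obj X (i + 1)\<lparr>carrier := cycles X (i + 1)\<rparr>)"
    "module R (obj X i\<lparr>carrier := boundaries X i\<rparr>)"
    using module.submodule_restrict_module[OF X(1)] submodule_cycles[OF assms]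
      submodule_boundaries[OF assms] by blast+
  then show ?thesis
    unfolding short_exact_def using X(1) module_morphismD[OF X(3)[of i]]
    by (auto simp: module_morphism_def cycles_def boundaries_def)
qed

text \<open>An isomorphism is the right-hand map of a short exact sequence with zero kernel, so the
  long exact sequence transports vanishing against its direction without an inverse.\<close>

lemma cohomology_zero_iso:
  assumes "module R M" "module R N" "module_iso R M N" "set xs \<subseteq> carrier R" "cohomology_zero R N xs i"
  shows "cohomology_zero R M xs i"
proof -
  interpret M: sequence_cohomology R M xs by (rule sequence_cohomologyI) fact+
  obtain f where f: "module_morphism R M N f" "bij_betw f (carrier M) (carrier N)"
    using assms(3) by (auto simp: module_iso_def)
  let ?L = "M\<lparr>carrier := {\<zero>\<^bsub>M\<^esub>}\<rparr>"
  have L: "module R ?L" by (rule M.submodule_restrict_module[OF M.submodule_zero])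
  have f0: "f \<zero>\<^bsub>M\<^esub> = \<zero>\<^bsub>N\<^esub>" by (rule module_morphism_zero[OF assms(1,2) f(1)])
  have "x = \<zero>\<^bsub>M\<^esub>" if "x \<in> carrier M" "f x = \<zero>\<^bsub>N\<^esub>" for x
    using that f(2) f0 M.M.zero_closed unfolding bij_betw_def inj_on_def by metis
  then have "short_exact R ?L M N (\<lambda>x. x) f"
    unfolding short_exact_def using assms(1,2) L f f0
    by (auto simp: module_morphism_def bij_betw_def)
  then interpret long_exact R ?L M N "\<lambda>x. x" f xs using assms(4) by unfold_locales
  show ?thesis
    by (rule cohomology_zero_middle[OF L.cohomology_zero_trivial assms(5)]) simp
qed

lemma G_injective_cohomology_zero:
  fixes R :: "('a, 'k) ring_scheme" and G :: "('a, 'b) module"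
  assumes "noetherian_ring R" "G_injective R G" "set xs \<subseteq> carrier R" "i > 0"
  shows "cohomology_zero R G xs i"
proof -
  obtain C :: "('a, 'b) rcomplex" where C: "exact_complex R C" "\<And>i. injective_module R (obj C i)"
    "module_iso R G (kernel_module C 0)" and G: "module R G"
    using assms(2) by (auto simp: G_injective_def)
  have cC: "is_complex R C" and ex: "\<And>i. cycles C i = boundaries C i"
    using C(1) by (auto simp: exact_complex_def)
  have acyclic: "cohomology_zero R (obj C j) xs i" if "i > 0" for i j
    using baer_cohomology_zero[OF assms(1) is_complexD(1)[OF cC] injective_module_baer[OF C(2)] assms(3) that] .
  \<comment> \<open>The index n measures the distance below the number of generators. All kernels j
    are treated together, since each shift raises the degree and moves to the next kernel.\<close>
  have "cohomology_zero R (kernel_module C j) xs i" if "i > 0" "i > int (length xs) - int n" for n i j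
    using that
  proof (induction n arbitrary: i j)
    case 0
    interpret sequence_cohomology R "kernel_module C j" xs
      unfolding kernel_module_def
      by (rule sequence_cohomologyI[OF module.submodule_restrict_module[OF is_complexD(1)[OF cC]
            submodule_cycles[OF cC]] assms(3)])
    show ?case using cohomology_zero_above 0 by simp
  next
    case (Suc n)
    interpret long_exact R "kernel_module C (j + 1)" "obj C (j + 1)" "kernel_module C j" "\<lambda>x. x" "bdry C (j + 1)" xs
      using short_exact_cycles_boundaries[OF cC, of j] assms(3) ex
      by unfold_locales (simp_all add: kernel_module_def)
    show ?case
      by (rule cohomology_zero_right[OF acyclic Suc.IH]) (use Suc.prems in auto)
  qed
  from this[of i "length xs" 0] have "cohomology_zero R (kernel_module C 0) xs i" using assms(4) by simp
  moreover have "module R (kernel_module C 0)"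
    unfolding kernel_module_def
    by (rule module.submodule_restrict_module[OF is_complexD(1)[OF cC] submodule_cycles[OF cC]])
  ultimately show ?thesis using cohomology_zero_iso[OF G _ C(3) assms(3)] by blast
qed


section \<open>Quasi-isomorphisms\<close>

lemma coset_eq_iff:
  assumes "module R M" "submodule N R M" "x \<in> carrier M" "y \<in> carrier M"
  shows "N +>\<^bsub>M\<^esub> x = N +>\<^bsub>M\<^esub> y \<longleftrightarrow> x \<ominus>\<^bsub>M\<^esub> y \<in> N"
proof -
  interpret module R M by fact
  note N = submodule_facts[OF assms(2)]
  have mem: "z \<in> N +>\<^bsub>M\<^esub> x \<longleftrightarrow> z \<in> carrier M \<and> z \<ominus>\<^bsub>M\<^esub> x \<in> N" if "x \<in> carrier M" for x z
  proof
    assume "z \<in> N +>\<^bsub>M\<^esub> x"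
    then obtain n where "n \<in> N" "z = n \<oplus>\<^bsub>M\<^esub> x" by (auto simp: a_r_coset_def')
    then show "z \<in> carrier M \<and> z \<ominus>\<^bsub>M\<^esub> x \<in> N"
      using N(1) that by (auto simp: a_minus_def M.a_assoc M.r_neg subset_iff)
  next
    assume z: "z \<in> carrier M \<and> z \<ominus>\<^bsub>M\<^esub> x \<in> N"
    then have "z = (z \<ominus>\<^bsub>M\<^esub> x) \<oplus>\<^bsub>M\<^esub> x" using that by (simp add: a_minus_def M.a_assoc M.l_neg)
    then show "z \<in> N +>\<^bsub>M\<^esub> x" using z by (auto simp: a_r_coset_def')
  qed
  have comp: "(a \<ominus>\<^bsub>M\<^esub> b) \<oplus>\<^bsub>M\<^esub> (b \<ominus>\<^bsub>M\<^esub> c) = a \<ominus>\<^bsub>M\<^esub> c" if "a \<in> carrier M" "b \<in> carrier M" "c \<in> carrier M" for a b c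
    using that by (simp add: a_minus_def M.a_assoc M.r_neg1)
  have swap: "\<ominus>\<^bsub>M\<^esub> (a \<ominus>\<^bsub>M\<^esub> b) = b \<ominus>\<^bsub>M\<^esub> a" if "a \<in> carrier M" "b \<in> carrier M" for a b
    using that by (simp add: a_minus_def M.minus_add M.a_comm)
  show ?thesis
  proof
    assume e: "N +>\<^bsub>M\<^esub> x = N +>\<^bsub>M\<^esub> y"
    have "x \<in> N +>\<^bsub>M\<^esub> x" using mem[OF assms(3)] assms(3) N(2) by (simp add: a_minus_def M.r_neg)
    then show "x \<ominus>\<^bsub>M\<^esub> y \<in> N" using e mem[OF assms(4)] by simp
  next
    assume d: "x \<ominus>\<^bsub>M\<^esub> y \<in> N"
    have d': "y \<ominus>\<^bsub>M\<^esub> x \<in> N" using N(6)[OF d] swap assms by simp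
    have "z \<ominus>\<^bsub>M\<^esub> x \<in> N \<longleftrightarrow> z \<ominus>\<^bsub>M\<^esub> y \<in> N" if "z \<in> carrier M" for z
      using N(3)[OF _ d, of "z \<ominus>\<^bsub>M\<^esub> x"] N(3)[OF _ d', of "z \<ominus>\<^bsub>M\<^esub> y"] comp[OF that assms(3,4)] comp[OF that assms(4,3)]
      by auto
    then show "N +>\<^bsub>M\<^esub> x = N +>\<^bsub>M\<^esub> y" using mem assms by blast
  qed
qed

lemma chain_mapD:
  assumes "is_complex R X" "is_complex R Y" "chain_map R X Y f"
  shows "module_morphism R (obj X i) (obj Y i) (f i)"
    "z \<in> cycles X i \<Longrightarrow> f i z \<in> cycles Y i" "z \<in> boundaries X i \<Longrightarrow> f i z \<in> boundaries Y i"
proof -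
  show f: "module_morphism R (obj X i) (obj Y i) (f i)" for i using assms(3) by (auto simp: chain_map_def)
  have c: "bdry Y i (f i x) = f (i - 1) (bdry X i x)" if "x \<in> carrier (obj X i)" for x i
    using assms(3) that by (auto simp: chain_map_def)
  show "f i z \<in> cycles Y i" if "z \<in> cycles X i"
    using that c[of z i] module_morphismD(1)[OF f[of i]] module_morphism_zero[OF is_complexD(1)[OF assms(1)]
      is_complexD(1)[OF assms(2)] f[of "i - 1"]] by (auto simp: cycles_def)
  show "f i z \<in> boundaries Y i" if "z \<in> boundaries X i"
    using that c[of _ "i + 1"] module_morphismD(1)[OF f[of "i + 1"]] 
    unfolding boundaries_def by (auto simp: image_iff) (metis add_diff_cancel_right')
qed

text \<open>The union in \<open>homology_map\<close> ranges over all representatives of a class; the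
  cosets of their images coincide, so it collapses to a single coset.\<close>

lemma homology_map_coset:
  assumes "is_complex R X" "is_complex R Y" "chain_map R X Y f" "z \<in> cycles X i"
  shows "homology_map Y f i (boundaries X i +>\<^bsub>obj X i\<^esub> z) = boundaries Y i +>\<^bsub>obj Y i\<^esub> f i z"
proof -
  note X = is_complexD[OF assms(1)] and Y = is_complexD[OF assms(2)] and f = chain_mapD[OF assms(1-3)]
  interpret X: module R "obj X i" by (rule X)
  interpret Y: module R "obj Y i" by (rule Y)
  note B = X.submodule_facts[OF submodule_boundaries[OF assms(1)]]
  have z: "z \<in> carrier (obj X i)" using assms(4) by (simp add: cycles_def)
  have "boundaries Y i +>\<^bsub>obj Y i\<^esub> f i w = boundaries Y i +>\<^bsub>obj Y i\<^esub> f i z"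
    if w: "w \<in> boundaries X i +>\<^bsub>obj X i\<^esub> z" for w
  proof -
    obtain b where b: "b \<in> boundaries X i" "w = b \<oplus>\<^bsub>obj X i\<^esub> z" using w by (auto simp: a_r_coset_def')
    have bc: "b \<in> carrier (obj X i)" using b B(1) by blast
    have c: "f i b \<in> carrier (obj Y i)" "f i z \<in> carrier (obj Y i)" "f i w \<in> carrier (obj Y i)"
      using module_morphismD(1)[OF f(1)] bc z b(2) by auto
    have "f i w \<ominus>\<^bsub>obj Y i\<^esub> f i z = f i b"
      using module_morphismD(2)[OF f(1) bc z] c b(2) by (simp add: a_minus_def Y.M.a_assoc Y.M.r_neg)
    then show ?thesis
      using coset_eq_iff[OF Y(1) submodule_boundaries[OF assms(2)] c(3,2)] f(3)[OF b(1)] by simp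
  qed
  moreover have "z \<in> boundaries X i +>\<^bsub>obj X i\<^esub> z"
    using B(2) z by (force simp: a_r_coset_def')
  ultimately show ?thesis unfolding homology_map_def by blast
qed

lemma quasi_isoD:
  assumes "quasi_iso R X Y f"
  shows "is_complex R X" "is_complex R Y" "chain_map R X Y f"
    "z \<in> cycles X i \<Longrightarrow> f i z \<in> boundaries Y i \<Longrightarrow> z \<in> boundaries X i"
    "w \<in> cycles Y i \<Longrightarrow> \<exists>z\<in>cycles X i. w \<ominus>\<^bsub>obj Y i\<^esub> f i z \<in> boundaries Y i"
proof -
  show q: "is_complex R X" "is_complex R Y" "chain_map R X Y f" using assms by (auto simp: quasi_iso_def)
  have bij: "bij_betw (homology_map Y f i) (carrier (homology X i)) (carrier (homology Y i))" for i
    using assms by (auto simp: quasi_iso_def)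
  note f = chain_mapD[OF q] and X = is_complexD[OF q(1)] and Y = is_complexD[OF q(2)]
  have coset: "boundaries X i +>\<^bsub>obj X i\<^esub> z \<in> carrier (homology X i)" if "z \<in> cycles X i" for z i and X :: "('a, 'f) rcomplex"
    using that by (auto simp: homology_def)
  show "z \<in> boundaries X i" if z: "z \<in> cycles X i" "f i z \<in> boundaries Y i"
  proof -
    interpret X: rmodule R "obj X i" unfolding rmodule_def by (rule X)
    interpret Y: rmodule R "obj Y i" unfolding rmodule_def by (rule Y)
    have 0: "\<zero>\<^bsub>obj X i\<^esub> \<in> cycles X i" using X.submodule_facts(2)[OF submodule_cycles[OF q(1)]] .
    have zc: "z \<in> carrier (obj X i)" "f i z \<in> carrier (obj Y i)"
      using z module_morphismD(1)[OF f(1)] by (auto simp: cycles_def)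
    have "f i z \<ominus>\<^bsub>obj Y i\<^esub> f i \<zero>\<^bsub>obj X i\<^esub> \<in> boundaries Y i"
      using z(2) zc module_morphism_zero[OF X(1) Y(1) f(1)] by (simp add: a_minus_def)
    then have "boundaries Y i +>\<^bsub>obj Y i\<^esub> f i z = boundaries Y i +>\<^bsub>obj Y i\<^esub> f i \<zero>\<^bsub>obj X i\<^esub>"
      using coset_eq_iff[OF Y(1) submodule_boundaries[OF q(2)]] zc module_morphismD(1)[OF f(1)] by simp
    then have "homology_map Y f i (boundaries X i +>\<^bsub>obj X i\<^esub> z) = homology_map Y f i (boundaries X i +>\<^bsub>obj X i\<^esub> \<zero>\<^bsub>obj X i\<^esub>)"
      using homology_map_coset[OF q] z(1) 0 by simp
    then have "boundaries X i +>\<^bsub>obj X i\<^esub> z = boundaries X i +>\<^bsub>obj X i\<^esub> \<zero>\<^bsub>obj X i\<^esub>"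
      by (rule inj_onD[OF bij_betw_imp_inj_on[OF bij[of i]] _ coset[OF z(1)] coset[OF 0]])
    then show ?thesis
      using coset_eq_iff[OF X(1) submodule_boundaries[OF q(1)]] zc by (simp add: a_minus_def)
  qed
  show "\<exists>z\<in>cycles X i. w \<ominus>\<^bsub>obj Y i\<^esub> f i z \<in> boundaries Y i" if w: "w \<in> cycles Y i"
  proof -
    have "boundaries Y i +>\<^bsub>obj Y i\<^esub> w \<in> homology_map Y f i ` carrier (homology X i)"
      using bij[of i] w unfolding bij_betw_def by (auto simp: homology_def)
    then obtain z where z: "z \<in> cycles X i"
      "boundaries Y i +>\<^bsub>obj Y i\<^esub> w = homology_map Y f i (boundaries X i +>\<^bsub>obj X i\<^esub> z)"
      by (auto simp: homology_def)
    then have "boundaries Y i +>\<^bsub>obj Y i\<^esub> w = boundaries Y i +>\<^bsub>obj Y i\<^esub> f i z"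
      using homology_map_coset[OF q] by simp
    then have "w \<ominus>\<^bsub>obj Y i\<^esub> f i z \<in> boundaries Y i"
      using coset_eq_iff[OF Y(1) submodule_boundaries[OF q(2)]] w z(1) f(2)[OF z(1)] by (auto simp: cycles_def)
    then show ?thesis using z(1) by blast
  qed
qed

lemma stalk_cycles:
  assumes "is_complex R (stalk M)"
  shows "cycles (stalk M) 0 = carrier M" "boundaries (stalk M) i = {\<zero>\<^bsub>M\<^esub>}"
    "i \<noteq> 0 \<Longrightarrow> cycles (stalk M) i = {\<zero>\<^bsub>M\<^esub>}" "obj (stalk M) 0 = M"
proof -
  have "module R (obj (stalk M) 0)" using is_complexD(1)[OF assms] .
  then interpret module R M by (simp add: stalk_def)
  show "cycles (stalk M) 0 = carrier M" "boundaries (stalk M) i = {\<zero>\<^bsub>M\<^esub>}"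
    "i \<noteq> 0 \<Longrightarrow> cycles (stalk M) i = {\<zero>\<^bsub>M\<^esub>}" "obj (stalk M) 0 = M"
    using M.zero_closed by (auto simp: cycles_def boundaries_def stalk_def)
qed

text \<open>The two legs of the roof transport homology: A is exact away from degree 0, and in
  degree 0 its cycles modulo boundaries are a copy of M. The second claim is phrased as a short
  exact sequence so that the long exact sequence applies.\<close>

lemma derived_iso_stalk:
  fixes M :: "('a, 'm) module" and A :: "('a, 'u) rcomplex"
  assumes "derived_iso R (stalk M) A"
  shows "i \<noteq> 0 \<Longrightarrow> cycles A i = boundaries A i"
    and "\<exists>h. short_exact R (obj A 0\<lparr>carrier := boundaries A 0\<rparr>) (obj A 0\<lparr>carrier := cycles A 0\<rparr>) M (\<lambda>x. x) h"
proof -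
  obtain Z :: "('a, 'u) rcomplex" and f g where f: "quasi_iso R Z (stalk M) f" and g: "quasi_iso R Z A g"
    using assms by (auto simp: derived_iso_def)
  note F = quasi_isoD[OF f] and G = quasi_isoD[OF g]
  note fc = chain_mapD[OF F(1-3)] and gc = chain_mapD[OF G(1-3)]
  note st = stalk_cycles[OF F(2)]
  show "cycles A i = boundaries A i" if "i \<noteq> 0"
  proof
    show "boundaries A i \<subseteq> cycles A i" by (rule boundaries_subset_cycles[OF G(2)])
    show "cycles A i \<subseteq> boundaries A i"
    proof
      fix w assume w: "w \<in> cycles A i"
      interpret A: module R "obj A i" by (rule is_complexD(1)[OF G(2)])
      note B = A.submodule_facts[OF submodule_boundaries[OF G(2)]]
      obtain z where z: "z \<in> cycles Z i" "w \<ominus>\<^bsub>obj A i\<^esub> g i z \<in> boundaries A i" using G(5)[OF w] by blast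
      \<comment> \<open>Away from degree 0 the target is zero, so z is a boundary in the middle
        complex and so is its image in A.\<close>
      have "f i z \<in> boundaries (stalk M) i" using fc(2)[OF z(1)] st(2,3) that by simp
      then have "g i z \<in> boundaries A i" using gc(3) F(4)[OF z(1)] by blast
      then have "(w \<ominus>\<^bsub>obj A i\<^esub> g i z) \<oplus>\<^bsub>obj A i\<^esub> g i z \<in> boundaries A i" using B(3) z(2) by blast
      moreover have "w \<in> carrier (obj A i)" "g i z \<in> carrier (obj A i)"
        using w gc(2)[OF z(1)] by (auto simp: cycles_def)
      ultimately show "w \<in> boundaries A i" by (simp add: a_minus_def A.M.a_assoc A.M.l_neg)
    qed
  qed
  interpret A: module R "obj A 0" by (rule is_complexD(1)[OF G(2)])
  interpret Z: module R "obj Z 0" by (rule is_complexD(1)[OF F(1)])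
  have modM: "module R M" using is_complexD(1)[OF F(2), of 0] st(4) by simp
  interpret M: module R M by (rule modM)
  have f0: "module_morphism R (obj Z 0) M (f 0)" using fc(1)[of 0] st(4) by simp
  note g0 = gc(1)[of 0]
  note cA = A.submodule_facts[OF submodule_cycles[OF G(2), of 0]] and bA = A.submodule_facts[OF submodule_boundaries[OF G(2), of 0]]
  note cZ = Z.submodule_facts[OF submodule_cycles[OF F(1), of 0]] and bZ = Z.submodule_facts[OF submodule_boundaries[OF F(1), of 0]]
  \<comment> \<open>A cycle of the middle complex whose image in A is homologous to w. Applying the
    other leg of the roof gives h; another choice changes it by a boundary, on which that leg is
    zero.\<close>
  define c where "c w = (SOME z. z \<in> cycles Z 0 \<and> w \<ominus>\<^bsub>obj A 0\<^esub> g 0 z \<in> boundaries A 0)" for w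
  have c: "c w \<in> cycles Z 0 \<and> w \<ominus>\<^bsub>obj A 0\<^esub> g 0 (c w) \<in> boundaries A 0" if "w \<in> cycles A 0" for w
  proof -
    have "\<exists>z. z \<in> cycles Z 0 \<and> w \<ominus>\<^bsub>obj A 0\<^esub> g 0 z \<in> boundaries A 0" using G(5)[OF that] by blast
    from someI_ex[OF this] show ?thesis unfolding c_def .
  qed
  define h where "h w = f 0 (c w)" for w
  have comp: "(a \<ominus>\<^bsub>obj A 0\<^esub> b) \<ominus>\<^bsub>obj A 0\<^esub> (a \<ominus>\<^bsub>obj A 0\<^esub> d) = d \<ominus>\<^bsub>obj A 0\<^esub> b"
    if "a \<in> carrier (obj A 0)" "b \<in> carrier (obj A 0)" "d \<in> carrier (obj A 0)" for a b d
  proof -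
    have "a \<oplus>\<^bsub>obj A 0\<^esub> \<ominus>\<^bsub>obj A 0\<^esub> b \<oplus>\<^bsub>obj A 0\<^esub> (\<ominus>\<^bsub>obj A 0\<^esub> a \<oplus>\<^bsub>obj A 0\<^esub> d) =
       (a \<oplus>\<^bsub>obj A 0\<^esub> \<ominus>\<^bsub>obj A 0\<^esub> a) \<oplus>\<^bsub>obj A 0\<^esub> (d \<oplus>\<^bsub>obj A 0\<^esub> \<ominus>\<^bsub>obj A 0\<^esub> b)"
      using that by (simp add: A.M.a_ac)
    then show ?thesis using that by (simp add: a_minus_def A.M.minus_add A.M.r_neg)
  qed
  have h_eq: "h w = f 0 z" if w: "w \<in> cycles A 0" "z \<in> cycles Z 0" "w \<ominus>\<^bsub>obj A 0\<^esub> g 0 z \<in> boundaries A 0" for w z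
  proof -
    note cw = c[OF w(1)]
    have cl: "w \<in> carrier (obj A 0)" "g 0 z \<in> carrier (obj A 0)" "g 0 (c w) \<in> carrier (obj A 0)"
      "z \<in> carrier (obj Z 0)" "c w \<in> carrier (obj Z 0)"
      using w cw cA(1) cZ(1) module_morphismD(1)[OF g0] by auto
    have "(w \<ominus>\<^bsub>obj A 0\<^esub> g 0 z) \<ominus>\<^bsub>obj A 0\<^esub> (w \<ominus>\<^bsub>obj A 0\<^esub> g 0 (c w)) \<in> boundaries A 0"
      using bA(5) w(3) cw by blast
    then have "g 0 (c w \<ominus>\<^bsub>obj Z 0\<^esub> z) \<in> boundaries A 0"
      using comp[OF cl(1-3)] module_morphism_minus[OF Z.module_axioms A.module_axioms g0 cl(5,4)] by simp
    then have "c w \<ominus>\<^bsub>obj Z 0\<^esub> z \<in> boundaries Z 0" using G(4) cZ(5) cw w(2) by blast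
    then have "f 0 (c w \<ominus>\<^bsub>obj Z 0\<^esub> z) = \<zero>\<^bsub>M\<^esub>" using fc(3) st(2) by blast
    then have "h w \<ominus>\<^bsub>M\<^esub> f 0 z = \<zero>\<^bsub>M\<^esub>"
      using module_morphism_minus[OF Z.module_axioms modM f0 cl(5,4)] by (simp add: h_def)
    then have "(h w \<ominus>\<^bsub>M\<^esub> f 0 z) \<oplus>\<^bsub>M\<^esub> f 0 z = f 0 z" using module_morphismD(1)[OF f0 cl(4)] by simp
    then show ?thesis using module_morphismD(1)[OF f0] cl by (simp add: h_def a_minus_def M.M.a_assoc M.M.l_neg)
  qed
  have "short_exact R (obj A 0\<lparr>carrier := boundaries A 0\<rparr>) (obj A 0\<lparr>carrier := cycles A 0\<rparr>) M (\<lambda>x. x) h"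
    unfolding short_exact_def
  proof (intro conjI)
    show "module R (obj A 0\<lparr>carrier := boundaries A 0\<rparr>)" "module R (obj A 0\<lparr>carrier := cycles A 0\<rparr>)"
      using A.submodule_restrict_module submodule_boundaries[OF G(2)] submodule_cycles[OF G(2)] by auto
    show "module R M" by (rule modM)
    show "module_morphism R (obj A 0\<lparr>carrier := boundaries A 0\<rparr>) (obj A 0\<lparr>carrier := cycles A 0\<rparr>) (\<lambda>x. x)"
      by (rule submodule_inclusion[OF submodule_boundaries[OF G(2)] boundaries_subset_cycles[OF G(2)]])
    show "module_morphism R (obj A 0\<lparr>carrier := cycles A 0\<rparr>) M h"
      unfolding module_morphism_def
    proof (intro conjI ballI)
      show "h \<in> carrier (obj A 0\<lparr>carrier := cycles A 0\<rparr>) \<rightarrow> carrier M"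
        using c subsetD[OF cZ(1)] module_morphismD(1)[OF f0] by (auto simp: h_def)
    next
      fix u v assume "u \<in> carrier (obj A 0\<lparr>carrier := cycles A 0\<rparr>)" "v \<in> carrier (obj A 0\<lparr>carrier := cycles A 0\<rparr>)"
      then have uv: "u \<in> cycles A 0" "v \<in> cycles A 0" by auto
      note cu = c[OF uv(1)] and cv = c[OF uv(2)]
      have cl: "u \<in> carrier (obj A 0)" "v \<in> carrier (obj A 0)" "c u \<in> carrier (obj Z 0)" "c v \<in> carrier (obj Z 0)"
        "g 0 (c u) \<in> carrier (obj A 0)" "g 0 (c v) \<in> carrier (obj A 0)"
        using uv cu cv cA(1) cZ(1) module_morphismD(1)[OF g0] by auto
      have "(u \<oplus>\<^bsub>obj A 0\<^esub> v) \<ominus>\<^bsub>obj A 0\<^esub> g 0 (c u \<oplus>\<^bsub>obj Z 0\<^esub> c v) = 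
          (u \<ominus>\<^bsub>obj A 0\<^esub> g 0 (c u)) \<oplus>\<^bsub>obj A 0\<^esub> (v \<ominus>\<^bsub>obj A 0\<^esub> g 0 (c v))"
        using module_morphismD(2)[OF g0 cl(3,4)] cl by (simp add: a_minus_def A.M.minus_add A.M.a_ac)
      then have "h (u \<oplus>\<^bsub>obj A 0\<^esub> v) = f 0 (c u \<oplus>\<^bsub>obj Z 0\<^esub> c v)"
        using cu cv bA(3) by (intro h_eq cA(3)[OF uv] cZ(3)) auto
      then show "h (u \<oplus>\<^bsub>obj A 0\<lparr>carrier := cycles A 0\<rparr>\<^esub> v) = h u \<oplus>\<^bsub>M\<^esub> h v"
        using module_morphismD(2)[OF f0 cl(3,4)] by (simp add: h_def)
    next
      fix r u assume "r \<in> carrier R" "u \<in> carrier (obj A 0\<lparr>carrier := cycles A 0\<rparr>)"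
      then have u: "r \<in> carrier R" "u \<in> cycles A 0" by auto
      note cu = c[OF u(2)]
      have cl: "u \<in> carrier (obj A 0)" "c u \<in> carrier (obj Z 0)" "g 0 (c u) \<in> carrier (obj A 0)"
        using u cu cA(1) cZ(1) module_morphismD(1)[OF g0] by auto
      have "r \<odot>\<^bsub>obj A 0\<^esub> u \<ominus>\<^bsub>obj A 0\<^esub> g 0 (r \<odot>\<^bsub>obj Z 0\<^esub> c u) = r \<odot>\<^bsub>obj A 0\<^esub> (u \<ominus>\<^bsub>obj A 0\<^esub> g 0 (c u))"
        using module_morphismD(3)[OF g0 u(1) cl(2)] cl u by (simp add: a_minus_def A.smult_r_distr A.smult_r_minus)
      then have "h (r \<odot>\<^bsub>obj A 0\<^esub> u) = f 0 (r \<odot>\<^bsub>obj Z 0\<^esub> c u)"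
        using cu bA(4) u by (intro h_eq cA(4)[OF u] cZ(4)) auto
      then show "h (r \<odot>\<^bsub>obj A 0\<lparr>carrier := cycles A 0\<rparr>\<^esub> u) = r \<odot>\<^bsub>M\<^esub> h u"
        using module_morphismD(3)[OF f0 u(1) cl(2)] by (simp add: h_def)
    qed
    show "inj_on (\<lambda>x. x) (carrier (obj A 0\<lparr>carrier := boundaries A 0\<rparr>))" by simp
    show "h ` carrier (obj A 0\<lparr>carrier := cycles A 0\<rparr>) = carrier M"
    proof
      show "h ` carrier (obj A 0\<lparr>carrier := cycles A 0\<rparr>) \<subseteq> carrier M"
        using c subsetD[OF cZ(1)] module_morphismD(1)[OF f0] by (auto simp: h_def)
      show "carrier M \<subseteq> h ` carrier (obj A 0\<lparr>carrier := cycles A 0\<rparr>)"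
      proof
        fix m assume m: "m \<in> carrier M"
        then obtain z where z: "z \<in> cycles Z 0" "m \<ominus>\<^bsub>M\<^esub> f 0 z = \<zero>\<^bsub>M\<^esub>"
          using F(5)[of m 0] st by auto
        have fz: "f 0 z \<in> carrier M" using z(1) cZ(1) module_morphismD(1)[OF f0] by blast
        have "(m \<ominus>\<^bsub>M\<^esub> f 0 z) \<oplus>\<^bsub>M\<^esub> f 0 z = f 0 z" using z(2) fz by simp
        then have "m = f 0 z" using m fz by (simp add: a_minus_def M.M.a_assoc M.M.l_neg)
        moreover have "g 0 z \<in> cycles A 0" using gc(2)[OF z(1)] .
        moreover have "g 0 z \<ominus>\<^bsub>obj A 0\<^esub> g 0 z \<in> boundaries A 0"
          using bA(2) cA(1) \<open>g 0 z \<in> cycles A 0\<close> by (auto simp: a_minus_def A.M.r_neg)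
        ultimately show "m \<in> h ` carrier (obj A 0\<lparr>carrier := cycles A 0\<rparr>)" using h_eq z(1) by force
      qed
    qed
    have "h w = \<zero>\<^bsub>M\<^esub> \<longleftrightarrow> w \<in> boundaries A 0" if w: "w \<in> cycles A 0" for w
    proof
      note cw = c[OF w]
      have cl: "w \<in> carrier (obj A 0)" "g 0 (c w) \<in> carrier (obj A 0)"
        using w cw cA(1) cZ(1) module_morphismD(1)[OF g0] by auto
      {
        assume "h w = \<zero>\<^bsub>M\<^esub>"
        then have "c w \<in> boundaries Z 0" using F(4)[of "c w" 0] cw st(2) by (simp add: h_def)
        then have "(w \<ominus>\<^bsub>obj A 0\<^esub> g 0 (c w)) \<oplus>\<^bsub>obj A 0\<^esub> g 0 (c w) \<in> boundaries A 0" using bA(3) gc(3) cw by blast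
        then show "w \<in> boundaries A 0" using cl by (simp add: a_minus_def A.M.a_assoc A.M.l_neg)
      next
        assume "w \<in> boundaries A 0"
        then have "w \<ominus>\<^bsub>obj A 0\<^esub> (w \<ominus>\<^bsub>obj A 0\<^esub> g 0 (c w)) \<in> boundaries A 0" using bA(5) cw by blast
        then have "g 0 (c w) \<in> boundaries A 0"
          using cl by (simp add: a_minus_def A.M.minus_add A.M.a_assoc[symmetric] A.M.r_neg)
        then have "c w \<in> boundaries Z 0" using G(4) cw by blast
        then show "h w = \<zero>\<^bsub>M\<^esub>" using fc(3) st(2) by (auto simp: h_def)
      }
    qed
    then show "(\<lambda>x. x) ` carrier (obj A 0\<lparr>carrier := boundaries A 0\<rparr>) =
        {x \<in> carrier (obj A 0\<lparr>carrier := cycles A 0\<rparr>). h x = \<zero>\<^bsub>M\<^esub>}"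
      using boundaries_subset_cycles[OF G(2), of 0] by auto
  qed
  then show "\<exists>h. short_exact R (obj A 0\<lparr>carrier := boundaries A 0\<rparr>) (obj A 0\<lparr>carrier := cycles A 0\<rparr>) M (\<lambda>x. x) h"
    by blast
qed

section \<open>Vanishing of cohomology above the Gorenstein injective dimension\<close>

text \<open>The complex of G-injective modules is cut at degree 0. Its upper half resolves the
  boundaries, which therefore have no positive cohomology. Its lower half is a coresolution of the
  cycles of length n, which bounds their cohomology by n. As M is cycles modulo boundaries, the
  bound passes to M.\<close>

lemma Gid_le_cohomology_zero:
  fixes M :: "('a, 'm) module"
  assumes noeth: "noetherian_ring R" and gid: "Gid_le TYPE('u) R (stalk M) n" and xs: "set xs \<subseteq> carrier R"
    and M: "carrier M \<noteq> {\<zero>\<^bsub>M\<^esub>}"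
  shows "n \<ge> 0" "i > n \<Longrightarrow> cohomology_zero R M xs i"
proof -
  obtain A :: "('a, 'u) rcomplex" and m where A: "is_complex R A" "\<And>i. G_injective R (obj A i)"
    "\<And>i. i < - n \<Longrightarrow> carrier (obj A i) = {\<zero>\<^bsub>obj A i\<^esub>}" "derived_iso R (stalk M) A"
    using gid unfolding Gid_le_def by blast
  note D = derived_iso_stalk[OF A(4)]
  obtain h where h: "short_exact R (obj A 0\<lparr>carrier := boundaries A 0\<rparr>) (obj A 0\<lparr>carrier := cycles A 0\<rparr>) M (\<lambda>x. x) h"
    using D(2) by blast
  then interpret E: long_exact R "obj A 0\<lparr>carrier := boundaries A 0\<rparr>" "obj A 0\<lparr>carrier := cycles A 0\<rparr>" M "\<lambda>x. x" h xs
    using xs by unfold_locales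
  \<comment> \<open>For negative n the complex vanishes in degree 0, and so would M.\<close>
  show n: "n \<ge> 0"
  proof (rule ccontr)
    assume "\<not> n \<ge> 0"
    then have "carrier (obj A 0) = {\<zero>\<^bsub>obj A 0\<^esub>}" using A(3)[of 0] by simp
    then have "cycles A 0 \<subseteq> {\<zero>\<^bsub>obj A 0\<^esub>}" by (auto simp: cycles_def)
    then have "carrier M \<subseteq> {h \<zero>\<^bsub>obj A 0\<^esub>}" using E.g_surj by auto
    then have "carrier M \<subseteq> {\<zero>\<^bsub>M\<^esub>}" using subsetD[OF _ E.N.M.zero_closed, of "{h \<zero>\<^bsub>obj A 0\<^esub>}"] by simp
    moreover have "{\<zero>\<^bsub>M\<^esub>} \<subseteq> carrier M" using E.N.M.zero_closed by simp
    ultimately show False using M by (simp add: subset_antisym)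
  qed
  have acyclic: "cohomology_zero R (obj A j) xs i" if "i > 0" for i j
    by (rule G_injective_cohomology_zero[OF noeth A(2) xs that])
  \<comment> \<open>Shifting along the resolution raises the degree until it exceeds the number of
    generators. Starting from j \<ge> 0 the indices j + 1 that occur are nonzero, where cycles and
    boundaries agree.\<close>
  have B: "cohomology_zero R (obj A j\<lparr>carrier := boundaries A j\<rparr>) xs i"
    if "i > 0" "j \<ge> 0" "i > int (length xs) - int q" for q i j
    using that
  proof (induction q arbitrary: i j)
    case 0
    interpret sequence_cohomology R "obj A j\<lparr>carrier := boundaries A j\<rparr>" xs
      by (rule sequence_cohomologyI[OF module.submodule_restrict_module[OF is_complexD(1)[OF A(1)]
            submodule_boundaries[OF A(1)]] xs])
    show ?case using cohomology_zero_above 0 by simp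
  next
    case (Suc q)
    interpret long_exact R "obj A (j + 1)\<lparr>carrier := cycles A (j + 1)\<rparr>" "obj A (j + 1)"
        "obj A j\<lparr>carrier := boundaries A j\<rparr>" "\<lambda>x. x" "bdry A (j + 1)" xs
      using short_exact_cycles_boundaries[OF A(1), of j] xs by unfold_locales
    show ?case
      by (rule cohomology_zero_right[OF acyclic]) (use Suc D(1)[of "j + 1"] in auto)
  qed
  \<comment> \<open>The shift now lowers i and j together, so i > n + j is preserved. The number q
    bounds how far j lies above -n, below which the complex is zero.\<close>
  have Z: "cohomology_zero R (obj A j\<lparr>carrier := cycles A j\<rparr>) xs i"
    if "i > 0" "j \<le> 0" "i > n + j" "j < int q - n" for q i j
    using that
  proof (induction q arbitrary: i j)
    case 0
    interpret sequence_cohomology R "obj A j\<lparr>carrier := cycles A j\<rparr>" xs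
      by (rule sequence_cohomologyI[OF module.submodule_restrict_module[OF is_complexD(1)[OF A(1)]
            submodule_cycles[OF A(1)]] xs])
    have "carrier (obj A j\<lparr>carrier := cycles A j\<rparr>) = {\<zero>\<^bsub>obj A j\<lparr>carrier := cycles A j\<rparr>\<^esub>}"
      using A(3)[of j] 0 M.zero_closed by (auto simp: cycles_def)
    then show ?case by (rule cohomology_zero_trivial)
  next
    case (Suc q)
    have e: "cycles A (j - 1) = boundaries A (j - 1)" using D(1)[of "j - 1"] Suc.prems by simp
    interpret long_exact R "obj A j\<lparr>carrier := cycles A j\<rparr>" "obj A j"
        "obj A (j - 1)\<lparr>carrier := cycles A (j - 1)\<rparr>" "\<lambda>x. x" "bdry A j" xs
      using short_exact_cycles_boundaries[OF A(1), of "j - 1"] xs e by unfold_locales simp_all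
    have "cohomology_zero R (obj A (j - 1)\<lparr>carrier := cycles A (j - 1)\<rparr>) xs (i - 1)"
    \<comment> \<open>In degree 1 the shift arrives at degree 0, which the induction hypothesis does
      not cover; but then n + j < 1, and the next term of the complex is already zero.\<close>
    proof (cases "i = 1")
      case True
      then have "j - 1 < - n" using Suc.prems by simp
      then have "carrier (obj A (j - 1)\<lparr>carrier := cycles A (j - 1)\<rparr>) = {\<zero>\<^bsub>obj A (j - 1)\<lparr>carrier := cycles A (j - 1)\<rparr>\<^esub>}"
        using A(3)[of "j - 1"] N.M.zero_closed by (auto simp: cycles_def)
      then show ?thesis by (rule N.cohomology_zero_trivial)
    next
      case False
      then show ?thesis using Suc.IH[of "i - 1" "j - 1"] Suc.prems by simp
    qed
    then show ?case using cohomology_zero_left[of "i - 1"] acyclic Suc.prems by simp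
  qed
  show "cohomology_zero R M xs i" if "i > n"
  proof -
    have "cohomology_zero R (obj A 0\<lparr>carrier := cycles A 0\<rparr>) xs i"
      \<comment> \<open>Any q above n would do for j = 0.\<close>
      by (rule Z[of i 0 "nat n + nat n + 1"]) (use n that in auto)
    moreover have "cohomology_zero R (obj A 0\<lparr>carrier := boundaries A 0\<rparr>) xs (i + 1)"
      by (rule B[of "i + 1" 0 "length xs"]) (use n that in auto)
    ultimately show ?thesis by (rule E.cohomology_zero_right)
  qed
qed

section \<open>Artinian subquotients\<close>

text \<open>The descending chain condition for the quotient Z/B, read off from the submodules of U
  between B and Z.\<close>

definition artinian_between ::
    "('a, 'k) ring_scheme \<Rightarrow> ('a, 'b) module \<Rightarrow> 'b set \<Rightarrow> 'b set \<Rightarrow> bool" where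
  "artinian_between R U B Z \<longleftrightarrow>
     (\<forall>W :: nat \<Rightarrow> 'b set.
        (\<forall>j. submodule (W j) R U \<and> B \<subseteq> W j \<and> W j \<subseteq> Z \<and> W (Suc j) \<subseteq> W j) \<longrightarrow>
        (\<exists>k. \<forall>j\<ge>k. W j = W k))"

lemma artinian_betweenI:
  assumes "\<And>W :: nat \<Rightarrow> 'b set. (\<And>j. submodule (W j) R U) \<Longrightarrow> (\<And>j. B \<subseteq> W j) \<Longrightarrow> (\<And>j. W j \<subseteq> Z) \<Longrightarrow>
    (\<And>i j. i \<le> j \<Longrightarrow> W j \<subseteq> W i) \<Longrightarrow> \<exists>k. \<forall>j\<ge>k. W k \<subseteq> W j"
  shows "artinian_between R U B Z"
  unfolding artinian_between_def
proof (intro allI impI)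
  fix W :: "nat \<Rightarrow> 'b set"
  assume W: "\<forall>j. submodule (W j) R U \<and> B \<subseteq> W j \<and> W j \<subseteq> Z \<and> W (Suc j) \<subseteq> W j"
  have anti: "W j \<subseteq> W i" if "i \<le> j" for i j
    using lift_Suc_antimono_le[of W i j] W that by blast
  then have "\<exists>k. \<forall>j\<ge>k. W k \<subseteq> W j" using W assms[of W] by blast
  then show "\<exists>k. \<forall>j\<ge>k. W j = W k" using anti by blast
qed

lemma artinian_betweenD:
  fixes W :: "nat \<Rightarrow> 'b set"
  assumes "artinian_between R U B Z" "\<And>j. submodule (W j) R U" "\<And>j. B \<subseteq> W j" "\<And>j. W j \<subseteq> Z"
    "\<And>j. W (Suc j) \<subseteq> W j"
  obtains k where "\<And>j. j \<ge> k \<Longrightarrow> W j = W k"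
  using assms unfolding artinian_between_def by meson

text \<open>An image of an artinian module is artinian. The map is a relation that is single valued
  only modulo C, the form in which the connecting homomorphism is available.\<close>

lemma artinian_between_relation:
  fixes U :: "('a, 'b) module" and V :: "('a, 'c) module"
  assumes U: "module R U" and V: "module R V" and art: "artinian_between R U B Z"
    and Z: "submodule Z R U"
    and add: "\<And>z w z' w'. \<rho> z w \<Longrightarrow> \<rho> z' w' \<Longrightarrow> \<rho> (z \<oplus>\<^bsub>U\<^esub> z') (w \<oplus>\<^bsub>V\<^esub> w')"
    and smult: "\<And>r z w. r \<in> carrier R \<Longrightarrow> \<rho> z w \<Longrightarrow> \<rho> (r \<odot>\<^bsub>U\<^esub> z) (r \<odot>\<^bsub>V\<^esub> w)"
    and zero: "\<rho> \<zero>\<^bsub>U\<^esub> \<zero>\<^bsub>V\<^esub>"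
    and B: "\<And>z. z \<in> B \<Longrightarrow> z \<in> Z \<and> (\<exists>w\<in>C. \<rho> z w)"
    and surj: "\<And>w. w \<in> K \<Longrightarrow> \<exists>z\<in>Z. \<rho> z w"
    and unique: "\<And>z w w'. \<rho> z w \<Longrightarrow> \<rho> z w' \<Longrightarrow> w \<ominus>\<^bsub>V\<^esub> w' \<in> C"
    and K: "K \<subseteq> carrier V"
  shows "artinian_between R V C K"
proof (rule artinian_betweenI)
  interpret U: module R U by fact
  interpret V: module R V by fact
  fix W :: "nat \<Rightarrow> 'c set"
  assume W: "\<And>j. submodule (W j) R V" "\<And>j. C \<subseteq> W j" "\<And>j. W j \<subseteq> K" "\<And>i j. i \<le> j \<Longrightarrow> W j \<subseteq> W i"
  \<comment> \<open>The preimage of the chain stabilises; as every element of K has a preimage and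
    values are unique modulo C, the chain itself does.\<close>
  define W' where "W' j = {z \<in> Z. \<exists>w\<in>W j. \<rho> z w}" for j
  note sZ = U.submodule_facts[OF Z]
  have "submodule (W' j) R U" for j
  proof (rule U.submodule_criterion)
    note sW = V.submodule_facts[OF W(1)[of j]]
    show "W' j \<subseteq> carrier U" using sZ(1) by (auto simp: W'_def)
    show "\<zero>\<^bsub>U\<^esub> \<in> W' j" using zero sZ(2) sW(2) by (auto simp: W'_def)
    show "a \<oplus>\<^bsub>U\<^esub> b \<in> W' j" if "a \<in> W' j" "b \<in> W' j" for a b
      using that add sZ(3) sW(3) unfolding W'_def by blast
    show "r \<odot>\<^bsub>U\<^esub> a \<in> W' j" if "r \<in> carrier R" "a \<in> W' j" for r a
      using that smult sZ(4) sW(4) unfolding W'_def by blast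
  qed
  moreover have "B \<subseteq> W' j" for j using B W(2) unfolding W'_def by blast
  moreover have "W' j \<subseteq> Z" for j by (auto simp: W'_def)
  moreover have "W' (Suc j) \<subseteq> W' j" for j using W(4)[of j "Suc j"] by (auto simp: W'_def)
  ultimately obtain k where k: "\<And>j. j \<ge> k \<Longrightarrow> W' j = W' k" using artinian_betweenD[OF art, of W'] by blast
  have "W k \<subseteq> W j" if "j \<ge> k" for j
  proof
    fix w assume w: "w \<in> W k"
    then obtain z where z: "z \<in> Z" "\<rho> z w" using surj W(3) by blast
    then have "z \<in> W' j" using k[OF that] w by (auto simp: W'_def)
    then obtain w' where w': "w' \<in> W j" "\<rho> z w'" by (auto simp: W'_def)
    have "w \<ominus>\<^bsub>V\<^esub> w' \<in> W j" using unique[OF z(2) w'(2)] W(2) by blast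
    then have "(w \<ominus>\<^bsub>V\<^esub> w') \<oplus>\<^bsub>V\<^esub> w' \<in> W j" using V.submodule_facts(3)[OF W(1)] w'(1) by blast
    moreover have "w \<in> carrier V" "w' \<in> carrier V" using w w' W(3) K by blast+
    ultimately show "w \<in> W j" by (simp add: a_minus_def V.M.a_assoc V.M.l_neg)
  qed
  then show "\<exists>k. \<forall>j\<ge>k. W k \<subseteq> W j" by blast
qed

text \<open>An extension of artinian modules is artinian, for subquotients that form an exact row.
  The chain is controlled by its preimages on the left and its images on the right.\<close>

lemma artinian_between_extension:
  fixes U :: "('a, 'b) module" and U' :: "('a, 'c) module" and U'' :: "('a, 'd) module"
  assumes U: "module R U" and U': "module R U'" and U'': "module R U''"
    and art: "artinian_between R U' B' Z'" "artinian_between R U'' B'' Z''"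
    and sub: "submodule Z' R U'" "submodule Z'' R U''" "submodule B'' R U''" "B'' \<subseteq> Z''" "Z \<subseteq> carrier U"
    and F: "module_morphism R U' U F" "\<And>z. z \<in> B' \<Longrightarrow> z \<in> Z' \<and> F z \<in> B"
    and G: "\<And>z. z \<in> Z \<Longrightarrow> G z \<in> Z''"
      "\<And>x y. x \<in> Z \<Longrightarrow> y \<in> Z \<Longrightarrow> G (x \<oplus>\<^bsub>U\<^esub> y) = G x \<oplus>\<^bsub>U''\<^esub> G y"
      "\<And>r x. r \<in> carrier R \<Longrightarrow> x \<in> Z \<Longrightarrow> G (r \<odot>\<^bsub>U\<^esub> x) = r \<odot>\<^bsub>U''\<^esub> G x"
      "\<And>x y. x \<in> Z \<Longrightarrow> y \<in> Z \<Longrightarrow> G (x \<ominus>\<^bsub>U\<^esub> y) = G x \<ominus>\<^bsub>U''\<^esub> G y"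
    and exact: "\<And>z. z \<in> Z \<Longrightarrow> G z \<in> B'' \<Longrightarrow> \<exists>z'\<in>Z'. z \<ominus>\<^bsub>U\<^esub> F z' \<in> B"
  shows "artinian_between R U B Z"
proof (rule artinian_betweenI)
  interpret U: module R U by fact
  interpret U': module R U' by fact
  interpret U'': module R U'' by fact
  note F' = module_morphismD[OF F(1)]
  fix W :: "nat \<Rightarrow> 'b set"
  assume W: "\<And>j. submodule (W j) R U" "\<And>j. B \<subseteq> W j" "\<And>j. W j \<subseteq> Z" "\<And>i j. i \<le> j \<Longrightarrow> W j \<subseteq> W i"
  note sW = U.submodule_facts[OF W(1)]
  note s' = U'.submodule_facts[OF sub(1)] and s'' = U''.submodule_facts[OF sub(2)] and sB = U''.submodule_facts[OF sub(3)]
  define W' where "W' j = {z \<in> Z'. F z \<in> W j}" for j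
  define W'' where "W'' j = {z \<in> Z''. \<exists>w\<in>W j. z \<ominus>\<^bsub>U''\<^esub> G w \<in> B''}" for j
  have G0: "G \<zero>\<^bsub>U\<^esub> = \<zero>\<^bsub>U''\<^esub>"
  proof -
    have z: "\<zero>\<^bsub>U\<^esub> \<in> Z" using sW(2) W(3) by blast
    then show ?thesis using G(3)[of "\<zero>\<^bsub>R\<^esub>" "\<zero>\<^bsub>U\<^esub>"] G(1)[OF z] s''(1) by auto
  qed
  have "submodule (W' j) R U'" for j
  proof (rule U'.submodule_criterion)
    show "\<zero>\<^bsub>U'\<^esub> \<in> W' j" using s'(2) module_morphism_zero[OF U' U F(1)] sW(2) by (auto simp: W'_def)
    show "a \<oplus>\<^bsub>U'\<^esub> b \<in> W' j" if "a \<in> W' j" "b \<in> W' j" for a b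
    proof -
      have "a \<in> carrier U'" "b \<in> carrier U'" using that s'(1) by (auto simp: W'_def)
      then show ?thesis using that s'(3) sW(3) F'(2) by (auto simp: W'_def)
    qed
    show "r \<odot>\<^bsub>U'\<^esub> a \<in> W' j" if "r \<in> carrier R" "a \<in> W' j" for r a
    proof -
      have "a \<in> carrier U'" using that s'(1) by (auto simp: W'_def)
      then show ?thesis using that s'(4) sW(4) F'(3) by (auto simp: W'_def)
    qed
  qed (use s'(1) in \<open>auto simp: W'_def\<close>)
  moreover have "B' \<subseteq> W' j" for j using F(2) W(2) by (auto simp: W'_def)
  moreover have "W' j \<subseteq> Z'" for j by (auto simp: W'_def)
  moreover have "W' (Suc j) \<subseteq> W' j" for j using W(4)[of j "Suc j"] by (auto simp: W'_def)
  ultimately obtain k' where k': "\<And>j. j \<ge> k' \<Longrightarrow> W' j = W' k'" using artinian_betweenD[OF art(1), of W'] by blast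
  have "submodule (W'' j) R U''" for j
  proof (rule U''.submodule_criterion)
    show "\<zero>\<^bsub>U''\<^esub> \<in> W'' j" using s''(2) sB(2) sB(6)[OF sB(2)] sW(2) G0
      by (auto simp: W''_def a_minus_def intro!: bexI[of _ "\<zero>\<^bsub>U\<^esub>"])
    show "a \<oplus>\<^bsub>U''\<^esub> b \<in> W'' j" if ab: "a \<in> W'' j" "b \<in> W'' j" for a b
    proof -
      obtain v w where vw: "v \<in> W j" "w \<in> W j" "a \<ominus>\<^bsub>U''\<^esub> G v \<in> B''" "b \<ominus>\<^bsub>U''\<^esub> G w \<in> B''"
        using ab by (auto simp: W''_def)
      have Z: "v \<in> Z" "w \<in> Z" using vw W(3) by auto
      have c: "a \<in> carrier U''" "b \<in> carrier U''" "G v \<in> carrier U''" "G w \<in> carrier U''"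
        using ab s''(1) G(1)[OF Z(1)] G(1)[OF Z(2)] by (auto simp: W''_def)
      have "(a \<oplus>\<^bsub>U''\<^esub> b) \<ominus>\<^bsub>U''\<^esub> G (v \<oplus>\<^bsub>U\<^esub> w) = (a \<ominus>\<^bsub>U''\<^esub> G v) \<oplus>\<^bsub>U''\<^esub> (b \<ominus>\<^bsub>U''\<^esub> G w)"
        using c G(2)[OF Z] by (simp add: a_minus_def U''.M.minus_add U''.M.a_ac)
      then have "(a \<oplus>\<^bsub>U''\<^esub> b) \<ominus>\<^bsub>U''\<^esub> G (v \<oplus>\<^bsub>U\<^esub> w) \<in> B''" using sB(3) vw by simp
      then show ?thesis using ab s''(3) sW(3)[OF vw(1,2)] by (auto simp: W''_def)
    qed
    show "r \<odot>\<^bsub>U''\<^esub> a \<in> W'' j" if r: "r \<in> carrier R" "a \<in> W'' j" for r a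
    proof -
      obtain v where v: "v \<in> W j" "a \<ominus>\<^bsub>U''\<^esub> G v \<in> B''" using r by (auto simp: W''_def)
      have Z: "v \<in> Z" using v W(3) by auto
      have c: "a \<in> carrier U''" "G v \<in> carrier U''" using r s''(1) G(1)[OF Z(1)] by (auto simp: W''_def)
      have "r \<odot>\<^bsub>U''\<^esub> a \<ominus>\<^bsub>U''\<^esub> G (r \<odot>\<^bsub>U\<^esub> v) = r \<odot>\<^bsub>U''\<^esub> (a \<ominus>\<^bsub>U''\<^esub> G v)"
        using c G(3)[OF r(1) Z] r by (simp add: a_minus_def U''.smult_r_distr U''.smult_r_minus)
      then have "r \<odot>\<^bsub>U''\<^esub> a \<ominus>\<^bsub>U''\<^esub> G (r \<odot>\<^bsub>U\<^esub> v) \<in> B''" using sB(4) v r by simp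
      then show ?thesis using r s''(4) sW(4)[OF r(1) v(1)] by (auto simp: W''_def)
    qed
  qed (use s''(1) in \<open>auto simp: W''_def\<close>)
  moreover have "B'' \<subseteq> W'' j" for j
  proof
    fix b assume b: "b \<in> B''"
    then have "b \<ominus>\<^bsub>U''\<^esub> G \<zero>\<^bsub>U\<^esub> \<in> B''" using G0 sB(2,5) by simp
    then show "b \<in> W'' j" using b sub(4) sW(2) by (auto simp: W''_def)
  qed
  moreover have "W'' j \<subseteq> Z''" for j by (auto simp: W''_def)
  moreover have "W'' (Suc j) \<subseteq> W'' j" for j using W(4)[of j "Suc j"] by (auto simp: W''_def)
  ultimately obtain k'' where k'': "\<And>j. j \<ge> k'' \<Longrightarrow> W'' j = W'' k''" using artinian_betweenD[OF art(2), of W''] by blast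
  define k where "k = max k' k''"
  have "W k \<subseteq> W j" if j: "j \<ge> k" for j
  proof
    fix w assume w: "w \<in> W k"
    have e: "W' j = W' k" "W'' j = W'' k" using k'[of j] k'[of k] k''[of j] k''[of k] j by (auto simp: k_def)
    have wZ: "w \<in> Z" using w W(3) by blast
    have Gw: "G w \<in> carrier U''" using G(1)[OF wZ] s''(1) by blast
    have "G w \<ominus>\<^bsub>U''\<^esub> G w \<in> B''" using sB(2) Gw by (simp add: a_minus_def U''.M.r_neg)
    then have "G w \<in> W'' j" using w G(1)[OF wZ] e by (auto simp: W''_def)
    then obtain v where v: "v \<in> W j" "G w \<ominus>\<^bsub>U''\<^esub> G v \<in> B''" by (auto simp: W''_def)
    have vZ: "v \<in> Z" using v W(3) by blast
    \<comment> \<open>The usual comparison: v has the same image as w on the right, and the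
      difference comes from the left, where the two chain members agree.\<close>
    have wv: "w \<ominus>\<^bsub>U\<^esub> v \<in> W k" using sW(5)[OF w] v(1) W(4)[OF j] by blast
    then obtain z' where z': "z' \<in> Z'" "(w \<ominus>\<^bsub>U\<^esub> v) \<ominus>\<^bsub>U\<^esub> F z' \<in> B"
      using exact[of "w \<ominus>\<^bsub>U\<^esub> v"] v(2) G(4)[OF wZ vZ] W(3) by auto
    have c: "w \<in> carrier U" "v \<in> carrier U" "F z' \<in> carrier U"
      using wZ vZ sub(5) z'(1) s'(1) F'(1) by auto
    have "(w \<ominus>\<^bsub>U\<^esub> v) \<ominus>\<^bsub>U\<^esub> ((w \<ominus>\<^bsub>U\<^esub> v) \<ominus>\<^bsub>U\<^esub> F z') = F z'"
    proof -
      have "x \<ominus>\<^bsub>U\<^esub> (x \<ominus>\<^bsub>U\<^esub> y) = y" if "x \<in> carrier U" "y \<in> carrier U" for x y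
        using that by (simp add: a_minus_def U.M.minus_add U.M.a_assoc[symmetric] U.M.r_neg)
      then show ?thesis using c by simp
    qed
    moreover have "(w \<ominus>\<^bsub>U\<^esub> v) \<ominus>\<^bsub>U\<^esub> ((w \<ominus>\<^bsub>U\<^esub> v) \<ominus>\<^bsub>U\<^esub> F z') \<in> W k" using sW(5)[OF wv] z'(2) W(2) by blast
    ultimately have "z' \<in> W' j" using z'(1) e by (auto simp: W'_def)
    then have "F z' \<in> W j" by (simp add: W'_def)
    then have "((w \<ominus>\<^bsub>U\<^esub> v) \<ominus>\<^bsub>U\<^esub> F z') \<oplus>\<^bsub>U\<^esub> F z' \<oplus>\<^bsub>U\<^esub> v \<in> W j" using sW(3) z'(2) v(1) W(2) by blast
    then show "w \<in> W j" using c by (simp add: a_minus_def U.M.a_assoc U.M.l_neg)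
  qed
  then show "\<exists>k. \<forall>j\<ge>k. W k \<subseteq> W j" by blast
qed

text \<open>Melkersson's criterion for a principal ideal: the images of \<open>(B :\<^bsub>W j\<^esub> r\<^sup>t\<^sup>+\<^sup>1)\<close> under \<open>r\<^sup>t\<close> in
  \<open>(B :\<^bsub>Z\<^esub> r)\<close> form a family that decreases in both indices.\<close>

lemma artinian_between_torsion:
  fixes R :: "('a, 'k) ring_scheme" (structure) and U :: "('a, 'b) module"
  assumes U: "module R U" and r: "r \<in> carrier R" and B: "submodule B R U" and Z: "submodule Z R U"
    and tors: "\<And>z. z \<in> Z \<Longrightarrow> \<exists>k::nat. r [^] k \<odot>\<^bsub>U\<^esub> z \<in> B"
    and art: "artinian_between R U B {z \<in> Z. r \<odot>\<^bsub>U\<^esub> z \<in> B}" and BZ: "B \<subseteq> Z"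
  shows "artinian_between R U B Z"
proof (rule artinian_betweenI)
  interpret rmodule R U unfolding rmodule_def by fact
  fix W :: "nat \<Rightarrow> 'b set"
  assume W: "\<And>j. submodule (W j) R U" "\<And>j. B \<subseteq> W j" "\<And>j. W j \<subseteq> Z" "\<And>i j. i \<le> j \<Longrightarrow> W j \<subseteq> W i"
  note sW = submodule_facts[OF W(1)] and sB = submodule_facts[OF B] and sZ = submodule_facts[OF Z]
  have rt: "r [^] t \<in> carrier R" for t :: nat using r by simp
  \<comment> \<open>Up to B this is r^t applied to those elements of \<open>W j\<close> that r^(t+1)
    sends into B.\<close>
  define V where "V j t = {v \<in> carrier U. \<exists>w\<in>W j. r [^] Suc t \<odot>\<^bsub>U\<^esub> w \<in> B \<and> v \<ominus>\<^bsub>U\<^esub> r [^] t \<odot>\<^bsub>U\<^esub> w \<in> B}" for j t :: nat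
  have sV: "submodule (V j t) R U" for j t
  proof (rule submodule_criterion)
    show "\<zero>\<^bsub>U\<^esub> \<in> V j t" unfolding V_def using sW(2) sB(2) rt rt[of "Suc t"]
      by (auto simp: a_minus_def simp del: R.nat_pow_Suc intro!: bexI[of _ "\<zero>\<^bsub>U\<^esub>"])
    show "a \<oplus>\<^bsub>U\<^esub> b \<in> V j t" if ab: "a \<in> V j t" "b \<in> V j t" for a b
    proof -
      obtain v w where vw: "a \<in> carrier U" "b \<in> carrier U" "v \<in> W j" "w \<in> W j"
        "r [^] Suc t \<odot>\<^bsub>U\<^esub> v \<in> B" "a \<ominus>\<^bsub>U\<^esub> r [^] t \<odot>\<^bsub>U\<^esub> v \<in> B" "r [^] Suc t \<odot>\<^bsub>U\<^esub> w \<in> B" "b \<ominus>\<^bsub>U\<^esub> r [^] t \<odot>\<^bsub>U\<^esub> w \<in> B"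
        using ab unfolding V_def by blast
      have c: "v \<in> carrier U" "w \<in> carrier U" using vw sW(1) by auto
      have "r [^] Suc t \<odot>\<^bsub>U\<^esub> (v \<oplus>\<^bsub>U\<^esub> w) \<in> B"
        using sB(3)[OF vw(5,7)] c rt[of "Suc t"] by (simp add: smult_r_distr del: R.nat_pow_Suc)
      moreover have "(a \<oplus>\<^bsub>U\<^esub> b) \<ominus>\<^bsub>U\<^esub> r [^] t \<odot>\<^bsub>U\<^esub> (v \<oplus>\<^bsub>U\<^esub> w) = (a \<ominus>\<^bsub>U\<^esub> r [^] t \<odot>\<^bsub>U\<^esub> v) \<oplus>\<^bsub>U\<^esub> (b \<ominus>\<^bsub>U\<^esub> r [^] t \<odot>\<^bsub>U\<^esub> w)"
        using c vw rt by (simp add: a_minus_def smult_r_distr M.minus_add M.a_ac)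
      ultimately show ?thesis using vw sW(3)[OF vw(3,4)] sB(3) unfolding V_def by auto
    qed
    show "s \<odot>\<^bsub>U\<^esub> a \<in> V j t" if s: "s \<in> carrier R" "a \<in> V j t" for s a
    proof -
      obtain v where v: "a \<in> carrier U" "v \<in> W j" "r [^] Suc t \<odot>\<^bsub>U\<^esub> v \<in> B" "a \<ominus>\<^bsub>U\<^esub> r [^] t \<odot>\<^bsub>U\<^esub> v \<in> B"
        using s unfolding V_def by blast
      have c: "v \<in> carrier U" using v sW(1) by auto
      have "r [^] Suc t \<odot>\<^bsub>U\<^esub> (s \<odot>\<^bsub>U\<^esub> v) \<in> B"
        using sB(4)[OF s(1) v(3)] c rt[of "Suc t"] s(1) by (simp add: smult_commute del: R.nat_pow_Suc)
      moreover have "s \<odot>\<^bsub>U\<^esub> a \<ominus>\<^bsub>U\<^esub> r [^] t \<odot>\<^bsub>U\<^esub> (s \<odot>\<^bsub>U\<^esub> v) = s \<odot>\<^bsub>U\<^esub> (a \<ominus>\<^bsub>U\<^esub> r [^] t \<odot>\<^bsub>U\<^esub> v)"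
        using c v rt s(1) by (simp add: a_minus_def smult_r_distr smult_r_minus smult_commute[of "r [^] t" s])
      ultimately show ?thesis using v sW(4)[OF s(1) v(2)] sB(4)[OF s(1) v(4)] s(1) unfolding V_def by auto
    qed
  qed (auto simp: V_def)
  have BV: "B \<subseteq> V j t" for j t
  proof
    fix b assume b: "b \<in> B"
    have "r [^] Suc t \<odot>\<^bsub>U\<^esub> \<zero>\<^bsub>U\<^esub> \<in> B" "b \<ominus>\<^bsub>U\<^esub> r [^] t \<odot>\<^bsub>U\<^esub> \<zero>\<^bsub>U\<^esub> \<in> B"
      using b sB(2,5) rt rt[of "Suc t"] by (simp_all del: R.nat_pow_Suc)
    then show "b \<in> V j t" using b sB(1) sW(2) unfolding V_def by blast
  qed
  have VK: "V j t \<subseteq> {z \<in> Z. r \<odot>\<^bsub>U\<^esub> z \<in> B}" for j t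
  proof
    fix v assume "v \<in> V j t"
    then obtain w where w: "v \<in> carrier U" "w \<in> W j" "r [^] Suc t \<odot>\<^bsub>U\<^esub> w \<in> B" "v \<ominus>\<^bsub>U\<^esub> r [^] t \<odot>\<^bsub>U\<^esub> w \<in> B"
      unfolding V_def by blast
    have c: "w \<in> carrier U" using w sW(1) by auto
    have e: "(v \<ominus>\<^bsub>U\<^esub> r [^] t \<odot>\<^bsub>U\<^esub> w) \<oplus>\<^bsub>U\<^esub> r [^] t \<odot>\<^bsub>U\<^esub> w = v"
      using w c rt by (simp add: a_minus_def M.a_assoc M.l_neg)
    have "(v \<ominus>\<^bsub>U\<^esub> r [^] t \<odot>\<^bsub>U\<^esub> w) \<oplus>\<^bsub>U\<^esub> r [^] t \<odot>\<^bsub>U\<^esub> w \<in> Z"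
    proof (rule sZ(3))
      show "v \<ominus>\<^bsub>U\<^esub> r [^] t \<odot>\<^bsub>U\<^esub> w \<in> Z" using w(4) BZ by blast
      show "r [^] t \<odot>\<^bsub>U\<^esub> w \<in> Z" by (rule sZ(4)[OF rt]) (use w(2) W(3) in blast)
    qed
    moreover have "r \<odot>\<^bsub>U\<^esub> ((v \<ominus>\<^bsub>U\<^esub> r [^] t \<odot>\<^bsub>U\<^esub> w) \<oplus>\<^bsub>U\<^esub> r [^] t \<odot>\<^bsub>U\<^esub> w) \<in> B"
    proof -
      have "r \<odot>\<^bsub>U\<^esub> (r [^] t \<odot>\<^bsub>U\<^esub> w) = r [^] Suc t \<odot>\<^bsub>U\<^esub> w"
        using c r by (simp add: smult_assoc1[symmetric] R.m_comm)
      then have "r \<odot>\<^bsub>U\<^esub> (v \<ominus>\<^bsub>U\<^esub> r [^] t \<odot>\<^bsub>U\<^esub> w) \<oplus>\<^bsub>U\<^esub> r \<odot>\<^bsub>U\<^esub> (r [^] t \<odot>\<^bsub>U\<^esub> w) \<in> B"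
        using sB(3)[OF sB(4)[OF r w(4)] w(3)] by simp
      then show ?thesis using c w rt r by (simp add: smult_r_distr)
    qed
    ultimately show "v \<in> {z \<in> Z. r \<odot>\<^bsub>U\<^esub> z \<in> B}" using e by simp
  qed
  have Vj: "V j t \<subseteq> V i t" if "i \<le> j" for i j t
    using W(4)[OF that] unfolding V_def by blast
  have Vt1: "V j (Suc t) \<subseteq> V j t" for j t
  proof
    fix v assume "v \<in> V j (Suc t)"
    then obtain w where w: "v \<in> carrier U" "w \<in> W j" "r [^] Suc (Suc t) \<odot>\<^bsub>U\<^esub> w \<in> B" "v \<ominus>\<^bsub>U\<^esub> r [^] Suc t \<odot>\<^bsub>U\<^esub> w \<in> B"
      unfolding V_def by blast
    have c: "w \<in> carrier U" using w sW(1) by auto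
    have "r [^] Suc t \<odot>\<^bsub>U\<^esub> (r \<odot>\<^bsub>U\<^esub> w) \<in> B" "v \<ominus>\<^bsub>U\<^esub> r [^] t \<odot>\<^bsub>U\<^esub> (r \<odot>\<^bsub>U\<^esub> w) \<in> B"
      using w c r by (simp_all add: smult_assoc1)
    then show "v \<in> V j t" using w(1) sW(4)[OF r w(2)] unfolding V_def by blast
  qed
  have Vt: "V j t \<subseteq> V j s" if "s \<le> t" for j s t
    using lift_Suc_antimono_le[of "V j", OF Vt1 that] .
  have V1: "V (Suc j) t \<subseteq> V j t" for j t by (rule Vj) simp
  have V2: "V (Suc j) (Suc j) \<subseteq> V j j" for j using V1[of j "Suc j"] Vt1[of j j] by (rule subset_trans)
  \<comment> \<open>The diagonal is one descending chain and stabilises at k. It controls all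
    entries with t \<ge> k at once, so only the finitely many chains with t < k need separate
    indices.\<close>
  obtain k where k: "\<And>j. j \<ge> k \<Longrightarrow> V j j = V k k"
    using artinian_betweenD[OF art, of "\<lambda>j. V j j", OF sV BV VK V2] by blast
  have "\<exists>n. \<forall>j\<ge>n. V j t = V n t" for t
    using artinian_betweenD[OF art, of "\<lambda>j. V j t", OF sV BV VK V1] by metis
  then obtain n where n: "\<And>t j. j \<ge> n t \<Longrightarrow> V j t = V (n t) t" by metis
  define N where "N = Max (insert k (n ` {..<k}))"
  have N: "N \<ge> k" "\<And>t. t < k \<Longrightarrow> N \<ge> n t" unfolding N_def by (auto intro: Max_ge)
  have stable: "V j t = V N t" if "j \<ge> N" for j t
  proof (cases "t < k")
    case True
    then show ?thesis using n[of t j] n[of t N] N(2)[OF True] that by simp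
  next
    case False
    \<comment> \<open>The entry is squeezed between the diagonal entries at \<open>max a t\<close>
      and at k.\<close>
    have "V a t = V k k" if "a \<ge> k" for a
    proof
      show "V a t \<subseteq> V k k" using Vj[OF that, of t] Vt[of k t k] False by auto
      have "V (max a t) (max a t) \<subseteq> V a t" using Vj[of a "max a t" "max a t"] Vt[of t "max a t" a] by auto
      then show "V k k \<subseteq> V a t" using k[of "max a t"] that by simp
    qed
    then show ?thesis using that N(1) by simp
  qed
  \<comment> \<open>Stability supplies w' in \<open>W j\<close> with the same image under r^t modulo
    B. Replacing w by w - w' lowers the exponent, and torsion guarantees that some exponent is
    available at the start.\<close>
  have "w \<in> W j" if "j \<ge> N" "w \<in> W N" "r [^] (t::nat) \<odot>\<^bsub>U\<^esub> w \<in> B" for j t w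
    using that
  proof (induction t arbitrary: w)
    case 0
    then have "w \<in> carrier U" using sW(1) by blast
    then show ?case using W(2) 0 by auto
  next
    case (Suc t)
    have c: "w \<in> carrier U" using Suc.prems sW(1) by auto
    have "r [^] t \<odot>\<^bsub>U\<^esub> w \<ominus>\<^bsub>U\<^esub> r [^] t \<odot>\<^bsub>U\<^esub> w \<in> B" using c sB(2) rt by (simp add: a_minus_def M.r_neg)
    then have "r [^] t \<odot>\<^bsub>U\<^esub> w \<in> V N t" using Suc.prems(2,3) c rt unfolding V_def by blast
    then have "r [^] t \<odot>\<^bsub>U\<^esub> w \<in> V j t" using stable[OF Suc.prems(1)] by simp
    then obtain w' where w': "w' \<in> W j" "r [^] t \<odot>\<^bsub>U\<^esub> w \<ominus>\<^bsub>U\<^esub> r [^] t \<odot>\<^bsub>U\<^esub> w' \<in> B" unfolding V_def by blast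
    have c': "w' \<in> carrier U" using w' sW(1) by auto
    have "r [^] t \<odot>\<^bsub>U\<^esub> (w \<ominus>\<^bsub>U\<^esub> w') \<in> B"
      using w'(2) c c' rt by (simp add: a_minus_def smult_r_distr smult_r_minus)
    moreover have "w \<ominus>\<^bsub>U\<^esub> w' \<in> W N" using sW(5)[OF Suc.prems(2)] w'(1) W(4)[OF Suc.prems(1)] by blast
    ultimately have "w \<ominus>\<^bsub>U\<^esub> w' \<in> W j" using Suc.IH Suc.prems(1) by blast
    then have "(w \<ominus>\<^bsub>U\<^esub> w') \<oplus>\<^bsub>U\<^esub> w' \<in> W j" using sW(3) w'(1) by blast
    then show ?case using c c' by (simp add: a_minus_def M.a_assoc M.l_neg)
  qed
  then have "W N \<subseteq> W j" if "j \<ge> N" for j using tors W(3) that by blast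
  then show "\<exists>k. \<forall>j\<ge>k. W k \<subseteq> W j" by blast
qed

section \<open>Artinian cohomology in the long exact sequence\<close>

definition artinian_cohomology ::
    "('a, 'k) ring_scheme \<Rightarrow> ('a, 'b) module \<Rightarrow> 'a list \<Rightarrow> int \<Rightarrow> bool" where
  "artinian_cohomology R N xs i \<longleftrightarrow>
     artinian_between R (cochain_module N) (coboundaries R N xs i) (cocycles R N xs i)"

lemma (in sequence_cohomology) artinian_cohomology_zero:
  assumes "cohomology_zero R M xs i"
  shows "artinian_cohomology R M xs i"
  unfolding artinian_cohomology_def
proof (rule artinian_betweenI)
  fix W :: "nat \<Rightarrow> (nat \<Rightarrow> bool list \<Rightarrow> 'b) set"
  assume "\<And>j. B i \<subseteq> W j" "\<And>j. W j \<subseteq> Z i"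
  then show "\<exists>k. \<forall>j\<ge>k. W k \<subseteq> W j" using assms unfolding cohomology_zero_def by blast
qed

context long_exact
begin

lemma artinian_cohomology_middle:
  assumes "artinian_cohomology R L xs i" "artinian_cohomology R N xs i"
  shows "artinian_cohomology R M xs i"
  unfolding artinian_cohomology_def
proof (rule artinian_between_extension[OF M.T_module L.T_module N.T_module assms[unfolded artinian_cohomology_def]
      L.submodule_cocycles N.submodule_cocycles N.submodule_coboundaries N.coboundaries_subset_cocycles])
  show "M.Z i \<subseteq> carrier M.T" using M.T.submodule_facts(1)[OF M.submodule_cocycles] .
  show "module_morphism R L.T M.T (push f)"
    using module_morphismD[OF f_morphism] by (auto simp: module_morphism_def push_def)
  show "z \<in> L.Z i \<and> push f z \<in> M.B i" if "z \<in> L.B i" for z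
    using that L.coboundaries_subset_cocycles push_coboundaries[OF L_module M_module f_morphism xs_closed] by blast
  show "push g z \<in> N.Z i" if "z \<in> M.Z i" for z
    using push_cocycles[OF M_module N_module g_morphism xs_closed that] .
  have c: "x t \<sigma> \<in> carrier M" if "x \<in> M.Z i" for x t \<sigma> using that M.cochains_closed by (auto simp: cocycles_def)
  note gD = module_morphismD[OF g_morphism]
  show "push g (x \<oplus>\<^bsub>M.T\<^esub> y) = push g x \<oplus>\<^bsub>N.T\<^esub> push g y" if "x \<in> M.Z i" "y \<in> M.Z i" for x y
    using c[OF that(1)] c[OF that(2)] gD by (simp add: push_def)
  show "push g (r \<odot>\<^bsub>M.T\<^esub> x) = r \<odot>\<^bsub>N.T\<^esub> push g x" if "r \<in> carrier R" "x \<in> M.Z i" for r x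
    using c[OF that(2)] that(1) gD by (simp add: push_def)
  show "push g (x \<ominus>\<^bsub>M.T\<^esub> y) = push g x \<ominus>\<^bsub>N.T\<^esub> push g y" if xy: "x \<in> M.Z i" "y \<in> M.Z i" for x y
  proof -
    have "push g x t \<sigma> \<in> carrier N" "push g y t \<sigma> \<in> carrier N" for t \<sigma>
      using c xy gD(1) by (auto simp: push_def)
    then show ?thesis
      using M.T_minus[OF c[OF xy(1)] c[OF xy(2)]] N.T_minus[of "push g x" "push g y"] c xy
        module_morphism_minus[OF M_module N_module g_morphism] by (simp add: push_def)
  qed
  show "\<exists>z'\<in>L.Z i. z \<ominus>\<^bsub>M.T\<^esub> push f z' \<in> M.B i" if "z \<in> M.Z i" "push g z \<in> N.B i" for z
    using exact_middle[OF that] by blast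
qed

lemma connecting_add:
  assumes "connecting i \<Phi> \<Psi>" "connecting i \<Phi>' \<Psi>'"
  shows "connecting i (\<Phi> \<oplus>\<^bsub>N.T\<^esub> \<Phi>') (\<Psi> \<oplus>\<^bsub>L.T\<^esub> \<Psi>')"
proof -
  obtain \<Theta> \<Theta>' where T: "\<Theta> \<in> M.C i" "\<forall>\<^sub>F t in sequentially. push g \<Theta> t = \<Phi> t"
      "\<forall>\<^sub>F t in sequentially. M.\<delta> \<Theta> t = push f \<Psi> t"
    and T': "\<Theta>' \<in> M.C i" "\<forall>\<^sub>F t in sequentially. push g \<Theta>' t = \<Phi>' t"
      "\<forall>\<^sub>F t in sequentially. M.\<delta> \<Theta>' t = push f \<Psi>' t"
    and Z: "\<Phi> \<in> N.Z i" "\<Phi>' \<in> N.Z i" "\<Psi> \<in> L.Z (i + 1)" "\<Psi>' \<in> L.Z (i + 1)"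
    using assms unfolding connecting_def by blast
  have "\<forall>\<^sub>F t in sequentially. push g (\<Theta> \<oplus>\<^bsub>M.T\<^esub> \<Theta>') t = (\<Phi> \<oplus>\<^bsub>N.T\<^esub> \<Phi>') t"
    using T(2) T'(2)
  proof eventually_elim
    case (elim t)
    show ?case
      using fun_cong[OF elim(1)] fun_cong[OF elim(2)] module_morphismD(2)[OF g_morphism]
        M.cochains_closed[OF T(1)] M.cochains_closed[OF T'(1)] by (simp add: push_def)
  qed
  moreover have "\<forall>\<^sub>F t in sequentially. M.\<delta> (\<Theta> \<oplus>\<^bsub>M.T\<^esub> \<Theta>') t = push f (\<Psi> \<oplus>\<^bsub>L.T\<^esub> \<Psi>') t"
    using T(3) T'(3)
  proof eventually_elim
    case (elim t)
    have "\<Psi> t \<sigma> \<in> carrier L" "\<Psi>' t \<sigma> \<in> carrier L" for \<sigma>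
      using Z L.cochains_closed by (auto simp: cocycles_def)
    then show ?case
      unfolding M.cobdry_add[OF T(1) T'(1)]
      using elim module_morphismD(2)[OF f_morphism] by (simp add: push_def)
  qed
  moreover have "\<Theta> \<oplus>\<^bsub>M.T\<^esub> \<Theta>' \<in> M.C i" using M.T.submodule_facts(3)[OF M.submodule_cochains T(1) T'(1)] .
  moreover have "\<Phi> \<oplus>\<^bsub>N.T\<^esub> \<Phi>' \<in> N.Z i" "\<Psi> \<oplus>\<^bsub>L.T\<^esub> \<Psi>' \<in> L.Z (i + 1)"
    using N.T.submodule_facts(3)[OF N.submodule_cocycles Z(1,2)]
      L.T.submodule_facts(3)[OF L.submodule_cocycles Z(3,4)] by auto
  ultimately show ?thesis unfolding connecting_def by blast
qed

lemma connecting_smult: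
  assumes r: "r \<in> carrier R" and "connecting i \<Phi> \<Psi>"
  shows "connecting i (r \<odot>\<^bsub>N.T\<^esub> \<Phi>) (r \<odot>\<^bsub>L.T\<^esub> \<Psi>)"
proof -
  obtain \<Theta> where T: "\<Theta> \<in> M.C i" "\<forall>\<^sub>F t in sequentially. push g \<Theta> t = \<Phi> t"
      "\<forall>\<^sub>F t in sequentially. M.\<delta> \<Theta> t = push f \<Psi> t"
    and Z: "\<Phi> \<in> N.Z i" "\<Psi> \<in> L.Z (i + 1)"
    using assms unfolding connecting_def by blast
  have "\<forall>\<^sub>F t in sequentially. push g (r \<odot>\<^bsub>M.T\<^esub> \<Theta>) t = (r \<odot>\<^bsub>N.T\<^esub> \<Phi>) t"
    using T(2)
  proof eventually_elim
    case (elim t)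
    show ?case
      using fun_cong[OF elim(1)] module_morphismD(3)[OF g_morphism r]
        M.cochains_closed[OF T(1)] by (simp add: push_def)
  qed
  moreover have "\<forall>\<^sub>F t in sequentially. M.\<delta> (r \<odot>\<^bsub>M.T\<^esub> \<Theta>) t = push f (r \<odot>\<^bsub>L.T\<^esub> \<Psi>) t"
    using T(3)
  proof eventually_elim
    case (elim t)
    have "\<Psi> t \<sigma> \<in> carrier L" for \<sigma> using Z L.cochains_closed by (auto simp: cocycles_def)
    then show ?case
      unfolding M.cobdry_smult[OF r T(1)]
      using elim module_morphismD(3)[OF f_morphism r] by (simp add: push_def)
  qed
  moreover have "r \<odot>\<^bsub>M.T\<^esub> \<Theta> \<in> M.C i" using M.T.submodule_facts(4)[OF M.submodule_cochains r T(1)] .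
  moreover have "r \<odot>\<^bsub>N.T\<^esub> \<Phi> \<in> N.Z i" "r \<odot>\<^bsub>L.T\<^esub> \<Psi> \<in> L.Z (i + 1)"
    using N.T.submodule_facts(4)[OF N.submodule_cocycles r Z(1)]
      L.T.submodule_facts(4)[OF L.submodule_cocycles r Z(2)] by auto
  ultimately show ?thesis unfolding connecting_def by blast
qed

text \<open>The kernel of H^(i+1)(L) in H^(i+1)(M) is the image of H^i(N) under the connecting map,
  hence artinian with it.\<close>

lemma artinian_cohomology_kernel:
  assumes "artinian_cohomology R N xs i"
  shows "artinian_between R L.T (L.B (i + 1)) {\<Psi> \<in> L.Z (i + 1). push f \<Psi> \<in> M.B (i + 1)}"
proof (rule artinian_between_relation[where \<rho> = "connecting i", OF N.T_module L.T_module
      assms[unfolded artinian_cohomology_def] N.submodule_cocycles connecting_add connecting_smult])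
  show zero: "connecting i \<zero>\<^bsub>N.T\<^esub> \<zero>\<^bsub>L.T\<^esub>"
    unfolding connecting_def
  proof (intro conjI bexI)
    show "\<zero>\<^bsub>N.T\<^esub> \<in> N.Z i" "\<zero>\<^bsub>L.T\<^esub> \<in> L.Z (i + 1)"
      using N.T.submodule_facts(2)[OF N.submodule_cocycles] L.T.submodule_facts(2)[OF L.submodule_cocycles] by auto
    show "\<zero>\<^bsub>M.T\<^esub> \<in> M.C i" using M.T.submodule_facts(2)[OF M.submodule_cochains] .
    show "\<forall>\<^sub>F t in sequentially. push g \<zero>\<^bsub>M.T\<^esub> t = \<zero>\<^bsub>N.T\<^esub> t"
      using module_morphism_zero[OF M_module N_module g_morphism] by (simp add: push_def)
    have "M.\<delta> \<zero>\<^bsub>M.T\<^esub> t = (\<lambda>_. \<zero>\<^bsub>M\<^esub>)" for t by (rule M.cobdry_zero) simp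
    then show "\<forall>\<^sub>F t in sequentially. M.\<delta> \<zero>\<^bsub>M.T\<^esub> t = push f \<zero>\<^bsub>L.T\<^esub> t"
      using module_morphism_zero[OF L_module M_module f_morphism] by (simp add: push_def)
  qed
  show "z \<in> N.Z i \<and> (\<exists>w\<in>L.B (i + 1). connecting i z w)" if "z \<in> N.B i" for z
    using that N.coboundaries_subset_cocycles connecting_exists connecting_coboundary by (metis subsetD)
  show "\<exists>z\<in>N.Z i. connecting i z w" if w: "w \<in> {\<Psi> \<in> L.Z (i + 1). push f \<Psi> \<in> M.B (i + 1)}" for w
  proof -
    obtain z where z: "connecting i z w" using exact_left[of w i] w by blast
    then have "z \<in> N.Z i" by (simp add: connecting_def)
    then show ?thesis using z by blast
  qed
  \<comment> \<open>Subtracting the two instances of the relation connects z - z = 0 with w - w',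
    and a zero class connects only to a zero class.\<close>
  show "w \<ominus>\<^bsub>L.T\<^esub> w' \<in> L.B (i + 1)" if w: "connecting i z w" "connecting i z w'" for z w w'
  proof -
    have "w' \<in> L.C (i + 1)" "z \<in> N.C i" using w by (auto simp: connecting_def cocycles_def)
    then have e: "w \<oplus>\<^bsub>L.T\<^esub> (\<ominus> \<one>) \<odot>\<^bsub>L.T\<^esub> w' = w \<ominus>\<^bsub>L.T\<^esub> w'"
      "z \<oplus>\<^bsub>N.T\<^esub> (\<ominus> \<one>) \<odot>\<^bsub>N.T\<^esub> z = z \<ominus>\<^bsub>N.T\<^esub> z"
      using L.T_uminus N.T_uminus by (simp_all add: a_minus_def)
    have "z \<in> carrier N.T" using N.T.submodule_facts(1)[OF N.submodule_cochains] \<open>z \<in> N.C i\<close> by blast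
    then have "z \<ominus>\<^bsub>N.T\<^esub> z \<in> N.B i"
      using N.T.submodule_facts(2)[OF N.submodule_coboundaries] N.T.M.r_neg unfolding a_minus_def by metis
    moreover have "connecting i (z \<ominus>\<^bsub>N.T\<^esub> z) (w \<ominus>\<^bsub>L.T\<^esub> w')"
      using connecting_add[OF w(1) connecting_smult[OF _ w(2), of "\<ominus> \<one>"]] e by simp
    ultimately show ?thesis using connecting_coboundary by blast
  qed
  show "{\<Psi> \<in> L.Z (i + 1). push f \<Psi> \<in> M.B (i + 1)} \<subseteq> carrier L.T"
    using L.T.submodule_facts(1)[OF L.submodule_cocycles] by blast
qed

end

section \<open>Prime ideals of noetherian rings\<close>

locale noetherian_cring = cring R for R :: "('a, 'k) ring_scheme" (structure) +
  assumes noetherian: "noetherian_ring R"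
begin

lemma primeidealD:
  assumes "primeideal Q R"
  shows "ideal Q R" "\<one> \<notin> Q" "Q \<subseteq> carrier R"
    "\<And>a b. a \<in> carrier R \<Longrightarrow> b \<in> carrier R \<Longrightarrow> a \<otimes> b \<in> Q \<Longrightarrow> a \<in> Q \<or> b \<in> Q"
    "\<And>a b. a \<in> carrier R - Q \<Longrightarrow> b \<in> carrier R - Q \<Longrightarrow> a \<otimes> b \<in> carrier R - Q"
proof -
  interpret primeideal Q R by fact
  show "ideal Q R" by (rule is_ideal)
  show "\<one> \<notin> Q" using I_notcarr one_imp_carrier by metis
  show "Q \<subseteq> carrier R" by (rule a_subset)
  show "\<And>a b. a \<in> carrier R \<Longrightarrow> b \<in> carrier R \<Longrightarrow> a \<otimes> b \<in> Q \<Longrightarrow> a \<in> Q \<or> b \<in> Q" by (rule I_prime)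
  then show "\<And>a b. a \<in> carrier R - Q \<Longrightarrow> b \<in> carrier R - Q \<Longrightarrow> a \<otimes> b \<in> carrier R - Q" by blast
qed

lemma minus_add_cancel: "a \<in> carrier R \<Longrightarrow> b \<in> carrier R \<Longrightarrow> (a \<ominus> b) \<oplus> b = a"
  by (simp add: a_minus_def a_assoc l_neg)

lemma add_minus_cancel: "a \<in> carrier R \<Longrightarrow> b \<in> carrier R \<Longrightarrow> (a \<oplus> b) \<ominus> b = a"
  by (simp add: a_minus_def a_assoc r_neg)

lemma ideal_maximal:
  assumes "I \<in> \<F>" "\<And>I. I \<in> \<F> \<Longrightarrow> ideal I R"
  obtains J where "J \<in> \<F>" "\<And>J'. J' \<in> \<F> \<Longrightarrow> J \<subset> J' \<Longrightarrow> False"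
  using noetherian_module_maximal[OF noetherian_regular_module[OF is_cring noetherian], of \<F>] assms
  unfolding submodule_regular_iff by (metis empty_iff psubsetE subset_refl)

definition adjoin :: "'a set \<Rightarrow> 'a \<Rightarrow> 'a set" where
  "adjoin I b = {x \<in> carrier R. \<exists>a\<in>I. \<exists>r\<in>carrier R. x = a \<oplus> b \<otimes> r}"

lemma adjoin:
  assumes "ideal I R" "b \<in> carrier R"
  shows "ideal (adjoin I b) R" "I \<subseteq> adjoin I b" "b \<in> adjoin I b"
    "\<And>J. ideal J R \<Longrightarrow> I \<subseteq> J \<Longrightarrow> b \<in> J \<Longrightarrow> adjoin I b \<subseteq> J"
proof -
  note I = ideal_facts[OF assms(1)]
  have mem: "a \<oplus> b \<otimes> r \<in> adjoin I b" if "a \<in> I" "r \<in> carrier R" for a r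
    using that I(1) assms(2) by (auto simp: adjoin_def)
  show "I \<subseteq> adjoin I b" using mem[OF _ zero_closed] I(1) assms(2) by force
  show "b \<in> adjoin I b" using mem[OF I(2) one_closed] assms(2) by simp
  show "adjoin I b \<subseteq> J" if "ideal J R" "I \<subseteq> J" "b \<in> J" for J
    using ideal_facts(3,5)[OF that(1)] that(2,3) by (auto simp: adjoin_def)
  show "ideal (adjoin I b) R"
  proof (rule ideal_criterion)
    show "\<zero> \<in> adjoin I b" using mem[OF I(2) zero_closed] assms(2) by simp
    show "x \<oplus> y \<in> adjoin I b" if xy: "x \<in> adjoin I b" "y \<in> adjoin I b" for x y
    proof -
      obtain u r v s where *: "u \<in> I" "r \<in> carrier R" "x = u \<oplus> b \<otimes> r" "v \<in> I" "s \<in> carrier R" "y = v \<oplus> b \<otimes> s"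
        using xy by (auto simp: adjoin_def)
      have "x \<oplus> y = (u \<oplus> v) \<oplus> b \<otimes> (r \<oplus> s)" using * I(1) assms(2) by (simp add: r_distr a_ac subset_iff)
      then show ?thesis using mem[OF I(3)[OF *(1,4)] a_closed[OF *(2,5)]] by simp
    qed
    show "t \<otimes> x \<in> adjoin I b" if x: "t \<in> carrier R" "x \<in> adjoin I b" for t x
    proof -
      obtain u r where *: "u \<in> I" "r \<in> carrier R" "x = u \<oplus> b \<otimes> r" using x by (auto simp: adjoin_def)
      have "t \<otimes> x = t \<otimes> u \<oplus> b \<otimes> (t \<otimes> r)" using * I(1) assms(2) x by (simp add: r_distr m_lcomm subset_iff)
      then show ?thesis using mem[OF I(4)[OF x(1) *(1)] m_closed[OF x(1) *(2)]] by simp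
    qed
  qed (auto simp: adjoin_def)
qed

lemma not_prime_witness:
  assumes "ideal I R" "\<not> primeideal I R" "I \<noteq> carrier R"
  obtains u v where "u \<in> carrier R" "v \<in> carrier R" "u \<notin> I" "v \<notin> I" "u \<otimes> v \<in> I"
  using ideal.primeidealCE[OF assms(1) is_cring assms(2)] assms(3) by metis

text \<open>The contraction to R of the extension of I to the localization at Q. Ideals equal to
  their saturation stand for ideals of the local ring.\<close>

definition saturation :: "'a set \<Rightarrow> 'a set \<Rightarrow> 'a set" where
  "saturation Q I = {r \<in> carrier R. \<exists>s\<in>carrier R - Q. s \<otimes> r \<in> I}"

lemma saturation:
  assumes Q: "primeideal Q R" and I: "ideal I R"
  shows "ideal (saturation Q I) R" "I \<subseteq> saturation Q I"
    "saturation Q (saturation Q I) \<subseteq> saturation Q I"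
    "\<And>J. I \<subseteq> J \<Longrightarrow> saturation Q I \<subseteq> saturation Q J"
proof -
  note fQ = primeidealD[OF Q] and fI = ideal_facts[OF I]
  show "I \<subseteq> saturation Q I"
    using fI(1) fQ(2) by (auto simp: saturation_def intro!: bexI[of _ \<one>])
  show "saturation Q I \<subseteq> saturation Q J" if "I \<subseteq> J" for J
    using that by (auto simp: saturation_def)
  show "saturation Q (saturation Q I) \<subseteq> saturation Q I"
  proof
    fix r assume "r \<in> saturation Q (saturation Q I)"
    then obtain s t where *: "r \<in> carrier R" "s \<in> carrier R - Q" "t \<in> carrier R - Q" "t \<otimes> (s \<otimes> r) \<in> I"
      by (auto simp: saturation_def)
    then have "(t \<otimes> s) \<otimes> r \<in> I" by (simp add: m_assoc)
    then show "r \<in> saturation Q I" using * fQ(5)[OF *(3,2)] by (auto simp: saturation_def)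
  qed
  show "ideal (saturation Q I) R"
  proof (rule ideal_criterion)
    show "\<zero> \<in> saturation Q I" using fI(2) \<open>I \<subseteq> saturation Q I\<close> by blast
    show "a \<oplus> b \<in> saturation Q I" if ab: "a \<in> saturation Q I" "b \<in> saturation Q I" for a b
    proof -
      obtain s t where *: "a \<in> carrier R" "b \<in> carrier R" "s \<in> carrier R - Q" "t \<in> carrier R - Q"
        "s \<otimes> a \<in> I" "t \<otimes> b \<in> I" using ab by (auto simp: saturation_def)
      have "(s \<otimes> t) \<otimes> (a \<oplus> b) = t \<otimes> (s \<otimes> a) \<oplus> s \<otimes> (t \<otimes> b)"
        using * by (simp add: r_distr m_ac)
      then have "(s \<otimes> t) \<otimes> (a \<oplus> b) \<in> I" using fI(3,4) * by simp
      then show ?thesis using * fQ(5)[OF *(3,4)] by (auto simp: saturation_def)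
    qed
    show "r \<otimes> a \<in> saturation Q I" if ra: "r \<in> carrier R" "a \<in> saturation Q I" for r a
    proof -
      obtain s where *: "a \<in> carrier R" "s \<in> carrier R - Q" "s \<otimes> a \<in> I" using ra by (auto simp: saturation_def)
      have "s \<otimes> (r \<otimes> a) = r \<otimes> (s \<otimes> a)" using * ra by (simp add: m_lcomm)
      then have "s \<otimes> (r \<otimes> a) \<in> I" using fI(4)[OF ra(1) *(3)] by simp
      then show ?thesis using *(1,2) ra(1) unfolding saturation_def by blast
    qed
  qed (auto simp: saturation_def)
qed

text \<open>In the language of localizations: \<open>R\<^sub>Q / I R\<^sub>Q\<close> is an artinian ring.\<close>

lemma saturated_chain_stable:
  assumes Q: "primeideal Q R" and I: "ideal I R"
    and minimal: "\<And>Q'. primeideal Q' R \<Longrightarrow> I \<subseteq> Q' \<Longrightarrow> Q' \<subseteq> Q \<Longrightarrow> Q' = Q"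
    and J: "\<And>n. ideal (J n) R" "\<And>n. saturation Q (J n) \<subseteq> J n" "\<And>n. I \<subseteq> J n" "\<And>n. J (Suc n) \<subseteq> J n"
  shows "\<exists>k. \<forall>n\<ge>k. J n = J k"
proof -
  note fQ = primeidealD[OF Q]
  define chain where "chain I J \<longleftrightarrow> (\<forall>n. ideal (J n) R \<and> saturation Q (J n) \<subseteq> J n \<and> I \<subseteq> J n \<and> J (Suc n) \<subseteq> J n)"
    for I and J :: "nat \<Rightarrow> 'a set"
  define stable where "stable I \<longleftrightarrow> (\<forall>J. chain I J \<longrightarrow> (\<exists>k. \<forall>n\<ge>k. J n = J k))" for I
  define mini where "mini I \<longleftrightarrow> (\<forall>Q'. primeideal Q' R \<longrightarrow> I \<subseteq> Q' \<longrightarrow> Q' \<subseteq> Q \<longrightarrow> Q' = Q)" for I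
  \<comment> \<open>A saturated ideal that contains some s outside Q contains 1. Hence a chain that
    is not constantly R eventually lies inside Q.\<close>
  have everything: "J = carrier R" if "ideal J R" "saturation Q J \<subseteq> J" "s \<in> J" "s \<notin> Q" for J s
  proof -
    have "s \<in> carrier R" using that ideal_facts(1) by blast
    then have "\<one> \<in> saturation Q J" using that by (auto simp: saturation_def intro!: bexI[of _ s])
    then show ?thesis using that ideal.one_imp_carrier by blast
  qed
  have "stable I"
  proof (rule ccontr)
    assume "\<not> stable I"
    \<comment> \<open>Noetherian induction on I: a maximal counterexample K is not prime, because
      the only prime between K and Q is Q, above which every chain inside Q is constant.\<close>
    moreover define F where "F = {I. ideal I R \<and> mini I \<and> \<not> stable I}"
    ultimately have "I \<in> F" using I minimal by (auto simp: mini_def)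
    moreover have "ideal I R" if "I \<in> F" for I using that by (simp add: F_def)
    ultimately obtain K where "K \<in> F" and Kmax: "\<And>K'. K' \<in> F \<Longrightarrow> K \<subset> K' \<Longrightarrow> False"
      using ideal_maximal[of I F] by blast
    then have K: "ideal K R" "mini K" "\<not> stable K" by (simp_all add: F_def)
    have max: "stable K'" if "ideal K' R" "mini K'" "K \<subset> K'" for K'
      using Kmax[of K'] that by (auto simp: F_def)
    note fK = ideal_facts[OF K(1)]
    obtain J where J: "chain K J" "\<not> (\<exists>k. \<forall>n\<ge>k. J n = J k)" using K(3) by (auto simp: stable_def)
    have Jn: "ideal (J n) R" "saturation Q (J n) \<subseteq> J n" "K \<subseteq> J n" "J (Suc n) \<subseteq> J n" for n
      using J(1) by (auto simp: chain_def)
    have anti: "J n \<subseteq> J m" if "m \<le> n" for m n using lift_Suc_antimono_le[of J, OF Jn(4) that] .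
    have nt: "\<exists>n. J n \<noteq> carrier R" using J(2) by metis
    then obtain n\<^sub>0 where n\<^sub>0: "J n\<^sub>0 \<noteq> carrier R" by blast
    have JQ: "J n \<subseteq> Q" if "n \<ge> n\<^sub>0" for n
    proof
      fix s assume "s \<in> J n"
      then have "s \<in> J n\<^sub>0" using anti[OF that] by blast
      then show "s \<in> Q" using everything[OF Jn(1,2)] n\<^sub>0 by blast
    qed
    have KQ: "K \<subseteq> Q" using Jn(3) JQ[of n\<^sub>0] by blast
    have "K \<noteq> Q"
    proof
      assume "K = Q"
      then have "J n = Q" if "n \<ge> n\<^sub>0" for n using JQ[OF that] Jn(3)[of n] by blast
      then have "\<forall>n\<ge>n\<^sub>0. J n = J n\<^sub>0" by simp
      then show False using J(2) by blast
    qed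
    then have "\<not> primeideal K R" using K(2) KQ by (auto simp: mini_def)
    moreover have "K \<noteq> carrier R" using KQ fQ(2) by auto
    ultimately obtain u v where uv: "u \<in> carrier R" "v \<in> carrier R" "u \<notin> K" "v \<notin> K" "u \<otimes> v \<in> K"
      using not_prime_witness[OF K(1)] by blast
    note adj = adjoin[OF K(1) uv(1)]
    have mini_mono: "mini K'" if "K \<subseteq> K'" for K' using that K(2) by (auto simp: mini_def)
    \<comment> \<open>With u v in K and neither factor in K, the ideals K + (u) and (K : u) are both
      strictly larger than K, so chains above them stabilise. They are the two ends of the exact
      sequence of multiplication by u on R/K.\<close>
    have 1: "stable (adjoin K u)"
      by (rule max[OF adj(1) mini_mono]) (use adj(2,3) uv in auto)
    define colon where "colon L = {r \<in> carrier R. r \<otimes> u \<in> L}" for L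
    have colon_ideal: "ideal (colon L) R" if "ideal L R" for L
      using ideal_facts[OF that] uv(1) unfolding colon_def
      by (intro ideal_criterion) (auto simp: l_distr m_assoc)
    have "K \<subseteq> colon K" using fK uv(1) by (auto simp: colon_def)
    moreover have "v \<in> colon K" using uv by (simp add: colon_def m_comm)
    ultimately have 2: "stable (colon K)" by (intro max[OF colon_ideal[OF K(1)] mini_mono]) (use uv in auto)
    have adjJ: "ideal (adjoin (J n) u) R" "J n \<subseteq> adjoin (J n) u" "u \<in> adjoin (J n) u" for n
      using adjoin[OF Jn(1) uv(1)] by auto
    have "chain (adjoin K u) (\<lambda>n. saturation Q (adjoin (J n) u))"
      unfolding chain_def
    proof (intro allI conjI)
      fix n
      note sat = saturation[OF Q adjJ(1)[of n]]
      show "ideal (saturation Q (adjoin (J n) u)) R"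
        "saturation Q (saturation Q (adjoin (J n) u)) \<subseteq> saturation Q (adjoin (J n) u)" by (rule sat)+
      show "adjoin K u \<subseteq> saturation Q (adjoin (J n) u)"
        using adj(4)[OF adjJ(1)] adjJ(2,3) Jn(3) sat(2) by blast
      have "adjoin (J (Suc n)) u \<subseteq> adjoin (J n) u"
        by (rule adjoin(4)[OF Jn(1) uv(1) adjJ(1)]) (use adjJ(2,3) Jn(4) in blast)+
      then show "saturation Q (adjoin (J (Suc n)) u) \<subseteq> saturation Q (adjoin (J n) u)"
        by (rule saturation(4)[OF Q adjJ(1)])
    qed
    then obtain k\<^sub>1 where k\<^sub>1: "\<And>n. n \<ge> k\<^sub>1 \<Longrightarrow> saturation Q (adjoin (J n) u) = saturation Q (adjoin (J k\<^sub>1) u)"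
      using 1 unfolding stable_def by blast
    have "chain (colon K) (\<lambda>n. colon (J n))"
      unfolding chain_def
    proof (intro allI conjI)
      fix n
      show "ideal (colon (J n)) R" by (rule colon_ideal[OF Jn(1)])
      show "colon K \<subseteq> colon (J n)" "colon (J (Suc n)) \<subseteq> colon (J n)" using Jn(3,4)[of n] by (auto simp: colon_def)
      show "saturation Q (colon (J n)) \<subseteq> colon (J n)"
      proof
        fix r assume "r \<in> saturation Q (colon (J n))"
        then obtain s where *: "r \<in> carrier R" "s \<in> carrier R - Q" "s \<otimes> r \<otimes> u \<in> J n" by (auto simp: saturation_def colon_def)
        then have "r \<otimes> u \<in> saturation Q (J n)" using uv(1) by (auto simp: saturation_def m_assoc)
        then show "r \<in> colon (J n)" using Jn(2) * by (auto simp: colon_def)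
      qed
    qed
    then obtain k\<^sub>2 where k\<^sub>2: "\<And>n. n \<ge> k\<^sub>2 \<Longrightarrow> colon (J n) = colon (J k\<^sub>2)"
      using 2 unfolding stable_def by blast
    define k where "k = max k\<^sub>1 k\<^sub>2"
    have "J n = J k" if n: "n \<ge> k" for n
    proof
      show "J n \<subseteq> J k" by (rule anti[OF n])
      show "J k \<subseteq> J n"
      proof
        fix r assume r: "r \<in> J k"
        have e: "saturation Q (adjoin (J n) u) = saturation Q (adjoin (J k) u)" "colon (J n) = colon (J k)"
          using k\<^sub>1[of n] k\<^sub>1[of k] k\<^sub>2[of n] k\<^sub>2[of k] n by (auto simp: k_def)
        have rc: "r \<in> carrier R" using r ideal_facts(1)[OF Jn(1)] by blast
        have "r \<in> saturation Q (adjoin (J n) u)"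
          using e saturation(2)[OF Q adjJ(1)] adjJ(2) r by blast
        then obtain s i t where *: "s \<in> carrier R - Q" "i \<in> J n" "t \<in> carrier R" "s \<otimes> r = i \<oplus> u \<otimes> t"
          by (auto simp: saturation_def adjoin_def)
        have i: "i \<in> carrier R" "i \<in> J k" using * ideal_facts(1)[OF Jn(1)] anti[OF n] by blast+
        \<comment> \<open>The agreement of the ideals J + (u) provides s r = i + u t, and the
          agreement of the ideals (J : u) moves u t into the smaller J.\<close>
        have "u \<otimes> t = s \<otimes> r \<ominus> i" using * i uv(1) by (simp add: a_minus_def a_ac r_neg2)
        also have "\<dots> \<in> J k"
          by (rule ideal_facts(6)[OF Jn(1) ideal_facts(4)[OF Jn(1) _ r] i(2)]) (use * in blast)
        finally have "t \<in> colon (J k)" using * uv(1) by (simp add: colon_def m_comm)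
        then have "u \<otimes> t \<in> J n" using e uv(1) * by (auto simp: colon_def m_comm)
        then have "s \<otimes> r \<in> J n" using * ideal_facts(3)[OF Jn(1)] by simp
        then have "r \<in> saturation Q (J n)" using *(1) rc unfolding saturation_def by blast
        then show "r \<in> J n" using Jn(2) by blast
      qed
    qed
    then show False using J(2) by blast
  qed
  moreover have "chain I J" using J by (simp add: chain_def)
  ultimately show ?thesis by (auto simp: stable_def)
qed

text \<open>A form of Nakayama's lemma for the localization at \<open>Q\<close>.  A submodule that is maximal among the
  proper saturated ones contains \<open>Q N\<close>: otherwise \<open>u \<in> K + R q u\<close> up to a unit, and \<open>1 - r q\<close>
  is a unit.\<close>

lemma nakayama_prime:
  fixes M :: "('a, 'b) module"
  assumes M: "noetherian_module R M" and Q: "primeideal Q R"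
    and N': "submodule N' R M" and N: "submodule N R M"
    and gen: "\<And>u K. u \<in> N \<Longrightarrow> submodule K R M \<Longrightarrow> N' \<subseteq> K \<Longrightarrow> (\<And>q v. q \<in> Q \<Longrightarrow> v \<in> N \<Longrightarrow> q \<odot>\<^bsub>M\<^esub> v \<in> K)
        \<Longrightarrow> \<exists>s\<in>carrier R - Q. s \<odot>\<^bsub>M\<^esub> u \<in> K"
    and u: "u \<in> N"
  shows "\<exists>s\<in>carrier R - Q. s \<odot>\<^bsub>M\<^esub> u \<in> N'"
proof (rule ccontr)
  interpret rmodule R M using M by (simp add: rmodule_def noetherian_module_def)
  note fQ = primeidealD[OF Q] and fN = submodule_facts[OF N]
  assume neg: "\<not> (\<exists>s\<in>carrier R - Q. s \<odot>\<^bsub>M\<^esub> u \<in> N')"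
  define sat where "sat K = {v \<in> carrier M. \<exists>s\<in>carrier R - Q. s \<odot>\<^bsub>M\<^esub> v \<in> K}" for K
  have sat: "submodule (sat K) R M" "K \<subseteq> sat K" "sat (sat K) \<subseteq> sat K" if K: "submodule K R M" for K
  proof -
    note fK = submodule_facts[OF K]
    show 2: "K \<subseteq> sat K" using fK(1) fQ(2) by (auto simp: sat_def intro!: bexI[of _ \<one>])
    show "sat (sat K) \<subseteq> sat K"
    proof
      fix v assume "v \<in> sat (sat K)"
      then obtain s t where *: "v \<in> carrier M" "s \<in> carrier R - Q" "t \<in> carrier R - Q" "t \<odot>\<^bsub>M\<^esub> (s \<odot>\<^bsub>M\<^esub> v) \<in> K"
        by (auto simp: sat_def)
      then have "(t \<otimes> s) \<odot>\<^bsub>M\<^esub> v \<in> K" by (simp add: smult_assoc1)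
      then show "v \<in> sat K" using * fQ(5)[OF *(3,2)] by (auto simp: sat_def)
    qed
    show "submodule (sat K) R M"
    proof (rule submodule_criterion)
      show "\<zero>\<^bsub>M\<^esub> \<in> sat K" using 2 fK(2) by blast
      show "a \<oplus>\<^bsub>M\<^esub> b \<in> sat K" if ab: "a \<in> sat K" "b \<in> sat K" for a b
      proof -
        obtain s t where *: "a \<in> carrier M" "b \<in> carrier M" "s \<in> carrier R - Q" "t \<in> carrier R - Q"
          "s \<odot>\<^bsub>M\<^esub> a \<in> K" "t \<odot>\<^bsub>M\<^esub> b \<in> K" using ab by (auto simp: sat_def)
        have "(s \<otimes> t) \<odot>\<^bsub>M\<^esub> (a \<oplus>\<^bsub>M\<^esub> b) = t \<odot>\<^bsub>M\<^esub> (s \<odot>\<^bsub>M\<^esub> a) \<oplus>\<^bsub>M\<^esub> s \<odot>\<^bsub>M\<^esub> (t \<odot>\<^bsub>M\<^esub> b)"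
          using * by (simp add: smult_r_distr smult_assoc1 smult_commute[of t s])
        then have "(s \<otimes> t) \<odot>\<^bsub>M\<^esub> (a \<oplus>\<^bsub>M\<^esub> b) \<in> K" using fK(3,4) * by simp
        then show ?thesis using * fQ(5)[OF *(3,4)] by (auto simp: sat_def)
      qed
      show "r \<odot>\<^bsub>M\<^esub> a \<in> sat K" if ra: "r \<in> carrier R" "a \<in> sat K" for r a
      proof -
        obtain s where *: "a \<in> carrier M" "s \<in> carrier R - Q" "s \<odot>\<^bsub>M\<^esub> a \<in> K" using ra by (auto simp: sat_def)
        have "s \<odot>\<^bsub>M\<^esub> (r \<odot>\<^bsub>M\<^esub> a) = r \<odot>\<^bsub>M\<^esub> (s \<odot>\<^bsub>M\<^esub> a)" using * ra by (simp add: smult_commute)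
        then have "s \<odot>\<^bsub>M\<^esub> (r \<odot>\<^bsub>M\<^esub> a) \<in> K" using fK(4)[OF ra(1) *(3)] by simp
        then show ?thesis using *(1,2) ra(1) unfolding sat_def by blast
      qed
    qed (auto simp: sat_def)
  qed
  define F where "F = {K. submodule K R M \<and> N' \<subseteq> K \<and> sat K \<subseteq> K \<and> \<not> N \<subseteq> K}"
  have "u \<notin> sat N'" using neg by (simp add: sat_def)
  then have "sat N' \<in> F" using sat[OF N'] u by (auto simp: F_def)
  then have "F \<noteq> {}" by blast
  moreover have "submodule K R M" if "K \<in> F" for K using that by (simp add: F_def)
  ultimately obtain K where KF: "K \<in> F" and max: "\<And>K'. K' \<in> F \<Longrightarrow> K \<subseteq> K' \<Longrightarrow> K' = K"
    using noetherian_module_maximal[OF M, of F] by blast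
  have K: "submodule K R M" "N' \<subseteq> K" "sat K \<subseteq> K" "\<not> N \<subseteq> K" using KF by (auto simp: F_def)
  note fK = submodule_facts[OF K(1)]
  have QN: "q \<odot>\<^bsub>M\<^esub> v \<in> K" if q: "q \<in> Q" and v: "v \<in> N" for q v
  proof (rule ccontr)
    assume qv: "q \<odot>\<^bsub>M\<^esub> v \<notin> K"
    have c: "v \<in> carrier M" "q \<in> carrier R" using v fN(1) q fQ(3) by auto
    define L where "L = {n \<in> carrier M. \<exists>r\<in>carrier R. n \<ominus>\<^bsub>M\<^esub> r \<odot>\<^bsub>M\<^esub> (q \<odot>\<^bsub>M\<^esub> v) \<in> K}"
    have L: "submodule L R M" "K \<subseteq> L" "q \<odot>\<^bsub>M\<^esub> v \<in> L"
      using submodule_add_cyclic[OF K(1), of "q \<odot>\<^bsub>M\<^esub> v"] c unfolding L_def by simp_all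
    note sL = sat[OF L(1)]
    have "sat L \<noteq> K" "K \<subseteq> sat L" using sL(2) L(2,3) qv by auto
    then have "sat L \<notin> F" using max by blast
    then have "N \<subseteq> sat L" using sL K(2) \<open>K \<subseteq> sat L\<close> by (auto simp: F_def)
    then obtain s r where *: "s \<in> carrier R - Q" "r \<in> carrier R" "s \<odot>\<^bsub>M\<^esub> v \<ominus>\<^bsub>M\<^esub> r \<odot>\<^bsub>M\<^esub> (q \<odot>\<^bsub>M\<^esub> v) \<in> K"
      using v by (auto simp: sat_def L_def)
    have "(s \<ominus> r \<otimes> q) \<odot>\<^bsub>M\<^esub> v \<in> K"
      using * c by (simp add: a_minus_def smult_l_distr smult_l_minus smult_assoc1)
    moreover have "s \<ominus> r \<otimes> q \<notin> Q"
    proof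
      note fq = ideal_facts[OF fQ(1)]
      assume "s \<ominus> r \<otimes> q \<in> Q"
      then have "(s \<ominus> r \<otimes> q) \<oplus> r \<otimes> q \<in> Q" using fq(3,4) * q by blast
      then show False using * c by (simp add: minus_add_cancel)
    qed
    ultimately have "v \<in> sat K" using * c by (auto simp: sat_def intro!: bexI[of _ "s \<ominus> r \<otimes> q"])
    then have "v \<in> K" using K(3) by blast
    then show False using qv fK(4) c by blast
  qed
  have "N \<subseteq> K"
  proof
    fix v assume v: "v \<in> N"
    obtain s where "s \<in> carrier R - Q" "s \<odot>\<^bsub>M\<^esub> v \<in> K" using gen[OF v K(1,2) QN] by blast
    then have "v \<in> sat K" using v fN(1) by (auto simp: sat_def)
    then show "v \<in> K" using K(3) by blast
  qed
  then show False using K(4) by blast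
qed

text \<open>Krull's principal ideal theorem, by way of the symbolic powers of \<open>q\<close> modulo \<open>P\<close>.\<close>

lemma principal_ideal_theorem:
  assumes P: "primeideal P R" and q: "primeideal q R" and Q: "primeideal Q R"
    and "P \<subset> q" "q \<subset> Q" and y: "y \<in> Q"
    and minimal: "\<And>Q'. primeideal Q' R \<Longrightarrow> P \<subseteq> Q' \<Longrightarrow> y \<in> Q' \<Longrightarrow> Q' \<subseteq> Q \<Longrightarrow> Q' = Q"
  shows False
proof -
  note fP = primeidealD[OF P] and fq = primeidealD[OF q] and fQ = primeidealD[OF Q]
  note iP = ideal_facts[OF fP(1)] and iq = ideal_facts[OF fq(1)] and iQ = ideal_facts[OF fQ(1)]
  have reg: "noetherian_module R (regular_module R)" by (rule noetherian_regular_module[OF is_cring noetherian])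
  have yc: "y \<in> carrier R" using y fQ(3) by blast
  have yq: "y \<notin> q" using minimal[OF q] \<open>P \<subset> q\<close> \<open>q \<subset> Q\<close> by blast
  \<comment> \<open>This is q J + P.\<close>
  define E where "E J = Idl ({x \<otimes> z | x z. x \<in> q \<and> z \<in> J} \<union> P)" for J
  have E: "ideal (E J) R" "P \<subseteq> E J" "\<And>x z. x \<in> q \<Longrightarrow> z \<in> J \<Longrightarrow> x \<otimes> z \<in> E J"
    "\<And>K. ideal K R \<Longrightarrow> P \<subseteq> K \<Longrightarrow> (\<And>x z. x \<in> q \<Longrightarrow> z \<in> J \<Longrightarrow> x \<otimes> z \<in> K) \<Longrightarrow> E J \<subseteq> K" if "J \<subseteq> carrier R" for J
  proof -
    have c: "{x \<otimes> z | x z. x \<in> q \<and> z \<in> J} \<union> P \<subseteq> carrier R" using that fP(3) fq(3) by auto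
    show "ideal (E J) R" unfolding E_def by (rule genideal_ideal[OF c])
    show "P \<subseteq> E J" "\<And>x z. x \<in> q \<Longrightarrow> z \<in> J \<Longrightarrow> x \<otimes> z \<in> E J" using genideal_self[OF c] unfolding E_def by auto
    show "E J \<subseteq> K" if "ideal K R" "P \<subseteq> K" "\<And>x z. x \<in> q \<Longrightarrow> z \<in> J \<Longrightarrow> x \<otimes> z \<in> K" for K
      unfolding E_def by (rule genideal_minimal[OF that(1)]) (use that(2,3) in auto)
  qed
  \<comment> \<open>The symbolic powers of q modulo P; saturation at q makes them primary to q, so
    elements outside q can be cancelled.\<close>
  define J where "J = rec_nat (carrier R) (\<lambda>_ J. saturation q (E J))"
  have J0: "J 0 = carrier R" and JS: "J (Suc n) = saturation q (E (J n))" for n by (auto simp: J_def)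
  have Ji: "ideal (J n) R" for n
  proof (induction n)
    case 0 then show ?case using J0 oneideal by simp
  next
    case (Suc n)
    then show ?case unfolding JS using saturation(1)[OF q E(1)] ideal_facts(1) by blast
  qed
  note Jc = ideal_facts(1)[OF Ji]
  have Jsat: "saturation q (J n) \<subseteq> J n" for n
  proof (cases n)
    case 0 then show ?thesis using J0 by (auto simp: saturation_def)
  next
    case (Suc m) then show ?thesis using JS saturation(3)[OF q E(1)[OF Jc]] by simp
  qed
  have PJ: "P \<subseteq> J n" for n
  proof (cases n)
    case 0 then show ?thesis using J0 fP(3) by simp
  next
    case (Suc m) then show ?thesis using JS saturation(2)[OF q E(1)[OF Jc]] E(2)[OF Jc] by blast
  qed
  have EJ: "E (J n) \<subseteq> J (Suc n)" for n unfolding JS by (rule saturation(2)[OF q E(1)[OF Jc]])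
  have Jdec: "J (Suc n) \<subseteq> J n" for n
  proof (induction n)
    case 0 then show ?case using Jc J0 by simp
  next
    case (Suc n)
    have "E (J (Suc n)) \<subseteq> E (J n)"
      by (rule E(4)[OF Jc E(1)[OF Jc] E(2)[OF Jc]]) (use E(3)[OF Jc] Suc in blast)
    then have "saturation q (E (J (Suc n))) \<subseteq> saturation q (E (J n))"
      by (rule saturation(4)[OF q E(1)[OF Jc]])
    then show ?case by (simp only: JS)
  qed
  \<comment> \<open>Modulo y the symbolic powers form a chain in the local ring at Q modulo P + (y),
    which is artinian because Q is minimal over that ideal.\<close>
  define I where "I n = saturation Q (adjoin (J n) y)" for n
  have adjJ: "ideal (adjoin (J n) y) R" "J n \<subseteq> adjoin (J n) y" "y \<in> adjoin (J n) y" for n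
    using adjoin[OF Ji yc] by auto
  have "\<exists>k. \<forall>n\<ge>k. I n = I k"
  proof (rule saturated_chain_stable[OF Q adjoin(1)[OF fP(1) yc]])
    show "Q' = Q" if "primeideal Q' R" "adjoin P y \<subseteq> Q'" "Q' \<subseteq> Q" for Q'
      using minimal[OF that(1)] that adjoin(2,3)[OF fP(1) yc] by blast
    show "ideal (I n) R" "saturation Q (I n) \<subseteq> I n" for n
      unfolding I_def by (rule saturation[OF Q adjJ(1)])+
    show "adjoin P y \<subseteq> I n" for n
      using adjoin(4)[OF fP(1) yc adjJ(1)] PJ adjJ(2,3) saturation(2)[OF Q adjJ(1)] unfolding I_def by blast
    have "adjoin (J (Suc n)) y \<subseteq> adjoin (J n) y" for n
      by (rule adjoin(4)[OF Ji yc adjJ(1)]) (use adjJ(2,3) Jdec in blast)+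
    then show "I (Suc n) \<subseteq> I n" for n unfolding I_def by (rule saturation(4)[OF Q adjJ(1)])
  qed
  then obtain k where k: "I (Suc k) = I k" by (metis le_Suc_eq order_refl)
  have step: "r \<in> J (Suc k)" if r: "r \<in> J k" for r
  proof -
    have "\<exists>s\<in>carrier R - Q. s \<odot>\<^bsub>regular_module R\<^esub> r \<in> J (Suc k)"
    proof (rule nakayama_prime[OF reg Q, of "J (Suc k)" "J k"])
      show "submodule (J (Suc k)) R (regular_module R)" "submodule (J k) R (regular_module R)"
        using Ji submodule_regular_iff by auto
      fix v K assume v: "v \<in> J k" and K: "submodule K R (regular_module R)" "J (Suc k) \<subseteq> K"
        and QK: "\<And>x w. x \<in> Q \<Longrightarrow> w \<in> J k \<Longrightarrow> x \<odot>\<^bsub>regular_module R\<^esub> w \<in> K"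
      have iK: "ideal K R" using K(1) submodule_regular_iff by blast
      have "v \<in> I (Suc k)" using v k adjJ(2) saturation(2)[OF Q adjJ(1)] unfolding I_def by blast
      then obtain s w t where *: "s \<in> carrier R - Q" "w \<in> J (Suc k)" "t \<in> carrier R" "s \<otimes> v = w \<oplus> y \<otimes> t"
        by (auto simp: I_def saturation_def adjoin_def)
      have c: "v \<in> carrier R" "w \<in> carrier R" "w \<in> J k" using v * Jc Jdec by blast+
      have "y \<otimes> t = s \<otimes> v \<ominus> w" using * c yc by (simp add: a_minus_def a_ac r_neg2)
      also have "\<dots> \<in> J k"
        by (rule ideal_facts(6)[OF Ji ideal_facts(4)[OF Ji _ v] c(3)]) (use * in blast)
      \<comment> \<open>Since y is outside q, the factor y cancels and t lies in \<open>J k\<close>.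
        Hence \<open>J k\<close> is contained in \<open>J (Suc k)\<close> + Q \<open>J k\<close> at
        Q, as Nakayama requires.\<close>
      finally have "t \<in> saturation q (J k)" using * yc yq by (auto simp: saturation_def)
      then have "t \<in> J k" using Jsat by blast
      then have "s \<otimes> v \<in> K" using * K(2) QK[OF y] ideal_facts(3)[OF iK] by auto
      then show "\<exists>s\<in>carrier R - Q. s \<odot>\<^bsub>regular_module R\<^esub> v \<in> K"
        using *(1) unfolding regular_module_simps by blast
    qed (rule r)
    then obtain s where s: "s \<in> carrier R - Q" "s \<otimes> r \<in> J (Suc k)" by auto
    \<comment> \<open>A multiplier outside Q is also outside q, and \<open>J (Suc k)\<close> is
      saturated at q.\<close>
    then have "r \<in> saturation q (J (Suc k))"
      using r Jc \<open>q \<subset> Q\<close> by (auto simp: saturation_def intro!: bexI[of _ s])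
    then show ?thesis using Jsat by blast
  qed
  have "J k \<subseteq> P"
  proof
    fix r assume r: "r \<in> J k"
    have "\<exists>s\<in>carrier R - q. s \<odot>\<^bsub>regular_module R\<^esub> r \<in> P"
    proof (rule nakayama_prime[OF reg q, of P "J k"])
      show "submodule P R (regular_module R)" "submodule (J k) R (regular_module R)"
        using Ji fP submodule_regular_iff by auto
      fix v K assume v: "v \<in> J k" and K: "submodule K R (regular_module R)" "P \<subseteq> K"
        and qK: "\<And>x w. x \<in> q \<Longrightarrow> w \<in> J k \<Longrightarrow> x \<odot>\<^bsub>regular_module R\<^esub> w \<in> K"
      have "E (J k) \<subseteq> K" by (rule E(4)[OF Jc _ K(2)]) (use K(1) qK submodule_regular_iff in auto)
      moreover have "v \<in> saturation q (E (J k))" using step[OF v] JS by simp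
      ultimately show "\<exists>s\<in>carrier R - q. s \<odot>\<^bsub>regular_module R\<^esub> v \<in> K" by (auto simp: saturation_def)
    qed (rule r)
    then obtain s where "s \<in> carrier R - q" "s \<otimes> r \<in> P" by auto
    then show "r \<in> P" using fP(4)[of s r] r Jc \<open>P \<subset> q\<close> by blast
  qed
  \<comment> \<open>R/P is a domain, so products of elements of q outside P survive in every
    symbolic power.\<close>
  moreover have "\<not> J n \<subseteq> P" for n
  proof (induction n)
    case 0
    then show ?case using J0 fP(2) by auto
  next
    case (Suc n)
    obtain z where z: "z \<in> q" "z \<notin> P" using \<open>P \<subset> q\<close> by blast
    obtain j where j: "j \<in> J n" "j \<notin> P" using Suc by blast
    have "z \<otimes> j \<in> J (Suc n)" using E(3)[OF Jc z(1) j(1)] EJ by blast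
    moreover have "z \<otimes> j \<notin> P" using fP(4)[of z j] z j fq(3) Jc by blast
    ultimately show ?case by blast
  qed
  ultimately show False by blast
qed

section \<open>Minimal primes and prime avoidance\<close>

text \<open>Noetherian induction: if u v lies in a non-prime K, a prime over K contains u or v, so
  the finite sets for K + (u) and K + (v) together serve K. The finite set may contain primes that
  are not minimal.\<close>

lemma finitely_many_minimal_primes:
  assumes "ideal I R"
  shows "\<exists>S. finite S \<and> (\<forall>T\<in>S. primeideal T R \<and> I \<subseteq> T) \<and> (\<forall>Q. primeideal Q R \<longrightarrow> I \<subseteq> Q \<longrightarrow> (\<exists>T\<in>S. T \<subseteq> Q))"
proof (rule ccontr)
  let ?good = "\<lambda>I. \<exists>S. finite S \<and> (\<forall>T\<in>S. primeideal T R \<and> I \<subseteq> T) \<and> (\<forall>Q. primeideal Q R \<longrightarrow> I \<subseteq> Q \<longrightarrow> (\<exists>T\<in>S. T \<subseteq> Q))"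
  assume "\<not> ?good I"
  moreover define F where "F = {I. ideal I R \<and> \<not> ?good I}"
  ultimately have "I \<in> F" using assms by simp
  moreover have "ideal I R" if "I \<in> F" for I using that by (simp add: F_def)
  ultimately obtain K where "K \<in> F" and Kmax: "\<And>K'. K' \<in> F \<Longrightarrow> K \<subset> K' \<Longrightarrow> False"
    using ideal_maximal[of I F] by blast
  then have K: "ideal K R" "\<not> ?good K" by (simp_all add: F_def)
  have max: "?good K'" if "ideal K' R" "K \<subset> K'" for K'
  proof (rule ccontr)
    assume "\<not> ?good K'"
    then have "K' \<in> F" using that(1) by (simp add: F_def)
    then show False using Kmax that(2) by blast
  qed
  have "K \<noteq> carrier R"
  proof
    assume "K = carrier R"
    then have "?good K" using primeidealD(2,3) by (intro exI[of _ "{}"]) auto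
    then show False using K(2) by blast
  qed
  moreover have "\<not> primeideal K R"
  proof
    assume "primeideal K R"
    then have "?good K" by (intro exI[of _ "{K}"]) auto
    then show False using K(2) by blast
  qed
  ultimately obtain u v where uv: "u \<in> carrier R" "v \<in> carrier R" "u \<notin> K" "v \<notin> K" "u \<otimes> v \<in> K"
    using not_prime_witness[OF K(1)] by metis
  note au = adjoin[OF K(1) uv(1)] and av = adjoin[OF K(1) uv(2)]
  obtain S where S: "finite S" "\<And>T. T \<in> S \<Longrightarrow> primeideal T R \<and> adjoin K u \<subseteq> T"
    "\<And>Q. primeideal Q R \<Longrightarrow> adjoin K u \<subseteq> Q \<Longrightarrow> \<exists>T\<in>S. T \<subseteq> Q"
    using max[OF au(1)] au(2,3) uv(3) by blast
  obtain S' where S': "finite S'" "\<And>T. T \<in> S' \<Longrightarrow> primeideal T R \<and> adjoin K v \<subseteq> T"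
    "\<And>Q. primeideal Q R \<Longrightarrow> adjoin K v \<subseteq> Q \<Longrightarrow> \<exists>T\<in>S'. T \<subseteq> Q"
    using max[OF av(1)] av(2,3) uv(4) by blast
  have "\<exists>T\<in>S \<union> S'. T \<subseteq> Q" if Q: "primeideal Q R" "K \<subseteq> Q" for Q
  proof -
    have "u \<in> Q \<or> v \<in> Q" using primeidealD(4)[OF Q(1) uv(1,2)] uv(5) Q(2) by blast
    then have "adjoin K u \<subseteq> Q \<or> adjoin K v \<subseteq> Q" using au(4) av(4) primeidealD(1)[OF Q(1)] Q(2) by blast
    then show ?thesis using S(3)[OF Q(1)] S'(3)[OF Q(1)] by blast
  qed
  then have "?good K" using S(1,2) S'(1,2) au(2) av(2) by (intro exI[of _ "S \<union> S'"]) blast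
  then show False using K(2) by blast
qed

lemma minimal_prime_below:
  assumes "ideal I R" "primeideal Q R" "I \<subseteq> Q"
  obtains Q' where "primeideal Q' R" "I \<subseteq> Q'" "Q' \<subseteq> Q"
    "\<And>Q''. primeideal Q'' R \<Longrightarrow> I \<subseteq> Q'' \<Longrightarrow> Q'' \<subseteq> Q' \<Longrightarrow> Q'' = Q'"
proof -
  obtain S where S: "finite S" "\<And>T. T \<in> S \<Longrightarrow> primeideal T R \<and> I \<subseteq> T"
    "\<And>Q. primeideal Q R \<Longrightarrow> I \<subseteq> Q \<Longrightarrow> \<exists>T\<in>S. T \<subseteq> Q"
    using finitely_many_minimal_primes[OF assms(1)] by blast
  have "finite {T \<in> S. T \<subseteq> Q}" "{T \<in> S. T \<subseteq> Q} \<noteq> {}" using S(1) S(3)[OF assms(2,3)] by auto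
  then obtain Q' where Q': "Q' \<in> S" "Q' \<subseteq> Q" "\<And>T. T \<in> S \<Longrightarrow> T \<subseteq> Q \<Longrightarrow> T \<subseteq> Q' \<Longrightarrow> Q' = T"
    using finite_has_minimal[of "{T \<in> S. T \<subseteq> Q}"] by auto
  have "Q'' = Q'" if "primeideal Q'' R" "I \<subseteq> Q''" "Q'' \<subseteq> Q'" for Q''
    using S(3)[OF that(1,2)] Q' that(3) by blast
  then show ?thesis using that[of Q'] Q'(1,2) S(2) by blast
qed

lemma prime_avoidance:
  assumes "finite S" "\<And>T. T \<in> S \<Longrightarrow> primeideal T R" "ideal I R" "\<And>T. T \<in> S \<Longrightarrow> \<not> I \<subseteq> T"
  shows "\<exists>y\<in>I. \<forall>T\<in>S. y \<notin> T"
  using assms(1,2,4)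
proof (induction "card S" arbitrary: S rule: less_induct)
  case less
  note fI = ideal_facts[OF assms(3)]
  show ?case
  proof (cases "\<exists>T\<in>S. \<exists>T'\<in>S. T \<noteq> T' \<and> T \<subseteq> T'")
    case True
    then obtain T T' where T: "T \<in> S" "T' \<in> S" "T \<noteq> T'" "T \<subseteq> T'" by blast
    have "card (S - {T}) < card S" using less.prems(1) T(1) by (intro card_Diff1_less)
    then obtain y where "y \<in> I" "\<forall>T\<in>S - {T}. y \<notin> T" using less.hyps[of "S - {T}"] less.prems by auto
    then show ?thesis using T by blast
  next
    case antichain: False
    show ?thesis
    proof (cases "S = {}")
      case True
      then show ?thesis using fI(2) by blast
    next
      case False
      then obtain T where T: "T \<in> S" by blast
      note fT = primeidealD[OF less.prems(2)[OF T]]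
      have "card (S - {T}) < card S" using less.prems(1) T by (intro card_Diff1_less)
      then obtain y where y: "y \<in> I" "\<forall>T\<in>S - {T}. y \<notin> T" using less.hyps[of "S - {T}"] less.prems by auto
      \<comment> \<open>In an antichain each other prime has an element outside T; multiplying by
        one of each gives z in I, outside T but inside all the others. If y lies in T, then y + z
        avoids every member.\<close>
      have "\<exists>z\<in>I. z \<notin> T \<and> (\<forall>T'\<in>S'. z \<in> T')" if "finite S'" "S' \<subseteq> S - {T}" for S'
        using that
      proof (induction rule: finite_induct)
        case empty
        then show ?case using less.prems(3)[OF T] by auto
      next
        case (insert T' F)
        have "F \<subseteq> S - {T}" using insert.prems by blast
        from insert.IH[OF this] obtain z where z: "z \<in> I" "z \<notin> T" "\<forall>T'\<in>F. z \<in> T'" by blast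
        have "T' \<in> S" "T' \<noteq> T" using insert.prems by auto
        then have "\<not> T' \<subseteq> T" using antichain T by blast
        then obtain t where t: "t \<in> T'" "t \<notin> T" by blast
        have zt: "z \<in> carrier R" "t \<in> carrier R"
          using z fI(1) t insert.prems less.prems(2)[of T'] primeidealD(3) by auto
        have "z \<otimes> t \<in> I" using fI(5) zt z by blast
        moreover have "z \<otimes> t \<notin> T" using fT(4)[OF zt] z t by blast
        moreover have "z \<otimes> t \<in> T''" if "T'' \<in> insert T' F" for T''
        proof -
          have "primeideal T'' R" using that insert.prems less.prems(2) by blast
          note iT = ideal_facts[OF primeidealD(1)[OF this]]
          show ?thesis
          proof (cases "T'' = T'")
            case True
            then show ?thesis using iT(4) t zt by blast
          next
            case False
            then show ?thesis using iT(5)[of t z] z(3) that zt by blast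
          qed
        qed
        ultimately show ?case by blast
      qed
      then obtain z where z: "z \<in> I" "z \<notin> T" "\<forall>T'\<in>S - {T}. z \<in> T'" using less.prems(1) by blast
      show ?thesis
      proof (cases "y \<in> T")
        case False
        then show ?thesis using y by blast
      next
        case yT: True
        have c: "y \<in> carrier R" "z \<in> carrier R" using y z fI(1) by auto
        have "y \<oplus> z \<notin> T'" if T': "T' \<in> S" for T'
        proof
          note iT = ideal_facts[OF primeidealD(1)[OF less.prems(2)[OF T']]]
          assume m: "y \<oplus> z \<in> T'"
          show False
          proof (cases "T' = T")
            case True
            then have "(y \<oplus> z) \<ominus> y \<in> T" using m yT iT(6) by blast
            moreover have "(y \<oplus> z) \<ominus> y = z" using c by (simp add: a_minus_def a_comm[of y z] a_assoc r_neg)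
            ultimately show False using z by simp
          next
            case False
            then have "(y \<oplus> z) \<ominus> z \<in> T'" using m z T' iT(6) by blast
            moreover have "(y \<oplus> z) \<ominus> z = y" using c by (simp add: a_minus_def a_assoc r_neg)
            ultimately show False using y T' False by simp
          qed
        qed
        then show ?thesis using fI(3) y(1) z(1) by blast
      qed
    qed
  qed
qed

text \<open>Choose y in Q outside the primes minimal over P + (b) that lie properly below Q, and a
  prime Q' minimal over P + (y) inside Q. By the principal ideal theorem nothing lies strictly
  between P and Q'. So Q' differs from Q, which has q below it, and Q' cannot contain b, since then
  one of the avoided primes would lie in between.\<close>

lemma prime_between_avoiding:
  assumes P: "primeideal P R" and q: "primeideal q R" and Q: "primeideal Q R"
    and "P \<subset> q" "q \<subset> Q" and b: "b \<in> carrier R" "b \<notin> P"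
  obtains q' where "primeideal q' R" "P \<subset> q'" "q' \<subset> Q" "b \<notin> q'"
proof (cases "b \<in> q")
  case False
  then show ?thesis using that q assms(4,5) by blast
next
  case True
  note fP = primeidealD[OF P] and fQ = primeidealD[OF Q]
  note ab = adjoin[OF fP(1) b(1)]
  obtain S where S: "finite S" "\<And>T. T \<in> S \<Longrightarrow> primeideal T R \<and> adjoin P b \<subseteq> T"
    "\<And>Q. primeideal Q R \<Longrightarrow> adjoin P b \<subseteq> Q \<Longrightarrow> \<exists>T\<in>S. T \<subseteq> Q"
    using finitely_many_minimal_primes[OF ab(1)] by blast
  define S' where "S' = {T \<in> S. T \<subset> Q}"
  have below: "\<exists>T\<in>S'. T \<subseteq> Q'" if Q': "primeideal Q' R" "P \<subseteq> Q'" "b \<in> Q'" "Q' \<subset> Q" for Q'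
  proof -
    obtain T where "T \<in> S" "T \<subseteq> Q'"
      using S(3)[OF Q'(1) ab(4)[OF primeidealD(1)[OF Q'(1)] Q'(2,3)]] by blast
    then show ?thesis using Q'(4) unfolding S'_def by blast
  qed
  have "\<exists>y\<in>Q. \<forall>T\<in>S'. y \<notin> T"
    by (rule prime_avoidance) (use S fQ(1) in \<open>auto simp: S'_def\<close>)
  then obtain y where y: "y \<in> Q" "\<And>T. T \<in> S' \<Longrightarrow> y \<notin> T" by blast
  have yc: "y \<in> carrier R" using y fQ(3) by blast
  note ay = adjoin[OF fP(1) yc]
  \<comment> \<open>As b is in q, there is at least one avoided prime, and it contains P.\<close>
  have yP: "y \<notin> P"
  proof -
    obtain T where "T \<in> S'" using below[OF q] assms(4,5) True by blast
    then show ?thesis using y(2) S(2) ab(2) by (auto simp: S'_def)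
  qed
  obtain Q' where Q': "primeideal Q' R" "adjoin P y \<subseteq> Q'" "Q' \<subseteq> Q"
    "\<And>Q''. primeideal Q'' R \<Longrightarrow> adjoin P y \<subseteq> Q'' \<Longrightarrow> Q'' \<subseteq> Q' \<Longrightarrow> Q'' = Q'"
    using minimal_prime_below[OF ay(1) Q] ay(4)[OF fQ(1)] y(1) assms(4,5) by blast
  have PQ': "P \<subseteq> Q'" "y \<in> Q'" using Q'(2) ay(2,3) by auto
  have min: "Q'' = Q'" if "primeideal Q'' R" "P \<subseteq> Q''" "y \<in> Q''" "Q'' \<subseteq> Q'" for Q''
    using Q'(4)[OF that(1)] ay(4)[OF primeidealD(1)[OF that(1)] that(2,3)] that(4) by blast
  have "Q' \<noteq> Q"
    using principal_ideal_theorem[OF P q Q assms(4,5) y(1)] min by blast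
  then have Q'Q: "Q' \<subset> Q" using Q'(3) by blast
  moreover have "b \<notin> Q'"
  proof
    assume "b \<in> Q'"
    then obtain T where T: "T \<in> S'" "T \<subseteq> Q'" using below[OF Q'(1) PQ'(1) _ Q'Q] by blast
    have "primeideal T R" "P \<subset> T" "T \<subset> Q'"
      using T S(2) ab(2,3) b(2) y(2)[OF T(1)] PQ'(2) by (auto simp: S'_def)
    then show False using principal_ideal_theorem[OF P _ Q'(1) _ _ PQ'(2)] min by blast
  qed
  moreover have "P \<subset> Q'" using PQ' yP by blast
  ultimately show ?thesis using that Q'(1) by blast
qed

end

section \<open>Cohomological dimension over a local ring\<close>

lemma (in module) smult_diff:
  "r \<in> carrier R \<Longrightarrow> x \<in> carrier M \<Longrightarrow> y \<in> carrier M \<Longrightarrow> r \<odot>\<^bsub>M\<^esub> (x \<ominus>\<^bsub>M\<^esub> y) = r \<odot>\<^bsub>M\<^esub> x \<ominus>\<^bsub>M\<^esub> r \<odot>\<^bsub>M\<^esub> y"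
  by (simp add: a_minus_def smult_r_distr smult_r_minus)

locale noetherian_local = noetherian_cring R for R :: "('a, 'k) ring_scheme" (structure) +
  fixes \<mm> :: "'a set" and xs :: "'a list"
  assumes maximal: "maximalideal \<mm> R" and unique: "\<And>I. maximalideal I R \<Longrightarrow> I = \<mm>"
    and xs_closed: "set xs \<subseteq> carrier R" and generators: "\<mm> = Idl (set xs)"
begin

abbreviation "HZ M i \<equiv> cohomology_zero R M xs i"
abbreviation "RQ \<equiv> quot_module R"

lemma prime_subset_maximal:
  assumes "primeideal P R"
  shows "P \<subseteq> \<mm>"
proof -
  note fP = primeidealD[OF assms]
  define F where "F = {I. ideal I R \<and> P \<subseteq> I \<and> I \<noteq> carrier R}"
  have "P \<in> F" using fP by (auto simp: F_def)
  moreover have "ideal I R" if "I \<in> F" for I using that by (simp add: F_def)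
  ultimately obtain J where J: "J \<in> F" and max: "\<And>J'. J' \<in> F \<Longrightarrow> J \<subset> J' \<Longrightarrow> False"
    using ideal_maximal[of P F] by blast
  have "maximalideal J R"
  proof (rule maximalidealI)
    show "ideal J R" "carrier R \<noteq> J" using J by (auto simp: F_def)
    show "I = J \<or> I = carrier R" if "ideal I R" "J \<subseteq> I" "I \<subseteq> carrier R" for I
      using max[of I] J that by (auto simp: F_def)
  qed
  then show ?thesis using unique J by (auto simp: F_def)
qed

lemma maximal_prime: "primeideal \<mm> R"
  by (rule maximalideal_prime[OF maximal])

lemma prime_eq_maximal:
  assumes "primeideal P R" "set xs \<subseteq> P"
  shows "P = \<mm>"
  using genideal_minimal[OF primeidealD(1)[OF assms(1)] assms(2)] prime_subset_maximal[OF assms(1)] generators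
  by blast

lemma quot_cohomology: "ideal I R \<Longrightarrow> sequence_cohomology R (RQ I) xs"
  by (rule sequence_cohomologyI[OF quot_module_module xs_closed])

lemma cohomology_zero_filtration:
  assumes "noetherian_module R M" "submodule N\<^sub>0 R M" "submodule N\<^sub>1 R M" "N\<^sub>0 \<subseteq> N\<^sub>1"
    and "HZ (M\<lparr>carrier := N\<^sub>0\<rparr>) i"
    and "\<And>Q. primeideal Q R \<Longrightarrow> (\<And>r. r \<in> carrier R \<Longrightarrow> (\<And>x. x \<in> N\<^sub>1 \<Longrightarrow> r \<odot>\<^bsub>M\<^esub> x \<in> N\<^sub>0) \<Longrightarrow> r \<in> Q)
           \<Longrightarrow> HZ (RQ Q) i"
  shows "HZ (M\<lparr>carrier := N\<^sub>1\<rparr>) i"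
proof (rule prime_filtration_induct[OF noetherian assms(1-4), where P = "\<lambda>N. HZ (M\<lparr>carrier := N\<rparr>) i"])
  show "HZ (M\<lparr>carrier := N\<^sub>0\<rparr>) i" by fact
  fix N N' Q g
  assume a: "HZ (M\<lparr>carrier := N\<rparr>) i" "primeideal Q R"
    "\<And>r. r \<in> carrier R \<Longrightarrow> (\<And>x. x \<in> N\<^sub>1 \<Longrightarrow> r \<odot>\<^bsub>M\<^esub> x \<in> N\<^sub>0) \<Longrightarrow> r \<in> Q"
    "short_exact R (M\<lparr>carrier := N\<rparr>) (M\<lparr>carrier := N'\<rparr>) (RQ Q) (\<lambda>x. x) g"
  interpret long_exact R "M\<lparr>carrier := N\<rparr>" "M\<lparr>carrier := N'\<rparr>" "RQ Q" "\<lambda>x. x" g xs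
    by unfold_locales (rule a(4), rule xs_closed)
  show "HZ (M\<lparr>carrier := N'\<rparr>) i" using cohomology_zero_middle a assms(6) by blast
qed

lemma cohomology_zero_zero_module:
  assumes "module R M"
  shows "HZ (M\<lparr>carrier := {\<zero>\<^bsub>M\<^esub>}\<rparr>) i"
proof -
  interpret M: module R M by fact
  interpret sequence_cohomology R "M\<lparr>carrier := {\<zero>\<^bsub>M\<^esub>}\<rparr>" xs
    by (rule sequence_cohomologyI[OF M.submodule_restrict_module[OF M.submodule_zero] xs_closed])
  show ?thesis by (rule cohomology_zero_trivial) simp
qed

lemma cohomology_zero_killed_submodule:
  assumes M: "noetherian_module R M" and N: "submodule N R M"
    and kill: "\<And>r x. r \<in> I \<Longrightarrow> x \<in> N \<Longrightarrow> r \<odot>\<^bsub>M\<^esub> x = \<zero>\<^bsub>M\<^esub>" and "I \<subseteq> carrier R"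
    and "\<And>Q. primeideal Q R \<Longrightarrow> I \<subseteq> Q \<Longrightarrow> HZ (RQ Q) i"
  shows "HZ (M\<lparr>carrier := N\<rparr>) i"
proof -
  have mM: "module R M" using M by (simp add: noetherian_module_def)
  interpret M: module R M by fact
  show ?thesis
  proof (rule cohomology_zero_filtration[OF M M.submodule_zero N _ cohomology_zero_zero_module[OF mM]])
    show "{\<zero>\<^bsub>M\<^esub>} \<subseteq> N" using M.submodule_facts(2)[OF N] by simp
    fix Q assume Q: "primeideal Q R"
      "\<And>r. r \<in> carrier R \<Longrightarrow> (\<And>x. x \<in> N \<Longrightarrow> r \<odot>\<^bsub>M\<^esub> x \<in> {\<zero>\<^bsub>M\<^esub>}) \<Longrightarrow> r \<in> Q"
    have "I \<subseteq> Q"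
    proof
      fix r assume r: "r \<in> I"
      show "r \<in> Q" by (rule Q(2)) (use r assms(4) kill in auto)
    qed
    then show "HZ (RQ Q) i" using assms(5) Q(1) by blast
  qed
qed

lemma cohomology_zero_quot:
  assumes "ideal I R" "\<And>Q. primeideal Q R \<Longrightarrow> I \<subseteq> Q \<Longrightarrow> HZ (RQ Q) i"
  shows "HZ (RQ I) i"
proof -
  interpret module R "RQ I" by (rule quot_module_module) fact
  have "HZ (RQ I\<lparr>carrier := carrier (RQ I)\<rparr>) i"
    by (rule cohomology_zero_killed_submodule[OF noetherian_quot_module[OF noetherian assms(1)] carrier_is_submodule])
      (use quot_module_killed[OF assms(1)] ideal_facts(1)[OF assms(1)] assms(2) in auto)
  then show ?thesis by simp
qed

lemma artinian_cohomology_quot: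
  assumes I: "ideal I R" and *: "\<And>Q i. primeideal Q R \<Longrightarrow> I \<subseteq> Q \<Longrightarrow> artinian_cohomology R (RQ Q) xs i"
  shows "artinian_cohomology R (RQ I) xs i"
proof -
  let ?M = "RQ I"
  interpret U: module R ?M by (rule quot_module_module) fact
  have "artinian_cohomology R (?M\<lparr>carrier := carrier ?M\<rparr>) xs i"
  proof (rule prime_filtration_induct[OF noetherian noetherian_quot_module[OF noetherian I] U.submodule_zero
        U.carrier_is_submodule, where P = "\<lambda>N. artinian_cohomology R (?M\<lparr>carrier := N\<rparr>) xs i"])
    interpret Z: sequence_cohomology R "?M\<lparr>carrier := {\<zero>\<^bsub>?M\<^esub>}\<rparr>" xs
      by (rule sequence_cohomologyI[OF U.submodule_restrict_module[OF U.submodule_zero] xs_closed])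
    show "artinian_cohomology R (?M\<lparr>carrier := {\<zero>\<^bsub>?M\<^esub>}\<rparr>) xs i"
      by (rule Z.artinian_cohomology_zero[OF cohomology_zero_zero_module]) (rule U.module_axioms)
    fix N N' Q g
    assume a: "artinian_cohomology R (?M\<lparr>carrier := N\<rparr>) xs i" "primeideal Q R"
      "\<And>r. r \<in> carrier R \<Longrightarrow> (\<And>x. x \<in> carrier ?M \<Longrightarrow> r \<odot>\<^bsub>?M\<^esub> x \<in> {\<zero>\<^bsub>?M\<^esub>}) \<Longrightarrow> r \<in> Q"
      "short_exact R (?M\<lparr>carrier := N\<rparr>) (?M\<lparr>carrier := N'\<rparr>) (RQ Q) (\<lambda>x. x) g"
    interpret long_exact R "?M\<lparr>carrier := N\<rparr>" "?M\<lparr>carrier := N'\<rparr>" "RQ Q" "\<lambda>x. x" g xs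
      by unfold_locales (rule a(4), rule xs_closed)
    have "I \<subseteq> Q"
    proof
      fix r assume r: "r \<in> I"
      show "r \<in> Q" by (rule a(3)) (use quot_module_killed[OF I r] ideal_facts(1)[OF I] r in auto)
    qed
    then show "artinian_cohomology R (?M\<lparr>carrier := N'\<rparr>) xs i"
      using artinian_cohomology_middle a(1) *[OF a(2)] by blast
  qed auto
  then show ?thesis by simp
qed

lemma prime_quot_cancel:
  assumes P: "primeideal P R" and b: "b \<in> carrier R" "b \<notin> P" and x: "x \<in> carrier (RQ P)"
    and "b \<odot>\<^bsub>RQ P\<^esub> x = \<zero>\<^bsub>RQ P\<^esub>"
  shows "x = \<zero>\<^bsub>RQ P\<^esub>"
proof -
  note fP = primeidealD[OF P]
  obtain a where a: "a \<in> carrier R" "x = coset_rep R P a" using x by (auto simp: quot_module_simps)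
  then have "b \<otimes> a \<in> P"
    using assms(5) quot_module_ops(2)[OF fP(1) a(1) b(1)] coset_rep_zero_iff[OF fP(1), of "b \<otimes> a"] b by simp
  then have "a \<in> P" using fP(4)[OF b(1) a(1)] b(2) by blast
  then show ?thesis using coset_rep_zero_iff[OF fP(1) a(1)] a(2) by simp
qed

text \<open>Multiplication by b is injective because R/P is a domain, and its cokernel is R/(P +
  (b)). Many of the later arguments compare R/P with larger primes through this sequence.\<close>

lemma short_exact_mult:
  assumes P: "primeideal P R" and b: "b \<in> carrier R" "b \<notin> P"
  shows "short_exact R (RQ P) (RQ P) (RQ (adjoin P b)) (\<lambda>x. b \<odot>\<^bsub>RQ P\<^esub> x) (coset_rep R (adjoin P b))"
proof -
  note fP = primeidealD[OF P] and adj = adjoin[OF primeidealD(1)[OF P] b(1)]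
  interpret N: rmodule R "RQ P" unfolding rmodule_def by (rule quot_module_module[OF fP(1)])
  note surj = quot_module_surjection[OF fP(1) adj(1,2)]
  have ker: "coset_rep R (adjoin P b) x = \<zero>\<^bsub>RQ (adjoin P b)\<^esub> \<longleftrightarrow> x \<in> (\<lambda>x. b \<odot>\<^bsub>RQ P\<^esub> x) ` carrier (RQ P)"
    if x: "x \<in> carrier (RQ P)" for x
  proof -
    obtain a where a: "a \<in> carrier R" "x = coset_rep R P a" using x by (auto simp: quot_module_simps)
    have "coset_rep R (adjoin P b) x = \<zero>\<^bsub>RQ (adjoin P b)\<^esub> \<longleftrightarrow> a \<in> adjoin P b"
      using surj(3)[OF a(1)] coset_rep_zero_iff[OF adj(1) a(1)] a(2) by simp
    also have "\<dots> \<longleftrightarrow> (\<exists>r\<in>carrier R. a \<ominus> b \<otimes> r \<in> P)"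
    proof
      assume "a \<in> adjoin P b"
      then obtain p r where *: "p \<in> P" "r \<in> carrier R" "a = p \<oplus> b \<otimes> r" by (auto simp: adjoin_def)
      have "p \<in> carrier R" using * fP(3) by blast
      then have "a \<ominus> b \<otimes> r = p" using * b add_minus_cancel[of p "b \<otimes> r"] by simp
      then show "\<exists>r\<in>carrier R. a \<ominus> b \<otimes> r \<in> P" using * by blast
    next
      assume "\<exists>r\<in>carrier R. a \<ominus> b \<otimes> r \<in> P"
      then obtain r where *: "r \<in> carrier R" "a \<ominus> b \<otimes> r \<in> P" by blast
      then have "a = (a \<ominus> b \<otimes> r) \<oplus> b \<otimes> r" using minus_add_cancel[of a "b \<otimes> r"] a b by simp
      then show "a \<in> adjoin P b" using * a unfolding adjoin_def by blast
    qed
    also have "\<dots> \<longleftrightarrow> (\<exists>r\<in>carrier R. x = b \<odot>\<^bsub>RQ P\<^esub> coset_rep R P r)"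
      using coset_rep_eq_iff[OF fP(1) a(1)] quot_module_ops(2)[OF fP(1) _ b(1)] a b by auto
    also have "\<dots> \<longleftrightarrow> x \<in> (\<lambda>x. b \<odot>\<^bsub>RQ P\<^esub> x) ` carrier (RQ P)" by (auto simp: quot_module_simps)
    finally show ?thesis .
  qed
  have inj: "inj_on (\<lambda>x. b \<odot>\<^bsub>RQ P\<^esub> x) (carrier (RQ P))"
  proof (rule inj_onI)
    fix x y assume xy: "x \<in> carrier (RQ P)" "y \<in> carrier (RQ P)" "b \<odot>\<^bsub>RQ P\<^esub> x = b \<odot>\<^bsub>RQ P\<^esub> y"
    have "b \<odot>\<^bsub>RQ P\<^esub> (x \<ominus>\<^bsub>RQ P\<^esub> y) = b \<odot>\<^bsub>RQ P\<^esub> x \<ominus>\<^bsub>RQ P\<^esub> b \<odot>\<^bsub>RQ P\<^esub> y"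
      using xy b by (simp add: a_minus_def N.smult_r_distr N.smult_r_minus)
    then have "b \<odot>\<^bsub>RQ P\<^esub> (x \<ominus>\<^bsub>RQ P\<^esub> y) = \<zero>\<^bsub>RQ P\<^esub>" using xy b by (simp add: a_minus_def N.M.r_neg)
    then have "x \<ominus>\<^bsub>RQ P\<^esub> y = \<zero>\<^bsub>RQ P\<^esub>" using prime_quot_cancel[OF P b] xy by simp
    then have "(x \<ominus>\<^bsub>RQ P\<^esub> y) \<oplus>\<^bsub>RQ P\<^esub> y = y" using xy by simp
    then show "x = y" using xy by (simp add: a_minus_def N.M.a_assoc N.M.l_neg)
  qed
  have "module_morphism R (RQ P) (RQ P) (\<lambda>x. b \<odot>\<^bsub>RQ P\<^esub> x)"
    using b by (auto simp: module_morphism_def N.smult_r_distr N.smult_commute[of b])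
  then show ?thesis
    unfolding short_exact_def
    using quot_module_module[OF fP(1)] quot_module_module[OF adj(1)] surj(1,2) inj ker b by auto
qed

lemma short_exact_quot:
  assumes I: "ideal I R" and J: "ideal J R" and "I \<subseteq> J"
  obtains K where "submodule K R (RQ I)"
    "short_exact R (RQ I\<lparr>carrier := K\<rparr>) (RQ I) (RQ J) (\<lambda>x. x) (coset_rep R J)"
proof -
  interpret N: module R "RQ I" by (rule quot_module_module[OF I])
  interpret N': module R "RQ J" by (rule quot_module_module[OF J])
  note surj = quot_module_surjection[OF assms]
  define K where "K = {x \<in> carrier (RQ I). coset_rep R J x = \<zero>\<^bsub>RQ J\<^esub>}"
  have K: "submodule K R (RQ I)"
    unfolding K_def using module_morphismD[OF surj(1)] module_morphism_zero[OF N.module_axioms N'.module_axioms surj(1)]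
    by (intro N.submodule_criterion) auto
  have "short_exact R (RQ I\<lparr>carrier := K\<rparr>) (RQ I) (RQ J) (\<lambda>x. x) (coset_rep R J)"
    unfolding short_exact_def
    using N.submodule_restrict_module[OF K] N.module_axioms N'.module_axioms surj(1,2)
    by (auto simp: K_def module_morphism_def)
  then show ?thesis using that K by blast
qed

lemma cohomology_zero_residue: "i \<noteq> 0 \<Longrightarrow> HZ (RQ \<mm>) i"
  and cohomology_not_zero_residue: "\<not> HZ (RQ \<mm>) 0"
proof -
  note fm = primeidealD[OF maximal_prime]
  interpret sequence_cohomology R "RQ \<mm>" xs by (rule quot_cohomology[OF fm(1)])
  have kill: "x \<odot>\<^bsub>RQ \<mm>\<^esub> v = \<zero>\<^bsub>RQ \<mm>\<^esub>" if "x \<in> set xs" "v \<in> carrier (RQ \<mm>)" for x v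
    using quot_module_killed[OF fm(1) _ that(2)] generators genideal_self[OF xs_closed] that(1) by blast
  show "HZ (RQ \<mm>) i" if "i \<noteq> 0"
    using cohomology_zero_killed[OF kill, of i] cohomology_zero_negative[of i] that by (cases "i > 0") auto
  show "\<not> HZ (RQ \<mm>) 0"
  proof (rule cohomology_not_zero_killed[OF kill])
    show "coset_rep R \<mm> \<one> \<in> carrier (RQ \<mm>)" by (auto simp: quot_module_simps)
    show "coset_rep R \<mm> \<one> \<noteq> \<zero>\<^bsub>RQ \<mm>\<^esub>" using coset_rep_zero_iff[OF fm(1) one_closed] fm(2) by simp
  qed
qed

text \<open>The only nonzero cohomology is H^0, the residue field itself, which has no proper
  nonzero submodules.\<close>

lemma artinian_cohomology_residue: "artinian_cohomology R (RQ \<mm>) xs i"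
proof -
  note fm = primeidealD[OF maximal_prime]
  interpret sequence_cohomology R "RQ \<mm>" xs by (rule quot_cohomology[OF fm(1)])
  show ?thesis
  proof (cases "i = 0")
    case False
    then show ?thesis using artinian_cohomology_zero cohomology_zero_residue by blast
  next
    case [simp]: True
    \<comment> \<open>A class outside the coboundaries has a nonzero constant value u in the residue
      field, and every other value is a multiple of u.\<close>
    have all: "W = Z 0" if W: "submodule W R T" "B 0 \<subseteq> W" "W \<subseteq> Z 0" "W \<noteq> B 0" for W
    proof
      show "W \<subseteq> Z 0" by fact
      show "Z 0 \<subseteq> W"
      proof
        fix \<Psi> assume "\<Psi> \<in> Z 0"
        then have \<Psi>: "\<Psi> \<in> C 0" by (simp add: cocycles_def)
        obtain \<Phi> where \<Phi>W: "\<Phi> \<in> W" "\<Phi> \<notin> B 0" using W by blast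
        then have \<Phi>: "\<Phi> \<in> C 0" using W(3) by (auto simp: cocycles_def)
        obtain u where u: "u \<in> carrier (RQ \<mm>)" "\<forall>\<^sub>F t in sequentially. \<Phi> t = constant_cochain u t"
          using cochain_zero_eq_constant[OF \<Phi>] by blast
        obtain v where v: "v \<in> carrier (RQ \<mm>)" "\<forall>\<^sub>F t in sequentially. \<Psi> t = constant_cochain v t"
          using cochain_zero_eq_constant[OF \<Psi>] by blast
        have u0: "u \<noteq> \<zero>\<^bsub>RQ \<mm>\<^esub>"
        proof
          assume "u = \<zero>\<^bsub>RQ \<mm>\<^esub>"
          then have "\<forall>\<^sub>F t in sequentially. \<Phi> t = (\<lambda>_. \<zero>\<^bsub>RQ \<mm>\<^esub>)"
            using u(2) by (simp add: constant_cochain_def)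
          then show False using \<Phi>W(2) coboundaries_eventually_zero[OF \<Phi>] by blast
        qed
        obtain a where a: "a \<in> carrier R" "u = coset_rep R \<mm> a" using u(1) by (auto simp: quot_module_simps)
        obtain c where c: "c \<in> carrier R" "v = coset_rep R \<mm> c" using v(1) by (auto simp: quot_module_simps)
        have am: "a \<notin> \<mm>" using u0 a coset_rep_zero_iff[OF fm(1) a(1)] by simp
        note adj = adjoin[OF fm(1) a(1)]
        have "adjoin \<mm> a = carrier R"
          using maximalideal.I_maximal[OF maximal adj(1,2) ideal_facts(1)[OF adj(1)]] adj(3) am by blast
        then have "c \<in> adjoin \<mm> a" using c by simp
        then obtain p r where pr: "p \<in> \<mm>" "r \<in> carrier R" "c = p \<oplus> a \<otimes> r" by (auto simp: adjoin_def)
        have "p \<in> carrier R" using pr fm(3) by blast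
        then have "c \<ominus> a \<otimes> r = p" using pr a add_minus_cancel[of p "a \<otimes> r"] by simp
        then have "v = r \<odot>\<^bsub>RQ \<mm>\<^esub> u"
          using coset_rep_eq_iff[OF fm(1) c(1), of "a \<otimes> r"] quot_module_ops(2)[OF fm(1) a(1) pr(2)] a c pr
          by (simp add: m_comm)
        then have cv: "constant_cochain v t \<sigma> = r \<odot>\<^bsub>RQ \<mm>\<^esub> constant_cochain u t \<sigma>" for t \<sigma>
          using pr(2) by (simp add: constant_cochain_def)
        have r\<Phi>: "r \<odot>\<^bsub>T\<^esub> \<Phi> \<in> W" using T.submodule_facts(4)[OF W(1) pr(2) \<Phi>W(1)] .
        have r\<Phi>C: "r \<odot>\<^bsub>T\<^esub> \<Phi> \<in> C 0" using T.submodule_facts(4)[OF submodule_cochains pr(2) \<Phi>] .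
        have cl: "\<Psi> t \<sigma> \<in> carrier (RQ \<mm>)" "(r \<odot>\<^bsub>T\<^esub> \<Phi>) t \<sigma> \<in> carrier (RQ \<mm>)" for t \<sigma>
          using cochains_closed[OF \<Psi>] cochains_closed[OF r\<Phi>C] by auto
        have "\<forall>\<^sub>F t in sequentially. (\<Psi> \<ominus>\<^bsub>T\<^esub> r \<odot>\<^bsub>T\<^esub> \<Phi>) t = (\<lambda>_. \<zero>\<^bsub>RQ \<mm>\<^esub>)"
          using u(2) v(2)
        proof eventually_elim
          case (elim t)
          have "\<Psi> t \<sigma> = (r \<odot>\<^bsub>T\<^esub> \<Phi>) t \<sigma>" for \<sigma> using elim cv[of t \<sigma>] by simp
          then show ?case unfolding T_minus[OF cl] using cl by (auto simp: a_minus_def M.r_neg)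
        qed
        then have "\<Psi> \<ominus>\<^bsub>T\<^esub> r \<odot>\<^bsub>T\<^esub> \<Phi> \<in> B 0"
          by (rule coboundaries_eventually_zero[OF T_minus_closed[OF \<Psi> r\<Phi>C]])
        then have "(\<Psi> \<ominus>\<^bsub>T\<^esub> r \<odot>\<^bsub>T\<^esub> \<Phi>) \<oplus>\<^bsub>T\<^esub> r \<odot>\<^bsub>T\<^esub> \<Phi> \<in> W"
          using T.submodule_facts(3)[OF W(1) _ r\<Phi>] W(2) by blast
        moreover have "(\<Psi> \<ominus>\<^bsub>T\<^esub> r \<odot>\<^bsub>T\<^esub> \<Phi>) \<oplus>\<^bsub>T\<^esub> r \<odot>\<^bsub>T\<^esub> \<Phi> = \<Psi>"
          unfolding T_minus[OF cl] using cl by (auto simp: a_minus_def M.a_assoc M.l_neg)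
        ultimately show "\<Psi> \<in> W" by simp
      qed
    qed
    show ?thesis
      unfolding artinian_cohomology_def
    proof (rule artinian_betweenI)
      fix W :: "nat \<Rightarrow> (nat \<Rightarrow> bool list \<Rightarrow> 'a) set"
      assume W: "\<And>j. submodule (W j) R T" "\<And>j. B i \<subseteq> W j" "\<And>j. W j \<subseteq> Z i"
      show "\<exists>k. \<forall>j\<ge>k. W k \<subseteq> W j"
      proof (cases "\<exists>k. W k = B 0")
        case True
        then show ?thesis using W(2) by auto
      next
        case False
        then have "W j = Z 0" for j using all[OF W(1)] W(2,3) by simp
        then show ?thesis by simp
      qed
    qed
  qed
qed

lemma push_smult: "push (\<lambda>x. b \<odot>\<^bsub>N\<^esub> x) \<Phi> = b \<odot>\<^bsub>cochain_module N\<^esub> \<Phi>"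
  by (simp add: push_def)

text \<open>At a maximal counterexample J choose a generator r outside J. The kernel of r on
  H^i(R/J) is a quotient of H^(i-1) of R/(J + (r)), which is artinian because only larger primes
  occur there. Since H^i(R/J) is r-torsion, Melkersson's criterion applies.\<close>

lemma artinian_cohomology_prime:
  assumes "primeideal P R"
  shows "artinian_cohomology R (RQ P) xs i"
proof (rule ccontr)
  define F where "F = {P. primeideal P R \<and> (\<exists>i. \<not> artinian_cohomology R (RQ P) xs i)}"
  assume "\<not> ?thesis"
  then have "P \<in> F" using assms by (auto simp: F_def)
  moreover have "ideal P R" if "P \<in> F" for P using that primeidealD(1) by (auto simp: F_def)
  ultimately obtain J where J: "J \<in> F" and max: "\<And>J'. J' \<in> F \<Longrightarrow> J \<subset> J' \<Longrightarrow> False"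
    using ideal_maximal[of P F] by blast
  have prime: "primeideal J R" using J by (simp add: F_def)
  note fJ = primeidealD[OF prime]
  obtain i where i: "\<not> artinian_cohomology R (RQ J) xs i" using J by (auto simp: F_def)
  have "J \<noteq> \<mm>" using i artinian_cohomology_residue by auto
  then obtain r where r: "r \<in> set xs" "r \<notin> J" using prime_eq_maximal[OF prime] by blast
  have rc: "r \<in> carrier R" using r xs_closed by blast
  note adj = adjoin[OF fJ(1) rc]
  have "artinian_cohomology R (RQ (adjoin J r)) xs j" for j
  proof (rule artinian_cohomology_quot[OF adj(1)])
    fix Q j assume Q: "primeideal Q R" "adjoin J r \<subseteq> Q"
    then have "J \<subset> Q" using adj(2,3) r(2) by blast
    then show "artinian_cohomology R (RQ Q) xs j" using max[of Q] Q(1) by (auto simp: F_def)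
  qed
  note art = this[of "i - 1"]
  interpret long_exact R "RQ J" "RQ J" "RQ (adjoin J r)" "\<lambda>x. r \<odot>\<^bsub>RQ J\<^esub> x" "coset_rep R (adjoin J r)" xs
    by unfold_locales (rule short_exact_mult[OF prime rc r(2)], rule xs_closed)
  have "artinian_between R L.T (L.B i) {\<Psi> \<in> L.Z i. r \<odot>\<^bsub>L.T\<^esub> \<Psi> \<in> L.B i}"
    using artinian_cohomology_kernel[OF art] by (simp add: push_def)
  moreover have "\<exists>k::nat. r [^] k \<odot>\<^bsub>L.T\<^esub> z \<in> L.B i" if z: "z \<in> L.Z i" for z
  proof -
    obtain k :: nat where "r [^] k \<odot>\<^bsub>L.T\<^esub> z \<in> L.B i" by (rule L.torsion[OF r(1) z])
    then show ?thesis by (rule exI)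
  qed
  ultimately have "artinian_between R L.T (L.B i) (L.Z i)"
    by (intro artinian_between_torsion[OF L.T_module rc L.submodule_coboundaries L.submodule_cocycles _ _
        L.coboundaries_subset_cocycles])
  then show False using i by (simp add: artinian_cohomology_def)
qed

section \<open>The top degree of nonvanishing cohomology\<close>

text \<open>The number c(I) of the overview. For I inside the maximal ideal the set contains 0,
  through the residue field, and is bounded by the number of generators.\<close>

definition top_degree :: "'a set \<Rightarrow> int" where
  "top_degree I = Max {i. \<exists>Q. primeideal Q R \<and> I \<subseteq> Q \<and> \<not> HZ (RQ Q) i}"

lemma top_degree:
  assumes "I \<subseteq> \<mm>"
  shows "top_degree I \<ge> 0" "\<exists>Q. primeideal Q R \<and> I \<subseteq> Q \<and> \<not> HZ (RQ Q) (top_degree I)"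
    "\<And>Q i. primeideal Q R \<Longrightarrow> I \<subseteq> Q \<Longrightarrow> i > top_degree I \<Longrightarrow> HZ (RQ Q) i"
    "\<And>Q i. primeideal Q R \<Longrightarrow> I \<subseteq> Q \<Longrightarrow> \<not> HZ (RQ Q) i \<Longrightarrow> i \<le> top_degree I"
proof -
  let ?A = "{i. \<exists>Q. primeideal Q R \<and> I \<subseteq> Q \<and> \<not> HZ (RQ Q) i}"
  have "?A \<subseteq> {0..int (length xs)}"
  proof
    fix i assume "i \<in> ?A"
    then obtain Q where Q: "primeideal Q R" "\<not> HZ (RQ Q) i" by blast
    interpret sequence_cohomology R "RQ Q" xs by (rule quot_cohomology[OF primeidealD(1)[OF Q(1)]])
    show "i \<in> {0..int (length xs)}"
      using cohomology_zero_above[of i] cohomology_zero_negative[of i] Q(2) unfolding atLeastAtMost_iff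
      by linarith
  qed
  then have fin: "finite ?A" by (rule finite_subset) simp
  have 0: "0 \<in> ?A" using maximal_prime cohomology_not_zero_residue assms by blast
  show "top_degree I \<ge> 0" unfolding top_degree_def by (rule Max_ge[OF fin 0])
  show "\<exists>Q. primeideal Q R \<and> I \<subseteq> Q \<and> \<not> HZ (RQ Q) (top_degree I)"
    using Max_in[OF fin] 0 unfolding top_degree_def by blast
  show ub: "i \<le> top_degree I" if "primeideal Q R" "I \<subseteq> Q" "\<not> HZ (RQ Q) i" for Q i
    unfolding top_degree_def by (rule Max_ge[OF fin]) (use that in blast)
  show "HZ (RQ Q) i" if "primeideal Q R" "I \<subseteq> Q" "i > top_degree I" for Q i
    using ub[OF that(1,2)] that(3) by force
qed

lemma top_degree_antimono:
  assumes "I \<subseteq> J" "J \<subseteq> \<mm>"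
  shows "top_degree J \<le> top_degree I"
proof -
  have I: "I \<subseteq> \<mm>" using assms by blast
  obtain Q where Q: "primeideal Q R" "J \<subseteq> Q" "\<not> HZ (RQ Q) (top_degree J)"
    using top_degree(2)[OF assms(2)] by blast
  show ?thesis by (rule top_degree(4)[OF I Q(1) _ Q(3)]) (use Q(2) assms(1) in blast)
qed

end

lemma (in abelian_group) minus_add_self: "x \<in> carrier G \<Longrightarrow> y \<in> carrier G \<Longrightarrow> (x \<ominus> y) \<oplus> y = x"
  by (simp add: a_minus_def a_assoc l_neg)

context noetherian_local
begin

text \<open>Otherwise every b outside P could be replaced by some c b with c outside P and strictly
  smaller c b H, and iterating would give an infinite descending chain in the artinian module H =
  H^i(R/P).\<close>

lemma stable_multiple:
  assumes P: "primeideal P R"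
  obtains b where "b \<in> carrier R" "b \<notin> P"
    "\<And>c \<Phi>. c \<in> carrier R \<Longrightarrow> c \<notin> P \<Longrightarrow> \<Phi> \<in> cocycles R (RQ P) xs i \<Longrightarrow>
       \<exists>\<Psi>\<in>cocycles R (RQ P) xs i. b \<odot>\<^bsub>cochain_module (RQ P)\<^esub> \<Phi> \<ominus>\<^bsub>cochain_module (RQ P)\<^esub>
         (c \<otimes> b) \<odot>\<^bsub>cochain_module (RQ P)\<^esub> \<Psi> \<in> coboundaries R (RQ P) xs i"
proof -
  note fP = primeidealD[OF P]
  interpret sequence_cohomology R "RQ P" xs by (rule quot_cohomology[OF fP(1)])
  \<comment> \<open>The cocycles whose class lies in s H.\<close>
  define W where "W s = {\<Psi> \<in> Z i. \<exists>\<Phi>\<in>Z i. \<Psi> \<ominus>\<^bsub>T\<^esub> s \<odot>\<^bsub>T\<^esub> \<Phi> \<in> B i}" for s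
  note sZ = T.submodule_facts[OF submodule_cocycles[of i]] and sB = T.submodule_facts[OF submodule_coboundaries[of i]]
  have W: "submodule (W s) R T" "B i \<subseteq> W s" "W s \<subseteq> Z i" if s: "s \<in> carrier R" for s
  proof -
    show "W s \<subseteq> Z i" by (auto simp: W_def)
    show BW: "B i \<subseteq> W s"
    proof
      fix \<Psi> assume \<Psi>: "\<Psi> \<in> B i"
      have "\<Psi> \<in> carrier T" using \<Psi> sB(1) by blast
      have "\<Psi> \<ominus>\<^bsub>T\<^esub> s \<odot>\<^bsub>T\<^esub> \<zero>\<^bsub>T\<^esub> \<in> B i"
        unfolding T.smult_r_null[OF s] by (rule sB(5)[OF \<Psi> sB(2)])
      then show "\<Psi> \<in> W s" using \<Psi> sZ(2) coboundaries_subset_cocycles unfolding W_def by force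
    qed
    show "submodule (W s) R T"
    proof (rule T.submodule_criterion)
      show "W s \<subseteq> carrier T" using sZ(1) by (auto simp: W_def)
      show "\<zero>\<^bsub>T\<^esub> \<in> W s" using BW sB(2) by blast
      show "a \<oplus>\<^bsub>T\<^esub> b \<in> W s" if ab: "a \<in> W s" "b \<in> W s" for a b
      proof -
        obtain u v where *: "a \<in> Z i" "b \<in> Z i" "u \<in> Z i" "v \<in> Z i" "a \<ominus>\<^bsub>T\<^esub> s \<odot>\<^bsub>T\<^esub> u \<in> B i" "b \<ominus>\<^bsub>T\<^esub> s \<odot>\<^bsub>T\<^esub> v \<in> B i"
          using ab unfolding W_def by blast
        have c: "a \<in> carrier T" "b \<in> carrier T" "u \<in> carrier T" "v \<in> carrier T" "s \<odot>\<^bsub>T\<^esub> u \<in> carrier T" "s \<odot>\<^bsub>T\<^esub> v \<in> carrier T"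
          using * sZ(1) T.smult_closed[OF s] by blast+
        have "(a \<oplus>\<^bsub>T\<^esub> b) \<ominus>\<^bsub>T\<^esub> s \<odot>\<^bsub>T\<^esub> (u \<oplus>\<^bsub>T\<^esub> v) = (a \<ominus>\<^bsub>T\<^esub> s \<odot>\<^bsub>T\<^esub> u) \<oplus>\<^bsub>T\<^esub> (b \<ominus>\<^bsub>T\<^esub> s \<odot>\<^bsub>T\<^esub> v)"
          using c s by (simp only: a_minus_def T.smult_r_distr T.M.minus_add T.M.a_ac T.M.a_closed T.M.a_inv_closed)
        then have "(a \<oplus>\<^bsub>T\<^esub> b) \<ominus>\<^bsub>T\<^esub> s \<odot>\<^bsub>T\<^esub> (u \<oplus>\<^bsub>T\<^esub> v) \<in> B i" using sB(3)[OF *(5,6)] by simp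
        then show ?thesis using sZ(3)[OF *(1,2)] sZ(3)[OF *(3,4)] unfolding W_def by blast
      qed
      show "r \<odot>\<^bsub>T\<^esub> a \<in> W s" if r: "r \<in> carrier R" "a \<in> W s" for r a
      proof -
        obtain u where *: "a \<in> Z i" "u \<in> Z i" "a \<ominus>\<^bsub>T\<^esub> s \<odot>\<^bsub>T\<^esub> u \<in> B i" using r unfolding W_def by blast
        have c: "a \<in> carrier T" "u \<in> carrier T" "s \<odot>\<^bsub>T\<^esub> u \<in> carrier T"
          using * sZ(1) T.smult_closed[OF s] by blast+
        have "s \<odot>\<^bsub>T\<^esub> (r \<odot>\<^bsub>T\<^esub> u) = r \<odot>\<^bsub>T\<^esub> (s \<odot>\<^bsub>T\<^esub> u)"
          using T.smult_assoc1[OF s r(1) c(2)] T.smult_assoc1[OF r(1) s c(2)] m_comm[OF s r(1)] by simp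
        then have "r \<odot>\<^bsub>T\<^esub> a \<ominus>\<^bsub>T\<^esub> s \<odot>\<^bsub>T\<^esub> (r \<odot>\<^bsub>T\<^esub> u) = r \<odot>\<^bsub>T\<^esub> (a \<ominus>\<^bsub>T\<^esub> s \<odot>\<^bsub>T\<^esub> u)"
          using T.smult_diff[OF r(1) c(1,3)] by (simp only:)
        then have "r \<odot>\<^bsub>T\<^esub> a \<ominus>\<^bsub>T\<^esub> s \<odot>\<^bsub>T\<^esub> (r \<odot>\<^bsub>T\<^esub> u) \<in> B i" using sB(4)[OF r(1) *(3)] by simp
        then show ?thesis using sZ(4)[OF r(1) *(1)] sZ(4)[OF r(1) *(2)] unfolding W_def by blast
      qed
    qed
  qed
  have sub: "W (c \<otimes> s) \<subseteq> W s" if cs: "c \<in> carrier R" "s \<in> carrier R" for c s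
  proof
    fix \<Psi> assume "\<Psi> \<in> W (c \<otimes> s)"
    then obtain \<Phi> where *: "\<Psi> \<in> Z i" "\<Phi> \<in> Z i" "\<Psi> \<ominus>\<^bsub>T\<^esub> (c \<otimes> s) \<odot>\<^bsub>T\<^esub> \<Phi> \<in> B i" unfolding W_def by blast
    have "\<Phi> \<in> carrier T" using * sZ(1) by blast
    then have "(c \<otimes> s) \<odot>\<^bsub>T\<^esub> \<Phi> = s \<odot>\<^bsub>T\<^esub> (c \<odot>\<^bsub>T\<^esub> \<Phi>)"
      using T.smult_assoc1[OF cs(2,1)] m_comm[OF cs] by simp
    then show "\<Psi> \<in> W s" using * sZ(4)[OF cs(1) *(2)] unfolding W_def by auto
  qed
  have "\<exists>b. b \<in> carrier R - P \<and> (\<forall>c\<in>carrier R - P. W b \<subseteq> W (c \<otimes> b))"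
  proof (rule ccontr)
    assume "\<not> ?thesis"
    then have "\<forall>b. \<exists>c. b \<in> carrier R - P \<longrightarrow> c \<in> carrier R - P \<and> \<not> W b \<subseteq> W (c \<otimes> b)" by blast
    then obtain c where c: "\<And>b. b \<in> carrier R - P \<Longrightarrow> c b \<in> carrier R - P"
      "\<And>b. b \<in> carrier R - P \<Longrightarrow> \<not> W b \<subseteq> W (c b \<otimes> b)" by metis
    \<comment> \<open>Starting from 1, each term multiplies the previous one by a factor that
      shrinks the submodule; all terms stay outside the prime P.\<close>
    define b where "b = rec_nat \<one> (\<lambda>_ b. c b \<otimes> b)"
    have b_Suc: "b (Suc n) = c (b n) \<otimes> b n" for n by (simp add: b_def)
    have b: "b n \<in> carrier R - P" for n
    proof (induction n)
      case 0 then show ?case using fP(2) by (simp add: b_def)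
    next
      case (Suc n) then show ?case unfolding b_Suc using fP(5) c(1) by blast
    qed
    have bc: "b n \<in> carrier R" for n using b by blast
    have dec: "W (b (Suc n)) \<subseteq> W (b n)" for n unfolding b_Suc by (rule sub) (use b c(1) in blast)+
    note art = artinian_cohomology_prime[OF P, of i, unfolded artinian_cohomology_def]
    define V where "V n = W (b n)" for n
    have V: "submodule (V j) R T" "B i \<subseteq> V j" "V j \<subseteq> Z i" "V (Suc j) \<subseteq> V j" for j
      unfolding V_def by (rule W[OF bc] dec)+
    obtain k where k: "\<And>j. j \<ge> k \<Longrightarrow> V j = V k" 
      using artinian_betweenD[of R T "B i" "Z i" V, OF art V] by blast
    have "V (Suc k) = V k" by (rule k) simp
    then have "W (b (Suc k)) = W (b k)" by (simp only: V_def)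
    then show False using c(2)[OF b[of k]] b_Suc by simp
  qed
  then obtain b where b: "b \<in> carrier R" "b \<notin> P" "\<And>c. c \<in> carrier R - P \<Longrightarrow> W b \<subseteq> W (c \<otimes> b)" by blast
  have "\<exists>\<Psi>\<in>Z i. b \<odot>\<^bsub>T\<^esub> \<Phi> \<ominus>\<^bsub>T\<^esub> (c \<otimes> b) \<odot>\<^bsub>T\<^esub> \<Psi> \<in> B i" if c: "c \<in> carrier R" "c \<notin> P" and \<Phi>: "\<Phi> \<in> Z i" for c \<Phi>
  proof -
    have b\<Phi>: "b \<odot>\<^bsub>T\<^esub> \<Phi> \<in> Z i" using sZ(4)[OF b(1) \<Phi>] .
    have "b \<odot>\<^bsub>T\<^esub> \<Phi> \<ominus>\<^bsub>T\<^esub> b \<odot>\<^bsub>T\<^esub> \<Phi> \<in> B i"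
    proof -
      have "b \<odot>\<^bsub>T\<^esub> \<Phi> \<in> carrier T" using b\<Phi> sZ(1) by blast
      then have "b \<odot>\<^bsub>T\<^esub> \<Phi> \<ominus>\<^bsub>T\<^esub> b \<odot>\<^bsub>T\<^esub> \<Phi> = \<zero>\<^bsub>T\<^esub>" unfolding a_minus_def by (rule T.M.r_neg)
      then show ?thesis using sB(2) by simp
    qed
    then have "b \<odot>\<^bsub>T\<^esub> \<Phi> \<in> W b" using b\<Phi> \<Phi> unfolding W_def by blast
    then have "b \<odot>\<^bsub>T\<^esub> \<Phi> \<in> W (c \<otimes> b)" using b(3)[of c] c by blast
    then show ?thesis unfolding W_def by blast
  qed
  then show ?thesis using that b(1,2) by blast
qed


text \<open>The top degree of Q is attained at some prime over Q. A strictly larger prime would have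
  at least the same top degree, contrary to the hypothesis.\<close>

lemma cohomology_not_zero_top_degree:
  assumes "primeideal Q R" "\<And>q. primeideal q R \<Longrightarrow> Q \<subset> q \<Longrightarrow> top_degree q < top_degree Q"
  shows "\<not> HZ (RQ Q) (top_degree Q)"
proof -
  obtain Q' where Q': "primeideal Q' R" "Q \<subseteq> Q'" "\<not> HZ (RQ Q') (top_degree Q)"
    using top_degree(2)[OF prime_subset_maximal[OF assms(1)]] by blast
  have "top_degree Q \<le> top_degree Q'"
    by (rule top_degree(4)[OF prime_subset_maximal[OF Q'(1)] Q'(1) subset_refl Q'(3)])
  then have "\<not> Q \<subset> Q'" using assms(2)[OF Q'(1)] by fastforce
  then show ?thesis using Q'(2,3) by (metis psubsetI)
qed

lemma prime_pow_notin:
  assumes "primeideal P R" "r \<in> carrier R - P"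
  shows "r [^] (k::nat) \<in> carrier R - P"
proof (induction k)
  case 0
  then show ?case using primeidealD(2)[OF assms(1)] by simp
next
  case (Suc k)
  then show ?case using primeidealD(5)[OF assms(1) Suc assms(2)] by simp
qed

text \<open>Degree 0 classes are constants killed by a power of a generator outside P, and R/P is a
  domain.\<close>

lemma cohomology_zero_0:
  assumes "primeideal P R" "P \<noteq> \<mm>"
  shows "HZ (RQ P) 0"
  unfolding cohomology_zero_def
proof
  note fP = primeidealD[OF assms(1)]
  interpret sequence_cohomology R "RQ P" xs by (rule quot_cohomology[OF fP(1)])
  obtain r where r: "r \<in> set xs" "r \<notin> P" using prime_eq_maximal[OF assms(1)] assms(2) by blast
  fix \<Phi> assume \<Phi>: "\<Phi> \<in> Z 0"
  then have \<Phi>C: "\<Phi> \<in> C 0" by (simp add: cocycles_def)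
  obtain k :: nat where k: "r [^] k \<odot>\<^bsub>T\<^esub> \<Phi> \<in> B 0" by (rule torsion[OF r(1) \<Phi>])
  have rk: "r [^] k \<in> carrier R" "r [^] k \<notin> P"
    using prime_pow_notin[OF assms(1), of r k] r xs_closed by auto
  have "\<forall>\<^sub>F t in sequentially. (r [^] k \<odot>\<^bsub>T\<^esub> \<Phi>) t = (\<lambda>_. \<zero>\<^bsub>RQ P\<^esub>)"
    using k unfolding coboundaries_0_iff by blast
  then have "\<forall>\<^sub>F t in sequentially. \<Phi> t = (\<lambda>_. \<zero>\<^bsub>RQ P\<^esub>)"
  proof eventually_elim
    case (elim t)
    show ?case
    proof
      fix \<sigma>
      have "r [^] k \<odot>\<^bsub>RQ P\<^esub> \<Phi> t \<sigma> = \<zero>\<^bsub>RQ P\<^esub>" using fun_cong[OF elim, of \<sigma>] by simp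
      then show "\<Phi> t \<sigma> = \<zero>\<^bsub>RQ P\<^esub>" by (rule prime_quot_cancel[OF assms(1) rk cochains_closed[OF \<Phi>C]])
    qed
  qed
  then show "\<Phi> \<in> B 0" by (rule coboundaries_eventually_zero[OF \<Phi>C])
qed

lemma cohomology_zero_submodule_quot:
  assumes "primeideal P R" "submodule K R (RQ P)" "i > top_degree P"
  shows "HZ (RQ P\<lparr>carrier := K\<rparr>) i"
proof -
  note fP = primeidealD[OF assms(1)]
  interpret U: module R "RQ P" by (rule quot_module_module[OF fP(1)])
  show ?thesis
  proof (rule cohomology_zero_killed_submodule[OF noetherian_quot_module[OF noetherian fP(1)] assms(2) _ fP(3)])
    show "r \<odot>\<^bsub>RQ P\<^esub> x = \<zero>\<^bsub>RQ P\<^esub>" if "r \<in> P" "x \<in> K" for r x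
      by (rule quot_module_killed[OF fP(1) that(1)]) (use that(2) U.submodule_facts(1)[OF assms(2)] in blast)
    show "HZ (RQ Q) i" if "primeideal Q R" "P \<subseteq> Q" for Q
      by (rule top_degree(3)[OF prime_subset_maximal[OF assms(1)] that assms(3)])
  qed
qed

text \<open>If the top degree were 0, then H^0 would be right exact on R/P onto the residue field.
  But H^0(R/P) is zero and H^0 of the residue field is not.\<close>

lemma top_degree_pos:
  assumes "primeideal P R" "P \<noteq> \<mm>"
  shows "top_degree P > 0"
proof (rule ccontr)
  assume "\<not> top_degree P > 0"
  then have 0: "top_degree P < 0 + 1" by simp
  have "P \<subseteq> \<mm>" by (rule prime_subset_maximal[OF assms(1)])
  then obtain K where K: "submodule K R (RQ P)"
    "short_exact R (RQ P\<lparr>carrier := K\<rparr>) (RQ P) (RQ \<mm>) (\<lambda>x. x) (coset_rep R \<mm>)"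
    by (rule short_exact_quot[OF primeidealD(1)[OF assms(1)] primeidealD(1)[OF maximal_prime]])
  interpret E: long_exact R "RQ P\<lparr>carrier := K\<rparr>" "RQ P" "RQ \<mm>" "\<lambda>x. x" "coset_rep R \<mm>" xs
    by unfold_locales (rule K(2), rule xs_closed)
  have "HZ (RQ \<mm>) 0"
    by (rule E.cohomology_zero_right[OF cohomology_zero_0[OF assms]
        cohomology_zero_submodule_quot[OF assms(1) K(1) 0]])
  then show False using cohomology_not_zero_residue by blast
qed

lemma top_degree_maximal: "top_degree \<mm> = 0"
proof -
  obtain Q where Q: "primeideal Q R" "\<mm> \<subseteq> Q" "\<not> HZ (RQ Q) (top_degree \<mm>)"
    using top_degree(2)[OF subset_refl] by blast
  have "Q = \<mm>" using prime_subset_maximal[OF Q(1)] Q(2) by blast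
  then show ?thesis using Q(3) cohomology_zero_residue by blast
qed

text \<open>Multiplication by a generator outside \<open>q\<close> is locally nilpotent on \<open>H\<^sup>c(R/q)\<close>, so it is not
  injective there, and its kernel comes from \<open>H\<^sup>c\<^sup>-\<^sup>1\<close> of a proper quotient.\<close>

lemma cohomology_not_zero_above:
  assumes q: "primeideal q R" "q \<noteq> \<mm>" and c: "\<not> HZ (RQ q) c"
  obtains Q where "primeideal Q R" "q \<subset> Q" "\<not> HZ (RQ Q) (c - 1)"
proof -
  note fq = primeidealD[OF q(1)]
  obtain a where a: "a \<in> set xs" "a \<notin> q" using prime_eq_maximal[OF q(1)] q(2) by blast
  have ac: "a \<in> carrier R" using a xs_closed by blast
  note adj = adjoin[OF fq(1) ac]
  interpret E: long_exact R "RQ q" "RQ q" "RQ (adjoin q a)" "\<lambda>x. a \<odot>\<^bsub>RQ q\<^esub> x" "coset_rep R (adjoin q a)" xs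
    by unfold_locales (rule short_exact_mult[OF q(1) ac a(2)], rule xs_closed)
  have "\<not> HZ (RQ (adjoin q a)) (c - 1)"
  proof
    assume hz: "HZ (RQ (adjoin q a)) (c - 1)"
    have inj: "\<Psi> \<in> E.L.B c" if \<Psi>: "\<Psi> \<in> E.L.Z c" and a\<Psi>: "a \<odot>\<^bsub>E.L.T\<^esub> \<Psi> \<in> E.L.B c" for \<Psi>
    proof -
      have e: "c - 1 + 1 = c" by simp
      have p: "push (\<lambda>x. a \<odot>\<^bsub>RQ q\<^esub> x) \<Psi> \<in> E.L.B (c - 1 + 1)" unfolding e push_smult by (rule a\<Psi>)
      have z: "\<Psi> \<in> E.L.Z (c - 1 + 1)" unfolding e by (rule \<Psi>)
      obtain \<Phi> where con: "E.connecting (c - 1) \<Phi> \<Psi>" by (rule E.exact_left[OF z p])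
      then have "\<Phi> \<in> E.N.Z (c - 1)" by (simp add: E.connecting_def)
      then have "\<Phi> \<in> E.N.B (c - 1)" using hz by (auto simp: cohomology_zero_def)
      from E.connecting_coboundary[OF con this] show ?thesis unfolding e .
    qed
    note sZ = E.L.T.submodule_facts[OF E.L.submodule_cocycles[of c]]
    have pow: "\<Psi> \<in> E.L.B c" if "\<Psi> \<in> E.L.Z c" "a [^] k \<odot>\<^bsub>E.L.T\<^esub> \<Psi> \<in> E.L.B c" for \<Psi> and k :: nat
      using that
    proof (induction k arbitrary: \<Psi>)
      case 0
      have "\<Psi> \<in> carrier E.L.T" using 0(1) sZ(1) by blast
      then have "a [^] (0::nat) \<odot>\<^bsub>E.L.T\<^esub> \<Psi> = \<Psi>" unfolding nat_pow_0 by (rule E.L.T.smult_one)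
      then show ?case using 0(2) by (simp only:)
    next
      case (Suc k)
      have "\<Psi> \<in> carrier E.L.T" using Suc(2) sZ(1) by blast
      then have "a [^] Suc k \<odot>\<^bsub>E.L.T\<^esub> \<Psi> = a [^] k \<odot>\<^bsub>E.L.T\<^esub> (a \<odot>\<^bsub>E.L.T\<^esub> \<Psi>)"
        unfolding nat_pow_Suc by (rule E.L.T.smult_assoc1[OF nat_pow_closed[OF ac] ac])
      then have "a [^] k \<odot>\<^bsub>E.L.T\<^esub> (a \<odot>\<^bsub>E.L.T\<^esub> \<Psi>) \<in> E.L.B c" using Suc(3) by (simp only:)
      from Suc(1)[OF sZ(4)[OF ac Suc(2)] this] show ?case by (rule inj[OF Suc(2)])
    qed
    have "HZ (RQ q) c"
      unfolding cohomology_zero_def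
    proof
      fix \<Psi> assume \<Psi>: "\<Psi> \<in> E.L.Z c"
      obtain k :: nat where "a [^] k \<odot>\<^bsub>E.L.T\<^esub> \<Psi> \<in> E.L.B c" by (rule E.L.torsion[OF a(1) \<Psi>])
      then show "\<Psi> \<in> E.L.B c" by (rule pow[OF \<Psi>])
    qed
    then show False using c by blast
  qed
  then obtain Q where Q: "primeideal Q R" "adjoin q a \<subseteq> Q" "\<not> HZ (RQ Q) (c - 1)"
    using cohomology_zero_quot[OF adj(1)] by blast
  have "q \<subset> Q" using Q(2) adj(2,3) a(2) by blast
  then show ?thesis using that Q by blast
qed

text \<open>H^c is right exact here, so a class over R/q lifts to R/P. There b times the lift is y b
  times another class, and y is zero on R/q.\<close>

lemma stable_multiple_kills:
  assumes P: "primeideal P R" and q: "primeideal q R" and y: "P \<subseteq> q" "y \<in> q" "y \<notin> P"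
    and b: "b \<in> carrier R"
    and stable: "\<And>c \<Phi>. c \<in> carrier R \<Longrightarrow> c \<notin> P \<Longrightarrow> \<Phi> \<in> cocycles R (RQ P) xs (top_degree P) \<Longrightarrow>
       \<exists>\<Psi>\<in>cocycles R (RQ P) xs (top_degree P). b \<odot>\<^bsub>cochain_module (RQ P)\<^esub> \<Phi> \<ominus>\<^bsub>cochain_module (RQ P)\<^esub>
         (c \<otimes> b) \<odot>\<^bsub>cochain_module (RQ P)\<^esub> \<Psi> \<in> coboundaries R (RQ P) xs (top_degree P)"
    and \<xi>: "\<xi> \<in> cocycles R (RQ q) xs (top_degree P)"
  shows "b \<odot>\<^bsub>cochain_module (RQ q)\<^esub> \<xi> \<in> coboundaries R (RQ q) xs (top_degree P)"
proof -
  note fP = primeidealD[OF P] and fq = primeidealD[OF q]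
  let ?c = "top_degree P" and ?g = "coset_rep R q"
  obtain K where K: "submodule K R (RQ P)"
    "short_exact R (RQ P\<lparr>carrier := K\<rparr>) (RQ P) (RQ q) (\<lambda>x. x) ?g"
    by (rule short_exact_quot[OF fP(1) fq(1) y(1)])
  interpret E: long_exact R "RQ P\<lparr>carrier := K\<rparr>" "RQ P" "RQ q" "\<lambda>x. x" ?g xs
    by unfold_locales (rule K(2), rule xs_closed)
  have hz: "HZ (RQ P\<lparr>carrier := K\<rparr>) (?c + 1)" by (rule cohomology_zero_submodule_quot[OF P K(1)]) simp
  obtain \<Psi>' where con: "E.connecting ?c \<xi> \<Psi>'" by (rule E.connecting_exists[OF \<xi>])
  then have "\<Psi>' \<in> E.L.B (?c + 1)" using hz by (auto simp: E.connecting_def cohomology_zero_def)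
  then obtain \<Theta> where \<Theta>: "\<Theta> \<in> E.M.Z ?c" "\<forall>\<^sub>F t in sequentially. push ?g \<Theta> t = \<xi> t"
    by (rule E.exact_right[OF con])
  have yc: "y \<in> carrier R" using y(2) fq(3) by blast
  obtain \<Psi> where \<Psi>: "\<Psi> \<in> E.M.Z ?c" and mem: "b \<odot>\<^bsub>E.M.T\<^esub> \<Theta> \<ominus>\<^bsub>E.M.T\<^esub> (y \<otimes> b) \<odot>\<^bsub>E.M.T\<^esub> \<Psi> \<in> E.M.B ?c"
    using stable[OF yc y(3) \<Theta>(1)] by blast
  have yb: "y \<otimes> b \<in> carrier R" "y \<otimes> b \<in> q" using yc b ideal_facts(5)[OF fq(1) b y(2)] by auto
  have C: "\<Theta> \<in> E.M.C ?c" "\<Psi> \<in> E.M.C ?c" "\<xi> \<in> E.N.C ?c" using \<Theta>(1) \<Psi> \<xi> by (auto simp: cocycles_def)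
  note cl = E.M.cochains_closed[OF C(1)] E.M.cochains_closed[OF C(2)]
  have sm: "(b \<odot>\<^bsub>E.M.T\<^esub> \<Theta>) t \<sigma> \<in> carrier (RQ P)" "((y \<otimes> b) \<odot>\<^bsub>E.M.T\<^esub> \<Psi>) t \<sigma> \<in> carrier (RQ P)" for t \<sigma>
    using cl b yb(1) by simp_all
  have push: "push ?g (b \<odot>\<^bsub>E.M.T\<^esub> \<Theta> \<ominus>\<^bsub>E.M.T\<^esub> (y \<otimes> b) \<odot>\<^bsub>E.M.T\<^esub> \<Psi>) \<in> E.N.B ?c"
    by (rule push_coboundaries[OF E.M_module E.N_module E.g_morphism xs_closed mem])
  have "\<forall>\<^sub>F t in sequentially. (b \<odot>\<^bsub>E.N.T\<^esub> \<xi>) t =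
      push ?g (b \<odot>\<^bsub>E.M.T\<^esub> \<Theta> \<ominus>\<^bsub>E.M.T\<^esub> (y \<otimes> b) \<odot>\<^bsub>E.M.T\<^esub> \<Psi>) t"
    using \<Theta>(2)
  proof eventually_elim
    case (elim t)
    show ?case
    proof
      fix \<sigma>
      have kill: "?g ((y \<otimes> b) \<odot>\<^bsub>RQ P\<^esub> \<Psi> t \<sigma>) = \<zero>\<^bsub>RQ q\<^esub>"
        using module_morphismD(3)[OF E.g_morphism yb(1) cl(2)]
          quot_module_killed[OF fq(1) yb(2) module_morphismD(1)[OF E.g_morphism cl(2)]] by simp
      have "?g (b \<odot>\<^bsub>RQ P\<^esub> \<Theta> t \<sigma>) = b \<odot>\<^bsub>RQ q\<^esub> \<xi> t \<sigma>"
        using module_morphismD(3)[OF E.g_morphism b cl(1)] fun_cong[OF elim, of \<sigma>] by (simp add: push_def)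
      moreover have "b \<odot>\<^bsub>RQ q\<^esub> \<xi> t \<sigma> \<in> carrier (RQ q)" using E.N.cochains_closed[OF C(3)] b by simp
      ultimately have "?g (b \<odot>\<^bsub>RQ P\<^esub> \<Theta> t \<sigma> \<ominus>\<^bsub>RQ P\<^esub> (y \<otimes> b) \<odot>\<^bsub>RQ P\<^esub> \<Psi> t \<sigma>) = b \<odot>\<^bsub>RQ q\<^esub> \<xi> t \<sigma>"
        using module_morphism_minus[OF E.M_module E.N_module E.g_morphism, of "b \<odot>\<^bsub>RQ P\<^esub> \<Theta> t \<sigma>"
            "(y \<otimes> b) \<odot>\<^bsub>RQ P\<^esub> \<Psi> t \<sigma>"] cl b yb(1) kill by (simp add: a_minus_def)
      then show "(b \<odot>\<^bsub>E.N.T\<^esub> \<xi>) t \<sigma> = push ?g (b \<odot>\<^bsub>E.M.T\<^esub> \<Theta> \<ominus>\<^bsub>E.M.T\<^esub> (y \<otimes> b) \<odot>\<^bsub>E.M.T\<^esub> \<Psi>) t \<sigma>"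
        unfolding E.M.T_minus[OF sm] by (simp add: push_def)
    qed
  qed
  then show ?thesis
    by (rule E.N.coboundaries_cong[OF E.N.T.submodule_facts(4)[OF E.N.submodule_cochains b C(3)] push])
qed

text \<open>The vanishing over q + (b) makes b surjective on H^i(R/q), while by hypothesis b acts as
  zero.\<close>

lemma cohomology_zero_multiplier:
  assumes q: "primeideal q R" and b: "b \<in> carrier R" "b \<notin> q"
    and hz: "HZ (RQ (adjoin q b)) i"
    and kill: "\<And>\<Phi>. \<Phi> \<in> cocycles R (RQ q) xs i \<Longrightarrow> b \<odot>\<^bsub>cochain_module (RQ q)\<^esub> \<Phi> \<in> coboundaries R (RQ q) xs i"
  shows "HZ (RQ q) i"
  unfolding cohomology_zero_def
proof
  interpret E: long_exact R "RQ q" "RQ q" "RQ (adjoin q b)" "\<lambda>x. b \<odot>\<^bsub>RQ q\<^esub> x" "coset_rep R (adjoin q b)" xs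
    by unfold_locales (rule short_exact_mult[OF q b], rule xs_closed)
  fix \<Phi> assume \<Phi>: "\<Phi> \<in> E.L.Z i"
  have "push (coset_rep R (adjoin q b)) \<Phi> \<in> E.N.Z i"
    by (rule push_cocycles[OF E.M_module E.N_module E.g_morphism xs_closed \<Phi>])
  then have "push (coset_rep R (adjoin q b)) \<Phi> \<in> E.N.B i" using hz by (auto simp: cohomology_zero_def)
  then obtain \<Psi> where \<Psi>: "\<Psi> \<in> E.L.Z i" "\<Phi> \<ominus>\<^bsub>E.L.T\<^esub> push (\<lambda>x. b \<odot>\<^bsub>RQ q\<^esub> x) \<Psi> \<in> E.L.B i"
    by (rule E.exact_middle[OF \<Phi>])
  note sB = E.L.T.submodule_facts[OF E.L.submodule_coboundaries[of i]]
  have b\<Psi>: "b \<odot>\<^bsub>E.L.T\<^esub> \<Psi> \<in> E.L.B i" by (rule kill[OF \<Psi>(1)])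
  have "(\<Phi> \<ominus>\<^bsub>E.L.T\<^esub> b \<odot>\<^bsub>E.L.T\<^esub> \<Psi>) \<oplus>\<^bsub>E.L.T\<^esub> b \<odot>\<^bsub>E.L.T\<^esub> \<Psi> \<in> E.L.B i"
    by (rule sB(3)[OF \<Psi>(2)[unfolded push_smult] b\<Psi>])
  moreover have "\<Phi> \<in> carrier E.L.T" using \<Phi> E.L.T.submodule_facts(1)[OF E.L.submodule_cocycles] by blast
  moreover have "b \<odot>\<^bsub>E.L.T\<^esub> \<Psi> \<in> carrier E.L.T" using b\<Psi> sB(1) by blast
  ultimately show "\<Phi> \<in> E.L.B i" using E.L.T.M.minus_add_self by (simp only:)
qed

theorem top_degree_strict:
  assumes "primeideal P R" "primeideal q R" "P \<subset> q"
  shows "top_degree q < top_degree P"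
proof (rule ccontr)
  define F where "F = {P. primeideal P R \<and> (\<exists>q. primeideal q R \<and> P \<subset> q \<and> \<not> top_degree q < top_degree P)}"
  assume "\<not> ?thesis"
  then have "P \<in> F" using assms by (auto simp: F_def)
  moreover have "ideal I R" if "I \<in> F" for I using that primeidealD(1) by (auto simp: F_def)
  ultimately obtain J where J: "J \<in> F" and max: "\<And>J'. J' \<in> F \<Longrightarrow> J \<subset> J' \<Longrightarrow> False"
    using ideal_maximal[of P F] by blast
  have prime: "primeideal J R" using J by (simp add: F_def)
  \<comment> \<open>Maximality of J gives the strict drop for all pairs of primes above J; only
    pairs that start at J itself remain in question.\<close>
  have strict: "top_degree q' < top_degree q" if "primeideal q R" "primeideal q' R" "J \<subset> q" "q \<subset> q'" for q q'
    using max[of q] that by (auto simp: F_def)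
  have attained: "\<not> HZ (RQ q) (top_degree q)" if "primeideal q R" "J \<subset> q" for q
    by (rule cohomology_not_zero_top_degree[OF that(1) strict[OF that(1) _ that(2)]])
  have Jm: "J \<subseteq> \<mm>" by (rule prime_subset_maximal[OF prime])
  let ?c = "top_degree J"
  have le: "top_degree q \<le> ?c" if "primeideal q R" "J \<subset> q" for q
    by (rule top_degree_antimono) (use that prime_subset_maximal in auto)
  obtain q where q: "primeideal q R" "J \<subset> q" "\<not> top_degree q < ?c" using J unfolding F_def by blast
  then have qc: "top_degree q = ?c" using le[OF q(1,2)] by simp
  have "J \<noteq> \<mm>" using prime_subset_maximal[OF q(1)] q(2) by blast
  then have "?c > 0" by (rule top_degree_pos[OF prime])
  then have "q \<noteq> \<mm>" using qc top_degree_maximal by auto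
  then obtain Q where Q: "primeideal Q R" "q \<subset> Q" "\<not> HZ (RQ Q) (?c - 1)"
    by (rule cohomology_not_zero_above[OF q(1) _ attained[OF q(1,2), unfolded qc]])
  have Qge: "?c - 1 \<le> top_degree Q"
    by (rule top_degree(4)[OF prime_subset_maximal[OF Q(1)] Q(1) subset_refl Q(3)])
  obtain b where b: "b \<in> carrier R" "b \<notin> J" and stable: "\<And>c \<Phi>. c \<in> carrier R \<Longrightarrow> c \<notin> J \<Longrightarrow> \<Phi> \<in> cocycles R (RQ J) xs ?c \<Longrightarrow>
       \<exists>\<Psi>\<in>cocycles R (RQ J) xs ?c. b \<odot>\<^bsub>cochain_module (RQ J)\<^esub> \<Phi> \<ominus>\<^bsub>cochain_module (RQ J)\<^esub>
         (c \<otimes> b) \<odot>\<^bsub>cochain_module (RQ J)\<^esub> \<Psi> \<in> coboundaries R (RQ J) xs ?c"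
    by (rule stable_multiple[OF prime, of ?c]) (rule that, assumption, assumption, blast)
  obtain q' where q': "primeideal q' R" "J \<subset> q'" "q' \<subset> Q" "b \<notin> q'"
    by (rule prime_between_avoiding[OF prime q(1) Q(1) q(2) Q(2) b])
  \<comment> \<open>Strictness above J gives c - 1 \<le> \<open>top_degree Q\<close> <
    \<open>top_degree q'\<close> \<le> c, so no freedom is left.\<close>
  have q'c: "top_degree q' = ?c" using strict[OF q'(1) Q(1) q'(2,3)] Qge le[OF q'(1,2)] by simp
  obtain y where y: "y \<in> q'" "y \<notin> J" using q'(2) by blast
  have adj: "ideal (adjoin q' b) R" "q' \<subseteq> adjoin q' b" "b \<in> adjoin q' b"
    using adjoin[OF primeidealD(1)[OF q'(1)] b(1)] by auto
  \<comment> \<open>All primes over q' + (b) are strictly above q' and therefore have top degree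
    below c.\<close>
  have "HZ (RQ (adjoin q' b)) ?c"
  proof (rule cohomology_zero_quot[OF adj(1)])
    fix Q' assume Q': "primeideal Q' R" "adjoin q' b \<subseteq> Q'"
    then have "q' \<subset> Q'" using adj q'(4) by blast
    then have "top_degree Q' < ?c" using strict[OF q'(1) Q'(1) q'(2)] q'c by simp
    then show "HZ (RQ Q') ?c" by (rule top_degree(3)[OF prime_subset_maximal[OF Q'(1)] Q'(1) subset_refl])
  qed
  then have "HZ (RQ q') ?c"
    by (rule cohomology_zero_multiplier[OF q'(1) b(1) q'(4)])
      (rule stable_multiple_kills[OF prime q'(1) psubset_imp_subset[OF q'(2)] y b(1) stable])
  then show False using attained[OF q'(1,2)] q'c by simp
qed

lemma chain_length_le_top_degree:
  fixes p :: "nat \<Rightarrow> 'a set"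
  assumes "\<And>i. i \<le> n \<Longrightarrow> primeideal (p i) R" "\<And>i. i < n \<Longrightarrow> p i \<subset> p (Suc i)"
  shows "int n \<le> top_degree (p 0)"
proof -
  have "top_degree (p k) + int k \<le> top_degree (p 0)" if "k \<le> n" for k
    using that
  proof (induction k)
    case (Suc k)
    then have "top_degree (p (Suc k)) < top_degree (p k)"
      by (intro top_degree_strict assms) auto
    then show ?case using Suc by simp
  qed simp
  from this[of n] show ?thesis
    using top_degree(1)[OF prime_subset_maximal[OF assms(1)[of n]]] by simp
qed

end

section \<open>Finitely generated modules\<close>

lemma annihilator_ideal:
  assumes "module R M"
  shows "ideal (annihilator R M) R"
proof -
  interpret rmodule R M by (simp add: rmodule_def assms)
  show ?thesis
    by (rule R.ideal_criterion) (auto simp: annihilator_def smult_l_distr smult_assoc1)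
qed

text \<open>The submodule \<open>N\<close> below is chosen so that the localization of \<open>M/N\<close> at \<open>Q\<close> is a simple
  module.\<close>

lemma (in noetherian_cring) morphism_to_prime_quot:
  fixes M :: "('a, 'b) module"
  assumes M: "noetherian_module R M" and Q: "primeideal Q R" and ann: "annihilator R M \<subseteq> Q"
  obtains h u where "module_morphism R M (quot_module R Q) h" "u \<in> carrier M"
    "h u \<noteq> \<zero>\<^bsub>quot_module R Q\<^esub>"
proof -
  have mM: "module R M" using M by (simp add: noetherian_module_def)
  interpret M: rmodule R M by (simp add: rmodule_def mM)
  note fQ = primeidealD[OF Q]
  \<comment> \<open>The condition says that no element outside Q kills M/N, that is, M/N stays
    nonzero after localizing at Q.\<close>
  define F where "F = {N. submodule N R M \<and> (\<forall>s\<in>carrier R - Q. \<exists>x\<in>carrier M. s \<odot>\<^bsub>M\<^esub> x \<notin> N)}"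
  have "{\<zero>\<^bsub>M\<^esub>} \<in> F" using ann M.submodule_zero by (auto simp: F_def annihilator_def)
  then have "F \<noteq> {}" by blast
  moreover have "submodule N R M" if "N \<in> F" for N using that by (simp add: F_def)
  ultimately obtain N where NF: "N \<in> F" and max: "\<And>N'. N' \<in> F \<Longrightarrow> N \<subseteq> N' \<Longrightarrow> N' = N"
    using noetherian_module_maximal[OF M, of F] by blast
  have N: "submodule N R M" and out: "\<And>s. s \<in> carrier R - Q \<Longrightarrow> \<exists>x\<in>carrier M. s \<odot>\<^bsub>M\<^esub> x \<notin> N"
    using NF by (auto simp: F_def)
  note fN = M.submodule_facts[OF N]
  obtain u where u: "u \<in> carrier M" "u \<notin> N" using out[of \<one>] fQ(2) by auto
  define L where "L = {n \<in> carrier M. \<exists>r\<in>carrier R. n \<ominus>\<^bsub>M\<^esub> r \<odot>\<^bsub>M\<^esub> u \<in> N}"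
  have L: "submodule L R M" "N \<subseteq> L" "u \<in> L" using M.submodule_add_cyclic[OF N u(1)] unfolding L_def by simp_all
  then have "L \<notin> F" using max[of L] u(2) by blast
  \<comment> \<open>By maximality of N, after localizing at Q the class of u generates M/N: some s
    outside Q carries all of M into N + R u.\<close>
  then obtain s where s: "s \<in> carrier R" "s \<notin> Q" and sL: "\<And>x. x \<in> carrier M \<Longrightarrow> s \<odot>\<^bsub>M\<^esub> x \<in> L"
    using L(1) by (auto simp: F_def)
  have ex: "\<exists>r. r \<in> carrier R \<and> s \<odot>\<^bsub>M\<^esub> x \<ominus>\<^bsub>M\<^esub> r \<odot>\<^bsub>M\<^esub> u \<in> N" if "x \<in> carrier M" for x
    using sL[OF that] by (auto simp: L_def)
  \<comment> \<open>A multiplier outside Q that kills u modulo N would, together with s, kill all of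
    M/N. Hence the coefficient of u is well defined modulo Q.\<close>
  have colon: "t \<in> Q" if t: "t \<in> carrier R" "t \<odot>\<^bsub>M\<^esub> u \<in> N" for t
  proof (rule ccontr)
    assume "t \<notin> Q"
    then have "t \<otimes> s \<in> carrier R - Q" using fQ(5)[of t s] t s by blast
    then obtain x where x: "x \<in> carrier M" "(t \<otimes> s) \<odot>\<^bsub>M\<^esub> x \<notin> N" using out by blast
    obtain r where r: "r \<in> carrier R" "s \<odot>\<^bsub>M\<^esub> x \<ominus>\<^bsub>M\<^esub> r \<odot>\<^bsub>M\<^esub> u \<in> N" using ex[OF x(1)] by blast
    have "(t \<otimes> s) \<odot>\<^bsub>M\<^esub> x = t \<odot>\<^bsub>M\<^esub> ((s \<odot>\<^bsub>M\<^esub> x \<ominus>\<^bsub>M\<^esub> r \<odot>\<^bsub>M\<^esub> u) \<oplus>\<^bsub>M\<^esub> r \<odot>\<^bsub>M\<^esub> u)"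
      using t s r x u by (simp add: M.M.minus_add_self M.smult_assoc1)
    also have "\<dots> = t \<odot>\<^bsub>M\<^esub> (s \<odot>\<^bsub>M\<^esub> x \<ominus>\<^bsub>M\<^esub> r \<odot>\<^bsub>M\<^esub> u) \<oplus>\<^bsub>M\<^esub> r \<odot>\<^bsub>M\<^esub> (t \<odot>\<^bsub>M\<^esub> u)"
      using t s r x u by (simp add: M.smult_r_distr M.smult_commute[of t r])
    also have "\<dots> \<in> N" using fN(3,4) t r by blast
    finally show False using x(2) by blast
  qed
  define h where "h v = coset_rep R Q (SOME r. r \<in> carrier R \<and> s \<odot>\<^bsub>M\<^esub> v \<ominus>\<^bsub>M\<^esub> r \<odot>\<^bsub>M\<^esub> u \<in> N)" for v
  have h: "h v = coset_rep R Q r" if v: "v \<in> carrier M" and r: "r \<in> carrier R" "s \<odot>\<^bsub>M\<^esub> v \<ominus>\<^bsub>M\<^esub> r \<odot>\<^bsub>M\<^esub> u \<in> N" for v r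
  proof -
    obtain r' where r': "r' \<in> carrier R" "s \<odot>\<^bsub>M\<^esub> v \<ominus>\<^bsub>M\<^esub> r' \<odot>\<^bsub>M\<^esub> u \<in> N" "h v = coset_rep R Q r'"
      using someI_ex[OF ex[OF v]] unfolding h_def by blast
    have "(s \<odot>\<^bsub>M\<^esub> v \<ominus>\<^bsub>M\<^esub> r \<odot>\<^bsub>M\<^esub> u) \<ominus>\<^bsub>M\<^esub> (s \<odot>\<^bsub>M\<^esub> v \<ominus>\<^bsub>M\<^esub> r' \<odot>\<^bsub>M\<^esub> u)
        = (s \<odot>\<^bsub>M\<^esub> v \<ominus>\<^bsub>M\<^esub> s \<odot>\<^bsub>M\<^esub> v) \<oplus>\<^bsub>M\<^esub> (r' \<ominus> r) \<odot>\<^bsub>M\<^esub> u"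
      using v r(1) r'(1) s(1) u(1)
      by (simp add: a_minus_def M.smult_l_distr M.smult_l_minus M.M.minus_add M.M.a_ac)
    also have "\<dots> = (r' \<ominus> r) \<odot>\<^bsub>M\<^esub> u"
      using v r(1) r'(1) s(1) u(1) by (simp add: a_minus_def M.M.r_neg)
    finally have "(r' \<ominus> r) \<odot>\<^bsub>M\<^esub> u \<in> N" using fN(5)[OF r(2) r'(2)] by simp
    then have "r' \<ominus> r \<in> Q" using colon r(1) r'(1) by simp
    then show ?thesis using coset_rep_eq_iff[OF fQ(1) r'(1) r(1)] r'(3) by simp
  qed
  have "module_morphism R M (quot_module R Q) h"
    unfolding module_morphism_def
  proof (intro conjI ballI Pi_I)
    fix v assume v: "v \<in> carrier M"
    obtain r where r: "r \<in> carrier R" "s \<odot>\<^bsub>M\<^esub> v \<ominus>\<^bsub>M\<^esub> r \<odot>\<^bsub>M\<^esub> u \<in> N" using ex[OF v] by blast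
    show "h v \<in> carrier (quot_module R Q)" using h[OF v r] r(1) by (auto simp: quot_module_simps)
    fix w assume w: "w \<in> carrier M"
    obtain t where t: "t \<in> carrier R" "s \<odot>\<^bsub>M\<^esub> w \<ominus>\<^bsub>M\<^esub> t \<odot>\<^bsub>M\<^esub> u \<in> N" using ex[OF w] by blast
    have "s \<odot>\<^bsub>M\<^esub> (v \<oplus>\<^bsub>M\<^esub> w) \<ominus>\<^bsub>M\<^esub> (r \<oplus> t) \<odot>\<^bsub>M\<^esub> u = (s \<odot>\<^bsub>M\<^esub> v \<ominus>\<^bsub>M\<^esub> r \<odot>\<^bsub>M\<^esub> u) \<oplus>\<^bsub>M\<^esub> (s \<odot>\<^bsub>M\<^esub> w \<ominus>\<^bsub>M\<^esub> t \<odot>\<^bsub>M\<^esub> u)"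
      using v w r(1) t(1) s(1) u(1)
      by (simp add: a_minus_def M.smult_r_distr M.smult_l_distr M.M.minus_add M.M.a_ac)
    then have "s \<odot>\<^bsub>M\<^esub> (v \<oplus>\<^bsub>M\<^esub> w) \<ominus>\<^bsub>M\<^esub> (r \<oplus> t) \<odot>\<^bsub>M\<^esub> u \<in> N" using fN(3)[OF r(2) t(2)] by simp
    then show "h (v \<oplus>\<^bsub>M\<^esub> w) = h v \<oplus>\<^bsub>quot_module R Q\<^esub> h w"
      using h[of "v \<oplus>\<^bsub>M\<^esub> w" "r \<oplus> t"] h[OF v r] h[OF w t] v w r(1) t(1) quot_module_ops(1)[OF fQ(1) r(1) t(1)] by simp
  next
    fix a v assume a: "a \<in> carrier R" and v: "v \<in> carrier M"
    obtain r where r: "r \<in> carrier R" "s \<odot>\<^bsub>M\<^esub> v \<ominus>\<^bsub>M\<^esub> r \<odot>\<^bsub>M\<^esub> u \<in> N" using ex[OF v] by blast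
    have "s \<odot>\<^bsub>M\<^esub> (a \<odot>\<^bsub>M\<^esub> v) \<ominus>\<^bsub>M\<^esub> (a \<otimes> r) \<odot>\<^bsub>M\<^esub> u = a \<odot>\<^bsub>M\<^esub> (s \<odot>\<^bsub>M\<^esub> v \<ominus>\<^bsub>M\<^esub> r \<odot>\<^bsub>M\<^esub> u)"
      using a v r(1) s(1) u(1)
      by (simp add: M.smult_diff M.smult_assoc1 M.smult_commute[of s a])
    then have "s \<odot>\<^bsub>M\<^esub> (a \<odot>\<^bsub>M\<^esub> v) \<ominus>\<^bsub>M\<^esub> (a \<otimes> r) \<odot>\<^bsub>M\<^esub> u \<in> N" using fN(4)[OF a r(2)] by simp
    then show "h (a \<odot>\<^bsub>M\<^esub> v) = a \<odot>\<^bsub>quot_module R Q\<^esub> h v"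
      using h[of "a \<odot>\<^bsub>M\<^esub> v" "a \<otimes> r"] h[OF v r] a v r(1) quot_module_ops(2)[OF fQ(1) r(1) a] by simp
  qed
  moreover have "h u \<noteq> \<zero>\<^bsub>quot_module R Q\<^esub>"
  proof -
    have "s \<odot>\<^bsub>M\<^esub> u \<ominus>\<^bsub>M\<^esub> s \<odot>\<^bsub>M\<^esub> u \<in> N" using fN(2) s(1) u(1) by (simp add: a_minus_def M.M.r_neg)
    from h[OF u(1) s(1) this] show ?thesis using coset_rep_zero_iff[OF fQ(1) s(1)] s(2) by simp
  qed
  ultimately show ?thesis using that u(1) by blast
qed

context noetherian_local
begin

text \<open>If H^c(M) were zero, right exactness would give H^c(W) = 0 for the image W of a nonzero
  map from M to R/Q. The remaining quotient of R/Q by W involves only primes strictly above Q.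
  Choosing Q maximal with H^c(R/Q) nonzero makes H^c vanish there, so that H^c(R/Q) would vanish
  too.\<close>

theorem cohomology_not_zero_finitely_generated:
  fixes M :: "('a, 'b) module"
  assumes M: "noetherian_module R M" and ann: "annihilator R M \<subseteq> \<mm>"
  shows "\<not> HZ M (top_degree (annihilator R M))"
proof
  let ?I = "annihilator R M" and ?c = "top_degree (annihilator R M)"
  assume hz: "HZ M ?c"
  have mM: "module R M" using M by (simp add: noetherian_module_def)
  interpret M: module R M by (rule mM)
  define F where "F = {Q. primeideal Q R \<and> ?I \<subseteq> Q \<and> \<not> HZ (RQ Q) ?c}"
  obtain Q0 where "Q0 \<in> F" using top_degree(2)[OF ann] by (auto simp: F_def)
  moreover have "ideal I R" if "I \<in> F" for I using that primeidealD(1) by (auto simp: F_def)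
  ultimately obtain Q where QF: "Q \<in> F" and max: "\<And>Q'. Q' \<in> F \<Longrightarrow> Q \<subset> Q' \<Longrightarrow> False"
    using ideal_maximal[of Q0 F] by blast
  have Q: "primeideal Q R" "?I \<subseteq> Q" "\<not> HZ (RQ Q) ?c" using QF by (auto simp: F_def)
  note fQ = primeidealD[OF Q(1)]
  interpret U: module R "RQ Q" by (rule quot_module_module[OF fQ(1)])
  obtain h u where h: "module_morphism R M (RQ Q) h" and u: "u \<in> carrier M" "h u \<noteq> \<zero>\<^bsub>RQ Q\<^esub>"
    by (rule morphism_to_prime_quot[OF M Q(1,2)])
  note hD = module_morphismD[OF h] and h0 = module_morphism_zero[OF mM U.module_axioms h]
  define K where "K = {x \<in> carrier M. h x = \<zero>\<^bsub>RQ Q\<^esub>}"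
  define W where "W = h ` carrier M"
  have K: "submodule K R M"
    unfolding K_def using hD h0 by (intro M.submodule_criterion) auto
  have W: "submodule W R (RQ Q)"
  proof (rule U.submodule_criterion)
    show "W \<subseteq> carrier (RQ Q)" using hD(1) by (auto simp: W_def)
    show "\<zero>\<^bsub>RQ Q\<^esub> \<in> W" unfolding W_def h0[symmetric] by (rule imageI) simp
    show "a \<oplus>\<^bsub>RQ Q\<^esub> b \<in> W" if "a \<in> W" "b \<in> W" for a b
    proof -
      obtain x y where "x \<in> carrier M" "y \<in> carrier M" "a = h x" "b = h y" using \<open>a \<in> W\<close> \<open>b \<in> W\<close> by (auto simp: W_def)
      then show ?thesis using hD(2)[of x y] by (auto simp: W_def intro!: image_eqI[of _ _ "x \<oplus>\<^bsub>M\<^esub> y"])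
    qed
    show "r \<odot>\<^bsub>RQ Q\<^esub> a \<in> W" if "r \<in> carrier R" "a \<in> W" for r a
    proof -
      obtain x where "x \<in> carrier M" "a = h x" using \<open>a \<in> W\<close> by (auto simp: W_def)
      then show ?thesis using hD(3)[of r x] \<open>r \<in> carrier R\<close> by (auto simp: W_def intro!: image_eqI[of _ _ "r \<odot>\<^bsub>M\<^esub> x"])
    qed
  qed
  note fW = U.submodule_facts[OF W]
  have ses: "short_exact R (M\<lparr>carrier := K\<rparr>) M (RQ Q\<lparr>carrier := W\<rparr>) (\<lambda>x. x) h"
    unfolding short_exact_def
    using M.submodule_restrict_module[OF K] mM U.submodule_restrict_module[OF W] hD
    by (auto simp: K_def W_def module_morphism_def)
  interpret E: long_exact R "M\<lparr>carrier := K\<rparr>" M "RQ Q\<lparr>carrier := W\<rparr>" "\<lambda>x. x" h xs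
    by unfold_locales (rule ses, rule xs_closed)
  have "HZ (M\<lparr>carrier := K\<rparr>) (?c + 1)"
  proof (rule cohomology_zero_killed_submodule[OF M K])
    show "r \<odot>\<^bsub>M\<^esub> x = \<zero>\<^bsub>M\<^esub>" if "r \<in> ?I" "x \<in> K" for r x
      using that by (auto simp: annihilator_def K_def)
    show "?I \<subseteq> carrier R" by (auto simp: annihilator_def)
    show "HZ (RQ Q') (?c + 1)" if "primeideal Q' R" "?I \<subseteq> Q'" for Q'
      by (rule top_degree(3)[OF ann that]) simp
  qed
  then have hW: "HZ (RQ Q\<lparr>carrier := W\<rparr>) ?c" by (rule E.cohomology_zero_right[OF hz])
  have "h u \<in> carrier (RQ Q)" by (rule hD(1)[OF u(1)])
  then obtain s where s: "s \<in> carrier R" "h u = coset_rep R Q s" by (auto simp: quot_module_simps)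
  have sQ: "s \<notin> Q" using u(2) s coset_rep_zero_iff[OF fQ(1) s(1)] by simp
  \<comment> \<open>W contains the nonzero residue of s, so s kills the cokernel. As s is outside Q,
    no prime in a filtration of the cokernel equals Q.\<close>
  have sW: "s \<odot>\<^bsub>RQ Q\<^esub> x \<in> W" if x: "x \<in> carrier (RQ Q)" for x
  proof -
    obtain a where a: "a \<in> carrier R" "x = coset_rep R Q a" using x by (auto simp: quot_module_simps)
    have "s \<odot>\<^bsub>RQ Q\<^esub> x = a \<odot>\<^bsub>RQ Q\<^esub> h u"
      using quot_module_ops(2)[OF fQ(1) a(1) s(1)] quot_module_ops(2)[OF fQ(1) s(1) a(1)] a s
      by (simp add: m_comm)
    then show ?thesis using fW(4)[OF a(1), of "h u"] u(1) by (simp add: W_def)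
  qed
  have "HZ (RQ Q\<lparr>carrier := carrier (RQ Q)\<rparr>) ?c"
  proof (rule cohomology_zero_filtration[OF noetherian_quot_module[OF noetherian fQ(1)] W U.carrier_is_submodule fW(1) hW])
    fix Q' assume Q': "primeideal Q' R"
      "\<And>r. r \<in> carrier R \<Longrightarrow> (\<And>x. x \<in> carrier (RQ Q) \<Longrightarrow> r \<odot>\<^bsub>RQ Q\<^esub> x \<in> W) \<Longrightarrow> r \<in> Q'"
    have "s \<in> Q'" by (rule Q'(2)[OF s(1) sW])
    moreover have "Q \<subseteq> Q'"
    proof
      fix r assume r: "r \<in> Q"
      show "r \<in> Q'"
      proof (rule Q'(2))
        show "r \<in> carrier R" using r fQ(3) by blast
        show "r \<odot>\<^bsub>RQ Q\<^esub> x \<in> W" if "x \<in> carrier (RQ Q)" for x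
          unfolding quot_module_killed[OF fQ(1) r that] by (rule fW(2))
      qed
    qed
    ultimately have "Q \<subset> Q'" using sQ by blast
    then show "HZ (RQ Q') ?c" using max[of Q'] Q'(1) Q(2) by (auto simp: F_def)
  qed
  then show False using Q(3) by simp
qed

end

section \<open>Comparison of Krull dimension and Gorenstein injective dimension\<close>

lemma (in cring) quotient_prime_chain:
  assumes I: "ideal I R" and prime: "\<And>i. i \<le> n \<Longrightarrow> primeideal (p i) (R Quot I)"
    and strict: "\<And>i. i < n \<Longrightarrow> p i \<subset> p (Suc i)"
  obtains q where "\<And>i. i \<le> n \<Longrightarrow> primeideal (q i) R" "\<And>i. i < n \<Longrightarrow> q i \<subset> q (Suc i)" "I \<subseteq> q 0"
proof -
  interpret I: ideal I R by (rule I)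
  interpret h: ring_hom_ring R "R Quot I" "(+>) I" by (rule I.rcos_ring_hom_ring)
  define q where "q i = {r \<in> carrier R. I +> r \<in> p i}" for i :: nat
  have "primeideal (q i) R" if "i \<le> n" for i
    unfolding q_def by (rule h.primeideal_vimage[OF is_cring prime[OF that]])
  moreover have "q i \<subset> q (Suc i)" if i: "i < n" for i
  proof -
    obtain X where X: "X \<in> p (Suc i)" "X \<notin> p i" using strict[OF i] by blast
    have "p (Suc i) \<subseteq> carrier (R Quot I)"
      by (rule additive_subgroup.a_subset[OF ideal.axioms(1)[OF primeideal.axioms(1)[OF prime]]]) (use i in simp)
    then have "X \<in> carrier (R Quot I)" using X(1) by blast
    then have "X \<in> a_rcosets I" unfolding FactRing_def by (simp only: partial_object.simps)
    then obtain r where "r \<in> carrier R" "X = I +> r" by (auto simp: A_RCOSETS_def')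
    then show ?thesis using X strict[OF i] by (auto simp: q_def)
  qed
  moreover have "I \<subseteq> q 0"
  proof
    fix r assume r: "r \<in> I"
    have "\<zero>\<^bsub>R Quot I\<^esub> \<in> p 0"
      by (rule additive_subgroup.zero_closed[OF ideal.axioms(1)[OF primeideal.axioms(1)[OF prime]]]) simp
    then have "I +> r \<in> p 0" unfolding I.a_rcos_const[OF r] by (simp only: FactRing_def ring.simps)
    then show "r \<in> q 0" using r by (auto simp: q_def)
  qed
  ultimately show ?thesis by (rule that)
qed

lemma Gid_le_mono: "Gid_le U R X n \<Longrightarrow> n \<le> n' \<Longrightarrow> Gid_le U R X n'"
  unfolding Gid_le_def by (elim exE conjE, intro exI conjI) auto

text \<open>The admissible bounds are upward closed, nonempty and bounded below by 0, so there is
  exactly one place where they begin. This gives the definite description in \<open>Gid\<close> its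
  meaning.\<close>

lemma Gid_eq:
  assumes "\<not> exact_complex R X" "Gid_le U R X n\<^sub>0" and nonneg: "\<And>n. Gid_le U R X n \<Longrightarrow> n \<ge> 0"
  obtains n where "Gid U R X = ereal (of_int n)" "Gid_le U R X n"
proof -
  define k where "k = (LEAST k. Gid_le U R X (int k))"
  have "Gid_le U R X (int (nat n\<^sub>0))" using assms(2) nonneg[OF assms(2)] by simp
  then have k: "Gid_le U R X (int k)" unfolding k_def by (rule LeastI)
  have least: "int k \<le> n" if "Gid_le U R X n" for n
  proof -
    have "Gid_le U R X (int (nat n))" using that nonneg[OF that] by simp
    then have "k \<le> nat n" unfolding k_def by (rule Least_le)
    then show ?thesis using nonneg[OF that] by simp
  qed
  have "(THE n. Gid_le U R X n \<and> \<not> Gid_le U R X (n - 1)) = int k"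
  proof (rule the_equality)
    show "Gid_le U R X (int k) \<and> \<not> Gid_le U R X (int k - 1)" using k least[of "int k - 1"] by auto
    fix n assume n: "Gid_le U R X n \<and> \<not> Gid_le U R X (n - 1)"
    have "\<not> int k \<le> n - 1" using n Gid_le_mono[OF k] by blast
    moreover have "int k \<le> n" using n least by blast
    ultimately show "n = int k" by simp
  qed
  then have "Gid U R X = ereal (of_int (int k))" unfolding Gid_def using assms(1,2) by auto
  then show ?thesis using that k by blast
qed

theorem theorem3p4:
  fixes R :: "('a, 'k) ring_scheme"
    and D :: "('a, 'd) rcomplex"
    and M :: "('a, 'm) module"
  assumes "noetherian_local_ring R"
    and "dualizing_complex R D"
    and "module R M"
    and "finitely_generated R M"
    and "carrier M \<noteq> {\<zero>\<^bsub>M\<^esub>}"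
  shows "module_dim R M \<le> Gid TYPE('u) R (stalk M)"
proof -
  have R: "cring R" "noetherian_ring R" and "\<exists>!m. maximalideal m R"
    using assms(1) by (auto simp: noetherian_local_ring_def)
  then obtain m where m: "maximalideal m R" "\<And>I. maximalideal I R \<Longrightarrow> I = m" by blast
  obtain A where A: "A \<subseteq> carrier R" "finite A" "m = genideal R A"
    using noetherian_ring.finetely_gen[OF R(2) maximalideal.axioms(1)[OF m(1)]] by blast
  obtain xs where xs: "set xs = A" using finite_list[OF A(2)] by blast
  interpret noetherian_local R m xs
    by (intro noetherian_local.intro noetherian_cring.intro noetherian_cring_axioms.intro
        noetherian_local_axioms.intro R m) (use A xs in auto)
  note M = noetherian_module_finitely_generated[OF R(2) assms(3,4)]
  let ?I = "annihilator R M"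
  have I: "ideal ?I R" by (rule annihilator_ideal[OF assms(3)])
  have "\<not> exact_complex R (stalk M)"
  \<comment> \<open>A stalk complex has homology equal to its module, so exactness would force M to
    be zero and the value would not be minus infinity's opposite case: the branch of
    \<open>Gid\<close> for exact complexes is thus excluded.\<close>
  proof
    assume e: "exact_complex R (stalk M)"
    then have c: "is_complex R (stalk M)" by (simp add: exact_complex_def)
    show False using e stalk_cycles(1,2)[OF c] assms(5) by (auto simp: exact_complex_def)
  qed
  note not_exact = this
  show ?thesis
  proof (cases "\<exists>n. Gid_le TYPE('u) R (stalk M) n")
    case False
    then have "Gid TYPE('u) R (stalk M) = \<infinity>" unfolding Gid_def using not_exact by (simp only: if_False)
    then show ?thesis by simp
  next
    case True
    then obtain n where n: "Gid TYPE('u) R (stalk M) = ereal (of_int n)" "Gid_le TYPE('u) R (stalk M) n"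
      using Gid_eq[OF not_exact] Gid_le_cohomology_zero(1)[OF R(2) _ xs_closed assms(5)] by metis
    \<comment> \<open>The dimension is a supremum over chains, so each chain is bounded separately:
      its length is at most the top degree of its first prime, hence of the annihilator, and that
      degree carries nonzero cohomology of M and so cannot exceed n.\<close>
    have "ereal (real k) \<le> ereal (of_int n)"
      if p: "\<forall>i\<le>k. primeideal (p i) (R Quot ?I)" "\<forall>i<k. p i \<subset> p (Suc i)" for k and p :: "nat \<Rightarrow> 'a set set"
    proof -
      obtain q where q: "\<And>i. i \<le> k \<Longrightarrow> primeideal (q i) R" "\<And>i. i < k \<Longrightarrow> q i \<subset> q (Suc i)" "?I \<subseteq> q 0"
        using quotient_prime_chain[OF I, of k p] p by blast
      have q0: "q 0 \<subseteq> m" by (rule prime_subset_maximal[OF q(1)]) simp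
      have "int k \<le> top_degree (q 0)" by (rule chain_length_le_top_degree) (use q(1,2) in auto)
      also have "\<dots> \<le> top_degree ?I" by (rule top_degree_antimono[OF q(3) q0])
      also have "\<dots> \<le> n"
      proof (rule ccontr)
        assume "\<not> top_degree ?I \<le> n"
        then have "cohomology_zero R M xs (top_degree ?I)"
          by (intro Gid_le_cohomology_zero(2)[OF R(2) n(2) xs_closed assms(5)]) simp
        then show False using cohomology_not_zero_finitely_generated[OF M] q(3) q0 by blast
      qed
      finally show ?thesis by simp
    qed
    then show ?thesis unfolding module_dim_def krull_dim_def n(1) by (intro Sup_least) blast
  qed
qed

end
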